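(* (A) There is a constant $C_0>0$ such that for every integer $m\ge0$ the number (counted with multiplicity) of Neumann eigenfunctions of $-\Delta$ on $\Omega$ with eigenvalue $\lambda\le C_05^m$ is $$\frac12\Big(\frac{3^{m+1}+3}2+m+1\Big),$$ and the number (counted with multiplicity) of Dirichlet eigenfunctions on $\Omega$ with eigenvalue $\lambda\le C_05^m$ is $$\frac12\Big(\frac{3^{m+1}-3}2-m\Big).$$ (B) Write $N(\Omega)$ and $D(\Omega)$ for the dimensions of the Neumann and Dirichlet eigenspaces on $\Omega$ of a given eigenvalue. Then: (1) for the 0-series ($\lambda=0$), $N(\Omega)=1$ and $D(\Omega)=0$; (2) for every eigenvalue in the 2-series, $N(\Omega)=0$ and $D(\Omega)=0$; (3) for every eigenvalue in the 3-series, $N(\Omega)=1$ and $D(\Omega)=0$; (4) for every eigenvalue in the 5-series born on level $k\ge1$, $$N(\Omega)=\frac12\Big(\frac{3^{k-1}+1}2-k\Big),\qquad D(\Omega)=\frac12\Big(\frac{3^{k-1}+1}2+k\Big);$$ (5) for every eigenvalue in the 6-series born on level $k\ge1$, $$N(\Omega)=\frac12\Big(\frac{3^k+3}2+k\Big),\qquad D(\Omega)=\frac12\Big(\frac{3^k-3}2-k+1\Big).$$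
   Context: Let $q_0,q_1,q_2$ be the vertices of an equilateral triangle, $F_j(x)=(x+q_j)/2$, $SG$ the Sierpinski gasket ($SG=\bigcup_jF_jSG$ nonempty compact), $V_0=\{q_0,q_1,q_2\}$, $V_m=\bigcup_jF_jV_{m-1}$; $x\sim_my$ means $x\ne y$ in $V_m$ lie in a common level-$m$ cell $F_{w_1}\cdots F_{w_m}SG$. $\mathcal E_m(u,v)=\sum_{x\sim_my}(5/3)^m(u(x)-u(y))(v(x)-v(y))$ (sum over unordered pairs), $\mathcal E=\lim\mathcal E_m$. $dx$ is the self-similar probability measure on $SG$ giving each level-$m$ cell measure $3^{-m}$. $\Delta u=f$ ($f$ continuous) means $\mathcal E(u)<\infty$ and $\mathcal E(u,v)=-\int fv\,dx$ for all finite-energy $v$ vanishing on $V_0$. The normal derivative at $q_j$ is $\lim_m(5/3)^m[2u(q_j)-u(F_j^mq_{j+1})-u(F_j^mq_{j-1})]$. A Dirichlet (resp. Neumann) eigenfunction on $SG$ is a nonzero $u$ with $-\Delta u=\lambda u$ and $u=0$ (resp. zero normal derivative) on $V_0$. $\Omega$ is the open left half of $SG$ ($q_1$ side) cut along the symmetry line through $q_0$; $\partial\Omega=\{q_0,q_1\}\cup X$, $X=\{x_m\}_{m\ge1}$, $x_m=F_0^{m-1}F_2q_1$. Dirichlet (resp. Neumann) eigenfunctions on $\Omega$ satisfy $-\Delta u=\lambda u$ on $\Omega$ with $u=0$ (resp. zero normal derivative) on $\partial\Omega$; equivalently they are the restrictions to $\Omega$ of the Dirichlet eigenfunctions on $SG$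 that are odd (resp. Neumann eigenfunctions on $SG$ that are even) under the reflection fixing $q_0$ and exchanging $q_1,q_2$. Series (spectral decimation): every Dirichlet or Neumann eigenfunction $u$ on $SG$ restricts, for all large $m$, to a graph eigenfunction on $V_m$: $\sum_{y\sim_mx}(u(x)-u(y))=\mu_mu(x)$ for $x\in V_m\setminus V_0$ (with $u|_{V_0}=0$ in the Dirichlet case, and $2\sum_{y\sim_mx}(u(x)-u(y))=\mu_mu(x)$ for $x\in V_0$ in the Neumann case), with $\mu_{m-1}=\mu_m(5-\mu_m)$ and $\lambda=\frac32\lim_m5^m\mu_m$. For $\mu\in\{5,6\}$, $\lambda$ belongs to the $\mu$-series born on level $k\ge1$ if it arises from such a sequence with $\mu_k=\mu$ and $\mu_m\notin\{2,5,6\}$ for all $m>k$. The 2-series consists of the $\lambda$ arising from sequences with $\mu_1=2$ and $\mu_m\notin\{2,5,6\}$ for $m>1$. The 3-series consists of the $\lambda$ arising from sequences with $\mu_1=3$ and $\mu_m\notin\{2,5,6\}$ for $m>1$; these come from the nonconstant eigenvectors, with eigenvalue 3, of the graph Laplacian of the triangle $V_0$, and are said to be born on level 0. The 0-series is $\lambda=0$. *)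

theory Defs
  imports
    "HOL-Probability.Probability"
    "HOL-Library.Function_Algebras"
begin

section \<open>The Sierpinski gasket\<close>

text \<open>Indices live in the three-element type \<open>3\<close>, whose arithmetic is modulo 3, so \<open>j + 1\<close> and
  \<open>j - 1\<close> are the cyclic neighbours of \<open>j\<close>.\<close>

definition equilateral :: "(3 \<Rightarrow> real^2) \<Rightarrow> bool" where
  "equilateral q \<longleftrightarrow>
     q 0 \<noteq> q 1 \<and> dist (q 0) (q 1) = dist (q 1) (q 2) \<and> dist (q 1) (q 2) = dist (q 2) (q 0)"

definition F :: "(3 \<Rightarrow> real^2) \<Rightarrow> 3 \<Rightarrow> real^2 \<Rightarrow> real^2" where
  "F q j x = (x + q j) /\<^sub>R 2"

definition SG :: "(3 \<Rightarrow> real^2) \<Rightarrow> (real^2) set" where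
  "SG q = (THE K. K \<noteq> {} \<and> compact K \<and> K = (\<Union>j. F q j ` K))"

primrec V :: "(3 \<Rightarrow> real^2) \<Rightarrow> nat \<Rightarrow> (real^2) set" where
  "V q 0 = range q"
| "V q (Suc m) = (\<Union>j. F q j ` V q m)"

text \<open>\<open>foldr (F q) [w\<^sub>1, \<dots>, w\<^sub>m]\<close> is the composition of \<open>F q w\<^sub>1\<close>, \<dots>, \<open>F q w\<^sub>m\<close>, with \<open>F q w\<^sub>1\<close>
  outermost.\<close>

definition cell :: "(3 \<Rightarrow> real^2) \<Rightarrow> 3 list \<Rightarrow> (real^2) set" where
  "cell q w = foldr (F q) w ` SG q"

definition adj :: "(3 \<Rightarrow> real^2) \<Rightarrow> nat \<Rightarrow> real^2 \<Rightarrow> real^2 \<Rightarrow> bool" where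
  "adj q m x y \<longleftrightarrow> x \<noteq> y \<and> x \<in> V q m \<and> y \<in> V q m \<and>
     (\<exists>w. length w = m \<and> x \<in> cell q w \<and> y \<in> cell q w)"

text \<open>The condition on cells (the empty word gives \<open>SG q\<close>) determines the measure uniquely; it is
  a Borel measure on the plane concentrated on \<open>SG q\<close>.\<close>

definition SG_measure :: "(3 \<Rightarrow> real^2) \<Rightarrow> (real^2) measure" where
  "SG_measure q = (THE M. prob_space M \<and> sets M = sets borel \<and>
     (\<forall>w. measure M (cell q w) = (1/3) ^ length w))"


section \<open>Energy and Laplacian\<close>

text \<open>These are set up for a closed subset \<open>K\<close> of the gasket with boundary \<open>B\<close>. They are used for
  \<open>K = SG q\<close>, \<open>B = V q 0\<close>, and for the closed half gasket with the boundary of \<open>Omega\<close>.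
  The sum runs over ordered pairs, hence the factor \<open>1/2\<close>.\<close>

definition graph_energy ::
  "(3 \<Rightarrow> real^2) \<Rightarrow> (real^2) set \<Rightarrow> nat \<Rightarrow> (real^2 \<Rightarrow> real) \<Rightarrow> (real^2 \<Rightarrow> real) \<Rightarrow> real" where
  "graph_energy q K m u v =
     (1/2) * (\<Sum>(x, y) \<in> {(x, y). x \<in> K \<and> y \<in> K \<and> adj q m x y}.
        (5/3) ^ m * (u x - u y) * (v x - v y))"

definition energy ::
  "(3 \<Rightarrow> real^2) \<Rightarrow> (real^2) set \<Rightarrow> (real^2 \<Rightarrow> real) \<Rightarrow> (real^2 \<Rightarrow> real) \<Rightarrow> real" where
  "energy q K u v = lim (\<lambda>m. graph_energy q K m u v)"

text \<open>For both choices of \<open>K\<close> above, \<open>graph_energy q K m u u\<close> is nondecreasing in \<open>m\<close>, so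
  convergence means that the limit is finite.\<close>

definition finite_energy :: "(3 \<Rightarrow> real^2) \<Rightarrow> (real^2) set \<Rightarrow> (real^2 \<Rightarrow> real) \<Rightarrow> bool" where
  "finite_energy q K u \<longleftrightarrow>
     continuous_on K u \<and> convergent (\<lambda>m. graph_energy q K m u u)"

definition has_laplacian ::
  "(3 \<Rightarrow> real^2) \<Rightarrow> (real^2) set \<Rightarrow> (real^2) set \<Rightarrow> (real^2 \<Rightarrow> real) \<Rightarrow> (real^2 \<Rightarrow> real) \<Rightarrow> bool" where
  "has_laplacian q K B u f \<longleftrightarrow>
     continuous_on K f \<and> finite_energy q K u \<and>
     (\<forall>v. finite_energy q K v \<and> (\<forall>x\<in>B. v x = 0) \<longrightarrow>
        energy q K u v = - (LINT x:K|SG_measure q. f x * v x))"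


section \<open>Eigenfunctions on the gasket\<close>

text \<open>Functions on \<open>K\<close> are represented by functions on the plane that vanish off \<open>K\<close>.\<close>

definition eigen_eq ::
  "(3 \<Rightarrow> real^2) \<Rightarrow> (real^2) set \<Rightarrow> (real^2) set \<Rightarrow> real \<Rightarrow> (real^2 \<Rightarrow> real) \<Rightarrow> bool" where
  "eigen_eq q K B lam u \<longleftrightarrow>
     (\<forall>x. x \<notin> K \<longrightarrow> u x = 0) \<and> has_laplacian q K B u (\<lambda>x. - (lam * u x))"

definition SG_dirichlet_space :: "(3 \<Rightarrow> real^2) \<Rightarrow> real \<Rightarrow> (real^2 \<Rightarrow> real) set" where
  "SG_dirichlet_space q lam = {u. eigen_eq q (SG q) (V q 0) lam u \<and> (\<forall>x\<in>V q 0. u x = 0)}"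

definition SG_neumann_space :: "(3 \<Rightarrow> real^2) \<Rightarrow> real \<Rightarrow> (real^2 \<Rightarrow> real) set" where
  "SG_neumann_space q lam = {u. eigen_eq q (SG q) (V q 0) lam u \<and>
     (\<forall>j. (\<lambda>m. (5/3) ^ m *
             (2 * u (q j) - u ((F q j ^^ m) (q (j + 1))) - u ((F q j ^^ m) (q (j - 1)))))
           \<longlonglongrightarrow> 0)}"


section \<open>The half gasket\<close>

definition X :: "(3 \<Rightarrow> real^2) \<Rightarrow> (real^2) set" where
  "X q = {(F q 0 ^^ (m - 1)) (F q 2 (q 1)) | m. 1 \<le> m}"

definition Omega :: "(3 \<Rightarrow> real^2) \<Rightarrow> (real^2) set" where
  "Omega q = {x \<in> SG q. dist x (q 1) < dist x (q 2)} - {q 1}"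

definition bd_Omega :: "(3 \<Rightarrow> real^2) \<Rightarrow> (real^2) set" where
  "bd_Omega q = {q 0, q 1} \<union> X q"

definition cl_Omega :: "(3 \<Rightarrow> real^2) \<Rightarrow> (real^2) set" where
  "cl_Omega q = Omega q \<union> bd_Omega q"

text \<open>The normal derivative at a boundary point \<open>p\<close>, taken from inside \<open>Omega\<close>, is the limit of
  \<open>(5/3) ^ m\<close> times the sum of \<open>u p - u y\<close> over the level-\<open>m\<close> neighbours \<open>y\<close> of \<open>p\<close> in the closed
  half gasket. At \<open>q 1\<close> and at the points of \<open>X q\<close> there are (for large \<open>m\<close>) two such neighbours,
  the other two vertices of the level-\<open>m\<close> cell of \<open>cl_Omega q\<close> with vertex \<open>p\<close>, as in the formula
  on the gasket; at \<open>q 0\<close> the only one is \<open>(F q 0 ^^ m) (q 1)\<close>.\<close>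

definition has_normal_deriv_Omega ::
  "(3 \<Rightarrow> real^2) \<Rightarrow> (real^2 \<Rightarrow> real) \<Rightarrow> real^2 \<Rightarrow> real \<Rightarrow> bool" where
  "has_normal_deriv_Omega q u p d \<longleftrightarrow>
     (\<lambda>m. (5/3) ^ m * (\<Sum>y \<in> {y \<in> cl_Omega q. adj q m p y}. u p - u y)) \<longlonglongrightarrow> d"

definition Omega_dirichlet_space :: "(3 \<Rightarrow> real^2) \<Rightarrow> real \<Rightarrow> (real^2 \<Rightarrow> real) set" where
  "Omega_dirichlet_space q lam =
     {u. eigen_eq q (cl_Omega q) (bd_Omega q) lam u \<and> (\<forall>x\<in>bd_Omega q. u x = 0)}"

definition Omega_neumann_space :: "(3 \<Rightarrow> real^2) \<Rightarrow> real \<Rightarrow> (real^2 \<Rightarrow> real) set" where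
  "Omega_neumann_space q lam =
     {u. eigen_eq q (cl_Omega q) (bd_Omega q) lam u \<and>
         (\<forall>p\<in>bd_Omega q. has_normal_deriv_Omega q u p 0)}"


section \<open>Series of eigenvalues\<close>

definition graph_eigen_eq ::
  "(3 \<Rightarrow> real^2) \<Rightarrow> nat \<Rightarrow> real \<Rightarrow> (real^2 \<Rightarrow> real) \<Rightarrow> bool" where
  "graph_eigen_eq q m mu u \<longleftrightarrow> (\<exists>x\<in>V q m. u x \<noteq> 0) \<and>
     (\<forall>x\<in>V q m - V q 0. (\<Sum>y | adj q m x y. u x - u y) = mu * u x)"

definition graph_dirichlet_eigenfun ::
  "(3 \<Rightarrow> real^2) \<Rightarrow> nat \<Rightarrow> real \<Rightarrow> (real^2 \<Rightarrow> real) \<Rightarrow> bool" where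
  "graph_dirichlet_eigenfun q m mu u \<longleftrightarrow>
     graph_eigen_eq q m mu u \<and> (\<forall>x\<in>V q 0. u x = 0)"

definition graph_neumann_eigenfun ::
  "(3 \<Rightarrow> real^2) \<Rightarrow> nat \<Rightarrow> real \<Rightarrow> (real^2 \<Rightarrow> real) \<Rightarrow> bool" where
  "graph_neumann_eigenfun q m mu u \<longleftrightarrow>
     graph_eigen_eq q m mu u \<and>
     (\<forall>x\<in>V q 0. 2 * (\<Sum>y | adj q m x y. u x - u y) = mu * u x)"

text \<open>\<open>in_series q c k lam\<close>: \<open>lam\<close> is an eigenvalue on the gasket arising from a sequence
  \<open>(mu m)\<close>, \<open>m \<ge> k\<close>, with \<open>mu k = c\<close> that avoids the forbidden values 2, 5, 6 afterwards. Values
  of \<open>mu\<close> below \<open>k\<close> play no role.\<close>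

definition in_series :: "(3 \<Rightarrow> real^2) \<Rightarrow> real \<Rightarrow> nat \<Rightarrow> real \<Rightarrow> bool" where
  "in_series q c k lam \<longleftrightarrow> (\<exists>u mu.
     (u \<noteq> 0 \<and> u \<in> SG_dirichlet_space q lam \<and>
        (\<forall>\<^sub>F m in sequentially. graph_dirichlet_eigenfun q m (mu m) u) \<or>
      u \<noteq> 0 \<and> u \<in> SG_neumann_space q lam \<and>
        (\<forall>\<^sub>F m in sequentially. graph_neumann_eigenfun q m (mu m) u)) \<and>
     (\<forall>m>k. mu (m - 1) = mu m * (5 - mu m)) \<and>
     (\<lambda>m. 3/2 * (5 ^ m * mu m)) \<longlonglongrightarrow> lam \<and>
     mu k = c \<and> (\<forall>m>k. mu m \<notin> {2, 5, 6}))"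


section \<open>Dimensions and eigenvalue counts\<close>

interpretation fun_vs: vector_space "\<lambda>(c::real) (f :: real^2 \<Rightarrow> real) x. c * f x"
  by unfold_locales (auto simp: fun_eq_iff algebra_simps)

text \<open>\<open>fun_vs.dim\<close> is meaningless on infinite-dimensional spaces, so finite-dimensionality is
  required explicitly.\<close>

definition fin_dim :: "(real^2 \<Rightarrow> real) set \<Rightarrow> bool" where
  "fin_dim S \<longleftrightarrow> (\<exists>B. finite B \<and> S \<subseteq> fun_vs.span B)"

definition has_dim :: "(real^2 \<Rightarrow> real) set \<Rightarrow> real \<Rightarrow> bool" where
  "has_dim S d \<longleftrightarrow> fun_vs.subspace S \<and> fin_dim S \<and> real (fun_vs.dim S) = d"

text \<open>For a family \<open>E\<close> of eigenspaces: the number of eigenvalues \<open>\<le> c\<close>, counted with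
  multiplicity, is finite and equals \<open>n\<close>.\<close>

definition has_eigen_count :: "(real \<Rightarrow> (real^2 \<Rightarrow> real) set) \<Rightarrow> real \<Rightarrow> real \<Rightarrow> bool" where
  "has_eigen_count E c n \<longleftrightarrow>
     finite {lam. lam \<le> c \<and> E lam \<noteq> {0}} \<and>
     (\<forall>lam\<le>c. fun_vs.subspace (E lam) \<and> fin_dim (E lam)) \<and>
     (\<Sum>lam | lam \<le> c \<and> E lam \<noteq> {0}. real (fun_vs.dim (E lam))) = n"

end

theory Submission
  imports Defs
begin

text \<open>A function on the gasket is coded by its values at vertices, and the graph eigenvalue equation at a
  vertex says that the fluxes of the two cells meeting there cancel. If \<open>mu\<close> is not 2 or 5, a
  solution of level \<open>m + 1\<close> is determined by its restriction to level \<open>m\<close>, where the fluxes satisfy the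
  equations for \<open>mu (5 - mu)\<close> up to the factor \<open>6 - mu\<close>. So the multiplicities on the graphs of
  the half gasket follow recursively from the cases \<open>mu = 6\<close> (no equations are left on level \<open>m\<close>),
  \<open>mu = 5\<close> (balanced flows) and \<open>mu = 2\<close> (a sum of squares vanishes).

  Decimating downwards forever extends every function on level \<open>m\<close> to a continuous function, a
  spline. Pairing \<open>u\<close> with a spline changes the level-\<open>n\<close> quadratic form, \<open>n \<ge> m\<close>, only by explicit
  factors whose infinite product converges. Hence the weak eigenvalue equation
  on the half gasket is equivalent to the graph equation on level \<open>m\<close>, and eigenspaces are
  isomorphic to graph eigenspaces.

  The eigenvalues \<open>lam \<le> C0 5^m\<close> are those for which the sequence \<open>mu\<close> satisfies \<open>mu (m + 1) \<le> 3\<close>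
  and follows the lower inverse branch of \<open>mu (5 - mu)\<close> from then on. They correspond to the graph
  spectrum of level \<open>m\<close>, whose total multiplicity is computed by recursion: each
  value other than 0 and 6 has exactly two preimages that are not 2, 5 or 6.\<close>

section \<open>Dimension of spaces of real-valued functions\<close>

text \<open>The boundary of the half gasket is infinite, and the points of \<open>X\<close>
  accumulate at \<open>q 0\<close>. On every level exactly one cell, the one at \<open>q 0\<close>,
  is bisected by the symmetry line, and only two of its corners lie in the closed half; every
  recursion for the half gasket ends there. The odd or even extension to the whole cell replaces the
  missing corner. Odd splines vanish at the points of \<open>X\<close> inside the cut cell, even
  ones do not, while the weak equation admits only tests vanishing on the whole boundary. So in the
  Neumann case it says nothing about the cut cell or about \<open>X\<close>: the equations on
  \<open>X\<close> and at \<open>q 1\<close> come from the normal derivatives, and those in the cut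
  cell from the decay of its renormalized defects. The constant is \<open>3/2 * 5 * Lf 3\<close>,
  where \<open>Lf x\<close> is the limit of \<open>5 ^ n * (psi ^^ n) x\<close>: no value in a graph
  spectrum exceeds 6, and of the two preimages 2 and 3 of 6 the lower one is forbidden.\<close>

definition lc :: "real \<Rightarrow> ('a \<Rightarrow> real) \<Rightarrow> real \<Rightarrow> ('a \<Rightarrow> real) \<Rightarrow> 'a \<Rightarrow> real" where
  "lc a f b g = (\<lambda>x. a * f x + b * g x)"

text \<open>A dimension theory for real-valued functions on any type: codes and functions on the
  plane both occur, and \<open>fun_vs\<close> covers only the latter. \<open>dimn_basis\<close>
  translates at the end.\<close>

definition lin_sub :: "('a \<Rightarrow> real) set \<Rightarrow> bool" where
  "lin_sub S \<longleftrightarrow> (\<lambda>_. 0) \<in> S \<and> (\<forall>f\<in>S. \<forall>g\<in>S. \<forall>a b. lc a f b g \<in> S)"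

definition lin_on :: "('a \<Rightarrow> real) set \<Rightarrow> (('a \<Rightarrow> real) \<Rightarrow> ('b \<Rightarrow> real)) \<Rightarrow> bool" where
  "lin_on S L \<longleftrightarrow> (\<forall>f\<in>S. \<forall>g\<in>S. \<forall>a b. L (lc a f b g) = lc a (L f) b (L g))"

definition linf_on :: "('a \<Rightarrow> real) set \<Rightarrow> (('a \<Rightarrow> real) \<Rightarrow> real) \<Rightarrow> bool" where
  "linf_on S L \<longleftrightarrow> (\<forall>f\<in>S. \<forall>g\<in>S. \<forall>a b. L (lc a f b g) = a * L f + b * L g)"

text \<open>\<open>dimn n S\<close> says that the linear space \<open>S\<close> has dimension \<open>n\<close>, by successively splitting off the
  kernel of a nonzero functional.\<close>

primrec dimn :: "nat \<Rightarrow> ('a \<Rightarrow> real) set \<Rightarrow> bool" where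
  "dimn 0 S \<longleftrightarrow> S = {\<lambda>_. 0}"
| "dimn (Suc n) S \<longleftrightarrow> (\<exists>l s. linf_on S l \<and> s \<in> S \<and> l s = 1 \<and> dimn n {f \<in> S. l f = 0})"

lemma linf_on_zero: "linf_on S l \<Longrightarrow> f \<in> S \<Longrightarrow> l (\<lambda>_. 0) = 0"
proof -
  assume "linf_on S l" "f \<in> S"
  then have "l (lc 0 f 0 f) = 0 * l f + 0 * l f" unfolding linf_on_def by blast
  then show ?thesis by (simp add: lc_def)
qed

lemma lin_on_zero: "lin_on S L \<Longrightarrow> f \<in> S \<Longrightarrow> L (\<lambda>_. 0) = (\<lambda>_. 0)"
proof -
  assume "lin_on S L" "f \<in> S"
  then have "L (lc 0 f 0 f) = lc 0 (L f) 0 (L f)" unfolding lin_on_def by blast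
  then show ?thesis by (simp add: lc_def)
qed

lemma lin_sub_kernel: "lin_sub S \<Longrightarrow> linf_on S l \<Longrightarrow> lin_sub {f \<in> S. l f = 0}"
  unfolding lin_sub_def using linf_on_zero[of S l] by (auto simp: linf_on_def)

lemma lin_sub_kernel': "lin_sub S \<Longrightarrow> lin_on S L \<Longrightarrow> lin_sub {f \<in> S. L f = (\<lambda>_. 0)}"
  unfolding lin_sub_def using lin_on_zero[of S L] by (auto simp: lin_on_def lc_def)

text \<open>A functional on the image pulls back along \<open>L\<close> to a functional on
  \<open>S\<close>; its kernel has the same \<open>L\<close>-kernel and an image of one dimension
  less. When the image is trivial, \<open>S\<close> is the kernel.\<close>

lemma dimn_rank_nullity:
  "lin_sub S \<Longrightarrow> lin_on S L \<Longrightarrow> dimn a (L ` S) \<Longrightarrow> dimn b {f \<in> S. L f = (\<lambda>_. 0)}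
    \<Longrightarrow> dimn (a + b) S"
proof (induction a arbitrary: S)
  case 0
  have "{f \<in> S. L f = (\<lambda>_. 0)} = S" using 0(3) by auto
  then have "dimn b S" using back_subst[of "dimn b", OF 0(4)] by blast
  then show ?case by simp
next
  case (Suc a)
  obtain l s where l: "linf_on (L ` S) l" "s \<in> L ` S" "l s = 1" "dimn a {f \<in> L ` S. l f = 0}"
    using Suc.prems(3) by auto
  obtain t where t: "t \<in> S" "s = L t" using l(2) by auto
  define S' where "S' = {f \<in> S. l (L f) = 0}"
  have lin: "linf_on S (\<lambda>f. l (L f))"
    using l(1) Suc.prems(2) unfolding linf_on_def lin_on_def by auto
  have "L ` S' = {f \<in> L ` S. l f = 0}" by (auto simp: S'_def)
  moreover have "l (\<lambda>_. 0) = 0" using linf_on_zero[OF l(1,2)] .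
  then have "{f \<in> S'. L f = (\<lambda>_. 0)} = {f \<in> S. L f = (\<lambda>_. 0)}" by (auto simp: S'_def)
  moreover have "lin_on S' L" using Suc.prems(2) by (auto simp: lin_on_def S'_def)
  moreover have "lin_sub S'" using lin_sub_kernel[OF Suc.prems(1) lin] by (simp add: S'_def)
  ultimately have "dimn (a + b) S'" using Suc.IH[of S'] Suc.prems(4) l(4) by simp
  then show ?case unfolding add_Suc dimn.simps using lin t l(3) S'_def by blast
qed

lemma dimn_inj:
  assumes "lin_sub S" "lin_on S L" "dimn a (L ` S)" "\<And>f. f \<in> S \<Longrightarrow> L f = (\<lambda>_. 0) \<Longrightarrow> f = (\<lambda>_. 0)"
  shows "dimn a S"
proof -
  have z: "(\<lambda>_. 0) \<in> S" using assms(1) by (simp add: lin_sub_def)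
  then have "{f \<in> S. L f = (\<lambda>_. 0)} = {\<lambda>_. 0}" using assms(4) lin_on_zero[OF assms(2)] by blast
  then show ?thesis using dimn_rank_nullity[OF assms(1-3), of 0] by simp
qed

lemma lin_sub_image:
  assumes "lin_sub S" "lin_on S L" shows "lin_sub (L ` S)"
proof -
  have "(\<lambda>_. 0) \<in> L ` S" using assms lin_on_zero[OF assms(2)] unfolding lin_sub_def by (metis image_eqI)
  moreover have "lc a (L f) b (L g) \<in> L ` S" if "f \<in> S" "g \<in> S" for a b f g
    using that assms unfolding lin_sub_def lin_on_def by (metis image_eqI)
  ultimately show ?thesis by (auto simp: lin_sub_def)
qed

text \<open>\<open>M\<close> undoes \<open>L\<close>, so it maps the image back onto
  \<open>S\<close> injectively. In the application \<open>L\<close> builds splines and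
  \<open>M\<close> samples at vertices.\<close>

lemma dimn_iso:
  assumes "lin_sub S" "lin_on S L" "lin_on UNIV M" "\<And>f. f \<in> S \<Longrightarrow> M (L f) = f" "dimn n S"
  shows "dimn n (L ` S)"
proof (rule dimn_inj[of _ M])
  show "lin_sub (L ` S)" by (rule lin_sub_image[OF assms(1,2)])
  show "lin_on (L ` S) M" using assms(3) by (auto simp: lin_on_def)
  have "M ` L ` S = S" using assms(4) by (force simp: image_image)
  then show "dimn n (M ` L ` S)" using assms(5) by simp
  fix f assume "f \<in> L ` S" "M f = (\<lambda>_. 0)"
  then show "f = (\<lambda>_. 0)" using assms(4) lin_on_zero[OF assms(2)] lin_on_zero[OF assms(3)] by (metis UNIV_I imageE)
qed

lemma dimn_fun_finite:
  "finite A \<Longrightarrow> dimn (card A) {f. \<forall>x. x \<notin> A \<longrightarrow> f x = 0}"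
proof (induction A rule: finite_induct)
  case empty
  have "{f :: 'a \<Rightarrow> real. \<forall>x. f x = 0} = {\<lambda>_. 0}" by auto
  then show ?case by simp
next
  case (insert y A)
  let ?S = "{f :: 'a \<Rightarrow> real. \<forall>x. x \<notin> insert y A \<longrightarrow> f x = 0}"
  have "{f \<in> ?S. f y = 0} = {f. \<forall>x. x \<notin> A \<longrightarrow> f x = 0}" using insert(2) by auto
  then have "dimn (card A) {f \<in> ?S. f y = 0}" using insert by simp
  moreover have "linf_on ?S (\<lambda>f. f y)" by (simp add: linf_on_def lc_def)
  moreover have "(\<lambda>x. if x = y then 1 else 0) \<in> ?S" by simp
  ultimately show ?case unfolding card_insert_disjoint[OF insert(1,2)] dimn.simps
    by (intro exI[of _ "\<lambda>f. f y"] exI[of _ "\<lambda>x. if x = y then 1 else 0"]) simp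
qed

lemma dimn_UNIV: "dimn CARD('a::finite) (UNIV :: ('a \<Rightarrow> real) set)"
  using dimn_fun_finite[of "UNIV :: 'a set"] by simp

text \<open>If \<open>l s = 1\<close>, every \<open>f\<close> is \<open>l f\<close> times
  \<open>s\<close> plus an element of the kernel of \<open>l\<close>, so \<open>s\<close> completes
  a basis of the kernel.\<close>

lemma dimn_basis:
  "lin_sub S \<Longrightarrow> dimn n S \<Longrightarrow> \<exists>B. finite B \<and> card B = n \<and> fun_vs.independent B \<and> fun_vs.span B = S"
proof (induction n arbitrary: S)
  case 0
  then show ?case
    by (intro exI[of _ "{}"]) (auto simp: fun_vs.independent_empty fun_eq_iff)
next
  case (Suc n)
  obtain l s where l: "linf_on S l" "s \<in> S" "l s = 1" "dimn n {f \<in> S. l f = 0}"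
    using Suc.prems(2) by auto
  obtain B where B: "finite B" "card B = n" "fun_vs.independent B" "fun_vs.span B = {f \<in> S. l f = 0}"
    using Suc.IH[OF lin_sub_kernel[OF Suc.prems(1) l(1)] l(4)] by auto
  have s: "s \<notin> fun_vs.span B" using B l by auto
  then have "s \<notin> B" using fun_vs.span_base by blast
  have sub: "fun_vs.subspace S"
  proof (rule fun_vs.subspaceI)
    show "0 \<in> S" using Suc.prems(1) by (simp add: lin_sub_def zero_fun_def)
    fix x y assume xy: "x \<in> S" "y \<in> S"
    have "lc 1 x 1 y \<in> S" using xy Suc.prems(1) by (simp add: lin_sub_def)
    then show "x + y \<in> S" by (simp add: lc_def plus_fun_def)
  next
    fix c x assume x: "x \<in> S"
    have "lc c x 0 x \<in> S" using x Suc.prems(1) by (simp add: lin_sub_def)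
    then show "(\<lambda>t. c * x t) \<in> S" by (simp add: lc_def)
  qed
  have "B \<subseteq> S" using B fun_vs.span_superset by blast
  then have "fun_vs.span (insert s B) \<subseteq> S" using sub l(2) by (simp add: fun_vs.span_minimal)
  moreover have "f \<in> fun_vs.span (insert s B)" if f: "f \<in> S" for f
  proof -
    have "l (lc 1 f (- l f) s) = 1 * l f + (- l f) * l s" using l(1,2) f unfolding linf_on_def by blast
    moreover have "lc 1 f (- l f) s \<in> S" using f l(2) Suc.prems(1) by (simp add: lin_sub_def)
    ultimately have "lc 1 f (- l f) s \<in> fun_vs.span B" using B(4) l(3) by simp
    then have a: "lc 1 f (- l f) s \<in> fun_vs.span (insert s B)"
      using fun_vs.span_mono[of B "insert s B"] by blast
    have b: "(\<lambda>t. l f * s t) \<in> fun_vs.span (insert s B)"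
      by (intro fun_vs.span_scale fun_vs.span_base) simp
    have "lc 1 f (- l f) s + (\<lambda>t. l f * s t) = f" by (auto simp: lc_def plus_fun_def)
    then show ?thesis using fun_vs.span_add[OF a b] by simp
  qed
  ultimately have "fun_vs.span (insert s B) = S" by blast
  moreover have "fun_vs.independent (insert s B)" using B(3) s by (simp add: fun_vs.independent_insert)
  moreover have "finite (insert s B)" "card (insert s B) = Suc n" using B(1,2) \<open>s \<notin> B\<close> by auto
  ultimately show ?case by blast
qed

lemma has_dim_dimn:
  assumes "lin_sub S" "dimn n S" shows "has_dim S (real n)"
proof -
  obtain B where B: "finite B" "card B = n" "fun_vs.independent B" "fun_vs.span B = S"
    using dimn_basis[OF assms] by auto
  have "fun_vs.subspace S" using B(4) fun_vs.subspace_span by auto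
  moreover have "fin_dim S" unfolding fin_dim_def using B by auto
  moreover have "fun_vs.dim S = n" using B fun_vs.dim_span_eq_card_independent by auto
  ultimately show ?thesis by (simp add: has_dim_def)
qed

section \<open>Graph eigenfunctions in symbolic coordinates\<close>

lemma three_eq [simp]: "(3::3) = 0"
  by simp

lemma all3: "(\<forall>i::3. P i) \<longleftrightarrow> P 0 \<and> P 1 \<and> P 2"
  using forall_3[of P] by (auto simp: three_eq)

lemma ex3: "(\<exists>i::3. P i) \<longleftrightarrow> P 0 \<or> P 1 \<or> P 2"
  using all3[of "\<lambda>i. \<not> P i"] by auto

lemma sum3: "sum f (UNIV::3 set) = f 0 + f 1 + f 2"
  using sum_3[of f] by (simp add: ac_simps)

lemma neq3 [simp]: "(0::3) \<noteq> 1" "(0::3) \<noteq> 2" "(1::3) \<noteq> 2" "(1::3) \<noteq> 0" "(2::3) \<noteq> 0" "(2::3) \<noteq> 1"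
proof -
  have "card {0, 1, 2 :: 3} = 3"
  proof -
    have "{0, 1, 2 :: 3} = UNIV" using UNIV_3 by auto
    then show ?thesis by simp
  qed
  moreover have "card {0, 1, 2 :: 3} \<le> 2" if "(0::3) = 1 \<or> (0::3) = 2 \<or> (1::3) = 2"
    using that by (auto simp: card_insert_if)
  ultimately show "(0::3) \<noteq> 1" "(0::3) \<noteq> 2" "(1::3) \<noteq> 2" by auto
  then show "(1::3) \<noteq> 0" "(2::3) \<noteq> 0" "(2::3) \<noteq> 1" by metis+
qed

lemma arith3 [simp]: "- (1::3) = 2" "- (2::3) = 1" "(1::3) + 1 = 2" "(1::3) + 2 = 0" "(2::3) + 1 = 0" "(2::3) + 2 = 1"
proof -
  have "(1::3) + 2 = 3" "(1::3) + 3 = 4" "(2::3) + 2 = 4" by simp_all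
  then show a: "(1::3) + 2 = 0" "(2::3) + 2 = 1" by (metis three_eq add.right_neutral)+
  then show "(2::3) + 1 = 0" "(1::3) + 1 = 2" by (simp_all add: add.commute)
  show "- (1::3) = 2" "- (2::3) = 1" using a(1) by (metis neg_eq_iff_add_eq_0 add.commute)+
qed

lemma minus3 [simp]: "(1::3) - 2 = 2" "(2::3) - 1 = 1" "(0::3) - 1 = 2" "(0::3) - 2 = 1"
  by (simp_all only: diff_conv_add_uminus arith3 add_0)

text \<open>A code records a function \<open>u\<close> on the gasket: the entry at \<open>(w, j)\<close> is the value of \<open>u\<close> at the
  vertex \<open>q\<^sub>j\<close> of the cell of the word \<open>w\<close>. Level-\<open>m\<close> notions only look at words of length \<open>m\<close>.
  On the half gasket these are the words \<open>0\<^sup>j 1 v\<close> and, for the two vertices indexed \<open>0\<close> and \<open>1\<close> only,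
  the word \<open>0\<^sup>m\<close> of the cell that is cut in two.\<close>

type_synonym code = "3 list \<times> 3 \<Rightarrow> real"

definition sh :: "code \<Rightarrow> 3 \<Rightarrow> code" where
  "sh f i = (\<lambda>(w, j). f (i # w, j))"

text \<open>Right inverse of \<open>sh\<close>. The entries at the empty word are set to 0, as the
  normal form of a code of positive level demands.\<close>

definition jn :: "(3 \<Rightarrow> code) \<Rightarrow> code" where
  "jn h = (\<lambda>(w, j). case w of [] \<Rightarrow> 0 | i # v \<Rightarrow> h i (v, j))"

definition crn :: "nat \<Rightarrow> 3 \<Rightarrow> 3 list \<times> 3" where
  "crn n j = (replicate n j, j)"

text \<open>Restriction to the coarser level: the corner \<open>j\<close> of the cell
  \<open>w\<close> is also the corner \<open>j\<close> of its subcell \<open>w @ [j]\<close>, so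
  only the midpoints are forgotten.\<close>

definition crs :: "code \<Rightarrow> code" where
  "crs f = (\<lambda>(w, j). f (w @ [j], j))"

text \<open>Well-definedness as a function on vertices: the corner \<open>j\<close> of cell
  \<open>i\<close> and the corner \<open>i\<close> of cell \<open>j\<close> are the same
  point.\<close>

primrec cmp :: "nat \<Rightarrow> code \<Rightarrow> bool" where
  "cmp 0 f \<longleftrightarrow> True"
| "cmp (Suc n) f \<longleftrightarrow> (\<forall>i. cmp n (sh f i)) \<and> (\<forall>i j. sh f i (crn n j) = sh f j (crn n i))"

primrec hcmp :: "nat \<Rightarrow> code \<Rightarrow> bool" where
  "hcmp 0 f \<longleftrightarrow> True"
| "hcmp (Suc n) f \<longleftrightarrow> cmp n (sh f 1) \<and> hcmp n (sh f 0) \<and> sh f 1 (crn n 0) = sh f 0 (crn n 1)"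

text \<open>Vanishing at \<open>q 0\<close> and at the points of \<open>X\<close> among the vertices
  of level \<open>n\<close>; the first of these points is the corner 2 of cell 1.\<close>

primrec hz :: "nat \<Rightarrow> code \<Rightarrow> bool" where
  "hz 0 f \<longleftrightarrow> f ([], 0) = 0"
| "hz (Suc n) f \<longleftrightarrow> sh f 1 (crn n 2) = 0 \<and> hz n (sh f 0)"

text \<open>Normal form of a level-\<open>n\<close> code: entries of all other levels are set to 0,
  so that spaces of codes become finite-dimensional. \<open>hres\<close> also drops what lies
  outside the half gasket.\<close>

definition res :: "nat \<Rightarrow> code \<Rightarrow> code" where
  "res n f = (\<lambda>(w, j). if length w = n then f (w, j) else 0)"

primrec hres :: "nat \<Rightarrow> code \<Rightarrow> code" where
  "hres 0 f = (\<lambda>(w, j). if w = [] \<and> j \<noteq> 2 then f (w, j) else 0)"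
| "hres (Suc n) f = jn (\<lambda>i. if i = 1 then res n (sh f 1) else if i = 0 then hres n (sh f 0) else (\<lambda>_. 0))"

text \<open>\<open>T mu a j\<close> is the flux at the corner \<open>j\<close> of a single cell with corner values \<open>a\<close>: twice the
  value there minus the other two values, minus \<open>mu / 2\<close> times the value. At a vertex of two cells
  the graph eigenvalue equation says that the two fluxes cancel. The constant \<open>c\<close> multiplies all
  fluxes; \<open>c = 0\<close> removes the equations.\<close>

definition T :: "real \<Rightarrow> (3 \<Rightarrow> real) \<Rightarrow> 3 \<Rightarrow> real" where
  "T mu a j = (3 - mu / 2) * a j - (a 0 + a 1 + a 2)"

definition flx :: "real \<Rightarrow> real \<Rightarrow> nat \<Rightarrow> code \<Rightarrow> 3 \<Rightarrow> real" where
  "flx c mu n f j = c * T mu (\<lambda>k. f (replicate n j, k)) j"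

primrec net :: "real \<Rightarrow> real \<Rightarrow> nat \<Rightarrow> code \<Rightarrow> bool" where
  "net c mu 0 f \<longleftrightarrow> True"
| "net c mu (Suc n) f \<longleftrightarrow> (\<forall>i. net c mu n (sh f i)) \<and>
     (\<forall>i j. i \<noteq> j \<longrightarrow> flx c mu n (sh f i) j + flx c mu n (sh f j) i = 0)"

text \<open>The flag \<open>b\<close> selects Dirichlet (\<open>True\<close>) or Neumann (\<open>False\<close>) conditions at \<open>q\<^sub>0\<close> and on \<open>X\<close>.
  In the cut cell the flux is that of the odd, respectively even, extension to the whole cell.\<close>

primrec hflx :: "real \<Rightarrow> bool \<Rightarrow> real \<Rightarrow> nat \<Rightarrow> code \<Rightarrow> real" where
  "hflx c b mu 0 f = c * (if b then (3 - mu / 2) * f ([], 1) else (1 - mu / 2) * f ([], 1) - f ([], 0))"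
| "hflx c b mu (Suc n) f = flx c mu n (sh f 1) 1"

text \<open>At \<open>q 0\<close> the even extension has the flux
  \<open>2 * ((1 - mu / 4) * f ([], 0) - f ([], 1))\<close>, whence the case \<open>n = 0\<close>.
  At a point of \<open>X\<close> an even function has equal fluxes from both sides, so they cancel
  only if both vanish.\<close>

primrec hnet :: "real \<Rightarrow> bool \<Rightarrow> real \<Rightarrow> nat \<Rightarrow> code \<Rightarrow> bool" where
  "hnet c b mu 0 f \<longleftrightarrow> (if b then f ([], 0) = 0 else c * ((1 - mu / 4) * f ([], 0) - f ([], 1)) = 0)"
| "hnet c b mu (Suc n) f \<longleftrightarrow> net c mu n (sh f 1) \<and> hnet c b mu n (sh f 0) \<and>
     flx c mu n (sh f 1) 0 + hflx c b mu n (sh f 0) = 0 \<and>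
     (if b then sh f 1 (crn n 2) = 0 else flx c mu n (sh f 1) 2 = 0)"

text \<open>The condition at \<open>q 1\<close> is kept apart from \<open>hnet\<close> because the
  recursion meets that corner of the smaller half gasket as an interior junction.\<close>

definition Sol :: "real \<Rightarrow> bool \<Rightarrow> nat \<Rightarrow> real \<Rightarrow> code set" where
  "Sol c b n mu = {f. hres n f = f \<and> hcmp n f \<and> hnet c b mu n f \<and>
     (if b then f (crn n 1) = 0 else hflx c b mu n f = 0)}"

section \<open>Linearity and restriction of codes\<close>

lemma lc_pair [simp]: "lc a f b g (w, j) = a * f (w, j) + b * g (w, j)"
  by (simp add: lc_def)

lemma lc_zero [simp]: "lc a (\<lambda>_. 0) b (\<lambda>_. 0) = (\<lambda>_. 0)"
  by (simp add: lc_def)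

lemma lc_crn [simp]: "lc a f b g (crn n j) = a * f (crn n j) + b * g (crn n j)"
  by (simp add: lc_def)

lemma sh_apply [simp]: "sh f i (w, j) = f (i # w, j)"
  by (simp add: sh_def)

lemma sh_jn [simp]: "sh (jn h) i = h i"
  by (auto simp: sh_def jn_def)

lemma jn_Nil [simp]: "jn h ([], j) = 0"
  by (simp add: jn_def)

lemma code_eqI: "(\<And>j. f ([], j) = g ([], j)) \<Longrightarrow> (\<And>i. sh f i = sh g i) \<Longrightarrow> f = (g :: code)"
proof (rule ext, clarify)
  fix w j assume a: "\<And>j. f ([], j) = g ([], j)" "\<And>i. sh f i = sh g i"
  show "f (w, j) = g (w, j)"
    using a(1) a(2)[THEN fun_cong, of _ "(tl w, j)"] by (cases w) auto
qed

lemma sh_lc [simp]: "sh (lc a f b g) i = lc a (sh f i) b (sh g i)"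
  by (auto simp: sh_def lc_def)

lemma sh_zero [simp]: "sh (\<lambda>_. 0) i = (\<lambda>_. 0)"
  by (auto simp: sh_def)

lemma sh_crs [simp]: "sh (crs f) i = crs (sh f i)"
  by (auto simp: sh_def crs_def)

lemma crs_crn [simp]: "crs f (crn n j) = f (crn (Suc n) j)"
  by (simp add: crs_def crn_def replicate_append_same)

lemma crn_Suc: "f (crn (Suc n) j) = sh f j (crn n j)"
  by (simp add: crn_def)

lemma flx_Suc: "flx c mu (Suc n) f j = flx c mu n (sh f j) j"
  by (simp add: flx_def)

lemma T_lc: "T mu (\<lambda>k. a * f k + b * g k) j = a * T mu f j + b * T mu g j"
  by (simp add: T_def algebra_simps)

lemma flx_lc [simp]: "flx c mu n (lc a f b g) j = a * flx c mu n f j + b * flx c mu n g j"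
  by (simp add: flx_def T_lc algebra_simps)

lemma flx_zero [simp]: "flx c mu n (\<lambda>_. 0) j = 0"
  by (simp add: flx_def T_def)

lemma hflx_lc [simp]: "hflx c b mu n (lc x f y g) = x * hflx c b mu n f + y * hflx c b mu n g"
  by (cases n) (simp_all add: algebra_simps)

lemma hflx_zero [simp]: "hflx c b mu n (\<lambda>_. 0) = 0"
  by (cases n) simp_all

lemma cmp_lc: "cmp n f \<Longrightarrow> cmp n g \<Longrightarrow> cmp n (lc a f b g)"
  by (induction n arbitrary: f g) simp_all

lemma hcmp_lc: "hcmp n f \<Longrightarrow> hcmp n g \<Longrightarrow> hcmp n (lc a f b g)"
  by (induction n arbitrary: f g) (simp_all add: cmp_lc)

lemma hz_lc: "hz n f \<Longrightarrow> hz n g \<Longrightarrow> hz n (lc a f b g)"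
  by (induction n arbitrary: f g) simp_all

lemma net_lc: "net c mu n f \<Longrightarrow> net c mu n g \<Longrightarrow> net c mu n (lc a f b g)"
proof (induction n arbitrary: f g)
  case (Suc n)
  have "flx c mu n (lc a (sh f i) b (sh g i)) j + flx c mu n (lc a (sh f j) b (sh g j)) i = 0"
    if "i \<noteq> j" for i j
  proof -
    have "flx c mu n (sh f i) j = - flx c mu n (sh f j) i" "flx c mu n (sh g i) j = - flx c mu n (sh g j) i"
      using Suc.prems that by (auto simp: eq_neg_iff_add_eq_0)
    then show ?thesis by simp
  qed
  then show ?case using Suc by (simp del: flx_lc)
qed simp

lemma hnet_lc: "hnet c d mu n f \<Longrightarrow> hnet c d mu n g \<Longrightarrow> hnet c d mu n (lc a f b g)"
proof (induction n arbitrary: f g)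
  case 0
  have "c * ((1 - mu / 4) * (a * f ([], 0) + b * g ([], 0)) - (a * f ([], 1) + b * g ([], 1)))
      = a * (c * ((1 - mu / 4) * f ([], 0) - f ([], 1))) + b * (c * ((1 - mu / 4) * g ([], 0) - g ([], 1)))"
    by (simp add: algebra_simps)
  then show ?case using 0 by (cases d) (auto simp del: mult_eq_0_iff)
next
  case (Suc n)
  have "flx c mu n (sh f 1) 0 = - hflx c d mu n (sh f 0)" "flx c mu n (sh g 1) 0 = - hflx c d mu n (sh g 0)"
    using Suc.prems by (auto simp: eq_neg_iff_add_eq_0)
  then show ?case using Suc by (auto simp: net_lc)
qed

lemma cmp_zero [simp]: "cmp n (\<lambda>_. 0)"
  by (induction n) simp_all

lemma hcmp_zero [simp]: "hcmp n (\<lambda>_. 0)"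
  by (induction n) simp_all

lemma hz_zero [simp]: "hz n (\<lambda>_. 0)"
  by (induction n) simp_all

lemma net_zero [simp]: "net c mu n (\<lambda>_. 0)"
  by (induction n) simp_all

lemma hnet_zero [simp]: "hnet c b mu n (\<lambda>_. 0)"
  by (induction n) simp_all

lemma sh_res [simp]: "sh (res (Suc n) f) i = res n (sh f i)"
  by (auto simp: sh_def res_def)

lemma res_Nil [simp]: "res (Suc n) f ([], j) = 0"
  by (simp add: res_def)

lemma res_crn [simp]: "res n f (crn n j) = f (crn n j)"
  by (simp add: res_def crn_def)

lemma flx_res [simp]: "flx c mu n (res n f) j = flx c mu n f j"
  by (simp add: flx_def res_def)

lemma res_res [simp]: "res n (res n f) = res n f"
  by (auto simp: res_def)

lemma res_lc [simp]: "res n (lc a f b g) = lc a (res n f) b (res n g)"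
  by (auto simp: res_def lc_def)

lemma res_zero [simp]: "res n (\<lambda>_. 0) = (\<lambda>_. 0)"
  by (auto simp: res_def)

lemma cmp_res [simp]: "cmp n (res n f) = cmp n f"
  by (induction n arbitrary: f) simp_all

lemma net_res [simp]: "net c mu n (res n f) = net c mu n f"
  by (induction n arbitrary: f) simp_all

lemma hres_crn1 [simp]: "hres n f (crn n 1) = f (crn n 1)"
  by (cases n) (simp_all add: crn_Suc, simp_all add: crn_def)

lemma hflx_hres [simp]: "hflx c b mu n (hres n f) = hflx c b mu n f"
  by (cases n) simp_all

lemma hres_hres [simp]: "hres n (hres n f) = hres n f"
proof (induction n arbitrary: f)
  case (Suc n)
  show ?case by (rule code_eqI) (simp_all add: Suc)
qed auto

lemma hres_lc [simp]: "hres n (lc a f b g) = lc a (hres n f) b (hres n g)"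
proof (induction n arbitrary: f g)
  case (Suc n)
  show ?case by (rule code_eqI) (simp_all add: Suc)
qed auto

lemma hres_zero [simp]: "hres n (\<lambda>_. 0) = (\<lambda>_. 0)"
proof (induction n)
  case (Suc n)
  show ?case by (rule code_eqI) (simp_all add: Suc)
qed auto

lemma hcmp_hres [simp]: "hcmp n (hres n f) = hcmp n f"
  by (induction n arbitrary: f) simp_all

lemma hz_hres [simp]: "hz n (hres n f) = hz n f"
  by (induction n arbitrary: f) simp_all

lemma hnet_hres [simp]: "hnet c b mu n (hres n f) = hnet c b mu n f"
  by (induction n arbitrary: f) simp_all

lemma res_Suc_iff: "res (Suc n) f = f \<longleftrightarrow> (\<forall>j. f ([], j) = 0) \<and> (\<forall>i. res n (sh f i) = sh f i)"
proof
  assume a: "res (Suc n) f = f"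
  show "(\<forall>j. f ([], j) = 0) \<and> (\<forall>i. res n (sh f i) = sh f i)"
    using a by (metis res_Nil sh_res)
next
  assume a: "(\<forall>j. f ([], j) = 0) \<and> (\<forall>i. res n (sh f i) = sh f i)"
  show "res (Suc n) f = f" by (rule code_eqI) (use a in simp_all)
qed

lemma hres_Suc_iff: "hres (Suc n) f = f \<longleftrightarrow> (\<forall>j. f ([], j) = 0) \<and> res n (sh f 1) = sh f 1 \<and>
    hres n (sh f 0) = sh f 0 \<and> sh f 2 = (\<lambda>_. 0)"
proof
  assume a: "hres (Suc n) f = f"
  have "(\<forall>j. hres (Suc n) f ([], j) = 0) \<and> res n (sh f 1) = sh (hres (Suc n) f) 1 \<and>
    hres n (sh f 0) = sh (hres (Suc n) f) 0 \<and> sh (hres (Suc n) f) 2 = (\<lambda>_. 0)" by simp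
  then show "(\<forall>j. f ([], j) = 0) \<and> res n (sh f 1) = sh f 1 \<and>
    hres n (sh f 0) = sh f 0 \<and> sh f 2 = (\<lambda>_. 0)" unfolding a .
next
  assume a: "(\<forall>j. f ([], j) = 0) \<and> res n (sh f 1) = sh f 1 \<and>
    hres n (sh f 0) = sh f 0 \<and> sh f 2 = (\<lambda>_. 0)"
  have "\<forall>i. sh (hres (Suc n) f) i = sh f i" using a by (simp add: all3)
  then show "hres (Suc n) f = f" by (intro code_eqI[of "hres (Suc n) f" f]) (use a in auto)
qed

lemma lin_sub_Sol: "lin_sub (Sol c b n mu)"
  by (auto simp: lin_sub_def Sol_def hcmp_lc hnet_lc)

text \<open>The three cells are split off one after another: \<open>sh f 0\<close> has image
  \<open>Z 0\<close>, on its kernel \<open>sh f 1\<close> has image \<open>Z 1\<close>, and on the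
  common kernel \<open>sh f 2\<close> is injective.\<close>

lemma dimn_prod3:
  assumes S: "S = {f. (\<forall>j. f ([], j) = 0) \<and> (\<forall>i. sh f i \<in> Z i)}"
    and Z: "\<And>i. lin_sub (Z i)" "dimn d0 (Z 0)" "dimn d1 (Z 1)" "dimn d2 (Z 2)"
  shows "dimn (d0 + d1 + d2) S"
proof -
  have z: "(\<lambda>_. 0) \<in> Z i" for i using Z(1)[of i] by (simp add: lin_sub_def)
  have sub: "lin_sub S" using Z(1) by (auto simp: S lin_sub_def)
  define S1 where "S1 = {f \<in> S. sh f 0 = (\<lambda>_. 0)}"
  define S2 where "S2 = {f \<in> S1. sh f 1 = (\<lambda>_. 0)}"
  have lin: "lin_on A (\<lambda>f. sh f i)" for A i by (simp add: lin_on_def)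
  have sub1: "lin_sub S1" unfolding S1_def by (rule lin_sub_kernel'[OF sub lin])
  have sub2: "lin_sub S2" unfolding S2_def by (rule lin_sub_kernel'[OF sub1 lin])
  have im: "h \<in> (\<lambda>f. sh f i) ` {f \<in> S. \<forall>j. j \<noteq> i \<longrightarrow> sh f j = (\<lambda>_. 0)}" if "h \<in> Z i" for h i
  proof (rule image_eqI)
    show "h = sh (jn (\<lambda>j. if j = i then h else (\<lambda>_. 0))) i" by simp
    show "jn (\<lambda>j. if j = i then h else (\<lambda>_. 0)) \<in> {f \<in> S. \<forall>j. j \<noteq> i \<longrightarrow> sh f j = (\<lambda>_. 0)}"
      using that z by (simp add: S)
  qed
  have sup: "(\<lambda>f. sh f i) ` A \<subseteq> Z i" if "A \<subseteq> S" for A i using that by (auto simp: S)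
  have "(\<lambda>f. sh f 2) ` S2 = Z 2"
    using im[of _ 2] sup[of S2 2] by (force simp: S2_def S1_def)
  then have "dimn d2 ((\<lambda>f. sh f 2) ` S2)" using Z by simp
  moreover have "{f \<in> S2. sh f 2 = (\<lambda>_. 0)} = {\<lambda>_. 0}"
  proof -
    have "f = (\<lambda>_. 0)" if "f \<in> S2" "sh f 2 = (\<lambda>_. 0)" for f
    proof (rule code_eqI)
      have "\<forall>i. sh f i = (\<lambda>_. 0)" using that by (simp add: all3 S2_def S1_def)
      then show "sh f i = sh (\<lambda>_. 0) i" for i by simp
      show "f ([], j) = 0" for j using that by (simp add: S2_def S1_def S)
    qed
    then show ?thesis using sub2 by (auto simp: lin_sub_def)
  qed
  ultimately have d2: "dimn d2 S2"
    using dimn_rank_nullity[OF sub2 lin, of d2 2 0] by simp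
  have "(\<lambda>f. sh f 1) ` S1 = Z 1"
    using im[of _ 1] sup[of S1 1] by (force simp: S1_def)
  then have d1: "dimn (d1 + d2) S1"
    using dimn_rank_nullity[OF sub1 lin, of d1 1 d2] d2 Z by (simp add: S2_def)
  have "(\<lambda>f. sh f 0) ` S = Z 0"
    using im[of _ 0] sup[of S 0] by (force simp: S1_def)
  then show ?thesis
    using dimn_rank_nullity[OF sub lin, of d0 0 "d1 + d2"] d1 Z by (simp add: S1_def add.assoc)
qed

subsection \<open>Spectral decimation\<close>

text \<open>The eigenvalue equations at the midpoints of a cell with corner values \<open>a\<close>, solved for the values
  \<open>EV mu a i j\<close> at the midpoints. At \<open>mu = 2\<close> and \<open>mu = 5\<close> they cannot be solved (the formula divides by 0).\<close>

definition EV :: "real \<Rightarrow> (3 \<Rightarrow> real) \<Rightarrow> 3 \<Rightarrow> 3 \<Rightarrow> real" where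
  "EV mu a i j = (if i = j then a i
     else ((2 - mu) * (a i + a j) + 2 * (a 0 + a 1 + a 2)) / ((2 - mu) * (5 - mu)))"

definition R :: "real \<Rightarrow> real" where "R mu = mu * (5 - mu)"

text \<open>The ratio of fine to coarse fluxes of a decimated function.\<close>

definition k0 :: "real \<Rightarrow> real" where "k0 mu = (6 - mu) / ((2 - mu) * (5 - mu))"

text \<open>Corner values on the whole cut cell after reflection, with a sign if \<open>b\<close>.
  They are odd only for \<open>u = 0\<close>, which the Dirichlet condition supplies.\<close>

definition hval :: "bool \<Rightarrow> real \<Rightarrow> real \<Rightarrow> 3 \<Rightarrow> real" where
  "hval b u v = (\<lambda>k. if k = 0 then u else if k = 1 then v else if b then - v else v)"

primrec dec :: "real \<Rightarrow> nat \<Rightarrow> code \<Rightarrow> bool" where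
  "dec mu 0 f \<longleftrightarrow> (\<forall>i j. f ([i], j) = EV mu (\<lambda>k. f ([k], k)) i j)"
| "dec mu (Suc n) f \<longleftrightarrow> (\<forall>i. dec mu n (sh f i))"

text \<open>In the cut cell the decimation rule is applied to the reflected corner values, and only
  the midpoints in the closed half are recorded.\<close>

primrec hdec :: "bool \<Rightarrow> real \<Rightarrow> nat \<Rightarrow> code \<Rightarrow> bool" where
  "hdec b mu 0 f \<longleftrightarrow> (let a = hval b (f ([0], 0)) (f ([1], 1)) in
     f ([0], 1) = EV mu a 0 1 \<and> f ([1], 0) = EV mu a 1 0 \<and> f ([1], 2) = EV mu a 1 2)"
| "hdec b mu (Suc n) f \<longleftrightarrow> dec mu n (sh f 1) \<and> hdec b mu n (sh f 0)"

lemma EV_sym: "EV mu a i j = EV mu a j i"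
  by (simp add: EV_def add.commute)

text \<open>Adding the equations gives \<open>(2 - mu) * (x + y + z) = 2 * A\<close>, which
  decouples them.\<close>

lemma mid_solve:
  fixes mu a0 a1 a2 x y z :: real
  assumes mu: "mu \<noteq> 2" "mu \<noteq> 5"
  defines "A \<equiv> a0 + a1 + a2"
  shows "(5 - mu) * x = a0 + a1 + (x + y + z) \<and> (5 - mu) * y = a0 + a2 + (x + y + z) \<and>
      (5 - mu) * z = a1 + a2 + (x + y + z) \<longleftrightarrow>
    x = ((2 - mu) * (a0 + a1) + 2 * A) / ((2 - mu) * (5 - mu)) \<and>
    y = ((2 - mu) * (a0 + a2) + 2 * A) / ((2 - mu) * (5 - mu)) \<and>
    z = ((2 - mu) * (a1 + a2) + 2 * A) / ((2 - mu) * (5 - mu))" (is "?l \<longleftrightarrow> ?r")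
proof -
  have n: "(2 - mu) * (5 - mu) \<noteq> 0" "2 - mu \<noteq> 0" "5 - mu \<noteq> 0" using mu by auto
  have key: "x = ((2 - mu) * s + 2 * A) / ((2 - mu) * (5 - mu)) \<longleftrightarrow>
      (2 - mu) * ((5 - mu) * x) = (2 - mu) * s + 2 * A" for x s
    using n(1) by (simp add: nonzero_eq_divide_eq mult_ac)
  show ?thesis
  proof
    assume l: ?l
    have "(2 - mu) * (x + y + z) = 2 * A" using l unfolding A_def by algebra
    then show ?r unfolding key using l by (simp add: distrib_left)
  next
    assume ?r
    then have r: "(2 - mu) * ((5 - mu) * x) = (2 - mu) * (a0 + a1) + 2 * A"
      "(2 - mu) * ((5 - mu) * y) = (2 - mu) * (a0 + a2) + 2 * A"
      "(2 - mu) * ((5 - mu) * z) = (2 - mu) * (a1 + a2) + 2 * A" unfolding key by auto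
    have "(5 - mu) * ((2 - mu) * (x + y + z)) = (5 - mu) * (2 * A)" using r unfolding A_def by algebra
    then have s: "(2 - mu) * (x + y + z) = 2 * A" using n(3) by simp
    have "(2 - mu) * ((5 - mu) * x) = (2 - mu) * (a0 + a1 + (x + y + z))"
      "(2 - mu) * ((5 - mu) * y) = (2 - mu) * (a0 + a2 + (x + y + z))"
      "(2 - mu) * ((5 - mu) * z) = (2 - mu) * (a1 + a2 + (x + y + z))" using r s by (simp_all add: distrib_left)
    then show ?l using n(2) by simp
  qed
qed

text \<open>The identity behind spectral decimation: solving for the midpoints turns the flux for
  \<open>mu\<close> into a multiple of the flux for \<open>R mu\<close>. The factor vanishes exactly
  at \<open>mu = 6\<close>.\<close>

lemma T_EV:
  assumes mu: "mu \<noteq> 2" "mu \<noteq> 5"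
  shows "T mu (EV mu a j) j = k0 mu * T (R mu) a j"
proof -
  have n: "(2 - mu) * (5 - mu) \<noteq> 0" using mu by auto
  define D where "D = (2 - mu) * (5 - mu)"
  have m: "EV mu a i j * D = (2 - mu) * (a i + a j) + 2 * (a 0 + a 1 + a 2)" if "i \<noteq> j" for i j
    using n that by (simp add: EV_def D_def)
  have e: "EV mu a i i = a i" for i by (simp add: EV_def)
  have "T mu (EV mu a j) j * D = (6 - mu) * T (R mu) a j"
  proof -
    have "\<forall>j. T mu (EV mu a j) j * D = (6 - mu) * T (R mu) a j"
      unfolding all3 T_def e R_def
      using m[of 0 1] m[of 0 2] m[of 1 0] m[of 1 2] m[of 2 0] m[of 2 1] unfolding D_def
      by (simp add: field_simps)
    then show ?thesis by blast
  qed
  then show ?thesis using n unfolding k0_def D_def by (simp add: nonzero_eq_divide_eq mult_ac)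
qed

lemma sh_hres [simp]: "sh (hres (Suc n) f) 1 = res n (sh f 1)" "sh (hres (Suc n) f) 0 = hres n (sh f 0)"
  "sh (hres (Suc n) f) 2 = (\<lambda>_. 0)" "hres (Suc n) f ([], j) = 0"
  by simp_all

declare hres.simps(2) [simp del]

section \<open>Rescaling fluxes, and removing them with \<open>c = 0\<close>\<close>

lemma net_0 [simp]: "net 0 mu n f"
  by (induction n arbitrary: f) (simp_all add: flx_def)

lemma flx_0 [simp]: "flx 0 mu n f j = 0"
  by (simp add: flx_def)

lemma hflx_0 [simp]: "hflx 0 b mu n f = 0"
  by (cases n) simp_all

lemma hnet_0: "hnet 0 b mu n f \<longleftrightarrow> (b \<longrightarrow> hz n f)"
  by (induction n arbitrary: f) auto

lemma hnet_hz: "hnet c True mu n f \<Longrightarrow> hz n f"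
  by (induction n arbitrary: f) simp_all

lemma flx_scale: "flx c mu n f j = c * flx 1 mu n f j"
  by (simp add: flx_def)

lemma net_scale: "c \<noteq> 0 \<Longrightarrow> net c mu n f = net 1 mu n f"
proof (induction n arbitrary: f)
  case (Suc n)
  have "flx c mu n (sh f i) j + flx c mu n (sh f j) i = 0 \<longleftrightarrow> flx 1 mu n (sh f i) j + flx 1 mu n (sh f j) i = 0" for i j
    unfolding flx_scale[of c] distrib_left[symmetric] using Suc by simp
  then show ?case using Suc by simp
qed simp

lemma hflx_scale: "hflx c b mu n f = c * hflx 1 b mu n f"
  by (cases n) (simp_all add: flx_def)

lemma hnet_scale: "c \<noteq> 0 \<Longrightarrow> hnet c b mu n f = hnet 1 b mu n f"
proof (induction n arbitrary: f)
  case (Suc n)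
  have "flx c mu n (sh f 1) 0 + hflx c b mu n (sh f 0) = 0 \<longleftrightarrow> flx 1 mu n (sh f 1) 0 + hflx 1 b mu n (sh f 0) = 0"
    unfolding flx_scale[of c] hflx_scale[of c] distrib_left[symmetric] using Suc by simp
  moreover have "flx c mu n (sh f 1) 2 = 0 \<longleftrightarrow> flx 1 mu n (sh f 1) 2 = 0"
    unfolding flx_scale[of c] using Suc by simp
  ultimately show ?case using Suc by (simp add: net_scale[of c])
qed simp

lemma Sol_scale: "c \<noteq> 0 \<Longrightarrow> Sol c b n mu = Sol 1 b n mu"
  by (simp add: Sol_def hnet_scale[of c] hflx_scale[of c])

section \<open>The equations under decimation\<close>

lemma net1_dec:
  assumes mu: "mu \<noteq> 2" "mu \<noteq> 5" and c: "cmp (Suc 0) f"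
  shows "net 1 mu (Suc 0) f \<longleftrightarrow> dec mu 0 f"
proof -
  define a where "a k = f ([k], k)" for k
  define x y z where xyz: "x = f ([0], 1)" "y = f ([0], 2)" "z = f ([1], 2)"
  have c': "f ([1], 0) = x" "f ([2], 0) = y" "f ([2], 1) = z"
    using c unfolding xyz by (simp_all add: crn_def)
  have "net 1 mu (Suc 0) f \<longleftrightarrow> (5 - mu) * x = a 0 + a 1 + (x + y + z) \<and>
     (5 - mu) * y = a 0 + a 2 + (x + y + z) \<and> (5 - mu) * z = a 1 + a 2 + (x + y + z)"
    by (auto simp: all3 flx_def T_def c' xyz[symmetric] a_def[symmetric] algebra_simps)
  also have "\<dots> \<longleftrightarrow> dec mu 0 f"
    unfolding mid_solve[OF mu] by (auto simp: all3 EV_def c' xyz[symmetric] a_def[symmetric] add.commute)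
  finally show ?thesis .
qed

lemma flx1_dec:
  assumes mu: "mu \<noteq> 2" "mu \<noteq> 5" and d: "dec mu 0 f"
  shows "flx 1 mu (Suc 0) f j = flx (k0 mu) (R mu) 0 (crs f) j"
proof -
  have "(\<lambda>k. f ([j], k)) = EV mu (\<lambda>k. f ([k], k)) j"
    using d unfolding dec.simps by blast
  then show ?thesis using T_EV[OF mu, of "\<lambda>k. f ([k], k)" j] by (simp add: flx_def crs_def)
qed

lemma flx_dec:
  assumes mu: "mu \<noteq> 2" "mu \<noteq> 5"
  shows "dec mu n f \<Longrightarrow> flx 1 mu (Suc n) f j = flx (k0 mu) (R mu) n (crs f) j"
proof (induction n arbitrary: f)
  case 0
  then show ?case by (rule flx1_dec[OF mu])
next
  case (Suc n)
  have "flx 1 mu (Suc n) (sh f j) j = flx (k0 mu) (R mu) n (crs (sh f j)) j"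
    using Suc.prems by (intro Suc.IH) simp
  then show ?case unfolding flx_Suc[of _ _ "Suc n"] flx_Suc[of _ _ n "crs f"] sh_crs .
qed

text \<open>The junctions inside a level-\<open>n\<close> cell are its midpoints and give
  \<open>dec\<close>; at the older junctions the fluxes on both sides change by the same factor, by
  \<open>flx_dec\<close>.\<close>

lemma net_dec:
  assumes mu: "mu \<noteq> 2" "mu \<noteq> 5"
  shows "cmp (Suc n) f \<Longrightarrow> net 1 mu (Suc n) f \<longleftrightarrow> dec mu n f \<and> net (k0 mu) (R mu) n (crs f)"
proof (induction n arbitrary: f)
  case 0
  then show ?case using net1_dec[OF mu 0] by simp
next
  case (Suc n)
  have IH: "net 1 mu (Suc n) (sh f i) \<longleftrightarrow> dec mu n (sh f i) \<and> net (k0 mu) (R mu) n (crs (sh f i))" for i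
    by (rule Suc.IH) (use Suc.prems in simp)
  have "net 1 mu (Suc (Suc n)) f \<longleftrightarrow> (\<forall>i. net 1 mu (Suc n) (sh f i)) \<and>
     (\<forall>i j. i \<noteq> j \<longrightarrow> flx 1 mu (Suc n) (sh f i) j + flx 1 mu (Suc n) (sh f j) i = 0)"
    by (rule net.simps(2))
  also have "\<dots> \<longleftrightarrow> dec mu (Suc n) f \<and> net (k0 mu) (R mu) (Suc n) (crs f)"
    unfolding IH using flx_dec[OF mu] by (auto simp del: three_eq)
  finally show ?case .
qed

text \<open>The cut cell needs its own computation. An odd function has one unknown midpoint value
  left; an even one satisfies the system of \<open>mid_solve\<close> with two equal midpoints, and
  the equation at \<open>q 0\<close> scales like a flux.\<close>

lemma hnet1_dec:
  assumes mu: "mu \<noteq> 2" "mu \<noteq> 5" and c: "hcmp (Suc 0) f"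
  shows "hnet 1 b mu (Suc 0) f \<longleftrightarrow> hdec b mu 0 f \<and> hnet (k0 mu) b (R mu) 0 (crs f)"
proof -
  define u v p x where uvpx: "u = f ([0], 0)" "v = f ([1], 1)" "p = f ([0], 1)" "x = f ([1], 2)"
  have c': "f ([1], 0) = p" using c by (simp add: crn_def uvpx)
  have n: "2 - mu \<noteq> 0" "5 - mu \<noteq> 0" using mu by auto
  show ?thesis
  proof (cases b)
    case True
    have "hnet 1 b mu (Suc 0) f \<longleftrightarrow> u = 0 \<and> x = 0 \<and> (5 - mu) * p = v"
      using True by (auto simp: flx_def T_def c' uvpx[symmetric] crn_def algebra_simps)
    moreover have "hdec b mu 0 f \<longleftrightarrow> p = EV mu (hval b u v) 0 1 \<and> p = EV mu (hval b u v) 1 0 \<and> x = EV mu (hval b u v) 1 2"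
      unfolding hdec.simps Let_def c' uvpx[symmetric] ..
    moreover have "hnet (k0 mu) b (R mu) 0 (crs f) \<longleftrightarrow> u = 0"
      using True by (simp add: crs_def uvpx)
    moreover have "EV mu (hval True 0 v) 0 1 = v / (5 - mu)" "EV mu (hval True 0 v) 1 0 = v / (5 - mu)"
      "EV mu (hval True 0 v) 1 2 = 0"
      using n by (simp_all add: EV_def hval_def)
    moreover have "p = v / (5 - mu) \<longleftrightarrow> (5 - mu) * p = v" using n by (simp add: eq_divide_eq mult.commute)
    ultimately have "hdec b mu 0 f \<and> hnet (k0 mu) b (R mu) 0 (crs f) \<longleftrightarrow> hnet 1 b mu (Suc 0) f"
      using True by metis
    then show ?thesis by blast
  next
    case False
    have "hnet 1 b mu (Suc 0) f \<longleftrightarrow> (1 - mu / 4) * u = p \<and> (3 - mu) * p = u + v + x \<and> (4 - mu) * x = 2 * p + 2 * v"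
      using False by (auto simp: flx_def T_def c' uvpx[symmetric] crn_def algebra_simps)
    \<comment> \<open>Repeating the equation for the mirrored midpoint gives the shape of
      \<open>mid_solve\<close>.\<close>
    also have "\<dots> \<longleftrightarrow> (1 - mu / 4) * u = p \<and> ((5 - mu) * p = u + v + (p + p + x) \<and> (5 - mu) * p = u + v + (p + p + x)
       \<and> (5 - mu) * x = v + v + (p + p + x))"
      by (auto simp: algebra_simps)
    also have "\<dots> \<longleftrightarrow> (1 - mu / 4) * u = p \<and> hdec b mu 0 f"
      unfolding mid_solve[OF mu] using False
      by (auto simp: hval_def EV_def c' uvpx[symmetric] add.commute)
    also have "\<dots> \<longleftrightarrow> hdec b mu 0 f \<and> hnet (k0 mu) b (R mu) 0 (crs f)"
    proof -
      have "(1 - mu / 4) * u = p \<longleftrightarrow> k0 mu * ((1 - R mu / 4) * u - v) = 0" if "hdec b mu 0 f"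
      proof -
        have "p = EV mu (hval b u v) 0 1" using that by (simp add: uvpx Let_def)
        then have "p * ((2 - mu) * (5 - mu)) = (2 - mu) * (u + v) + 2 * (u + v + v)"
          using False n by (simp add: EV_def hval_def)
        then have "((1 - mu / 4) * u - p) * ((2 - mu) * (5 - mu)) = (6 - mu) * ((1 - R mu / 4) * u - v)"
          unfolding R_def by (simp add: field_simps)
        then have "(1 - mu / 4) * u - p = k0 mu * ((1 - R mu / 4) * u - v)"
          using n by (simp add: k0_def nonzero_eq_divide_eq)
        then show ?thesis by (metis eq_iff_diff_eq_0)
      qed
      then show ?thesis using False by (auto simp: crs_def uvpx[symmetric] simp del: hdec.simps)
    qed
    finally show ?thesis .
  qed
qed

lemma hflx1_dec:
  assumes mu: "mu \<noteq> 2" "mu \<noteq> 5" and d: "hdec b mu 0 f" "b \<longrightarrow> f ([0], 0) = 0"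
  shows "hflx 1 b mu (Suc 0) f = hflx (k0 mu) b (R mu) 0 (crs f)"
proof -
  define a where "a = hval b (f ([0], 0)) (f ([1], 1))"
  have "f ([1], k) = EV mu a 1 k" if "k = 0 \<or> k = 1 \<or> k = 2" for k
    using d(1) that by (auto simp: a_def Let_def) (simp add: EV_def hval_def)
  then have "(\<lambda>k. f ([1], k)) = EV mu a 1" using ex3[of "\<lambda>k. f ([1], k) \<noteq> EV mu a 1 k"] by auto
  then have "hflx 1 b mu (Suc 0) f = k0 mu * T (R mu) a 1" using T_EV[OF mu, of a 1] by (simp add: flx_def)
  also have "\<dots> = hflx (k0 mu) b (R mu) 0 (crs f)"
    using d(2) by (auto simp: T_def a_def hval_def crs_def algebra_simps)
  finally show ?thesis .
qed

text \<open>In the odd case the flux formula of the cut cell presupposes the value 0 at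
  \<open>q 0\<close>, hence the assumption on \<open>hz\<close>.\<close>

lemma hflx_dec:
  assumes mu: "mu \<noteq> 2" "mu \<noteq> 5"
  shows "hdec b mu n f \<Longrightarrow> (b \<longrightarrow> hz (Suc n) f) \<Longrightarrow> hflx 1 b mu (Suc n) f = hflx (k0 mu) b (R mu) n (crs f)"
proof (cases n)
  case 0
  assume "hdec b mu n f" "b \<longrightarrow> hz (Suc n) f"
  then show ?thesis using hflx1_dec[OF mu, of b f] 0 by simp
next
  case (Suc m)
  assume "hdec b mu n f" 
  then show ?thesis using flx_dec[OF mu, of m "sh f 1" 1] Suc by simp
qed

lemma hnet_dec:
  assumes mu: "mu \<noteq> 2" "mu \<noteq> 5"
  shows "hcmp (Suc n) f \<Longrightarrow> hnet 1 b mu (Suc n) f \<longleftrightarrow> hdec b mu n f \<and> hnet (k0 mu) b (R mu) n (crs f)"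
proof (induction n arbitrary: f)
  case 0
  show ?case by (rule hnet1_dec[OF mu 0])
next
  case (Suc n)
  have IH: "hnet 1 b mu (Suc n) (sh f 0) \<longleftrightarrow> hdec b mu n (sh f 0) \<and> hnet (k0 mu) b (R mu) n (crs (sh f 0))"
    by (rule Suc.IH) (use Suc.prems in simp)
  have IH1: "net 1 mu (Suc n) (sh f 1) \<longleftrightarrow> dec mu n (sh f 1) \<and> net (k0 mu) (R mu) n (crs (sh f 1))"
    by (rule net_dec[OF mu]) (use Suc.prems in simp)
  have hf: "hflx 1 b mu (Suc n) (sh f 0) = hflx (k0 mu) b (R mu) n (crs (sh f 0))"
    if "hdec b mu n (sh f 0)" "hnet (k0 mu) b (R mu) n (crs (sh f 0))"
  proof (rule hflx_dec[OF mu that(1)], rule impI)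
    assume b
    then show "hz (Suc n) (sh f 0)" using that IH hnet_hz[of 1 mu "Suc n" "sh f 0"] by simp
  qed
  have "hnet 1 b mu (Suc (Suc n)) f \<longleftrightarrow> net 1 mu (Suc n) (sh f 1) \<and> hnet 1 b mu (Suc n) (sh f 0) \<and>
     flx 1 mu (Suc n) (sh f 1) 0 + hflx 1 b mu (Suc n) (sh f 0) = 0 \<and>
     (if b then sh f 1 (crn (Suc n) 2) = 0 else flx 1 mu (Suc n) (sh f 1) 2 = 0)"
    by (rule hnet.simps(2))
  also have "\<dots> \<longleftrightarrow> hdec b mu (Suc n) f \<and> hnet (k0 mu) b (R mu) (Suc n) (crs f)"
    unfolding IH IH1 using flx_dec[OF mu, of n "sh f 1"] hf by (auto simp del: three_eq)
  finally show ?case .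
qed

section \<open>Extension of coarse solutions, existence and uniqueness\<close>

lemma ext_full:
  "cmp n g \<Longrightarrow> res n g = g \<Longrightarrow> \<exists>f. res (Suc n) f = f \<and> cmp (Suc n) f \<and> dec mu n f \<and> crs f = g"
proof (induction n arbitrary: g)
  case 0
  define f where "f = jn (\<lambda>i. res 0 (\<lambda>(w, j). EV mu (\<lambda>k. g ([], k)) i j))"
  have "crs f (w, j) = g (w, j)" for w j
  proof (cases w)
    case Nil
    then show ?thesis by (simp add: crs_def f_def jn_def res_def EV_def)
  next
    case (Cons i v)
    have "g (w, j) = res 0 g (w, j)" using 0 by simp
    then show ?thesis using Cons by (simp add: crs_def f_def jn_def res_def)
  qed
  then have c: "crs f = g" by auto
  have s: "f ([i], j) = EV mu (\<lambda>k. g ([], k)) i j" for i j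
    by (simp add: f_def jn_def res_def)
  have "res (Suc 0) f = f" by (simp add: res_Suc_iff f_def)
  moreover have "cmp (Suc 0) f" by (simp add: crn_def s EV_sym)
  moreover have "dec mu 0 f" by (simp add: s) (simp add: EV_def)
  ultimately show ?case using c by blast
next
  case (Suc n)
  have "\<forall>i. \<exists>f. res (Suc n) f = f \<and> cmp (Suc n) f \<and> dec mu n f \<and> crs f = sh g i"
    using Suc by (auto simp: res_Suc_iff)
  then obtain h where h: "\<And>i. res (Suc n) (h i) = h i" "\<And>i. cmp (Suc n) (h i)" "\<And>i. dec mu n (h i)"
    "\<And>i. crs (h i) = sh g i" by metis
  have "h i (crn (Suc n) j) = sh g i (crn n j)" for i j using h(4)[of i] by (metis crs_crn)
  then have "cmp (Suc (Suc n)) (jn h)" using h(2) Suc.prems(1) by simp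
  moreover have "res (Suc (Suc n)) (jn h) = jn h" using h(1) by (simp only: res_Suc_iff[of "Suc n"]) simp
  moreover have "crs (jn h) = g"
  proof (rule code_eqI)
    show "sh (crs (jn h)) i = sh g i" for i using h(4) by simp
    show "crs (jn h) ([], j) = g ([], j)" for j
      using h(1)[of j] Suc.prems(2) by (simp add: crs_def jn_def res_Suc_iff)
  qed
  ultimately show ?case using h(3) by (intro exI[of _ "jn h"]) simp
qed

text \<open>Together with \<open>hdec_zero\<close> this makes \<open>crs\<close> an isomorphism onto
  the coarse solutions. The symmetry of \<open>EV mu a i j\<close> in \<open>i\<close> and
  \<open>j\<close> makes the two recorded values of a midpoint agree.\<close>

lemma ext_half:
  "hcmp n g \<Longrightarrow> hres n g = g \<Longrightarrow> (b \<longrightarrow> hz n g) \<Longrightarrow>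
    \<exists>f. hres (Suc n) f = f \<and> hcmp (Suc n) f \<and> hdec b mu n f \<and> crs f = g"
proof (induction n arbitrary: g)
  case 0
  define a where "a = hval b (g ([], 0)) (g ([], 1))"
  define f where "f = jn (\<lambda>i. if i = 1 then res 0 (\<lambda>(w, j). EV mu a 1 j) else
     if i = 0 then hres 0 (\<lambda>(w, j). EV mu a 0 j) else (\<lambda>_. 0))"
  have g: "g (w, j) = 0" if "w \<noteq> [] \<or> j = 2" for w j
  proof -
    have "g (w, j) = hres 0 g (w, j)" using 0 by simp
    then show ?thesis using that by auto
  qed
  have c: "crs f = g"
  proof (rule ext, clarify)
    fix w :: "3 list" and j
    have "\<forall>j. crs f ([], j) = g ([], j)"
      by (simp add: all3 crs_def f_def jn_def res_def EV_def g, simp add: a_def hval_def)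
    moreover have "crs f (i # v, j) = g (i # v, j)" for i v
      by (auto simp: crs_def f_def jn_def res_def g)
    ultimately show "crs f (w, j) = g (w, j)" by (cases w) auto
  qed
  have s: "f ([1], j) = EV mu a 1 j" "f ([0], 1) = EV mu a 0 1" "f ([0], 0) = a 0" for j
    by (simp_all add: f_def jn_def res_def EV_def)
  have a: "a = hval b (f ([0], 0)) (f ([1], 1))"
    unfolding s by (simp add: EV_def) (simp add: a_def hval_def fun_eq_iff)
  have "hres (Suc 0) f = f" unfolding hres_Suc_iff by (simp add: f_def del: hres.simps)
  moreover have "hcmp (Suc 0) f" by (simp add: crn_def s EV_sym[of mu a 1])
  moreover have "hdec b mu 0 f" using s unfolding hdec.simps a[symmetric] Let_def by simp
  ultimately show ?case using c by blast
next
  case (Suc n)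
  have gs: "res n (sh g 1) = sh g 1" "hres n (sh g 0) = sh g 0"
    using Suc.prems(2) unfolding hres_Suc_iff by auto
  have "\<exists>f. hres (Suc n) f = f \<and> hcmp (Suc n) f \<and> hdec b mu n f \<and> crs f = sh g 0"
    by (rule Suc.IH) (use gs Suc.prems in simp_all)
  then obtain h0 where h0: "hres (Suc n) h0 = h0" "hcmp (Suc n) h0" "hdec b mu n h0" "crs h0 = sh g 0"
    by blast
  have "\<exists>f. res (Suc n) f = f \<and> cmp (Suc n) f \<and> dec mu n f \<and> crs f = sh g 1"
    by (rule ext_full) (use gs Suc.prems in simp_all)
  then obtain h1 where h1: "res (Suc n) h1 = h1" "cmp (Suc n) h1" "dec mu n h1" "crs h1 = sh g 1"
    by blast
  define f where "f = jn (\<lambda>i. if i = 1 then h1 else if i = 0 then h0 else (\<lambda>_. 0))"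
  have sf: "sh f 0 = h0" "sh f 1 = h1" "sh f 2 = (\<lambda>_. 0)" by (simp_all add: f_def)
  have "h0 (crn (Suc n) j) = sh g 0 (crn n j)" "h1 (crn (Suc n) j) = sh g 1 (crn n j)" for j
    using h0(4) h1(4) by (metis crs_crn)+
  then have "hcmp (Suc (Suc n)) f"
    using h0(2) h1(2) Suc.prems(1) unfolding hcmp.simps(2)[of "Suc n"] sf by simp
  moreover have "hres (Suc (Suc n)) f = f"
    using h0(1) h1(1) unfolding hres_Suc_iff[of "Suc n"] sf by (simp add: f_def)
  moreover have "crs f = g"
  proof (rule code_eqI)
    have "sh g 2 = (\<lambda>_. 0)" using Suc.prems(2) unfolding hres_Suc_iff by auto
    moreover have "crs (\<lambda>_. 0) = (\<lambda>_. 0)" by (auto simp: crs_def)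
    ultimately have "\<forall>i. sh (crs f) i = sh g i" unfolding all3 sh_crs sf using h0(4) h1(4) by simp
    then show "sh (crs f) i = sh g i" for i by blast
    have "h0 ([], j) = 0" "h1 ([], j) = 0" for j using h0(1) h1(1) unfolding hres_Suc_iff res_Suc_iff by auto
    then have "f ([j], j) = 0" for j by (simp add: f_def jn_def)
    moreover have "g ([], j) = 0" for j using Suc.prems(2) unfolding hres_Suc_iff by auto
    ultimately show "crs f ([], j) = g ([], j)" for j by (simp add: crs_def)
  qed
  ultimately show ?case using h0(3) h1(3) sf by (intro exI[of _ f]) simp
qed

lemma dec_zero: "cmp (Suc n) f \<Longrightarrow> dec mu n f \<Longrightarrow> res (Suc n) f = f \<Longrightarrow> res n (crs f) = (\<lambda>_. 0) \<Longrightarrow> f = (\<lambda>_. 0)"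
proof (induction n arbitrary: f)
  case 0
  have "f ([k], k) = 0" for k using 0(4)[THEN fun_cong, of "([], k)"] by (simp add: res_def crs_def)
  then have "f ([i], j) = 0" for i j using 0(2) by (simp add: EV_def)
  moreover have "f (w, j) = 0" if "length w \<noteq> 1" for w j
    using 0(3)[THEN fun_cong, of "(w, j)"] that by (simp add: res_def)
  ultimately have "f (w, j) = 0" for w j by (cases "length w = 1") (auto simp: length_Suc_conv)
  then show ?case by auto
next
  case (Suc n)
  have "sh f i = (\<lambda>_. 0)" for i
  proof (rule Suc.IH)
    show "cmp (Suc n) (sh f i)" "dec mu n (sh f i)" using Suc.prems by simp_all
    show "res (Suc n) (sh f i) = sh f i" using Suc.prems(3) by (simp add: res_Suc_iff[of "Suc n"])
    have "sh (res (Suc n) (crs f)) i = (\<lambda>_. 0)" unfolding Suc.prems(4) by simp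
    then show "res n (crs (sh f i)) = (\<lambda>_. 0)" by simp
  qed
  moreover have "f ([], j) = 0" for j using Suc.prems(3) by (simp add: res_Suc_iff[of "Suc n"])
  ultimately show ?case by (intro code_eqI[of f]) simp_all
qed

lemma hdec_zero: "hcmp (Suc n) f \<Longrightarrow> hdec b mu n f \<Longrightarrow> hres (Suc n) f = f \<Longrightarrow> hres n (crs f) = (\<lambda>_. 0) \<Longrightarrow> f = (\<lambda>_. 0)"
proof (induction n arbitrary: f)
  case 0
  have "f ([k], k) = 0" if "k \<noteq> 2" for k using that 0(4)[THEN fun_cong, of "([], k)"] by (simp add: crs_def)
  then have "hval b (f ([0], 0)) (f ([1], 1)) = (\<lambda>_. 0)" "f ([1], 1) = 0" "f ([0], 0) = 0" by (auto simp: hval_def)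
  then have "f ([1], 0) = 0" "f ([1], 2) = 0" "f ([0], 1) = 0" using 0(2) by (simp_all add: EV_def)
  note z = this \<open>f ([1], 1) = 0\<close> \<open>f ([0], 0) = 0\<close>
  have s: "(\<forall>j. f ([], j) = 0) \<and> res 0 (sh f 1) = sh f 1 \<and> hres 0 (sh f 0) = sh f 0 \<and> sh f 2 = (\<lambda>_. 0)"
    using 0(3) unfolding hres_Suc_iff .
  have "\<forall>j. f ([1], j) = 0" using z by (simp add: all3)
  then have "res 0 (sh f 1) = (\<lambda>_. 0)" by (auto simp: res_def)
  moreover have "\<forall>j. j \<noteq> 2 \<longrightarrow> f ([0], j) = 0" using z by (simp add: all3)
  then have "hres 0 (sh f 0) = (\<lambda>_. 0)" by auto
  ultimately have "\<forall>i. sh f i = (\<lambda>_. 0)" using s by (simp add: all3)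
  then show ?case using s by (intro code_eqI[of f]) simp_all
next
  case (Suc n)
  have s: "(\<forall>j. f ([], j) = 0) \<and> res (Suc n) (sh f 1) = sh f 1 \<and> hres (Suc n) (sh f 0) = sh f 0 \<and> sh f 2 = (\<lambda>_. 0)"
    using Suc.prems(3) unfolding hres_Suc_iff[of "Suc n"] .
  have "sh (hres (Suc n) (crs f)) i = (\<lambda>_. 0)" for i unfolding Suc.prems(4) by simp
  from this[of 0] this[of 1] have "hres n (crs (sh f 0)) = (\<lambda>_. 0)" "res n (crs (sh f 1)) = (\<lambda>_. 0)" by simp_all
  then have "sh f 0 = (\<lambda>_. 0)" "sh f 1 = (\<lambda>_. 0)"
    using Suc.IH[of "sh f 0"] dec_zero[of n "sh f 1" mu] Suc.prems(1,2) s by simp_all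
  then have "\<forall>i. sh f i = (\<lambda>_. 0)" using s by (simp add: all3)
  then show ?case using s by (intro code_eqI[of f]) simp_all
qed

lemma crs_lc: "crs (lc a f b g) = lc a (crs f) b (crs g)"
  by (auto simp: crs_def lc_def)

lemma hcmp_crs: "hcmp (Suc n) f \<Longrightarrow> hcmp n (crs f)"
proof (induction n arbitrary: f)
  case (Suc n)
  have "cmp (Suc m) g \<Longrightarrow> cmp m (crs g)" for m and g :: code
    by (induction m arbitrary: g) (auto simp: crn_Suc[symmetric] simp del: cmp.simps(2)[of "Suc _"])
  then show ?case using Suc by (simp del: cmp.simps)
qed simp

lemma hres_crs: "hres (Suc n) f = f \<Longrightarrow> hres n (crs f) = crs f"
proof (induction n arbitrary: f)
  case 0
  then have s: "(\<forall>j. f ([], j) = 0) \<and> res 0 (sh f 1) = sh f 1 \<and> hres 0 (sh f 0) = sh f 0 \<and> sh f 2 = (\<lambda>_. 0)"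
    unfolding hres_Suc_iff .
  have l: "sh f i (v @ [j], j) = 0" for i v j
  proof -
    have "res 0 (sh f 1) (v @ [j], j) = 0" "hres 0 (sh f 0) (v @ [j], j) = 0" by (simp_all add: res_def)
    then have "sh f 0 (v @ [j], j) = 0" "sh f 1 (v @ [j], j) = 0" "sh f 2 (v @ [j], j) = 0"
      using s by metis+
    then have "\<forall>i. sh f i (v @ [j], j) = 0" unfolding all3 by blast
    then show ?thesis by blast
  qed
  have "crs f (i # v, j) = 0" for i v j using l[of i v j] by (simp add: crs_def)
  moreover have "sh f 2 ([], 2) = 0" using s by metis
  then have "crs f ([], 2) = 0" by (simp add: crs_def)
  ultimately have "hres 0 (crs f) (w, j) = crs f (w, j)" for w j by (cases w) auto
  then show ?case by auto
next
  case (Suc n)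
  have s: "(\<forall>j. f ([], j) = 0) \<and> res (Suc n) (sh f 1) = sh f 1 \<and> hres (Suc n) (sh f 0) = sh f 0 \<and> sh f 2 = (\<lambda>_. 0)"
    using Suc.prems unfolding hres_Suc_iff[of "Suc n"] .
  have r: "res m (crs g) = crs g" if "res (Suc m) g = g" for m g
  proof (rule ext, clarify)
    fix w j
    have "res (Suc m) g (w @ [j], j) = g (w @ [j], j)" using that by simp
    then show "res m (crs g) (w, j) = crs g (w, j)" by (auto simp: res_def crs_def split: if_splits)
  qed
  have "sh f i ([], i) = 0" for i
  proof -
    have "\<forall>i. sh f i ([], i) = 0" unfolding all3 using s hres_Suc_iff res_Suc_iff by metis
    then show ?thesis by blast
  qed
  then have "crs f ([], j) = 0" for j by (simp add: crs_def)
  moreover have "crs (\<lambda>_. 0) = (\<lambda>_. 0)" by (auto simp: crs_def)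
  ultimately show ?case unfolding hres_Suc_iff sh_crs using s Suc.IH[of "sh f 0"] r[of n "sh f 1"] by simp
qed

text \<open>At \<open>mu = 6\<close> the coarse space has \<open>c = k0 6 = 0\<close>, hence no flux
  equations: the eigenvalue 6 is thereby reduced to a count of vertices.\<close>

lemma Sol_dec:
  assumes mu: "mu \<noteq> 2" "mu \<noteq> 5" and d: "dimn d (Sol (k0 mu) b n (R mu))"
  shows "dimn d (Sol 1 b (Suc n) mu)"
proof (rule dimn_inj)
  show "lin_sub (Sol 1 b (Suc n) mu)" by (rule lin_sub_Sol)
  show "lin_on (Sol 1 b (Suc n) mu) crs" by (simp add: lin_on_def crs_lc)
  have fl: "hflx 1 b mu (Suc n) f = hflx (k0 mu) b (R mu) n (crs f)"
    if "hcmp (Suc n) f" "hnet 1 b mu (Suc n) f" for f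
  proof (rule hflx_dec[OF mu])
    show "hdec b mu n f" using hnet_dec[OF mu that(1), of b] that(2) by blast
    show "b \<longrightarrow> hz (Suc n) f" using that(2) hnet_hz[of 1 mu "Suc n" f] by (cases b) (auto simp del: hnet.simps hz.simps)
  qed
  have "crs ` Sol 1 b (Suc n) mu = Sol (k0 mu) b n (R mu)"
  proof
    show "crs ` Sol 1 b (Suc n) mu \<subseteq> Sol (k0 mu) b n (R mu)"
      using hnet_dec[OF mu] hres_crs hcmp_crs fl by (auto simp: Sol_def simp del: hnet.simps hcmp.simps hres.simps)
    show "Sol (k0 mu) b n (R mu) \<subseteq> crs ` Sol 1 b (Suc n) mu"
    proof
      fix g assume g: "g \<in> Sol (k0 mu) b n (R mu)"
      then have g': "hres n g = g" "hcmp n g" "b \<longrightarrow> hz n g"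
        using hnet_hz[of "k0 mu" "R mu" n g] by (cases b; auto simp: Sol_def)+
      obtain f where f: "hres (Suc n) f = f" "hcmp (Suc n) f" "hdec b mu n f" "crs f = g"
        using ext_half[OF g'(2,1,3)] by blast
      have "hnet 1 b mu (Suc n) f" using hnet_dec[OF mu f(2)] f g by (simp add: Sol_def)
      then have "f \<in> Sol 1 b (Suc n) mu" using fl[of f] f g crs_crn[of f n 1]
        by (auto simp: Sol_def simp del: hnet.simps hcmp.simps hres.simps)
      then show "g \<in> crs ` Sol 1 b (Suc n) mu" using f by auto
    qed
  qed
  then show "dimn d (crs ` Sol 1 b (Suc n) mu)" using d by simp
  fix f assume f: "f \<in> Sol 1 b (Suc n) mu" "crs f = (\<lambda>_. 0)"
  then show "f = (\<lambda>_. 0)" using hdec_zero[of n f b mu] hnet_dec[OF mu, of n f b]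
    by (simp add: Sol_def del: hnet.simps hcmp.simps hres.simps)
qed

subsection \<open>Dimensions\<close>

lemma hres_0_eqI: "hres 0 f = f \<Longrightarrow> f ([], 0) = 0 \<Longrightarrow> f ([], 1) = 0 \<Longrightarrow> f = (\<lambda>_. 0)"
proof -
  assume a: "hres 0 f = f" "f ([], 0) = 0" "f ([], 1) = 0"
  have "hres 0 f (w, j) = 0" for w j using a(2,3) all3[of "\<lambda>j. f ([], j) = 0 \<or> j = 2"] by auto
  then show ?thesis using a(1) by auto
qed

lemma lin_onI:
  "(\<And>f g a b x. f \<in> S \<Longrightarrow> g \<in> S \<Longrightarrow> L (lc a f b g) x = a * L f x + b * L g x) \<Longrightarrow> lin_on S L"
  by (auto simp: lin_on_def lc_def)

lemma Sol_level0_dirichlet: "dimn 0 (Sol 1 True 0 mu)"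
proof -
  have "f = (\<lambda>_. 0)" if "f \<in> Sol 1 True 0 mu" for f
  proof -
    have "f ([], 0) = 0" "f ([], 1) = 0" "hres 0 f = f" using that by (auto simp: Sol_def crn_def)
    then show ?thesis using hres_0_eqI by blast
  qed
  then show ?thesis using lin_sub_Sol[of 1 True 0 mu] by (auto simp: lin_sub_def)
qed

text \<open>Two equations for two values, with determinant \<open>mu * (mu - 6) / 8\<close>. The
  value 6 stands for the eigenvalue 3 of the triangle, since the Neumann equations at the boundary
  vertices carry a factor 2.\<close>

lemma Sol_level0_neumann: "dimn (if mu = 0 \<or> mu = 6 then 1 else 0) (Sol 1 False 0 mu)"
proof -
  have eq: "f \<in> Sol 1 False 0 mu \<longleftrightarrow> hres 0 f = f \<and> (1 - mu / 4) * f ([], 0) = f ([], 1) \<and> (1 - mu / 2) * f ([], 1) = f ([], 0)" for f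
    by (auto simp: Sol_def)
  note z = hres_0_eqI
  show ?thesis
  proof (cases "mu = 0 \<or> mu = 6")
    case False
    have "f = (\<lambda>_. 0)" if f: "f \<in> Sol 1 False 0 mu" for f
    proof -
      have "(1 - mu / 4) * ((1 - mu / 2) * f ([], 1)) = f ([], 1)" using f eq by simp
      then have "mu * (mu - 6) * f ([], 1) = 0" by (simp add: field_simps)
      then have "f ([], 1) = 0" using False by simp
      then show ?thesis using f eq z by simp
    qed
    then show ?thesis using lin_sub_Sol[of 1 False 0 mu] False by (auto simp: lin_sub_def)
  next
    case True
    \<comment> \<open>The kernel vector is constant for \<open>mu = 0\<close> and has the values -2
      and 1 for \<open>mu = 6\<close>.\<close>
    let ?s = "\<lambda>(w :: 3 list, j :: 3). if w = [] \<and> j = 0 then 1 / (1 - mu / 4) else if w = [] \<and> j = 1 then 1 else 0 :: real"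
    have "hres 0 ?s = ?s" by (auto simp: fun_eq_iff)
    moreover have "?s ([], 0) = 1 / (1 - mu / 4)" "?s ([], 1) = 1" by simp_all
    ultimately have "?s \<in> Sol 1 False 0 mu" unfolding eq using True by (auto simp del: hres.simps)
    moreover have "{f \<in> Sol 1 False 0 mu. f ([], 1) = 0} = {\<lambda>_. 0}"
    proof -
      have "f = (\<lambda>_. 0)" if f: "f \<in> Sol 1 False 0 mu" "f ([], 1) = 0" for f
        using z[of f] f eq by simp
      then show ?thesis using lin_sub_Sol[of 1 False 0 mu] by (auto simp: lin_sub_def)
    qed
    moreover have "linf_on (Sol 1 False 0 mu) (\<lambda>f. f ([], 1))" by (simp add: linf_on_def)
    moreover have "?s ([], 1) = 1" by simp
    ultimately have "dimn (Suc 0) (Sol 1 False 0 mu)" unfolding dimn.simps by blast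
    then show ?thesis using True by simp
  qed
qed

section \<open>Functions without flux equations and the eigenvalue 6\<close>

definition cf :: "nat \<Rightarrow> (3 \<Rightarrow> real) \<Rightarrow> code" where
  "cf n a = (\<lambda>(w, j). if w = replicate n j then a j else 0)"

lemma sh_cf [simp]: "sh (cf (Suc n) a) i = cf n (\<lambda>j. if j = i then a j else 0)"
  by (auto simp: cf_def sh_def)

lemma cf_crn [simp]: "cf n a (crn n j) = a j"
  by (simp add: cf_def crn_def)

lemma res_cf [simp]: "res n (cf n a) = cf n a"
  by (auto simp: cf_def res_def)

lemma cmp_cf [simp]: "cmp n (cf n a)"
  by (induction n arbitrary: a) auto

lemma hcmp_cf [simp]: "hcmp n (cf n a)"
  by (induction n arbitrary: a) auto

lemma hz_cf: "a 0 = 0 \<Longrightarrow> hz n (cf n a)"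
proof (induction n arbitrary: a)
  case 0
  then show ?case by (simp add: cf_def)
qed simp

lemma cf_Nil [simp]: "cf (Suc n) a ([], j) = 0"
  by (simp add: cf_def)

definition FZ :: "nat \<Rightarrow> code set" where
  "FZ n = {f. res n f = f \<and> cmp n f \<and> (\<forall>j. f (crn n j) = 0)}"

text \<open>Dimension counts such as the following keep the shape in which \<open>dimn_rank_nullity\<close> produces them,
  with one summand for each of the three cells.\<close>

primrec fzd :: "nat \<Rightarrow> nat" where
  "fzd 0 = 0"
| "fzd (Suc n) = 3 + (fzd n + fzd n + fzd n)"

lemma lin_sub_FZ: "lin_sub (FZ n)"
  by (auto simp: lin_sub_def FZ_def cmp_lc)

text \<open>\<open>L f k\<close> is the value at the junction of the two cells other than
  \<open>k\<close>; once these three values are 0, the cells are independent.\<close>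

lemma dimn_FZ: "dimn (fzd n) (FZ n)"
proof (induction n)
  case 0
  have "f = (\<lambda>_. 0)" if "f \<in> FZ 0" for f
  proof -
    have f: "\<forall>j. f ([], j) = 0" "res 0 f = f" using that by (auto simp: FZ_def crn_def)
    have "res 0 f (w, j) = 0" for w j using f(1) by (simp add: res_def)
    then have "res 0 f = (\<lambda>_. 0)" by auto
    then show ?thesis using f(2) by simp
  qed
  then show ?case using lin_sub_FZ[of 0] by (auto simp: lin_sub_def)
next
  case (Suc n)
  define L where "L f = (\<lambda>k::3. if k = 0 then sh f 1 (crn n 2) else if k = 1 then sh f 0 (crn n 2) else sh f 0 (crn n 1))" for f
  have lin: "lin_on (FZ (Suc n)) L" by (rule lin_onI) (simp add: L_def)
  have "c \<in> L ` FZ (Suc n)" for c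
  proof (rule image_eqI)
    \<comment> \<open>Modulo 3, \<open>- (i + j)\<close> is the index different from both
      \<open>i\<close> and \<open>j\<close>.\<close>
    let ?f = "jn (\<lambda>i. cf n (\<lambda>j. if j = i then 0 else c (- (i + j))))"
    have "cf n a ([], j) = 0" if "n \<noteq> 0" for a j using that by (cases n) auto
    have "res (Suc n) ?f = ?f" unfolding res_Suc_iff by simp
    then show "?f \<in> FZ (Suc n)" by (auto simp: FZ_def crn_Suc add.commute)
    show "c = L ?f" by (rule ext, rule exhaust_3[THEN disjE]) (auto simp: L_def)
  qed
  then have "L ` FZ (Suc n) = UNIV" by blast
  then have im: "dimn 3 (L ` FZ (Suc n))" using dimn_UNIV[where 'a=3] by simp
  have "{f \<in> FZ (Suc n). L f = (\<lambda>_. 0)} = {f. (\<forall>j. f ([], j) = 0) \<and> (\<forall>i. sh f i \<in> FZ n)}"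
  proof (rule set_eqI, rule iffI)
    fix f assume f: "f \<in> {f \<in> FZ (Suc n). L f = (\<lambda>_. 0)}"
    have "L f 0 = 0" "L f 1 = 0" "L f 2 = 0" using f by simp_all
    then have "sh f 1 (crn n 2) = 0" "sh f 0 (crn n 2) = 0" "sh f 0 (crn n 1) = 0" by (simp_all add: L_def)
    moreover have "sh f i (crn n j) = sh f j (crn n i)" "sh f i (crn n i) = 0" for i j
      using f by (auto simp: FZ_def crn_Suc)
    ultimately have "\<forall>i j. sh f i (crn n j) = 0" unfolding all3 by metis
    moreover have "res (Suc n) f = f" "cmp (Suc n) f" using f by (auto simp: FZ_def)
    ultimately show "f \<in> {f. (\<forall>j. f ([], j) = 0) \<and> (\<forall>i. sh f i \<in> FZ n)}"
      unfolding res_Suc_iff by (auto simp: FZ_def)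
  next
    fix f assume f: "f \<in> {f. (\<forall>j. f ([], j) = 0) \<and> (\<forall>i. sh f i \<in> FZ n)}"
    then have "res (Suc n) f = f" unfolding res_Suc_iff by (auto simp: FZ_def)
    then show "f \<in> {f \<in> FZ (Suc n). L f = (\<lambda>_. 0)}" using f by (auto simp: FZ_def crn_Suc L_def)
  qed
  then have "dimn (fzd n + fzd n + fzd n) {f \<in> FZ (Suc n). L f = (\<lambda>_. 0)}"
    using dimn_prod3[of _ "\<lambda>_. FZ n"] Suc lin_sub_FZ by simp
  then show ?case unfolding fzd.simps by (rule dimn_rank_nullity[OF lin_sub_FZ lin im])
qed

definition HZ :: "bool \<Rightarrow> nat \<Rightarrow> code set" where
  "HZ b n = {f. hres n f = f \<and> hcmp n f \<and> (b \<longrightarrow> hz n f) \<and> f (crn n 1) = 0}"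

text \<open>Passing from the half cell at \<open>q 0\<close> to the half gasket adds the junction
  with cell 1 and, in the Neumann case, the first point of \<open>X\<close>. The summand 0 belongs
  to cell 2.\<close>

primrec hzd :: "bool \<Rightarrow> nat \<Rightarrow> nat" where
  "hzd b 0 = (if b then 0 else 1)"
| "hzd b (Suc n) = (if b then 1 else 2) + (hzd b n + fzd n + 0)"

lemma lin_sub_HZ: "lin_sub (HZ b n)"
  by (auto simp: lin_sub_def HZ_def hcmp_lc hz_lc)

lemma dimn_HZ: "dimn (hzd b n) (HZ b n)"
proof (induction n)
  case 0
  show ?case
  proof (cases b)
    case True
    have "HZ b 0 = {\<lambda>_. 0}"
      using True hres_0_eqI lin_sub_HZ[of b 0] by (auto simp: HZ_def crn_def lin_sub_def simp del: hres.simps)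
    then show ?thesis using True by simp
  next
    case False
    let ?s = "\<lambda>(w :: 3 list, j :: 3). if w = [] \<and> j = 0 then 1 else 0 :: real"
    have "?s \<in> HZ b 0" using False by (auto simp: HZ_def crn_def)
    moreover have "linf_on (HZ b 0) (\<lambda>f. f ([], 0))" by (simp add: linf_on_def)
    moreover have "{f \<in> HZ b 0. f ([], 0) = 0} = {\<lambda>_. 0}"
      using hres_0_eqI lin_sub_HZ[of b 0] by (auto simp: HZ_def crn_def lin_sub_def simp del: hres.simps)
    ultimately have "dimn (Suc 0) (HZ b 0)" unfolding dimn.simps
      by (intro exI[of _ "\<lambda>f. f ([], 0)"] exI[of _ ?s]) simp
    then show ?thesis using False by simp
  qed
next
  case (Suc n)
  define Z where "Z i = (if i = 0 then HZ b n else if i = 1 then FZ n else {\<lambda>_. 0})" for i :: 3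
  have subZ: "lin_sub (Z i)" for i
    using lin_sub_HZ lin_sub_FZ by (auto simp: Z_def) (simp add: lin_sub_def)
  have ker: "dimn (hzd b n + fzd n + 0) {f. (\<forall>j. f ([], j) = 0) \<and> (\<forall>i. sh f i \<in> Z i)}"
    by (rule dimn_prod3[OF refl subZ]) (simp_all add: Z_def Suc dimn_FZ)
  have kereq: "f \<in> HZ b (Suc n) \<and> sh f 1 (crn n 0) = 0 \<and> sh f 1 (crn n 2) = 0 \<longleftrightarrow>
      (\<forall>j. f ([], j) = 0) \<and> (\<forall>i. sh f i \<in> Z i)" for f
    unfolding HZ_def mem_Collect_eq hres_Suc_iff all3 Z_def FZ_def by (auto simp: crn_Suc)
  define g where "g x y = jn (\<lambda>i. if i = 1 then cf n (\<lambda>j. if j = 0 then x else if j = 2 then y else 0)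
      else if i = 0 then hres n (cf n (\<lambda>j. if j = 1 then x else 0)) else (\<lambda>_. 0))" for x y
  have g: "g x y \<in> HZ b (Suc n)" if "b \<longrightarrow> y = 0" for x y
    unfolding HZ_def mem_Collect_eq hres_Suc_iff using that by (auto simp: g_def crn_Suc hz_cf)
  have gv: "sh (g x y) 1 (crn n 0) = x" "sh (g x y) 1 (crn n 2) = y" for x y by (simp_all add: g_def)
  show ?case
  proof (cases b)
    case True
    define L where "L f = (\<lambda>u::unit. sh f 1 (crn n 0))" for f
    have lin: "lin_on (HZ b (Suc n)) L" by (rule lin_onI) (simp add: L_def)
    have "c \<in> L ` HZ b (Suc n)" for c
      using g[of 0 "c ()"] gv[of "c ()" 0] by (intro image_eqI[of _ _ "g (c ()) 0"]) (auto simp: L_def)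
    then have "L ` HZ b (Suc n) = UNIV" by blast
    then have im: "dimn 1 (L ` HZ b (Suc n))" using dimn_UNIV[where 'a=unit] by simp
    have "f \<in> HZ b (Suc n) \<Longrightarrow> sh f 1 (crn n 2) = 0" for f using True by (simp add: HZ_def)
    then have "{f \<in> HZ b (Suc n). L f = (\<lambda>_. 0)} = {f. (\<forall>j. f ([], j) = 0) \<and> (\<forall>i. sh f i \<in> Z i)}"
      using kereq by (auto simp: L_def fun_eq_iff)
    then show ?thesis using dimn_rank_nullity[OF lin_sub_HZ lin im] ker True by simp
  next
    case False
    define L where "L f = (\<lambda>u::bool. if u then sh f 1 (crn n 0) else sh f 1 (crn n 2))" for f
    have lin: "lin_on (HZ b (Suc n)) L" by (rule lin_onI) (simp add: L_def)
    have "c \<in> L ` HZ b (Suc n)" for c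
      using g[of "c False" "c True"] gv[of "c True" "c False"] False
      by (intro image_eqI[of _ _ "g (c True) (c False)"]) (auto simp: L_def)
    then have "L ` HZ b (Suc n) = UNIV" by blast
    then have im: "dimn 2 (L ` HZ b (Suc n))" using dimn_UNIV[where 'a=bool] by simp
    have "{f \<in> HZ b (Suc n). L f = (\<lambda>_. 0)} = {f. (\<forall>j. f ([], j) = 0) \<and> (\<forall>i. sh f i \<in> Z i)}"
      using kereq by (auto simp: L_def fun_eq_iff)
    then show ?thesis using dimn_rank_nullity[OF lin_sub_HZ lin im] ker False by simp
  qed
qed

text \<open>In the Neumann case the value at \<open>q 1\<close> is free as well, since its flux
  condition is void.\<close>

lemma dimn_Sol_0: "dimn (hzd b n + (if b then 0 else 1)) (Sol 0 b n mu)"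
proof (cases b)
  case True
  then have "Sol 0 b n mu = HZ b n" by (auto simp: Sol_def HZ_def hnet_0)
  then show ?thesis using dimn_HZ[of b n] True by simp
next
  case False
  define L where "L f = (\<lambda>u::unit. f (crn n 1))" for f :: code
  have lin: "lin_on (Sol 0 b n mu) L" by (rule lin_onI) (simp add: L_def)
  have "c \<in> L ` Sol 0 b n mu" for c
  proof (rule image_eqI)
    show "hres n (cf n (\<lambda>j. c ())) \<in> Sol 0 b n mu" using False by (simp add: Sol_def hnet_0)
    show "c = L (hres n (cf n (\<lambda>j. c ())))" by (simp add: L_def)
  qed
  then have "L ` Sol 0 b n mu = UNIV" by blast
  then have im: "dimn 1 (L ` Sol 0 b n mu)" using dimn_UNIV[where 'a=unit] by simp
  have "{f \<in> Sol 0 b n mu. L f = (\<lambda>_. 0)} = HZ b n"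
    using False by (auto simp: Sol_def HZ_def hnet_0 L_def fun_eq_iff)
  then show ?thesis using dimn_rank_nullity[OF lin_sub_Sol lin im] dimn_HZ[of b n] False by (simp add: add.commute)
qed

lemma dimn_Sol_6: "dimn (hzd b n + (if b then 0 else 1)) (Sol 1 b (Suc n) 6)"
proof (rule Sol_dec)
  show "dimn (hzd b n + (if b then 0 else 1)) (Sol (k0 6) b n (R 6))"
    using dimn_Sol_0[of b n "R 6"] by (simp add: k0_def)
qed auto

subsubsection \<open>The eigenvalue 2\<close>

text \<open>For \<open>mu = 2\<close> the sum of the midpoint equations loses its unknowns and
  forces corner values of sum 0; the sum of the midpoints stays free and enters every flux as the
  same constant.\<close>

lemma net2_level1:
  assumes c: "cmp (Suc 0) f" and n: "net 1 2 (Suc 0) f"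
  shows "\<exists>s. (\<forall>j. flx 1 2 (Suc 0) f j = 2 / 3 * f (crn (Suc 0) j) - s) \<and> (\<Sum>j\<in>UNIV. f (crn (Suc 0) j)) = 0 \<and>
     ((\<forall>j. f (crn (Suc 0) j) = 0) \<longrightarrow> s = 0 \<longrightarrow> res (Suc 0) f = (\<lambda>_. 0))"
proof -
  define a where "a k = f ([k], k)" for k
  define x y z where xyz: "x = f ([0], 1)" "y = f ([0], 2)" "z = f ([1], 2)"
  have c': "f ([1], 0) = x" "f ([2], 0) = y" "f ([2], 1) = z"
    using c unfolding xyz by (simp_all add: crn_def)
  have e: "3 * x = a 0 + a 1 + (x + y + z)" "3 * y = a 0 + a 2 + (x + y + z)" "3 * z = a 1 + a 2 + (x + y + z)"
    using n by (auto simp: all3 flx_def T_def c' xyz[symmetric] a_def[symmetric] algebra_simps)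
  then have s: "a 0 + a 1 + a 2 = 0" by simp
  define S where "S = 2 / 3 * (x + y + z)"
  have fl: "\<forall>j. flx 1 2 (Suc 0) f j = 2 / 3 * a j - S"
  proof -
    have "flx 1 2 (Suc 0) f 0 = 2 * a 0 - (a 0 + x + y)" "flx 1 2 (Suc 0) f 1 = 2 * a 1 - (x + a 1 + z)"
      "flx 1 2 (Suc 0) f 2 = 2 * a 2 - (y + z + a 2)"
      by (simp_all add: flx_def T_def c' xyz[symmetric] a_def[symmetric])
    then show ?thesis unfolding all3 S_def using e s by (intro conjI; algebra)
  qed
  have ac: "f (crn (Suc 0) j) = a j" for j by (simp add: a_def crn_def)
  have "res (Suc 0) f = (\<lambda>_. 0)" if "\<forall>j. a j = 0" "S = 0"
  proof -
    have "x = 0" "y = 0" "z = 0" using e that by (simp_all add: S_def)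
    then have "\<forall>i j. f ([i], j) = 0" using that c' by (simp add: all3 xyz a_def)
    then show ?thesis by (auto simp: res_def length_Suc_conv fun_eq_iff)
  qed
  then show ?thesis using fl s by (intro exI[of _ S]) (simp add: ac sum3)
qed

text \<open>Pairing the corner values with the fluxes gives a sum of squares.\<close>

lemma net2:
  "cmp (Suc n) f \<Longrightarrow> net 1 2 (Suc n) f \<Longrightarrow>
    (\<Sum>j\<in>UNIV. f (crn (Suc n) j) * flx 1 2 (Suc n) f j) \<ge> 0 \<and>
    ((\<Sum>j\<in>UNIV. f (crn (Suc n) j) * flx 1 2 (Suc n) f j) = 0 \<longrightarrow>
       (\<forall>j. f (crn (Suc n) j) = 0) \<and>
       (\<exists>s. (\<forall>j. flx 1 2 (Suc n) f j = s) \<and> (s = 0 \<longrightarrow> res (Suc n) f = (\<lambda>_. 0))))"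
proof (induction n arbitrary: f)
  case 0
  obtain s where s: "\<forall>j. flx 1 2 (Suc 0) f j = 2 / 3 * f (crn (Suc 0) j) - s" "(\<Sum>j\<in>UNIV. f (crn (Suc 0) j)) = 0"
    "(\<forall>j. f (crn (Suc 0) j) = 0) \<longrightarrow> s = 0 \<longrightarrow> res (Suc 0) f = (\<lambda>_. 0)"
    using net2_level1[OF 0] by blast
  let ?a = "\<lambda>j. f (crn (Suc 0) j)"
  have "(\<Sum>j\<in>UNIV. ?a j * flx 1 2 (Suc 0) f j) = 2 / 3 * (\<Sum>j\<in>UNIV. ?a j * ?a j) - s * (\<Sum>j\<in>UNIV. ?a j)"
  proof -
    have fl2: "flx 1 2 (Suc 0) f j = 2 / 3 * ?a j - s" for j using s(1) by blast
    show ?thesis unfolding sum3 fl2 by (simp add: algebra_simps)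
  qed
  then have e: "(\<Sum>j\<in>UNIV. ?a j * flx 1 2 (Suc 0) f j) = 2 / 3 * (\<Sum>j\<in>UNIV. ?a j * ?a j)" using s(2) by simp
  have p: "(\<Sum>j\<in>UNIV. ?a j * ?a j) \<ge> 0" by (intro sum_nonneg) simp
  have "(\<forall>j. ?a j = 0) \<and> (\<exists>s. (\<forall>j. flx 1 2 (Suc 0) f j = s) \<and> (s = 0 \<longrightarrow> res (Suc 0) f = (\<lambda>_. 0)))"
    if "(\<Sum>j\<in>UNIV. ?a j * ?a j) = 0"
  proof -
    have z: "\<forall>j. ?a j = 0" using that by (subst (asm) sum_nonneg_eq_0_iff) auto
    then have "\<forall>j. flx 1 2 (Suc 0) f j = - s" using s(1) by simp
    moreover have "- s = 0 \<longrightarrow> res (Suc 0) f = (\<lambda>_. 0)" using z s(3) by simp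
    ultimately show ?thesis using z by blast
  qed
  moreover have "(\<Sum>j\<in>UNIV. ?a j * flx 1 2 (Suc 0) f j) \<ge> 0" using e p by simp
  moreover have "(\<Sum>j\<in>UNIV. ?a j * ?a j) = 0" if "(\<Sum>j\<in>UNIV. ?a j * flx 1 2 (Suc 0) f j) = 0"
    using e that by simp
  ultimately show ?case by blast
next
  case (Suc n)
  let ?E = "\<lambda>g. \<Sum>j\<in>UNIV. g (crn (Suc n) j) * flx 1 2 (Suc n) g j"
  have IH: "?E (sh f i) \<ge> 0 \<and> (?E (sh f i) = 0 \<longrightarrow> (\<forall>j. sh f i (crn (Suc n) j) = 0) \<and>
       (\<exists>s. (\<forall>j. flx 1 2 (Suc n) (sh f i) j = s) \<and> (s = 0 \<longrightarrow> res (Suc n) (sh f i) = (\<lambda>_. 0))))" for i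
  proof (rule Suc.IH)
    show "cmp (Suc n) (sh f i)" using Suc.prems(1) unfolding cmp.simps(2)[of "Suc n"] by blast
    show "net 1 2 (Suc n) (sh f i)" using Suc.prems(2) unfolding net.simps(2)[of _ _ "Suc n"] by blast
  qed
  have j: "sh f i (crn (Suc n) j) = sh f j (crn (Suc n) i)" for i j
    using Suc.prems(1) unfolding cmp.simps(2)[of "Suc n"] by blast
  have fl: "flx 1 2 (Suc n) (sh f j) i = - flx 1 2 (Suc n) (sh f i) j" if "i \<noteq> j" for i j
    using Suc.prems(2) that unfolding net.simps(2)[of _ _ "Suc n"] by (metis add.commute eq_neg_iff_add_eq_0)
  have fl': "flx 1 2 (Suc n) (sh f 1) 0 = - flx 1 2 (Suc n) (sh f 0) 1"
    "flx 1 2 (Suc n) (sh f 2) 0 = - flx 1 2 (Suc n) (sh f 0) 2"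
    "flx 1 2 (Suc n) (sh f 2) 1 = - flx 1 2 (Suc n) (sh f 1) 2"
    by (rule fl, simp)+
  \<comment> \<open>Junction values agree and junction fluxes are opposite, so only the corner terms
    survive.\<close>
  have E: "(\<Sum>j\<in>UNIV. f (crn (Suc (Suc n)) j) * flx 1 2 (Suc (Suc n)) f j) = (\<Sum>i\<in>UNIV. ?E (sh f i))"
    unfolding sum3 crn_Suc[of f] flx_Suc[of _ _ "Suc n" f] j[of 1 0] j[of 2 0] j[of 2 1] fl' by (simp add: algebra_simps)
  have zero: "(\<forall>j. f (crn (Suc (Suc n)) j) = 0) \<and>
       (\<exists>s. (\<forall>j. flx 1 2 (Suc (Suc n)) f j = s) \<and> (s = 0 \<longrightarrow> res (Suc (Suc n)) f = (\<lambda>_. 0)))"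
    if "(\<Sum>i\<in>UNIV. ?E (sh f i)) = 0"
  proof -
    have eh: "\<forall>i\<in>UNIV. ?E (sh f i) = 0" by (rule sum_nonneg_eq_0_iff[THEN iffD1, OF _ _ that]) (simp, use IH in blast)
    have "\<forall>i. \<exists>s. (\<forall>j. sh f i (crn (Suc n) j) = 0) \<and> (\<forall>j. flx 1 2 (Suc n) (sh f i) j = s) \<and>
      (s = 0 \<longrightarrow> res (Suc n) (sh f i) = (\<lambda>_. 0))"
    proof (rule allI)
      fix i
      have "(\<forall>j. sh f i (crn (Suc n) j) = 0) \<and> (\<exists>s. (\<forall>j. flx 1 2 (Suc n) (sh f i) j = s) \<and>
        (s = 0 \<longrightarrow> res (Suc n) (sh f i) = (\<lambda>_. 0)))"
        by (rule IH[of i, THEN conjunct2, THEN mp]) (rule eh[rule_format, OF UNIV_I])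
      then show "\<exists>s. (\<forall>j. sh f i (crn (Suc n) j) = 0) \<and> (\<forall>j. flx 1 2 (Suc n) (sh f i) j = s) \<and>
        (s = 0 \<longrightarrow> res (Suc n) (sh f i) = (\<lambda>_. 0))" by blast
    qed
    then obtain s where "\<forall>i. (\<forall>j. sh f i (crn (Suc n) j) = 0) \<and> (\<forall>j. flx 1 2 (Suc n) (sh f i) j = s i) \<and>
      (s i = 0 \<longrightarrow> res (Suc n) (sh f i) = (\<lambda>_. 0))" by (rule choice[THEN exE])
    then have s: "\<And>i j. sh f i (crn (Suc n) j) = 0" "\<And>i j. flx 1 2 (Suc n) (sh f i) j = s i"
      "\<And>i. s i = 0 \<Longrightarrow> res (Suc n) (sh f i) = (\<lambda>_. 0)" by blast+
    \<comment> \<open>Each cell has one common flux; opposite signs across all three junctions of a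
      triangle of cells force it to be 0.\<close>
    have "s 1 = - s 0" "s 2 = - s 0" "s 2 = - s 1" using fl' unfolding s(2) by auto
    then have "\<forall>i. s i = 0" by (simp add: all3)
    then have "res (Suc n) (sh f i) = (\<lambda>_. 0)" for i using s(3) by blast
    then have "res (Suc (Suc n)) f = (\<lambda>_. 0)" by (intro code_eqI[of "res _ f"]) simp_all
    moreover have "f (crn (Suc (Suc n)) j) = 0" for j using s(1) by (simp only: crn_Suc[of f])
    moreover have "flx 1 2 (Suc (Suc n)) f j = 0" for j
      using s(2) \<open>\<forall>i. s i = 0\<close> by (simp only: flx_Suc[of _ _ "Suc n" f])
    ultimately show ?thesis by blast
  qed
  have "(\<Sum>i\<in>UNIV. ?E (sh f i)) \<ge> 0" by (rule sum_nonneg) (use IH in blast)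
  then show ?case unfolding E using zero by blast
qed

text \<open>The pairing of \<open>net2\<close>, carried along the half gasket: at each point of
  \<open>X\<close> either the value or the flux is 0. In the smallest case the flux at
  \<open>q 1\<close> is 2/3 (Dirichlet) or 2 (Neumann) times the value there.\<close>

lemma hnet2:
  "hcmp (Suc n) f \<Longrightarrow> hnet 1 b 2 (Suc n) f \<Longrightarrow>
    f (crn (Suc n) 1) * hflx 1 b 2 (Suc n) f \<ge> 0 \<and>
    (f (crn (Suc n) 1) * hflx 1 b 2 (Suc n) f = 0 \<longrightarrow>
       f (crn (Suc n) 1) = 0 \<and> hflx 1 b 2 (Suc n) f = 0 \<and> hres (Suc n) f = (\<lambda>_. 0))"
proof (induction n arbitrary: f)
  case 0
  define u v p x where uvpx: "u = f ([0], 0)" "v = f ([1], 1)" "p = f ([0], 1)" "x = f ([1], 2)"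
  have c': "f ([1], 0) = p" using 0(1) by (simp add: crn_def uvpx)
  have vv: "f (crn (Suc 0) 1) = v" by (simp add: crn_def uvpx)
  have fl: "hflx 1 b 2 (Suc 0) f = 2 * v - (p + v + x)"
    by (simp add: flx_def T_def c' uvpx[symmetric])
  have z: "hres (Suc 0) f = (\<lambda>_. 0)" if "u = 0" "v = 0" "p = 0" "x = 0"
  proof -
    have "\<forall>j. f ([1], j) = 0" using that c' by (simp add: all3 uvpx)
    then have a: "res 0 (sh f 1) = (\<lambda>_. 0)" by (auto simp: res_def)
    have "\<forall>j. j \<noteq> 2 \<longrightarrow> f ([0], j) = 0" using that by (simp add: all3 uvpx)
    then have "hres 0 (sh f 0) = (\<lambda>_. 0)" by auto
    then have "\<forall>i. sh (hres (Suc 0) f) i = (\<lambda>_. 0)" using a by (simp add: all3 del: hres.simps(1))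
    then show ?thesis by (intro code_eqI[of "hres _ f"]) simp_all
  qed
  show ?case
  proof (cases b)
    case True
    have "u = 0" "x = 0" "v = 3 * p"
      using 0(2) True by (auto simp: flx_def T_def c' uvpx[symmetric] crn_def algebra_simps)
    then show ?thesis unfolding fl vv using z by auto
  next
    case False
    have "hnet 1 b mu (Suc 0) f \<longleftrightarrow> (1 - mu / 4) * u = p \<and> (3 - mu) * p = u + v + x \<and> (4 - mu) * x = 2 * p + 2 * v" for mu
      using False by (auto simp: flx_def T_def c' uvpx[symmetric] crn_def algebra_simps)
    from this[of 2] have "(1 - 2 / 4) * u = p" "(3 - 2) * p = u + v + x" "(4 - 2) * x = 2 * p + 2 * v"
      using 0(2) by blast+
    then have "u = - 2 * v" "p = - v" "x = 0" by simp_all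
    then show ?thesis unfolding fl vv using z by auto
  qed
next
  case (Suc n)
  let ?g = "sh f 1" let ?h = "sh f 0"
  let ?E = "\<Sum>j\<in>UNIV. ?g (crn (Suc n) j) * flx 1 2 (Suc n) ?g j"
  let ?H = "?h (crn (Suc n) 1) * hflx 1 b 2 (Suc n) ?h"
  note pr = Suc.prems[unfolded hcmp.simps(2)[of "Suc n"] hnet.simps(2)[of _ _ _ "Suc n"]]
  have IH: "?H \<ge> 0 \<and> (?H = 0 \<longrightarrow> ?h (crn (Suc n) 1) = 0 \<and> hflx 1 b 2 (Suc n) ?h = 0 \<and> hres (Suc n) ?h = (\<lambda>_. 0))"
    by (rule Suc.IH) (use pr in blast)+
  have G: "?E \<ge> 0 \<and> (?E = 0 \<longrightarrow> (\<forall>j. ?g (crn (Suc n) j) = 0) \<and>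
       (\<exists>s. (\<forall>j. flx 1 2 (Suc n) ?g j = s) \<and> (s = 0 \<longrightarrow> res (Suc n) ?g = (\<lambda>_. 0))))"
    by (rule net2) (use pr in blast)+
  have z: "?g (crn (Suc n) 2) * flx 1 2 (Suc n) ?g 2 = 0" using pr by (cases b) auto
  have "hflx 1 b 2 (Suc n) ?h = - flx 1 2 (Suc n) ?g 0" using pr by (simp add: eq_neg_iff_add_eq_0 add.commute)
  then have E: "f (crn (Suc (Suc n)) 1) * hflx 1 b 2 (Suc (Suc n)) f = ?E + ?H"
    using pr z unfolding sum3 crn_Suc[of f] hflx.simps(2)[of _ _ _ "Suc n"] by simp
  have zero: "f (crn (Suc (Suc n)) 1) = 0 \<and> hflx 1 b 2 (Suc (Suc n)) f = 0 \<and> hres (Suc (Suc n)) f = (\<lambda>_. 0)"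
    if "?E + ?H = 0"
  proof -
    have eh: "?E = 0" "?H = 0" using that IH G by linarith+
    then obtain s where s: "\<forall>j. ?g (crn (Suc n) j) = 0" "\<forall>j. flx 1 2 (Suc n) ?g j = s" "s = 0 \<longrightarrow> res (Suc n) ?g = (\<lambda>_. 0)"
      using G by blast
    have "hflx 1 b 2 (Suc n) ?h = 0" "hres (Suc n) ?h = (\<lambda>_. 0)" using eh IH by auto
    moreover have "s = 0" using pr s(2) calculation(1) by simp
    ultimately have "\<forall>i. sh (hres (Suc (Suc n)) f) i = (\<lambda>_. 0)" using s(3) by (simp add: all3)
    then have "hres (Suc (Suc n)) f = (\<lambda>_. 0)" by (intro code_eqI[of "hres _ f"]) simp_all
    then show ?thesis using s \<open>s = 0\<close> unfolding crn_Suc[of f] hflx.simps(2)[of _ _ _ "Suc n"] by simp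
  qed
  show ?case unfolding E using zero IH G by (intro conjI impI) (auto intro: add_nonneg_nonneg)
qed

lemma dimn_Sol_2: "dimn 0 (Sol 1 b (Suc n) 2)"
proof -
  have "f = (\<lambda>_. 0)" if f: "f \<in> Sol 1 b (Suc n) 2" for f
  proof -
    have "f (crn (Suc n) 1) * hflx 1 b 2 (Suc n) f = 0" using f unfolding Sol_def by (cases b) auto
    then have "hres (Suc n) f = (\<lambda>_. 0)" using f hnet2[of n f b] unfolding Sol_def by blast
    then show ?thesis using f by (simp add: Sol_def del: hres.simps)
  qed
  then show ?thesis using lin_sub_Sol[of 1 b "Suc n" 2] by (auto simp: lin_sub_def)
qed

subsubsection \<open>The eigenvalue 5\<close>

text \<open>At \<open>mu = 5\<close> the left sides of the midpoint equations vanish, so any two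
  corner values have the same sum.\<close>

lemma net5_level1:
  assumes c: "cmp (Suc 0) f"
  defines "S \<equiv> f ([0], 1) + f ([0], 2) + f ([1], 2)"
  shows "net 1 5 (Suc 0) f \<longleftrightarrow> f ([1], 1) = f ([0], 0) \<and> f ([2], 2) = f ([0], 0) \<and> S = - 2 * f ([0], 0)"
    and "flx 1 5 (Suc 0) f 0 = - (f ([0], 0) / 2) - f ([0], 1) - f ([0], 2)"
    and "flx 1 5 (Suc 0) f 1 = - (f ([1], 1) / 2) - f ([0], 1) - f ([1], 2)"
    and "flx 1 5 (Suc 0) f 2 = - (f ([2], 2) / 2) - f ([0], 2) - f ([1], 2)"
proof -
  define a where "a k = f ([k], k)" for k
  define x y z where xyz: "x = f ([0], 1)" "y = f ([0], 2)" "z = f ([1], 2)"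
  have c': "f ([1], 0) = x" "f ([2], 0) = y" "f ([2], 1) = z"
    using c unfolding xyz by (simp_all add: crn_def)
  have "net 1 5 (Suc 0) f \<longleftrightarrow> 0 = a 0 + a 1 + (x + y + z) \<and> 0 = a 0 + a 2 + (x + y + z) \<and> 0 = a 1 + a 2 + (x + y + z)"
    by (auto simp: all3 flx_def T_def c' xyz[symmetric] a_def[symmetric] algebra_simps)
  also have "\<dots> \<longleftrightarrow> a 1 = a 0 \<and> a 2 = a 0 \<and> x + y + z = - 2 * a 0" by (rule iffI; elim conjE; intro conjI; (linarith | algebra))
  finally show "net 1 5 (Suc 0) f \<longleftrightarrow> f ([1], 1) = f ([0], 0) \<and> f ([2], 2) = f ([0], 0) \<and> S = - 2 * f ([0], 0)"
    unfolding S_def xyz a_def .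
  show "flx 1 5 (Suc 0) f 0 = - (f ([0], 0) / 2) - f ([0], 1) - f ([0], 2)"
    "flx 1 5 (Suc 0) f 1 = - (f ([1], 1) / 2) - f ([0], 1) - f ([1], 2)"
    "flx 1 5 (Suc 0) f 2 = - (f ([2], 2) / 2) - f ([0], 2) - f ([1], 2)"
    by (simp_all add: flx_def T_def c' xyz[symmetric])
qed

text \<open>Shared junctions force one common corner value, and since junction fluxes cancel, the
  total corner flux adds up over the cells; each of the \<open>3 ^ n\<close> level-1 pieces
  contributes \<open>5 / 2 * \<alpha>\<close>.\<close>

lemma net5:
  "cmp (Suc n) f \<Longrightarrow> net 1 5 (Suc n) f \<Longrightarrow>
    \<exists>\<alpha>. (\<forall>j. f (crn (Suc n) j) = \<alpha>) \<and> (\<Sum>j\<in>UNIV. flx 1 5 (Suc n) f j) = 3 ^ n * (5 / 2) * \<alpha>"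
proof (induction n arbitrary: f)
  case 0
  let ?a = "f ([0], 0)"
  have e: "f ([1], 1) = ?a" "f ([2], 2) = ?a" "f ([0], 1) + f ([0], 2) + f ([1], 2) = - 2 * ?a"
    using net5_level1(1)[OF 0(1)] 0(2) by auto
  have "\<forall>j. f (crn (Suc 0) j) = ?a" using e by (simp add: all3 crn_def)
  moreover have "(\<Sum>j\<in>UNIV. flx 1 5 (Suc 0) f j) = 3 ^ 0 * (5 / 2) * ?a"
    unfolding sum3 net5_level1(2-4)[OF 0(1)] e using e(3) by simp
  ultimately show ?case by blast
next
  case (Suc n)
  have j: "sh f i (crn (Suc n) j) = sh f j (crn (Suc n) i)" for i j
    using Suc.prems(1) unfolding cmp.simps(2)[of "Suc n"] by blast
  have fl: "flx 1 5 (Suc n) (sh f j) i = - flx 1 5 (Suc n) (sh f i) j" if "i \<noteq> j" for i j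
    using Suc.prems(2) that unfolding net.simps(2)[of _ _ "Suc n"] by (metis add.commute eq_neg_iff_add_eq_0)
  have fl': "flx 1 5 (Suc n) (sh f 1) 0 = - flx 1 5 (Suc n) (sh f 0) 1"
    "flx 1 5 (Suc n) (sh f 2) 0 = - flx 1 5 (Suc n) (sh f 0) 2"
    "flx 1 5 (Suc n) (sh f 2) 1 = - flx 1 5 (Suc n) (sh f 1) 2"
    by (rule fl, simp)+
  have "\<exists>\<alpha>. (\<forall>j. sh f i (crn (Suc n) j) = \<alpha>) \<and> (\<Sum>j\<in>UNIV. flx 1 5 (Suc n) (sh f i) j) = 3 ^ n * (5 / 2) * \<alpha>" for i
  proof (rule Suc.IH)
    show "cmp (Suc n) (sh f i)" using Suc.prems(1) unfolding cmp.simps(2)[of "Suc n"] by blast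
    show "net 1 5 (Suc n) (sh f i)" using Suc.prems(2) unfolding net.simps(2)[of _ _ "Suc n"] by blast
  qed
  then obtain al where al: "\<And>i j. sh f i (crn (Suc n) j) = al i"
    "\<And>i. (\<Sum>j\<in>UNIV. flx 1 5 (Suc n) (sh f i) j) = 3 ^ n * (5 / 2) * al i" by metis
  have eq: "al i = al 0" for i using al(1) j by metis
  have "(\<Sum>j\<in>UNIV. flx 1 5 (Suc (Suc n)) f j) = (\<Sum>i\<in>UNIV. \<Sum>j\<in>UNIV. flx 1 5 (Suc n) (sh f i) j)"
    unfolding sum3 flx_Suc[of _ _ "Suc n" f] fl' by simp
  also have "\<dots> = (\<Sum>i\<in>UNIV. 3 ^ n * (5 / 2) * al i)" by (simp only: al(2))
  also have "\<dots> = 3 ^ Suc n * (5 / 2) * al 0" unfolding sum3 eq[of 1] eq[of 2] by simp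
  finally have "(\<Sum>j\<in>UNIV. flx 1 5 (Suc (Suc n)) f j) = 3 ^ Suc n * (5 / 2) * al 0" .
  moreover have "\<forall>j. f (crn (Suc (Suc n)) j) = al 0" using al(1) eq by (metis crn_Suc)
  ultimately show ?case by blast
qed

text \<open>When the corner values are 0, the corner fluxes of each level-1 piece sum to 0: such a
  solution is a balanced flow through the pieces.\<close>

definition Z5 :: "nat \<Rightarrow> code set" where
  "Z5 n = {f. res (Suc n) f = f \<and> cmp (Suc n) f \<and> net 1 5 (Suc n) f \<and> (\<forall>j. f (crn (Suc n) j) = 0)}"

definition Z50 :: "nat \<Rightarrow> code set" where
  "Z50 n = {f \<in> Z5 n. \<forall>j. flx 1 5 (Suc n) f j = 0}"

lemma lin_sub_Z5: "lin_sub (Z5 n)"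
  by (auto simp: lin_sub_def Z5_def cmp_lc net_lc simp del: cmp.simps net.simps)

lemma lin_sub_Z50: "lin_sub (Z50 n)"
  using lin_sub_Z5[of n] by (auto simp: lin_sub_def Z50_def)

lemma Z5_sum: "f \<in> Z5 n \<Longrightarrow> flx 1 5 (Suc n) f 0 + flx 1 5 (Suc n) f 1 + flx 1 5 (Suc n) f 2 = 0"
proof -
  assume f: "f \<in> Z5 n"
  obtain \<alpha> where a: "\<forall>j. f (crn (Suc n) j) = \<alpha>" "(\<Sum>j\<in>UNIV. flx 1 5 (Suc n) f j) = 3 ^ n * (5 / 2) * \<alpha>"
    using net5[of n f] f unfolding Z5_def by blast
  have "\<alpha> = 0" using a(1) f by (auto simp: Z5_def)
  then show ?thesis using a(2) by (simp add: sum3)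
qed

text \<open>Vanishing at the outer corners spreads to all junctions, since by \<open>net5\<close>
  the corners of every cell share one value.\<close>

lemma Z5_Suc: "f \<in> Z5 (Suc n) \<longleftrightarrow> (\<forall>j. f ([], j) = 0) \<and> (\<forall>i. sh f i \<in> Z5 n) \<and>
    (\<forall>i j. i \<noteq> j \<longrightarrow> flx 1 5 (Suc n) (sh f i) j + flx 1 5 (Suc n) (sh f j) i = 0)" (is "?l \<longleftrightarrow> ?r")
proof
  assume f: ?l
  have cm: "\<And>i. cmp (Suc n) (sh f i)" "\<And>i j. sh f i (crn (Suc n) j) = sh f j (crn (Suc n) i)"
    using f unfolding Z5_def mem_Collect_eq cmp.simps(2)[of "Suc n"] by blast+
  have nt: "\<And>i. net 1 5 (Suc n) (sh f i)"
    "\<And>i j. i \<noteq> j \<Longrightarrow> flx 1 5 (Suc n) (sh f i) j + flx 1 5 (Suc n) (sh f j) i = 0"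
    using f unfolding Z5_def mem_Collect_eq net.simps(2)[of _ _ "Suc n"] by blast+
  have rs: "\<And>j. f ([], j) = 0" "\<And>i. res (Suc n) (sh f i) = sh f i"
    using f unfolding Z5_def mem_Collect_eq res_Suc_iff[of "Suc n"] by blast+
  have "sh f i (crn (Suc n) j) = 0" for i j
  proof -
    have "sh f i (crn (Suc n) i) = 0" using f crn_Suc[of f "Suc n" i] by (simp add: Z5_def)
    then show ?thesis using net5[OF cm(1) nt(1), of i] by metis
  qed
  then have "sh f i \<in> Z5 n" for i unfolding Z5_def mem_Collect_eq using cm(1)[of i] nt(1)[of i] rs(2)[of i] by blast
  then show ?r using nt(2) rs(1) by blast
next
  assume r: ?r
  then have z: "\<And>i. res (Suc n) (sh f i) = sh f i" "\<And>i. cmp (Suc n) (sh f i)" "\<And>i. net 1 5 (Suc n) (sh f i)"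
    "\<And>i j. sh f i (crn (Suc n) j) = 0"
    unfolding Z5_def by blast+
  have "res (Suc (Suc n)) f = f" 
    by (intro res_Suc_iff[of "Suc n" f, THEN iffD2] conjI allI) (use r in blast, rule z(1))
  moreover have "cmp (Suc (Suc n)) f" 
    by (intro cmp.simps(2)[of "Suc n" f, THEN iffD2] conjI allI) (rule z(2), simp only: z(4))
  moreover have "net 1 5 (Suc (Suc n)) f" 
    by (intro net.simps(2)[of 1 5 "Suc n" f, THEN iffD2] conjI) (use z(3) in blast, use r in blast)
  moreover have "\<forall>j. f (crn (Suc (Suc n)) j) = 0" by (simp only: crn_Suc[of f] z(4) simp_thms)
  ultimately show ?l unfolding Z5_def by blast
qed

text \<open>The outer fluxes are routed through the cells recursively; balance is the only
  constraint.\<close>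

lemma Z5_ex: "c 0 + c 1 + c 2 = 0 \<Longrightarrow> \<exists>f\<in>Z5 n. \<forall>j. flx 1 5 (Suc n) f j = c j"
proof (induction n arbitrary: c)
  case 0
  define f where "f = jn (\<lambda>i. res 0 (\<lambda>(w, j). if i = j then 0 else c (- (i + j))))"
  have v: "f ([i], j) = (if i = j then 0 else c (- (i + j)))" for i j
    by (simp add: f_def jn_def res_def)
  have cm: "cmp (Suc 0) f" by (simp add: crn_def v add.commute)
  have "res (Suc 0) f = f" by (simp add: res_Suc_iff f_def)
  moreover have "net 1 5 (Suc 0) f" unfolding net5_level1(1)[OF cm] v using 0 by simp
  ultimately have "f \<in> Z5 0" using cm v by (simp add: Z5_def crn_def)
  moreover have "\<forall>j. flx 1 5 (Suc 0) f j = c j"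
    unfolding all3 net5_level1(2-4)[OF cm] v using 0 by simp
  ultimately show ?case by blast
next
  case (Suc n)
  \<comment> \<open>Cell 0 is the hub: each of the other two cells passes its outer flux straight on
    to it.\<close>
  define s where "s i = (if i = 0 then c else (\<lambda>j. if j = 0 then - c i else if j = i then c i else 0))" for i
  have "\<forall>i. s i 0 + s i 1 + s i 2 = 0" using Suc.prems by (simp add: all3 s_def)
  then have "\<forall>i. \<exists>f\<in>Z5 n. \<forall>j. flx 1 5 (Suc n) f j = s i j" using Suc.IH by blast
  then obtain h where h: "\<And>i. h i \<in> Z5 n" "\<And>i j. flx 1 5 (Suc n) (h i) j = s i j" by metis
  have "\<forall>i j. i \<noteq> j \<longrightarrow> s i j + s j i = 0" by (simp add: all3 s_def)
  then have "jn h \<in> Z5 (Suc n)" unfolding Z5_Suc sh_jn h(2) using h(1) by simp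
  moreover have "\<forall>j. flx 1 5 (Suc (Suc n)) (jn h) j = c j"
    unfolding flx_Suc[of _ _ "Suc n"] sh_jn h(2) by (simp add: all3 s_def)
  ultimately show ?case by blast
qed

text \<open>The number of holes enclosed by the \<open>3 ^ n\<close> level-1 pieces; each carries
  one independent circulation.\<close>

primrec zd :: "nat \<Rightarrow> nat" where
  "zd 0 = 0"
| "zd (Suc n) = 1 + (zd n + zd n + zd n)"

lemma Z50_Suc: "f \<in> Z50 (Suc n) \<longleftrightarrow> f \<in> Z5 (Suc n) \<and> (\<forall>j. flx 1 5 (Suc n) (sh f j) j = 0)"
  unfolding Z50_def by (simp add: flx_Suc[of _ _ "Suc n"])

text \<open>With no outer flux, balance in each cell makes one junction flux determine the others:
  they form a circulation. If it is 0, the cells decouple.\<close>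

lemma dimn_Z50: "dimn (zd n) (Z50 n)"
proof (induction n)
  case 0
  have "f = (\<lambda>_. 0)" if "f \<in> Z50 0" for f
  proof -
    have f: "res (Suc 0) f = f" "cmp (Suc 0) f" "net 1 5 (Suc 0) f" "\<forall>j. f (crn (Suc 0) j) = 0"
      "\<forall>j. flx 1 5 (Suc 0) f j = 0"
      using that unfolding Z50_def Z5_def by blast+
    have z: "f ([j], j) = 0" for j using f(4) by (simp add: crn_def)
    have "f ([0], 1) + f ([0], 2) + f ([1], 2) = 0" using f(3) net5_level1(1)[OF f(2)] z by simp
    moreover have "f ([0], 1) + f ([0], 2) = 0" "f ([0], 1) + f ([1], 2) = 0"
      using net5_level1(2,3)[OF f(2)] f(5) z by simp_all
    ultimately have "f ([0], 1) = 0" "f ([0], 2) = 0" "f ([1], 2) = 0" by linarith+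
    then have "\<forall>i j. f ([i], j) = 0" using f(2) z by (simp add: all3 crn_def)
    then have "res (Suc 0) f = (\<lambda>_. 0)" by (auto simp: res_def length_Suc_conv fun_eq_iff)
    then show ?thesis using f(1) by simp
  qed
  then show ?case using lin_sub_Z50[of 0] by (auto simp: lin_sub_def)
next
  case (Suc n)
  define L where "L f = (\<lambda>u::unit. flx 1 5 (Suc n) (sh f 0) 1)" for f
  have lin: "lin_on (Z50 (Suc n)) L" by (rule lin_onI) (simp add: L_def)
  have "c \<in> L ` Z50 (Suc n)" for c
  proof -
    define g where "g = c ()"
    \<comment> \<open>A circulation of strength \<open>g\<close> around the hole between the three
      cells.\<close>
    define s where "s i = (if i = 0 then (\<lambda>j :: 3. if j = 0 then 0 else if j = 1 then g else - g)
       else if i = 1 then (\<lambda>j. if j = 0 then - g else if j = 1 then 0 else g)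
       else (\<lambda>j. if j = 0 then g else if j = 1 then - g else 0))" for i :: 3
    have "\<forall>i. s i 0 + s i 1 + s i 2 = 0" by (simp add: all3 s_def)
    then have "\<forall>i. \<exists>f\<in>Z5 n. \<forall>j. flx 1 5 (Suc n) f j = s i j" using Z5_ex by blast
    then obtain h where h: "\<And>i. h i \<in> Z5 n" "\<And>i j. flx 1 5 (Suc n) (h i) j = s i j" by metis
    have "\<forall>i j. i \<noteq> j \<longrightarrow> s i j + s j i = 0" by (simp add: all3 s_def)
    then have "jn h \<in> Z5 (Suc n)" unfolding Z5_Suc sh_jn h(2) using h(1) by simp
    moreover have "\<forall>j. s j j = 0" by (simp add: all3 s_def)
    ultimately have "jn h \<in> Z50 (Suc n)" unfolding Z50_Suc sh_jn h(2) by blast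
    moreover have "L (jn h) = c" by (rule ext) (simp add: L_def h(2) s_def g_def)
    ultimately show ?thesis by blast
  qed
  then have "L ` Z50 (Suc n) = UNIV" by blast
  then have im: "dimn 1 (L ` Z50 (Suc n))" using dimn_UNIV[where 'a=unit] by simp
  have "f \<in> Z50 (Suc n) \<and> L f = (\<lambda>_. 0) \<longleftrightarrow> (\<forall>j. f ([], j) = 0) \<and> (\<forall>i. sh f i \<in> Z50 n)" for f
  proof
    assume f: "f \<in> Z50 (Suc n) \<and> L f = (\<lambda>_. 0)"
    let ?s = "\<lambda>i j. flx 1 5 (Suc n) (sh f i) j"
    have f': "(\<forall>j. f ([], j) = 0)" "\<And>i. sh f i \<in> Z5 n" "\<And>i j. i \<noteq> j \<Longrightarrow> ?s i j + ?s j i = 0" "\<And>j. ?s j j = 0"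
      using f unfolding Z50_Suc Z5_Suc by blast+
    have "L f () = 0" using f by metis
    then have s0: "?s 0 1 = 0" by (simp add: L_def)
    have "?s 0 1 + ?s 1 0 = 0" "?s 0 2 + ?s 2 0 = 0" "?s 1 2 + ?s 2 1 = 0" by (rule f'(3); simp)+
    then have "?s 0 2 = 0" "?s 1 0 = 0" "?s 2 0 = 0" "?s 1 2 = 0" "?s 2 1 = 0"
      using s0 f'(4)[of 0] f'(4)[of 1] f'(4)[of 2] Z5_sum[OF f'(2)[of 0]] Z5_sum[OF f'(2)[of 1]] by linarith+
    then have "\<forall>i j. ?s i j = 0" using s0 f'(4) by (simp add: all3)
    then show "(\<forall>j. f ([], j) = 0) \<and> (\<forall>i. sh f i \<in> Z50 n)" using f'(1,2) by (simp add: Z50_def)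
  next
    assume f: "(\<forall>j. f ([], j) = 0) \<and> (\<forall>i. sh f i \<in> Z50 n)"
    then have "\<And>i. sh f i \<in> Z5 n" "\<And>i j. flx 1 5 (Suc n) (sh f i) j = 0" unfolding Z50_def by blast+
    then show "f \<in> Z50 (Suc n) \<and> L f = (\<lambda>_. 0)" using f unfolding Z50_Suc Z5_Suc L_def by simp
  qed
  then have "{f \<in> Z50 (Suc n). L f = (\<lambda>_. 0)} = {f. (\<forall>j. f ([], j) = 0) \<and> (\<forall>i. sh f i \<in> Z50 n)}" by auto
  then have "dimn (zd n + zd n + zd n) {f \<in> Z50 (Suc n). L f = (\<lambda>_. 0)}"
    using dimn_prod3[of _ "\<lambda>_. Z50 n"] Suc lin_sub_Z50 by simp
  then show ?case unfolding zd.simps by (rule dimn_rank_nullity[OF lin_sub_Z50 lin im])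
qed

lemma half_level1:
  assumes c: "hcmp (Suc 0) f"
  defines "u \<equiv> f ([0], 0)" and "v \<equiv> f ([1], 1)" and "p \<equiv> f ([0], 1)" and "x \<equiv> f ([1], 2)"
  shows "hnet 1 b 5 (Suc 0) f \<longleftrightarrow> (if b then u = 0 \<and> x = 0 \<and> v = 0 else u = v \<and> x = - 3 / 2 * v \<and> p = - v / 4)"
    "hflx 1 b 5 (Suc 0) f = - v / 2 - p - x" "f (crn (Suc 0) 1) = v" "f ([1], 0) = p"
proof -
  show c': "f ([1], 0) = p" using c by (simp add: crn_def p_def)
  show "f (crn (Suc 0) 1) = v" by (simp add: crn_def v_def)
  note uvpx = u_def v_def p_def x_def
  show "hflx 1 b 5 (Suc 0) f = - v / 2 - p - x" by (simp add: flx_def T_def c' uvpx[symmetric])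
  show "hnet 1 b 5 (Suc 0) f \<longleftrightarrow> (if b then u = 0 \<and> x = 0 \<and> v = 0 else u = v \<and> x = - 3 / 2 * v \<and> p = - v / 4)"
  proof (cases b)
    case True
    then show ?thesis by (auto simp: flx_def T_def c' uvpx[symmetric] crn_def algebra_simps)
  next
    case False
    have "hnet 1 b mu (Suc 0) f \<longleftrightarrow> (1 - mu / 4) * u = p \<and> (3 - mu) * p = u + v + x \<and> (4 - mu) * x = 2 * p + 2 * v" for mu
      using False by (auto simp: flx_def T_def c' uvpx[symmetric] crn_def algebra_simps)
    then have "hnet 1 b 5 (Suc 0) f \<longleftrightarrow> (1 - 5 / 4) * u = p \<and> (3 - 5) * p = u + v + x \<and> (4 - 5) * x = 2 * p + 2 * v" .
    also have "\<dots> \<longleftrightarrow> u = v \<and> x = - 3 / 2 * v \<and> p = - v / 4"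
    proof
      assume "(1 - 5 / 4) * u = p \<and> (3 - 5) * p = u + v + x \<and> (4 - 5) * x = 2 * p + 2 * v"
      then have e: "u = - 4 * p" "- 2 * p = u + v + x" "x = - 2 * p - 2 * v" by auto
      have "v = - 4 * p" using e(2) unfolding e(1,3) by simp
      then show "u = v \<and> x = - 3 / 2 * v \<and> p = - v / 4" using e by simp
    qed simp
    finally show ?thesis using False by simp
  qed
qed

lemmas half_level1_D = half_level1(1)[where b = True, unfolded if_True]
lemmas half_level1_N = half_level1(1)[where b = False, unfolded if_False]

text \<open>A positive Dirichlet-to-Neumann factor: it starts at 5/4 and grows by
  \<open>3 ^ n * (5 / 2)\<close> per level, as no flux leaves through \<open>X\<close>. Zero flux at
  \<open>q 1\<close> therefore forces the value 0.\<close>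

lemma hnet5_neumann:
  "hcmp (Suc n) f \<Longrightarrow> hnet 1 False 5 (Suc n) f \<Longrightarrow>
    \<exists>p>0. hflx 1 False 5 (Suc n) f = p * f (crn (Suc n) 1)"
proof (induction n arbitrary: f)
  case 0
  have "hflx 1 False 5 (Suc 0) f = 5 / 4 * f (crn (Suc 0) 1)"
    using half_level1_N[OF 0(1)] 0(2) unfolding half_level1(2,3)[OF 0(1)] by auto
  then show ?case by (intro exI[of _ "5 / 4"]) simp
next
  case (Suc n)
  let ?g = "sh f 1" let ?h = "sh f 0"
  note pr = Suc.prems[unfolded hcmp.simps(2)[of "Suc n"] hnet.simps(2)[of _ _ _ "Suc n"]]
  obtain p where p: "p > 0" "hflx 1 False 5 (Suc n) ?h = p * ?h (crn (Suc n) 1)" using Suc.IH[of ?h] pr by blast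
  obtain a where a: "\<forall>j. ?g (crn (Suc n) j) = a" "(\<Sum>j\<in>UNIV. flx 1 5 (Suc n) ?g j) = 3 ^ n * (5 / 2) * a"
    using net5[of n ?g] pr by blast
  have "?h (crn (Suc n) 1) = a" using a(1) pr by metis
  then have "flx 1 5 (Suc n) ?g 0 = - p * a" using p pr by (simp add: eq_neg_iff_add_eq_0)
  moreover have "flx 1 5 (Suc n) ?g 2 = 0" using pr by simp
  ultimately have "flx 1 5 (Suc n) ?g 1 = (3 ^ n * (5 / 2) + p) * a" using a(2) by (simp add: sum3 algebra_simps)
  then have "hflx 1 False 5 (Suc (Suc n)) f = (3 ^ n * (5 / 2) + p) * f (crn (Suc (Suc n)) 1)"
    using a(1) unfolding crn_Suc[of f] hflx.simps(2)[of _ _ _ "Suc n"] by simp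
  moreover have "3 ^ n * (5 / 2) + p > 0" using p by (simp add: add_pos_pos)
  ultimately show ?case by blast
qed

text \<open>No circulation is added here: the Neumann conditions close the exits at \<open>X\<close>
  and \<open>q 1\<close>, so the flux between cell 1 and the rest is 0 too.\<close>

primrec nd5 :: "nat \<Rightarrow> nat" where
  "nd5 0 = 0"
| "nd5 (Suc n) = nd5 n + zd n + 0"

lemma Sol_5_neumann_crn: "f \<in> Sol 1 False (Suc n) 5 \<Longrightarrow> f (crn (Suc n) 1) = 0"
proof -
  assume f: "f \<in> Sol 1 False (Suc n) 5"
  obtain p where p: "p > 0" "hflx 1 False 5 (Suc n) f = p * f (crn (Suc n) 1)"
    using hnet5_neumann[of n f] f unfolding Sol_def by blast
  have "hflx 1 False 5 (Suc n) f = 0" using f by (simp add: Sol_def del: hcmp.simps hnet.simps hflx.simps)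
  then show ?thesis using p by simp
qed

lemma dimn_Sol_5_neumann: "dimn (nd5 n) (Sol 1 False (Suc n) 5)"
proof (induction n)
  case 0
  have "f = (\<lambda>_. 0)" if f: "f \<in> Sol 1 False (Suc 0) 5" for f
  proof -
    have f': "hres (Suc 0) f = f" "hcmp (Suc 0) f" "hnet 1 False 5 (Suc 0) f" "hflx 1 False 5 (Suc 0) f = 0"
      using f unfolding Sol_def by auto
    have z: "f ([1], 1) = 0" using Sol_5_neumann_crn[OF f] by (simp add: crn_def)
    then have "f ([0], 0) = 0" "f ([0], 1) = 0" "f ([1], 2) = 0" "f ([1], 0) = 0"
      using half_level1_N[OF f'(2)] half_level1(4)[OF f'(2)] f'(3) by simp_all
    then have "res 0 (sh f 1) = (\<lambda>_. 0)" "hres 0 (sh f 0) = (\<lambda>_. 0)"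
      using z all3[of "\<lambda>j. f ([1], j) = 0"] all3[of "\<lambda>j. f ([0], j) = 0 \<or> j = 2"] by (auto simp: res_def fun_eq_iff)
    then have "\<forall>i. sh (hres (Suc 0) f) i = (\<lambda>_. 0)" by (simp add: all3 del: hres.simps(1))
    then have "hres (Suc 0) f = (\<lambda>_. 0)" by (intro code_eqI[of "hres _ f"]) simp_all
    then show ?thesis using f'(1) by simp
  qed
  then show ?case using lin_sub_Sol[of 1 False "Suc 0" 5] by (auto simp: lin_sub_def)
next
  case (Suc n)
  define Z where "Z i = (if i = 0 then Sol 1 False (Suc n) 5 else if i = 1 then Z50 n else {\<lambda>_. 0})" for i :: 3
  have subZ: "lin_sub (Z i)" for i
    using lin_sub_Sol lin_sub_Z50 by (auto simp: Z_def) (simp add: lin_sub_def)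
  have "f \<in> Sol 1 False (Suc (Suc n)) 5 \<longleftrightarrow> (\<forall>j. f ([], j) = 0) \<and> (\<forall>i. sh f i \<in> Z i)" for f
  proof -
    let ?g = "sh f 1" let ?h = "sh f 0"
    have "f \<in> Sol 1 False (Suc (Suc n)) 5 \<longleftrightarrow> (\<forall>j. f ([], j) = 0) \<and> res (Suc n) ?g = ?g \<and>
      hres (Suc n) ?h = ?h \<and> sh f 2 = (\<lambda>_. 0) \<and> cmp (Suc n) ?g \<and> hcmp (Suc n) ?h \<and> ?g (crn (Suc n) 0) = ?h (crn (Suc n) 1) \<and>
      net 1 5 (Suc n) ?g \<and> hnet 1 False 5 (Suc n) ?h \<and> flx 1 5 (Suc n) ?g 0 + hflx 1 False 5 (Suc n) ?h = 0 \<and>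
      flx 1 5 (Suc n) ?g 2 = 0 \<and> flx 1 5 (Suc n) ?g 1 = 0" (is "_ \<longleftrightarrow> ?A")
      unfolding Sol_def mem_Collect_eq hres_Suc_iff[of "Suc n"] hcmp.simps(2)[of "Suc n"] hnet.simps(2)[of _ _ _ "Suc n"]
        hflx.simps(2)[of _ _ _ "Suc n"] by simp
    also have "\<dots> \<longleftrightarrow> (\<forall>j. f ([], j) = 0) \<and> ?g \<in> Z50 n \<and> ?h \<in> Sol 1 False (Suc n) 5 \<and> sh f 2 = (\<lambda>_. 0)" (is "_ \<longleftrightarrow> ?B")
    proof
      assume A: ?A
      obtain p where p: "p > 0" "hflx 1 False 5 (Suc n) ?h = p * ?h (crn (Suc n) 1)"
        using hnet5_neumann[of n ?h] A by blast
      obtain a where a: "\<forall>j. ?g (crn (Suc n) j) = a" "(\<Sum>j\<in>UNIV. flx 1 5 (Suc n) ?g j) = 3 ^ n * (5 / 2) * a"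
        using net5[of n ?g] A by blast
      have ha: "?h (crn (Suc n) 1) = a" using a(1) A by metis
      then have "flx 1 5 (Suc n) ?g 0 = - p * a" using p A by (simp add: eq_neg_iff_add_eq_0)
      then have "- p * a = 3 ^ n * (5 / 2) * a" using a(2) A by (simp add: sum3)
      \<comment> \<open>Balance in cell 1 against the positive factor of the rest leaves only the
        value 0 at the junction.\<close>
      then have "(3 ^ n * (5 / 2) + p) * a = 0" by (simp add: algebra_simps)
      moreover have "3 ^ n * (5 / 2) + p > 0" using p by (simp add: add_pos_pos)
      ultimately have "a = 0" by simp
      then have "hflx 1 False 5 (Suc n) ?h = 0" "flx 1 5 (Suc n) ?g 0 = 0" using ha p A by simp_all
      then have "\<forall>j. flx 1 5 (Suc n) ?g j = 0" "hflx 1 False 5 (Suc n) ?h = 0" using A unfolding all3 by blast+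
      then show ?B using A a(1) \<open>a = 0\<close> unfolding Z50_def Z5_def Sol_def by (simp only: mem_Collect_eq) simp
    next
      assume B: ?B
      have "?h (crn (Suc n) 1) = 0" using B Sol_5_neumann_crn by blast
      moreover have "?g (crn (Suc n) 0) = 0" "\<And>j. flx 1 5 (Suc n) ?g j = 0" using B unfolding Z50_def Z5_def by blast+
      moreover have "hflx 1 False 5 (Suc n) ?h = 0" using B unfolding Sol_def by simp
      ultimately show ?A using B unfolding Z50_def Z5_def Sol_def by simp
    qed
    also have "\<dots> \<longleftrightarrow> (\<forall>j. f ([], j) = 0) \<and> (\<forall>i. sh f i \<in> Z i)"
      by (simp only: all3[of "\<lambda>i. sh f i \<in> Z i"]) (auto simp: Z_def)
    finally show ?thesis .
  qed
  then have "Sol 1 False (Suc (Suc n)) 5 = {f. (\<forall>j. f ([], j) = 0) \<and> (\<forall>i. sh f i \<in> Z i)}" by auto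
  then show ?case unfolding nd5.simps
    by (rule dimn_prod3[OF _ subZ]) (simp_all add: Z_def Suc dimn_Z50)
qed

text \<open>The value 0 starts at the cut cell and passes through the junctions, because
  \<open>net5\<close> makes all corners of cell 1 equal.\<close>

lemma hnet5_dirichlet: "hcmp (Suc n) f \<Longrightarrow> hnet 1 True 5 (Suc n) f \<Longrightarrow> f (crn (Suc n) 1) = 0"
proof (induction n arbitrary: f)
  case 0
  then show ?case using half_level1_D[OF 0(1)] half_level1(3)[OF 0(1)] by metis
next
  case (Suc n)
  let ?g = "sh f 1" let ?h = "sh f 0"
  note pr = Suc.prems[unfolded hcmp.simps(2)[of "Suc n"] hnet.simps(2)[of _ _ _ "Suc n"]]
  have "?h (crn (Suc n) 1) = 0" using Suc.IH[of ?h] pr by blast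
  moreover obtain a where "\<forall>j. ?g (crn (Suc n) j) = a" using net5[of n ?g] pr by blast
  ultimately show ?case using pr unfolding crn_Suc[of f] by metis
qed

text \<open>Dirichlet points absorb any flux, so each point of \<open>X\<close> opens an exit for
  the flow. Here the exit at \<open>q 1\<close> is closed, so that only the exits at
  \<open>X\<close> are counted.\<close>

definition W5 :: "nat \<Rightarrow> code set" where
  "W5 n = {f \<in> Sol 1 True (Suc n) 5. hflx 1 True 5 (Suc n) f = 0}"

lemma lin_sub_W5: "lin_sub (W5 n)"
  unfolding W5_def by (rule lin_sub_kernel[OF lin_sub_Sol]) (simp add: linf_on_def del: hflx.simps)

primrec wd5 :: "nat \<Rightarrow> nat" where
  "wd5 0 = 0"
| "wd5 (Suc n) = 1 + (wd5 n + zd n + 0)"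

lemma Sol_5_dirichlet: "f \<in> Sol 1 True (Suc n) 5 \<longleftrightarrow> hres (Suc n) f = f \<and> hcmp (Suc n) f \<and> hnet 1 True 5 (Suc n) f"
  using hnet5_dirichlet[of n f] unfolding Sol_def by auto

lemma Sol_5_dirichlet_Suc: "f \<in> Sol 1 True (Suc (Suc n)) 5 \<longleftrightarrow> (\<forall>j. f ([], j) = 0) \<and> sh f 1 \<in> Z5 n \<and>
    sh f 0 \<in> Sol 1 True (Suc n) 5 \<and> sh f 2 = (\<lambda>_. 0) \<and> flx 1 5 (Suc n) (sh f 1) 0 + hflx 1 True 5 (Suc n) (sh f 0) = 0"
  (is "_ \<longleftrightarrow> ?B")
proof -
  let ?g = "sh f 1" let ?h = "sh f 0"
  have "f \<in> Sol 1 True (Suc (Suc n)) 5 \<longleftrightarrow> (\<forall>j. f ([], j) = 0) \<and> res (Suc n) ?g = ?g \<and>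
      hres (Suc n) ?h = ?h \<and> sh f 2 = (\<lambda>_. 0) \<and> cmp (Suc n) ?g \<and> hcmp (Suc n) ?h \<and> ?g (crn (Suc n) 0) = ?h (crn (Suc n) 1) \<and>
      net 1 5 (Suc n) ?g \<and> hnet 1 True 5 (Suc n) ?h \<and> flx 1 5 (Suc n) ?g 0 + hflx 1 True 5 (Suc n) ?h = 0 \<and>
      ?g (crn (Suc n) 2) = 0" (is "_ \<longleftrightarrow> ?A")
    unfolding Sol_5_dirichlet hres_Suc_iff[of "Suc n"] hcmp.simps(2)[of "Suc n"] hnet.simps(2)[of _ _ _ "Suc n"]
    by simp
  also have "\<dots> \<longleftrightarrow> ?B"
  proof
    assume A: ?A
    obtain a where a: "\<forall>j. ?g (crn (Suc n) j) = a" using net5[of n ?g] A by blast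
    have "a = 0" using a A by metis
    then show ?B using A a unfolding Z5_def Sol_5_dirichlet by blast
  next
    assume B: ?B
    then show ?A using hnet5_dirichlet[of n ?h] unfolding Z5_def Sol_5_dirichlet by simp
  qed
  finally show ?thesis .
qed

lemma Sol_5_dirichlet_ex: "\<exists>f\<in>Sol 1 True (Suc n) 5. hflx 1 True 5 (Suc n) f = t"
proof (cases n)
  case 0
  define f where "f = jn (\<lambda>i. if i = 1 then res 0 (\<lambda>(w, j). if j = 0 then - t else 0) else
     if i = 0 then hres 0 (\<lambda>(w, j). if j = 1 then - t else 0) else (\<lambda>_. 0))"
  have cm: "hcmp (Suc 0) f" by (simp add: f_def crn_def res_def)
  have "hres (Suc 0) f = f" unfolding hres_Suc_iff by (simp add: f_def del: hres.simps)
  moreover have v: "f ([0], 0) = 0" "f ([1], 1) = 0" "f ([0], 1) = - t" "f ([1], 2) = 0"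
    by (simp_all add: f_def jn_def res_def)
  ultimately have "f \<in> Sol 1 True (Suc 0) 5" "hflx 1 True 5 (Suc 0) f = t"
    unfolding Sol_5_dirichlet half_level1_D[OF cm] half_level1(2)[OF cm] using cm by simp_all
  then show ?thesis using 0 by blast
next
  case (Suc m)
  \<comment> \<open>A flow between \<open>q 1\<close> and the first point of \<open>X\<close>,
    inside cell 1.\<close>
  obtain g where g: "g \<in> Z5 m" "\<forall>j. flx 1 5 (Suc m) g j = (if j = 0 then 0 else if j = 1 then t else - t)"
    using Z5_ex[of "\<lambda>j. if j = 0 then 0 else if j = 1 then t else - t" m] by auto
  let ?f = "jn (\<lambda>i. if i = 1 then g else (\<lambda>_. 0))"
  have "(\<lambda>_. 0) \<in> Sol 1 True (Suc m) 5" using lin_sub_Sol unfolding lin_sub_def by blast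
  then have "?f \<in> Sol 1 True (Suc (Suc m)) 5" unfolding Sol_5_dirichlet_Suc using g by simp
  moreover have "hflx 1 True 5 (Suc (Suc m)) ?f = t" using g by simp
  ultimately show ?thesis using Suc by blast
qed

lemma dimn_W5: "dimn (wd5 n) (W5 n)"
proof (induction n)
  case 0
  have "f = (\<lambda>_. 0)" if f: "f \<in> W5 0" for f
  proof -
    have f': "hres (Suc 0) f = f" "hcmp (Suc 0) f" "hnet 1 True 5 (Suc 0) f" "hflx 1 True 5 (Suc 0) f = 0"
      using f unfolding W5_def Sol_5_dirichlet by auto
    have z: "f ([1], 1) = 0" "f ([0], 0) = 0" "f ([1], 2) = 0" using half_level1_D[OF f'(2)] f'(3) by blast+
    then have "f ([0], 1) = 0" using half_level1(2)[OF f'(2), of True] f'(4) by simp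
    then have "f ([0], 1) = 0" "f ([1], 0) = 0" using half_level1(4)[OF f'(2)] by simp_all
    then have "res 0 (sh f 1) = (\<lambda>_. 0)" "hres 0 (sh f 0) = (\<lambda>_. 0)"
      using z all3[of "\<lambda>j. f ([1], j) = 0"] all3[of "\<lambda>j. f ([0], j) = 0 \<or> j = 2"] by (auto simp: res_def fun_eq_iff)
    then have "\<forall>i. sh (hres (Suc 0) f) i = (\<lambda>_. 0)" by (simp add: all3 del: hres.simps(1))
    then have "hres (Suc 0) f = (\<lambda>_. 0)" by (intro code_eqI[of "hres _ f"]) simp_all
    then show ?thesis using f'(1) by simp
  qed
  then show ?case using lin_sub_W5[of 0] by (auto simp: lin_sub_def)
next
  case (Suc n)
  define Z where "Z i = (if i = 0 then W5 n else if i = 1 then Z50 n else {\<lambda>_. 0})" for i :: 3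
  have subZ: "lin_sub (Z i)" for i
    using lin_sub_W5 lin_sub_Z50 by (auto simp: Z_def) (simp add: lin_sub_def)
  define L where "L f = (\<lambda>u::unit. flx 1 5 (Suc n) (sh f 1) 0)" for f
  have lin: "lin_on (W5 (Suc n)) L" by (rule lin_onI) (simp add: L_def)
  have W: "f \<in> W5 (Suc n) \<longleftrightarrow> f \<in> Sol 1 True (Suc (Suc n)) 5 \<and> flx 1 5 (Suc n) (sh f 1) 1 = 0" for f
    by (simp add: W5_def)
  have "c \<in> L ` W5 (Suc n)" for c
  proof -
    define t where "t = c ()"
    \<comment> \<open>The flux \<open>t\<close> at the junction is balanced by \<open>- t\<close> at
      the first point of \<open>X\<close>; the smaller half gasket supplies the matching
      \<open>- t\<close> on its side.\<close>
    obtain g where g: "g \<in> Z5 n" "\<forall>j. flx 1 5 (Suc n) g j = (if j = 0 then t else if j = 1 then 0 else - t)"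
      using Z5_ex[of "\<lambda>j. if j = 0 then t else if j = 1 then 0 else - t" n] by auto
    obtain h where h: "h \<in> Sol 1 True (Suc n) 5" "hflx 1 True 5 (Suc n) h = - t" using Sol_5_dirichlet_ex by blast
    let ?f = "jn (\<lambda>i. if i = 1 then g else if i = 0 then h else (\<lambda>_. 0))"
    have "?f \<in> W5 (Suc n)" unfolding W Sol_5_dirichlet_Suc using g h by (simp del: hflx.simps)
    moreover have "L ?f = c" using g by (auto simp: L_def t_def)
    ultimately show ?thesis by blast
  qed
  then have "L ` W5 (Suc n) = UNIV" by blast
  then have im: "dimn 1 (L ` W5 (Suc n))" using dimn_UNIV[where 'a=unit] by simp
  have "f \<in> W5 (Suc n) \<and> L f = (\<lambda>_. 0) \<longleftrightarrow> (\<forall>j. f ([], j) = 0) \<and> (\<forall>i. sh f i \<in> Z i)" for f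
  proof -
    have "L f = (\<lambda>_. 0) \<longleftrightarrow> flx 1 5 (Suc n) (sh f 1) 0 = 0" by (auto simp: L_def fun_eq_iff)
    moreover have "sh f 1 \<in> Z50 n \<longleftrightarrow> sh f 1 \<in> Z5 n \<and> flx 1 5 (Suc n) (sh f 1) 0 = 0 \<and> flx 1 5 (Suc n) (sh f 1) 1 = 0"
      using Z5_sum[of "sh f 1" n] unfolding Z50_def all3 by auto
    moreover have "(\<forall>i. sh f i \<in> Z i) \<longleftrightarrow> sh f 0 \<in> W5 n \<and> sh f 1 \<in> Z50 n \<and> sh f 2 = (\<lambda>_. 0)"
      by (simp only: all3[of "\<lambda>i. sh f i \<in> Z i"]) (auto simp: Z_def)
    ultimately show ?thesis unfolding W Sol_5_dirichlet_Suc W5_def mem_Collect_eq by auto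
  qed
  then have "{f \<in> W5 (Suc n). L f = (\<lambda>_. 0)} = {f. (\<forall>j. f ([], j) = 0) \<and> (\<forall>i. sh f i \<in> Z i)}" by auto
  then have "dimn (wd5 n + zd n + 0) {f \<in> W5 (Suc n). L f = (\<lambda>_. 0)}"
    by (rule dimn_prod3[OF _ subZ]) (simp_all add: Z_def Suc dimn_Z50)
  then show ?case unfolding wd5.simps by (rule dimn_rank_nullity[OF lin_sub_W5 lin im])
qed

text \<open>The flux at \<open>q 1\<close> is free, because any flow can be let out through
  \<open>X\<close> or the cut cell; fixing it to 0 leaves \<open>W5\<close>.\<close>

lemma dimn_Sol_5_dirichlet: "dimn (1 + wd5 n) (Sol 1 True (Suc n) 5)"
proof -
  define L where "L f = (\<lambda>u::unit. hflx 1 True 5 (Suc n) f)" for f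
  have lin: "lin_on (Sol 1 True (Suc n) 5) L" by (rule lin_onI) (simp add: L_def del: hflx.simps)
  have "c \<in> L ` Sol 1 True (Suc n) 5" for c
  proof -
    obtain f where f: "f \<in> Sol 1 True (Suc n) 5" "hflx 1 True 5 (Suc n) f = c ()" using Sol_5_dirichlet_ex by blast
    then have "L f = c" by (auto simp: L_def)
    then show ?thesis using f(1) by blast
  qed
  then have "L ` Sol 1 True (Suc n) 5 = UNIV" by blast
  then have im: "dimn 1 (L ` Sol 1 True (Suc n) 5)" using dimn_UNIV[where 'a=unit] by simp
  have "{f \<in> Sol 1 True (Suc n) 5. L f = (\<lambda>_. 0)} = W5 n" by (auto simp: W5_def L_def fun_eq_iff)
  then show ?thesis using dimn_rank_nullity[OF lin_sub_Sol lin im] dimn_W5 by simp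
qed

subsection \<open>Quadratic forms and the weak formulation\<close>

text \<open>Graph energy of level \<open>n\<close> minus \<open>mu\<close> times a vertex mass, both
  summed cell by cell; a junction is counted in two cells, hence the \<open>mu / 2\<close> in
  \<open>T\<close>.\<close>

primrec Qf :: "real \<Rightarrow> nat \<Rightarrow> code \<Rightarrow> code \<Rightarrow> real" where
  "Qf mu 0 f g = (\<Sum>j\<in>UNIV. T mu (\<lambda>k. f ([], k)) j * g ([], j))"
| "Qf mu (Suc n) f g = (\<Sum>i\<in>UNIV. Qf mu n (sh f i) (sh g i))"

text \<open>On the cut cell this is half of the form of the odd or even extension.\<close>

primrec Qh :: "bool \<Rightarrow> real \<Rightarrow> nat \<Rightarrow> code \<Rightarrow> code \<Rightarrow> real" where
  "Qh b mu 0 f g = (if b then (3 - mu / 2) * f ([], 1) * g ([], 1)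
     else ((1 - mu / 4) * f ([], 0) - f ([], 1)) * g ([], 0) + ((1 - mu / 2) * f ([], 1) - f ([], 0)) * g ([], 1))"
| "Qh b mu (Suc n) f g = Qf mu n (sh f 1) (sh g 1) + Qh b mu n (sh f 0) (sh g 0)"

primrec mf :: "nat \<Rightarrow> code \<Rightarrow> real" where
  "mf 0 h = (\<Sum>j\<in>UNIV. h ([], j))"
| "mf (Suc n) h = (\<Sum>i\<in>UNIV. mf n (sh h i))"

primrec mh :: "nat \<Rightarrow> code \<Rightarrow> real" where
  "mh 0 h = h ([], 0) / 2 + h ([], 1)"
| "mh (Suc n) h = mf n (sh h 1) + mh n (sh h 0)"

lemma sh_mult: "sh (\<lambda>p. f p * g p) i = (\<lambda>p. sh f i p * sh g i p)"
  by (auto simp: sh_def)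

lemma Qf_mass: "Qf mu n f g = Qf 0 n f g - mu / 2 * mf n (\<lambda>p. f p * g p)"
proof (induction n arbitrary: f g)
  case 0
  show ?case by (simp add: sum3 T_def algebra_simps)
next
  case (Suc n)
  show ?case unfolding Qf.simps(2) mf.simps(2) sh_mult Suc.IH[of "sh f _"]
    by (simp add: sum_subtractf sum_distrib_left)
qed

lemma Qh_mass_neumann: "Qh False mu n f g = Qh False 0 n f g - mu / 2 * mh n (\<lambda>p. f p * g p)"
proof (induction n arbitrary: f g)
  case 0
  show ?case by (simp add: algebra_simps)
next
  case (Suc n)
  show ?case unfolding Qh.simps(2) mh.simps(2) sh_mult Suc.IH[of "sh f 0"] Qf_mass[of mu n]
    by (simp add: algebra_simps)
qed

text \<open>The odd extension brings one more edge, between the corners with values \<open>v\<close>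
  and \<open>- v\<close> of the cut cell. Half of its energy is the extra product term.\<close>

lemma Qh_mass_dirichlet: "hz n f \<Longrightarrow> hz n g \<Longrightarrow> Qh True mu n f g =
    Qh False 0 n f g + 2 * f (replicate n 0, 1) * g (replicate n 0, 1) - mu / 2 * mh n (\<lambda>p. f p * g p)"
proof (induction n arbitrary: f g)
  case 0
  then show ?case by (simp add: algebra_simps)
next
  case (Suc n)
  have IH: "Qh True mu n (sh f 0) (sh g 0) = Qh False 0 n (sh f 0) (sh g 0) +
      2 * sh f 0 (replicate n 0, 1) * sh g 0 (replicate n 0, 1) - mu / 2 * mh n (\<lambda>p. sh f 0 p * sh g 0 p)"
    by (rule Suc.IH) (use Suc.prems in simp_all)
  show ?case unfolding Qh.simps(2) mh.simps(2) sh_mult IH Qf_mass[of mu n]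
    by (simp add: algebra_simps)
qed

lemma Qf_sym: "Qf mu n f g = Qf mu n g f"
proof (induction n arbitrary: f g)
  case 0
  show ?case by (simp add: sum3 T_def algebra_simps)
next
  case (Suc n)
  show ?case unfolding Qf.simps(2) by (intro sum.cong refl Suc)
qed

lemma Qh_sym: "Qh b mu n f g = Qh b mu n g f"
proof (induction n arbitrary: f g)
  case 0
  show ?case by (simp add: algebra_simps)
next
  case (Suc n)
  show ?case unfolding Qh.simps(2) using Suc Qf_sym by metis
qed

lemma Qf_zero [simp]: "Qf mu n f (\<lambda>_. 0) = 0"
  by (induction n arbitrary: f) simp_all

lemma Qh_zero [simp]: "Qh b mu n f (\<lambda>_. 0) = 0"
  by (induction n arbitrary: f) simp_all

section \<open>Green's formula and test functions\<close>

lemma green: "cmp n g \<Longrightarrow> net 1 mu n f \<Longrightarrow> Qf mu n f g = (\<Sum>j\<in>UNIV. flx 1 mu n f j * g (crn n j))"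
proof (induction n arbitrary: f g)
  case 0
  show ?case by (simp add: flx_def crn_def)
next
  case (Suc n)
  have IH: "Qf mu n (sh f i) (sh g i) = (\<Sum>j\<in>UNIV. flx 1 mu n (sh f i) j * sh g i (crn n j))" for i
    by (rule Suc.IH) (use Suc.prems in simp_all)
  have j: "sh g i (crn n j) = sh g j (crn n i)" for i j
    using Suc.prems(1) unfolding cmp.simps(2) by blast
  have fl: "flx 1 mu n (sh f j) i = - flx 1 mu n (sh f i) j" if "i \<noteq> j" for i j
    using Suc.prems(2) that unfolding net.simps(2) by (metis add.commute eq_neg_iff_add_eq_0)
  have fl': "flx 1 mu n (sh f 1) 0 = - flx 1 mu n (sh f 0) 1" "flx 1 mu n (sh f 2) 0 = - flx 1 mu n (sh f 0) 2"
    "flx 1 mu n (sh f 2) 1 = - flx 1 mu n (sh f 1) 2"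
    by (rule fl, simp)+
  show ?case
    unfolding Qf.simps(2) IH unfolding sum3 flx_Suc crn_Suc fl' j[of 1 0] j[of 2 0] j[of 2 1] by simp
qed

lemma hgreen: "hcmp n g \<Longrightarrow> hnet 1 b mu n f \<Longrightarrow> (b \<longrightarrow> hz n g) \<Longrightarrow> Qh b mu n f g = hflx 1 b mu n f * g (crn n 1)"
proof (induction n arbitrary: f g)
  case 0
  then show ?case by (cases b) (simp_all add: crn_def)
next
  case (Suc n)
  have IH: "Qh b mu n (sh f 0) (sh g 0) = hflx 1 b mu n (sh f 0) * sh g 0 (crn n 1)"
    by (rule Suc.IH) (use Suc.prems in simp_all)
  have G: "Qf mu n (sh f 1) (sh g 1) = (\<Sum>j\<in>UNIV. flx 1 mu n (sh f 1) j * sh g 1 (crn n j))"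
    by (rule green) (use Suc.prems in simp_all)
  have "hflx 1 b mu n (sh f 0) = - flx 1 mu n (sh f 1) 0" "sh g 0 (crn n 1) = sh g 1 (crn n 0)"
    using Suc.prems by (simp_all add: eq_neg_iff_add_eq_0 add.commute)
  moreover have "flx 1 mu n (sh f 1) 2 * sh g 1 (crn n 2) = 0" using Suc.prems by (cases b) simp_all
  ultimately show ?case unfolding Qh.simps(2) IH G sum3 by (simp add: crn_Suc)
qed

text \<open>Tests inside one cell give its equations by induction; then \<open>green\<close>
  evaluates a test supported at one junction as the sum of the two fluxes there.\<close>

lemma weak_net:
  "(\<And>g. cmp n g \<Longrightarrow> (\<And>j. g (crn n j) = 0) \<Longrightarrow> Qf mu n f g = 0) \<Longrightarrow> net 1 mu n f"
proof (induction n arbitrary: f)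
  case (Suc n)
  have sub: "net 1 mu n (sh f i)" for i
  proof (rule Suc.IH)
    fix g assume g: "cmp n g" "\<And>j. g (crn n j) = 0"
    let ?g = "jn (\<lambda>k. if k = i then g else (\<lambda>_. 0))"
    have s: "sh ?g k = (if k = i then g else (\<lambda>_. 0))" for k by simp
    have "Qf mu (Suc n) f ?g = 0"
      by (rule Suc.prems) (use g in \<open>simp_all add: crn_Suc\<close>)
    moreover have "Qf mu (Suc n) f ?g = (\<Sum>k\<in>UNIV. if k = i then Qf mu n (sh f i) g else 0)"
      unfolding Qf.simps(2) s by (intro sum.cong) auto
    ultimately show "Qf mu n (sh f i) g = 0" by simp
  qed
  have "flx 1 mu n (sh f i) j + flx 1 mu n (sh f j) i = 0" if ij: "i \<noteq> j" for i j
  proof -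
    let ?h = "\<lambda>k. cf n (\<lambda>l. if k = i \<and> l = j \<or> k = j \<and> l = i then 1 else 0)"
    have c: "?h k (crn n l) = (if k = i \<and> l = j \<or> k = j \<and> l = i then 1 else 0)" for k l by simp
    have "Qf mu (Suc n) f (jn ?h) = 0"
      by (rule Suc.prems) (use ij in \<open>auto simp: crn_Suc\<close>)
    moreover have "Qf mu (Suc n) f (jn ?h) = (\<Sum>k\<in>UNIV. \<Sum>l\<in>UNIV. flx 1 mu n (sh f k) l * ?h k (crn n l))"
      unfolding Qf.simps(2) sh_jn by (intro sum.cong refl green sub cmp_cf)
    also have "\<dots> = flx 1 mu n (sh f i) j + flx 1 mu n (sh f j) i"
    proof -
      have "i = 0 \<or> i = 1 \<or> i = 2" "j = 0 \<or> j = 1 \<or> j = 2" using ex3[of "\<lambda>k. i = k"] ex3[of "\<lambda>k. j = k"] by auto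
      then show ?thesis unfolding c sum3 using ij by (elim disjE; simp)
    qed
    ultimately show ?thesis by simp
  qed
  then show ?case using sub by simp
qed simp

lemma jn_half_simps:
  fixes h0 h1 :: code
  defines "g \<equiv> jn (\<lambda>i. if i = 1 then h1 else if i = 0 then h0 else (\<lambda>_. 0))"
  shows "Qh b mu (Suc n) f g = Qf mu n (sh f 1) h1 + Qh b mu n (sh f 0) h0"
    "hcmp (Suc n) g \<longleftrightarrow> cmp n h1 \<and> hcmp n h0 \<and> h1 (crn n 0) = h0 (crn n 1)"
    "hz (Suc n) g \<longleftrightarrow> h1 (crn n 2) = 0 \<and> hz n h0" "g (crn (Suc n) 1) = h1 (crn n 1)"
    "g (0 # w, j) = h0 (w, j)"
  by (simp_all add: g_def crn_Suc) (simp add: jn_def)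

text \<open>As for \<open>weak_net\<close>. A test at a point of \<open>X\<close> exists only in the
  Neumann case; the Dirichlet conditions there come from \<open>hz n f\<close>.\<close>

lemma weak_hnet:
  "(\<And>g. hcmp n g \<Longrightarrow> (b \<longrightarrow> hz n g) \<Longrightarrow> g (crn n 1) = 0 \<Longrightarrow> Qh b mu n f g = 0) \<Longrightarrow> (b \<longrightarrow> hz n f) \<Longrightarrow> hnet 1 b mu n f"
proof (induction n arbitrary: f)
  case 0
  show ?case
  proof (cases b)
    case False
    have "Qh b mu 0 f (\<lambda>(w, j). if j = 0 then 1 else 0) = 0"
      by (rule 0(1)) (use False in \<open>simp_all add: crn_def\<close>)
    then show ?thesis using False by simp
  qed (use 0 in simp)
next
  case (Suc n)
  let ?j = "\<lambda>h1 h0. jn (\<lambda>i. if i = 1 then h1 else if i = 0 then h0 else (\<lambda>_. 0))"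
  note W = Suc.prems(1)[of "?j _ _", unfolded jn_half_simps]
  have net: "net 1 mu n (sh f 1)"
  proof (rule weak_net)
    fix g assume "cmp n g" "\<And>j. g (crn n j) = 0"
    then show "Qf mu n (sh f 1) g = 0" using W[of g "\<lambda>_. 0"] by simp
  qed
  have hn: "hnet 1 b mu n (sh f 0)"
  proof (rule Suc.IH)
    fix g assume "hcmp n g" "b \<longrightarrow> hz n g" "g (crn n 1) = 0"
    then show "Qh b mu n (sh f 0) g = 0" using W[of "\<lambda>_. 0" g] by simp
  qed (use Suc.prems(2) in simp)
  have "Qf mu n (sh f 1) (cf n (\<lambda>j. if j = 0 then 1 else 0)) + Qh b mu n (sh f 0) (cf n (\<lambda>j. if j = 1 then 1 else 0)) = 0"
    using W[of "cf n (\<lambda>j. if j = 0 then 1 else 0)" "cf n (\<lambda>j. if j = 1 then 1 else 0)"] by (simp add: hz_cf)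
  moreover have "Qf mu n (sh f 1) (cf n (\<lambda>j. if j = 0 then 1 else 0)) = flx 1 mu n (sh f 1) 0"
    by (subst green[OF cmp_cf net]) (simp add: sum3)
  moreover have "Qh b mu n (sh f 0) (cf n (\<lambda>j. if j = 1 then 1 else 0)) = hflx 1 b mu n (sh f 0)"
    by (subst hgreen[OF hcmp_cf hn]) (simp_all add: hz_cf)
  ultimately have J: "flx 1 mu n (sh f 1) 0 + hflx 1 b mu n (sh f 0) = 0" by simp
  have "flx 1 mu n (sh f 1) 2 = 0" if "\<not> b"
  proof -
    have "Qf mu n (sh f 1) (cf n (\<lambda>j. if j = 2 then 1 else 0)) = 0"
      using W[of "cf n (\<lambda>j. if j = 2 then 1 else 0)" "\<lambda>_. 0"] that by simp
    then show ?thesis by (subst (asm) green[OF cmp_cf net]) (simp add: sum3)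
  qed
  then show ?case using net hn J Suc.prems(2) by simp
qed

lemma weak_hflx:
  assumes "\<And>g. hcmp n g \<Longrightarrow> Qh False mu n f g = 0"
  shows "hnet 1 False mu n f" "hflx 1 False mu n f = 0"
proof -
  show h: "hnet 1 False mu n f" by (rule weak_hnet) (use assms in auto)
  have "Qh False mu n f (cf n (\<lambda>j. if j = 1 then 1 else 0)) = 0" by (rule assms) simp
  then show "hflx 1 False mu n f = 0" using hgreen[OF hcmp_cf h, of "\<lambda>j. if j = 1 then 1 else 0"] by simp
qed

text \<open>Only \<open>f\<close> is decimated; its midpoint equations remove the midpoint values of
  \<open>g\<close> from the form. This asymmetry lets an arbitrary \<open>u\<close> be paired with a
  spline.\<close>

lemma Qf_dec:
  assumes mu: "mu \<noteq> 2" "mu \<noteq> 5"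
  shows "cmp (Suc n) f \<Longrightarrow> cmp (Suc n) g \<Longrightarrow> dec mu n f \<Longrightarrow> Qf mu (Suc n) f g = k0 mu * Qf (R mu) n (crs f) (crs g)"
proof (induction n arbitrary: f g)
  case 0
  have "net 1 mu (Suc 0) f" using net1_dec[OF mu 0(1)] 0(3) by blast
  then have "Qf mu (Suc 0) f g = (\<Sum>j\<in>UNIV. flx 1 mu (Suc 0) f j * g (crn (Suc 0) j))" by (rule green[OF 0(2)])
  also have "\<dots> = k0 mu * Qf (R mu) 0 (crs f) (crs g)"
    unfolding flx1_dec[OF mu 0(3)] by (simp add: flx_def crn_def crs_def sum3 algebra_simps)
  finally show ?case .
next
  case (Suc n)
  have IH: "Qf mu (Suc n) (sh f i) (sh g i) = k0 mu * Qf (R mu) n (crs (sh f i)) (crs (sh g i))" for i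
    by (rule Suc.IH) (use Suc.prems in simp_all)
  show ?case unfolding Qf.simps(2)[of mu "Suc n"] IH unfolding Qf.simps(2) sh_crs by (simp add: sum_distrib_left)
qed

lemma Qh_dec1:
  assumes mu: "mu \<noteq> 2" "mu \<noteq> 5" and c: "hcmp (Suc 0) f" "hcmp (Suc 0) g"
    and d: "hdec b mu 0 f" "b \<longrightarrow> hz (Suc 0) f \<and> hz (Suc 0) g"
  shows "Qh b mu (Suc 0) f g = k0 mu * Qh b (R mu) 0 (crs f) (crs g)"
proof (cases b)
  case True
  have "hnet 1 b mu (Suc 0) f" unfolding hnet1_dec[OF mu c(1)] using d True by (simp add: crs_def)
  then have "Qh b mu (Suc 0) f g = hflx 1 b mu (Suc 0) f * g (crn (Suc 0) 1)"
    by (rule hgreen[OF c(2)]) (use d in auto)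
  also have "hflx 1 b mu (Suc 0) f = hflx (k0 mu) b (R mu) 0 (crs f)"
    by (rule hflx1_dec[OF mu d(1)]) (use d(2) in simp)
  finally show ?thesis using True by (simp add: crs_def crn_def)
next
  case False
  define u v p x where uvpx: "u = f ([0], 0)" "v = f ([1], 1)" "p = f ([0], 1)" "x = f ([1], 2)"
  define u' v' p' x' where uvpx': "u' = g ([0], 0)" "v' = g ([1], 1)" "p' = g ([0], 1)" "x' = g ([1], 2)"
  have c': "f ([1], 0) = p" "g ([1], 0) = p'" using c by (simp_all add: crn_def uvpx uvpx')
  have n: "2 - mu \<noteq> 0" "5 - mu \<noteq> 0" using mu by auto
  have "(5 - mu) * p = u + v + (p + p + x) \<and> (5 - mu) * p = u + v + (p + p + x) \<and> (5 - mu) * x = v + v + (p + p + x)"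
    unfolding mid_solve[OF mu] using False d(1)
    by (auto simp: hval_def EV_def c' uvpx[symmetric] add.commute)
  then have e: "(3 - mu) * p = u + v + x" "(4 - mu) * x = 2 * p + 2 * v" by (auto simp: algebra_simps)
  have "p = EV mu (hval b u v) 0 1" using d(1) by (simp add: uvpx Let_def)
  then have "p * ((2 - mu) * (5 - mu)) = (2 - mu) * (u + v) + 2 * (u + v + v)"
    using False n by (simp add: EV_def hval_def)
  then have "((1 - mu / 4) * u - p) * ((2 - mu) * (5 - mu)) = (6 - mu) * ((1 - R mu / 4) * u - v)"
    unfolding R_def by (simp add: field_simps)
  then have q0: "(1 - mu / 4) * u - p = k0 mu * ((1 - R mu / 4) * u - v)"
    using n by (simp add: k0_def nonzero_eq_divide_eq)
  have "hflx 1 b mu (Suc 0) f = hflx (k0 mu) b (R mu) 0 (crs f)"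
    by (rule hflx1_dec[OF mu d(1)]) (use False in simp)
  then have q1: "(3 - mu / 2) * v - (p + v + x) = k0 mu * ((1 - R mu / 2) * v - u)"
    using False by (simp add: flx_def T_def c' uvpx[symmetric] crs_def)
  have "Qh b mu (Suc 0) f g = ((3 - mu / 2) * p - (p + v + x)) * p' + ((3 - mu / 2) * v - (p + v + x)) * v'
     + ((3 - mu / 2) * x - (p + v + x)) * x' + (((1 - mu / 4) * u - p) * u' + ((1 - mu / 2) * p - u) * p')"
    using False by (simp add: sum3 T_def c' uvpx[symmetric] uvpx'[symmetric])
  also have "\<dots> = ((3 - mu) * p - (u + v + x)) * p' + ((3 - mu / 2) * v - (p + v + x)) * v'
     + ((4 - mu) * x - (2 * p + 2 * v)) / 2 * x' + ((1 - mu / 4) * u - p) * u'"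
    by (simp add: field_simps)
  also have "\<dots> = k0 mu * ((1 - R mu / 2) * v - u) * v' + k0 mu * ((1 - R mu / 4) * u - v) * u'"
    unfolding e q0 q1 by simp
  also have "\<dots> = k0 mu * Qh b (R mu) 0 (crs f) (crs g)"
    using False by (simp add: crs_def uvpx[symmetric] uvpx'[symmetric] algebra_simps)
  finally show ?thesis .
qed

lemma Qh_dec:
  assumes mu: "mu \<noteq> 2" "mu \<noteq> 5"
  shows "hcmp (Suc n) f \<Longrightarrow> hcmp (Suc n) g \<Longrightarrow> hdec b mu n f \<Longrightarrow> (b \<longrightarrow> hz (Suc n) f \<and> hz (Suc n) g) \<Longrightarrow>
    Qh b mu (Suc n) f g = k0 mu * Qh b (R mu) n (crs f) (crs g)"
proof (induction n arbitrary: f g)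
  case 0
  show ?case by (rule Qh_dec1[OF mu 0])
next
  case (Suc n)
  have IH: "Qh b mu (Suc n) (sh f 0) (sh g 0) = k0 mu * Qh b (R mu) n (crs (sh f 0)) (crs (sh g 0))"
    by (rule Suc.IH) (use Suc.prems in simp_all)
  have G: "Qf mu (Suc n) (sh f 1) (sh g 1) = k0 mu * Qf (R mu) n (crs (sh f 1)) (crs (sh g 1))"
    by (rule Qf_dec[OF mu]) (use Suc.prems in simp_all)
  show ?case unfolding Qh.simps(2)[of b mu "Suc n"] IH G unfolding Qh.simps(2) sh_crs by (simp add: algebra_simps)
qed

text \<open>\<open>hW\<close> is what testing with functions that vanish on \<open>\<partial>\<Omega>\<close> and near \<open>q\<^sub>0\<close> gives: the eigenvalue equation
  at all vertices off \<open>\<partial>\<Omega>\<close> except at the vertex \<open>q\<^sub>1\<close> of the cut cell.\<close>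

primrec hW :: "real \<Rightarrow> nat \<Rightarrow> code \<Rightarrow> bool" where
  "hW mu 0 f \<longleftrightarrow> True"
| "hW mu (Suc n) f \<longleftrightarrow> net 1 mu n (sh f 1) \<and> hW mu n (sh f 0) \<and>
     (n \<noteq> 0 \<longrightarrow> flx 1 mu n (sh f 1) 0 + hflx 1 False mu n (sh f 0) = 0)"

text \<open>The Neumann equations at the points of \<open>X\<close> on level \<open>n\<close>, which
  \<open>hW\<close> leaves out.\<close>

primrec xz :: "real \<Rightarrow> nat \<Rightarrow> code \<Rightarrow> bool" where
  "xz mu 0 f \<longleftrightarrow> True"
| "xz mu (Suc n) f \<longleftrightarrow> flx 1 mu n (sh f 1) 2 = 0 \<and> xz mu n (sh f 0)"

lemma weak_hW:
  "(\<And>g. hcmp n g \<Longrightarrow> hz n g \<Longrightarrow> g (crn n 1) = 0 \<Longrightarrow> g (replicate n 0, 1) = 0 \<Longrightarrow> Qh False mu n f g = 0) \<Longrightarrow> hW mu n f"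
proof (induction n arbitrary: f)
  case (Suc n)
  let ?j = "\<lambda>h1 h0. jn (\<lambda>i. if i = 1 then h1 else if i = 0 then h0 else (\<lambda>_. 0))"
  note W = Suc.prems[of "?j _ _", unfolded jn_half_simps replicate_Suc]
  have net: "net 1 mu n (sh f 1)"
  proof (rule weak_net)
    fix g assume "cmp n g" "\<And>j. g (crn n j) = 0"
    then show "Qf mu n (sh f 1) g = 0" using W[of g "\<lambda>_. 0"] by simp
  qed
  have hn: "hW mu n (sh f 0)"
  proof (rule Suc.IH)
    fix g assume "hcmp n g" "hz n g" "g (crn n 1) = 0" "g (replicate n 0, 1) = 0"
    then show "Qh False mu n (sh f 0) g = 0" using W[of "\<lambda>_. 0" g] by simp
  qed
  \<comment> \<open>For \<open>n = 0\<close> this junction is the corner \<open>q 1\<close> of the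
    cut cell, where tests must vanish; for larger \<open>n\<close> a test at the junction is 0 on
    the cut cell.\<close>
  have "flx 1 mu n (sh f 1) 0 + hflx 1 False mu n (sh f 0) = 0" if nz: "n \<noteq> 0"
  proof -
    obtain m where m: "n = Suc m" using nz by (cases n) auto
    let ?d = "\<lambda>i. cf n (\<lambda>j. if j = i then 1 else 0)"
    have "?d 1 (replicate n 0, 1) = 0" using m by (simp add: cf_def)
    then have "Qf mu n (sh f 1) (?d 0) + Qh False mu n (sh f 0) (?d 1) = 0"
      using W[of "?d 0" "?d 1"] by (simp add: hz_cf)
    moreover have "Qf mu n (sh f 1) (?d 0) = flx 1 mu n (sh f 1) 0"
      by (subst green[OF cmp_cf net]) (simp add: sum3)
    moreover have "Qh False mu n (sh f 0) (?d 1) = hflx 1 False mu n (sh f 0)"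
    proof -
      have nn: "net 1 mu m (sh (sh f 0) 1)" using hn m by simp
      have z: "cf m (\<lambda>j. if j = 0 then if j = 1 then 1 else 0 else 0) = (\<lambda>_. 0)" by (auto simp: cf_def)
      have "Qh False mu n (sh f 0) (?d 1) = Qf mu m (sh (sh f 0) 1) (cf m (\<lambda>j. if j = 1 then if j = 1 then 1 else 0 else 0))"
        unfolding m Qh.simps(2) sh_cf z by simp
      also have "\<dots> = flx 1 mu m (sh (sh f 0) 1) 1"
        by (subst green[OF cmp_cf nn]) (simp add: sum3)
      finally show ?thesis using m by simp
    qed
    ultimately show ?thesis by simp
  qed
  then show ?case using net hn by simp
qed simp

text \<open>What remains are the flux at \<open>q 1\<close> and the defects at the two corners of
  the cut cell; the weak equation gives no control over these.\<close>

lemma hW_green: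
  "hW mu (Suc n) f \<Longrightarrow> xz mu (Suc n) f \<Longrightarrow> hcmp (Suc n) g \<Longrightarrow>
   Qh False mu (Suc n) f g = hflx 1 False mu (Suc n) f * g (crn (Suc n) 1)
     + (T mu (\<lambda>k. f (replicate n 0 @ [1], k)) 0 + (1 - mu / 2) * f (replicate (Suc n) 0, 1) - f (replicate (Suc n) 0, 0))
         * g (replicate (Suc n) 0, 1)
     + ((1 - mu / 4) * f (replicate (Suc n) 0, 0) - f (replicate (Suc n) 0, 1)) * g (replicate (Suc n) 0, 0)"
proof (induction n arbitrary: f g)
  case 0
  have x: "T mu (\<lambda>k. f ([1], k)) 2 = 0" using 0(2) by (simp add: flx_def)
  have g: "g ([1], 0) = g ([0], 1)" using 0(3) by (simp add: crn_def)
  have "Qh False mu (Suc 0) f g = T mu (\<lambda>k. f ([1], k)) 0 * g ([1], 0) + T mu (\<lambda>k. f ([1], k)) 1 * g ([1], 1)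
    + T mu (\<lambda>k. f ([1], k)) 2 * g ([1], 2)
    + (((1 - mu / 4) * f ([0], 0) - f ([0], 1)) * g ([0], 0) + ((1 - mu / 2) * f ([0], 1) - f ([0], 0)) * g ([0], 1))"
    by (simp add: sum3)
  then show ?case unfolding x g by (simp add: flx_def crn_def distrib_right left_diff_distrib)
next
  case (Suc n)
  note IH = Suc.IH[of "sh f 0" "sh g 0"]
  have G: "Qf mu (Suc n) (sh f 1) (sh g 1) = (\<Sum>j\<in>UNIV. flx 1 mu (Suc n) (sh f 1) j * sh g 1 (crn (Suc n) j))"
    by (rule green) (use Suc.prems in simp_all)
  have "hflx 1 False mu (Suc n) (sh f 0) = - flx 1 mu (Suc n) (sh f 1) 0"
    using Suc.prems(1) unfolding hW.simps(2)[of mu "Suc n"] by (simp add: eq_neg_iff_add_eq_0 add.commute)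
  moreover have "sh g 0 (crn (Suc n) 1) = sh g 1 (crn (Suc n) 0)" "flx 1 mu (Suc n) (sh f 1) 2 = 0"
    using Suc.prems by simp_all
  ultimately have A: "Qf mu (Suc n) (sh f 1) (sh g 1) + hflx 1 False mu (Suc n) (sh f 0) * sh g 0 (crn (Suc n) 1)
     = hflx 1 False mu (Suc (Suc n)) f * g (crn (Suc (Suc n)) 1)"
    unfolding G sum3 by (simp add: crn_Suc[of g])
  have H: "hW mu (Suc n) (sh f 0)" "xz mu (Suc n) (sh f 0)" "hcmp (Suc n) (sh g 0)"
    using Suc.prems unfolding hW.simps(2)[of mu "Suc n"] xz.simps(2)[of mu "Suc n"] hcmp.simps(2)[of "Suc n"] by blast+
  show ?case unfolding Qh.simps(2)[of False mu "Suc n"] IH[OF H] A[symmetric] by simp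
qed

section \<open>Geometry of the gasket\<close>

text \<open>Barycentric coordinates. In an equilateral triangle \<open>a \<bullet> b = (a \<bullet> a) / 2\<close>, so the inverse of the Gram
  matrix of the edge vectors \<open>a\<close>, \<open>b\<close> is explicit.\<close>

definition bar :: "(3 \<Rightarrow> real^2) \<Rightarrow> 3 \<Rightarrow> real^2 \<Rightarrow> real" where
  "bar q i x = (let a = q 1 - q 0; b = q 2 - q 0; D = a \<bullet> a;
     s = 2 / (3 * D) * ((x - q 0) \<bullet> (2 *\<^sub>R a - b)); t = 2 / (3 * D) * ((x - q 0) \<bullet> (2 *\<^sub>R b - a))
     in if i = 1 then s else if i = 2 then t else 1 - s - t)"

locale triangle =
  fixes q :: "3 \<Rightarrow> real^2"
  assumes equilat: "equilateral q"
begin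

abbreviation "bc \<equiv> bar q"

lemma edge_products:
  defines "a \<equiv> q 1 - q 0" and "b \<equiv> q 2 - q 0"
  shows "a \<bullet> a > 0" "b \<bullet> b = a \<bullet> a" "a \<bullet> b = (a \<bullet> a) / 2" "b \<bullet> a = (a \<bullet> a) / 2"
proof -
  have "q 0 \<noteq> q 1" "dist (q 0) (q 1) = dist (q 1) (q 2)" "dist (q 1) (q 2) = dist (q 2) (q 0)"
    using equilat by (auto simp: equilateral_def)
  then have a0: "a \<noteq> 0" and n': "norm a = norm (a - b)" "norm (a - b) = norm b"
    by (simp_all add: dist_norm a_def b_def norm_minus_commute)
  have "norm a \<noteq> 0" using a0 by simp
  note n = this n'
  show p: "a \<bullet> a > 0" using a0 by simp
  have "a \<bullet> a = (a - b) \<bullet> (a - b)" "(a - b) \<bullet> (a - b) = b \<bullet> b" using n by (simp_all add: dot_square_norm)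
  then show bb: "b \<bullet> b = a \<bullet> a" and ab: "a \<bullet> b = (a \<bullet> a) / 2"
    by (simp_all add: inner_diff_left inner_diff_right inner_commute)
  then show "b \<bullet> a = (a \<bullet> a) / 2" by (simp add: inner_commute)
qed

lemma bar_sum: "bc 0 x + bc 1 x + bc 2 x = 1"
  by (simp add: bar_def Let_def)

lemma bar_mid: "bc i ((x + y) /\<^sub>R 2) = (bc i x + bc i y) / 2"
proof -
  have "((x + y) /\<^sub>R 2 - q 0) \<bullet> z = ((x - q 0) \<bullet> z + (y - q 0) \<bullet> z) / 2" for z
    by (simp add: inner_add_left inner_diff_left field_simps)
  note e = this
  define u v c where "u = 2 *\<^sub>R (q 1 - q 0) - (q 2 - q 0)" "v = 2 *\<^sub>R (q 2 - q 0) - (q 1 - q 0)"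
    "c = 2 / (3 * ((q 1 - q 0) \<bullet> (q 1 - q 0)))"
  note d = this
  show ?thesis unfolding bar_def Let_def e d[symmetric] by (auto simp: distrib_left field_simps)
qed

lemma bar_q: "bc i (q j) = (if i = j then 1 else 0)"
proof -
  define a where "a = q 1 - q 0"
  define b where "b = q 2 - q 0"
  note e = edge_products[folded a_def b_def]
  have "\<forall>i j. bc i (q j) = (if i = j then 1 else 0)"
    unfolding all3 bar_def Let_def a_def[symmetric] b_def[symmetric]
    using e(1) by (simp add: inner_diff_right e)
  then show ?thesis by blast
qed

lemma bar_F: "bc i (F q j x) = (bc i x + (if i = j then 1 else 0)) / 2"
  unfolding F_def bar_mid bar_q by simp

lemma bar_continuous: "continuous_on S (bc i)"
  unfolding bar_def Let_def by (cases "i = 1"; cases "i = 2") (use edge_products(1) in \<open>auto intro!: continuous_intros\<close>)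

text \<open>As the edge vectors \<open>a\<close> and \<open>b\<close> have the same length,
  comparing the distances means comparing \<open>y \<bullet> a\<close> with
  \<open>y \<bullet> b\<close>.\<close>

lemma dist_less_iff: "dist x (q 1) < dist x (q 2) \<longleftrightarrow> bc 2 x < bc 1 x"
proof -
  define a where "a = q 1 - q 0"
  define b where "b = q 2 - q 0"
  define y where "y = x - q 0"
  note e = edge_products[folded a_def b_def]
  have "dist x (q 1) = norm (y - a)" "dist x (q 2) = norm (y - b)" by (simp_all add: dist_norm y_def a_def b_def)
  then have "dist x (q 1) < dist x (q 2) \<longleftrightarrow> (y - a) \<bullet> (y - a) < (y - b) \<bullet> (y - b)"
    by (simp add: norm_lt)
  also have "\<dots> \<longleftrightarrow> y \<bullet> b < y \<bullet> a" using e by (simp add: inner_diff_left inner_diff_right inner_commute)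
  also have "\<dots> \<longleftrightarrow> bc 2 x < bc 1 x"
  proof -
    have "bc 1 x - bc 2 x = 2 / (a \<bullet> a) * (y \<bullet> a - y \<bullet> b)"
      unfolding bar_def Let_def a_def[symmetric] b_def[symmetric] y_def[symmetric] using e(1)
      by (simp add: inner_diff_right field_simps)
    then have "bc 2 x < bc 1 x \<longleftrightarrow> 0 < 2 / (a \<bullet> a) * (y \<bullet> a - y \<bullet> b)" by linarith
    then show ?thesis using e(1) by (simp add: zero_less_divide_iff zero_less_mult_iff)
  qed
  finally show ?thesis .
qed

subsection \<open>The gasket as the attractor\<close>

lemma dist_F: "dist (F q j x) (F q j y) = dist x y / 2"
proof -
  have "F q j x - F q j y = (x - y) /\<^sub>R 2" by (simp add: F_def scaleR_diff_right scaleR_add_right)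
  then show ?thesis by (simp add: dist_norm)
qed

lemma inj_F: "inj (F q j)"
  by (rule injI) (simp add: F_def)

lemma F_eq_iff [simp]: "F q j x = F q j y \<longleftrightarrow> x = y"
  using inj_F by (auto dest: injD)

lemma continuous_F: "continuous_on S (F q j)"
  unfolding F_def by (auto intro!: continuous_intros)

lemma F_inv [simp]: "F q j (2 *\<^sub>R x - q j) = x" "2 *\<^sub>R F q j x - q j = x"
  by (simp_all add: F_def)

lemma F_q [simp]: "F q j (q j) = q j"
  by (simp add: F_def scaleR_2[symmetric])

lemma F_comm: "F q i (q j) = F q j (q i)"
  by (simp add: F_def add.commute)

definition Vs :: "(real^2) set" where "Vs = (\<Union>n. V q n)"

lemma bounded_Vs: "bounded Vs"
proof -
  define M where "M = norm (q 0) + norm (q 1) + norm (q 2)"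
  have q: "norm (q j) \<le> M" for j
  proof -
    have "\<forall>j. norm (q j) \<le> M" by (simp add: all3 M_def)
    then show ?thesis by blast
  qed
  have "x \<in> V q n \<Longrightarrow> norm x \<le> M" for n x
  proof (induction n arbitrary: x)
    case 0
    then show ?case using q by auto
  next
    case (Suc n)
    then obtain j y where y: "y \<in> V q n" "x = F q j y" by auto
    have "norm (y + q j) \<le> M + M" using Suc.IH[OF y(1)] q[of j] norm_triangle_ineq[of y "q j"] by linarith
    then show ?case by (simp add: y F_def)
  qed
  then show ?thesis unfolding bounded_iff Vs_def by auto
qed

lemma V_0_mem: "q j \<in> V q n"
proof (induction n)
  case (Suc n)
  have "F q j (q j) \<in> F q j ` V q n" using Suc by blast
  then show ?case by auto
qed simp

lemma F_Vs: "(\<Union>j. F q j ` Vs) = Vs"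
proof
  show "(\<Union>j. F q j ` Vs) \<subseteq> Vs"
  proof
    fix x assume "x \<in> (\<Union>j. F q j ` Vs)"
    then obtain j n y where "x = F q j y" "y \<in> V q n" by (auto simp: Vs_def)
    then have "x \<in> V q (Suc n)" by auto
    then show "x \<in> Vs" unfolding Vs_def by blast
  qed
  show "Vs \<subseteq> (\<Union>j. F q j ` Vs)"
  proof
    fix x assume "x \<in> Vs"
    then obtain n where "x \<in> V q n" by (auto simp: Vs_def)
    then show "x \<in> (\<Union>j. F q j ` Vs)"
    proof (cases n)
      case 0
      then obtain j where "x = F q j (q j)" using \<open>x \<in> V q n\<close> by auto
      moreover have "q j \<in> Vs" using V_0_mem[of j 0] unfolding Vs_def by blast
      ultimately show ?thesis by blast
    next
      case (Suc m)
      then show ?thesis using \<open>x \<in> V q n\<close> by (auto simp: Vs_def)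
    qed
  qed
qed

lemma attractor_closure:
  "closure Vs \<noteq> {}" "compact (closure Vs)" "closure Vs = (\<Union>j. F q j ` closure Vs)"
proof -
  have "q 0 \<in> Vs" using V_0_mem[of 0 0] unfolding Vs_def by blast
  then show "closure Vs \<noteq> {}" by auto
  show c: "compact (closure Vs)" using bounded_Vs by (simp add: compact_closure)
  show "closure Vs = (\<Union>j. F q j ` closure Vs)"
  proof
    have "compact (\<Union>j. F q j ` closure Vs)"
      by (intro compact_UN finite compact_continuous_image continuous_F c)
    then have "closed (\<Union>j. F q j ` closure Vs)" by (rule compact_imp_closed)
    moreover have "Vs \<subseteq> (\<Union>j. F q j ` closure Vs)"
      using F_Vs closure_subset[of Vs] by blast
    ultimately show "closure Vs \<subseteq> (\<Union>j. F q j ` closure Vs)" by (simp add: closure_minimal)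
    have "F q j ` closure Vs \<subseteq> closure Vs" for j
      by (rule image_closure_subset[OF continuous_F]) (use F_Vs closure_subset[of Vs] in auto)
    then show "(\<Union>j. F q j ` closure Vs) \<subseteq> closure Vs" by blast
  qed
qed

text \<open>A point of \<open>K\<close> at maximal distance from \<open>K'\<close> is
  \<open>F q j y\<close> for some \<open>y\<close> in \<open>K\<close>, and \<open>F q j\<close> at
  least halves the distance of \<open>y\<close>; so the maximum is 0.\<close>

lemma attractor_subset:
  assumes K: "K \<noteq> {}" "compact K" "K = (\<Union>j. F q j ` K)"
    and K': "K' \<noteq> {}" "compact K'" "K' = (\<Union>j. F q j ` K')"
  shows "K \<subseteq> K'"
proof -
  have "\<exists>x\<in>K. \<forall>y\<in>K. infdist y K' \<le> infdist x K'"
    by (rule continuous_attains_sup[OF K(2,1)]) (intro continuous_intros)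
  then obtain x where x: "x \<in> K" "\<And>y. y \<in> K \<Longrightarrow> infdist y K' \<le> infdist x K'" by blast
  then obtain j y where y: "y \<in> K" "x = F q j y" using K(3) by blast
  obtain z where z: "z \<in> K'" "infdist y K' = dist y z"
    using infdist_attains_inf[of K' y] K' compact_imp_closed by blast
  have "F q j z \<in> K'" using z K'(3) by blast
  then have "infdist x K' \<le> dist x (F q j z)" by (rule infdist_le)
  also have "\<dots> = infdist y K' / 2" using z y by (simp add: dist_F)
  finally have "infdist x K' \<le> infdist x K' / 2" using x(2)[OF y(1)] by linarith
  then have "infdist x K' \<le> 0" by simp
  then have "infdist u K' = 0" if "u \<in> K" for u using x(2)[OF that] infdist_nonneg[of u K'] by linarith
  then show ?thesis using in_closed_iff_infdist_zero[of K'] K' compact_imp_closed by blast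
qed

lemma SG_closure: "SG q = closure Vs"
  unfolding SG_def
proof (rule the_equality)
  show "closure Vs \<noteq> {} \<and> compact (closure Vs) \<and> closure Vs = (\<Union>j. F q j ` closure Vs)"
    using attractor_closure by blast
  fix K assume "K \<noteq> {} \<and> compact K \<and> K = (\<Union>j. F q j ` K)"
  then show "K = closure Vs" using attractor_subset attractor_closure by (metis subset_antisym)
qed

lemma compact_SG: "compact (SG q)" and SG_ne: "SG q \<noteq> {}" and SG_eq: "SG q = (\<Union>j. F q j ` SG q)"
  using attractor_closure by (simp_all add: SG_closure)

lemma F_SG: "x \<in> SG q \<Longrightarrow> F q j x \<in> SG q"
  using SG_eq by blast

lemma SG_cases: "x \<in> SG q \<Longrightarrow> (\<And>j y. y \<in> SG q \<Longrightarrow> x = F q j y \<Longrightarrow> P) \<Longrightarrow> P"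
  using SG_eq by blast

lemma V_SG: "V q n \<subseteq> SG q"
  unfolding SG_closure Vs_def by (rule order_trans[OF _ closure_subset]) blast

lemma q_SG [simp]: "q j \<in> SG q"
  using V_SG[of 0] by auto

lemma SG_induct_closed:
  assumes c: "closed {x. P x}" and q: "\<And>j. P (q j)" and F: "\<And>j x. x \<in> Vs \<Longrightarrow> P x \<Longrightarrow> P (F q j x)" and x: "x \<in> SG q"
  shows "P x"
proof -
  have "x \<in> V q n \<Longrightarrow> P x" for n x
  proof (induction n arbitrary: x)
    case 0
    then show ?case using q by auto
  next
    case (Suc n)
    then show ?case using F by (auto simp: Vs_def)
  qed
  then have "Vs \<subseteq> {x. P x}" by (auto simp: Vs_def)
  then have "closure Vs \<subseteq> {x. P x}" using c by (simp add: closure_minimal)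
  then show ?thesis using x by (auto simp: SG_closure)
qed

lemma bar_nonneg: "x \<in> SG q \<Longrightarrow> bc i x \<ge> 0"
proof (rule SG_induct_closed[where P = "\<lambda>x. bc i x \<ge> 0"])
  show "closed {x. 0 \<le> bc i x}" by (intro closed_Collect_le continuous_intros bar_continuous)
qed (auto simp: bar_q bar_F)

lemma bar_repr: "x \<in> SG q \<Longrightarrow> x = bc 0 x *\<^sub>R q 0 + bc 1 x *\<^sub>R q 1 + bc 2 x *\<^sub>R q 2"
proof (rule SG_induct_closed[where P = "\<lambda>x. x = bc 0 x *\<^sub>R q 0 + bc 1 x *\<^sub>R q 1 + bc 2 x *\<^sub>R q 2"])
  show "closed {x. x = bc 0 x *\<^sub>R q 0 + bc 1 x *\<^sub>R q 1 + bc 2 x *\<^sub>R q 2}"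
    by (intro closed_Collect_eq continuous_intros bar_continuous)
  have "\<forall>j. q j = bc 0 (q j) *\<^sub>R q 0 + bc 1 (q j) *\<^sub>R q 1 + bc 2 (q j) *\<^sub>R q 2" by (simp add: all3 bar_q)
  then show "q j = bc 0 (q j) *\<^sub>R q 0 + bc 1 (q j) *\<^sub>R q 1 + bc 2 (q j) *\<^sub>R q 2" for j by blast
next
  fix j x assume x: "x = bc 0 x *\<^sub>R q 0 + bc 1 x *\<^sub>R q 1 + bc 2 x *\<^sub>R q 2"
  define y where "y = bc 0 x *\<^sub>R q 0 + bc 1 x *\<^sub>R q 1 + bc 2 x *\<^sub>R q 2"
  have "\<forall>j. bc 0 (F q j x) *\<^sub>R q 0 + bc 1 (F q j x) *\<^sub>R q 1 + bc 2 (F q j x) *\<^sub>R q 2 = (1/2) *\<^sub>R (y + q j)"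
    unfolding all3 bar_F y_def by (simp add: scaleR_add_right scaleR_add_left add_divide_distrib)
  moreover have "F q j x = (1/2) *\<^sub>R (y + q j)" for j using x by (simp add: F_def y_def)
  ultimately have "\<forall>j. F q j x = bc 0 (F q j x) *\<^sub>R q 0 + bc 1 (F q j x) *\<^sub>R q 1 + bc 2 (F q j x) *\<^sub>R q 2" by metis
  then show "F q j x = bc 0 (F q j x) *\<^sub>R q 0 + bc 1 (F q j x) *\<^sub>R q 1 + bc 2 (F q j x) *\<^sub>R q 2" by blast
qed

lemma bar_corner: "x \<in> SG q \<Longrightarrow> bc i x = 1 \<Longrightarrow> x = q i"
proof -
  assume x: "x \<in> SG q" "bc i x = 1"
  have n: "bc 0 x \<ge> 0" "bc 1 x \<ge> 0" "bc 2 x \<ge> 0" using bar_nonneg[OF x(1)] by auto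
  have "\<forall>i. bc i x = 1 \<longrightarrow> x = q i"
    unfolding all3 using n bar_sum[of x] bar_repr[OF x(1)] by (auto simp: add_nonneg_eq_0_iff)
  then show ?thesis using x(2) by blast
qed

text \<open>In barycentric coordinates the equation reads \<open>bc i x + 1 = bc i y\<close> and
  \<open>bc j x = bc j y + 1\<close>, while all coordinates lie between 0 and 1.\<close>

lemma F_SG_Int: "i \<noteq> j \<Longrightarrow> x \<in> SG q \<Longrightarrow> y \<in> SG q \<Longrightarrow> F q i x = F q j y \<Longrightarrow> x = q j \<and> y = q i"
proof -
  assume a: "i \<noteq> j" "x \<in> SG q" "y \<in> SG q" "F q i x = F q j y"
  have "bc i x + 1 = bc i y" "bc j x = bc j y + 1"
    using arg_cong[OF a(4), of "bc i"] arg_cong[OF a(4), of "bc j"] a(1) by (simp_all add: bar_F)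
  moreover have "bc i y \<le> 1" "bc j x \<le> 1"
  proof -
    have "\<forall>i. bc i y \<le> 1" "\<forall>i. bc i x \<le> 1" unfolding all3
      using bar_nonneg[OF a(2), of 0] bar_nonneg[OF a(2), of 1] bar_nonneg[OF a(2), of 2] bar_sum[of x]
        bar_nonneg[OF a(3), of 0] bar_nonneg[OF a(3), of 1] bar_nonneg[OF a(3), of 2] bar_sum[of y] by auto
    then show "bc i y \<le> 1" "bc j x \<le> 1" by blast+
  qed
  ultimately have "bc i y = 1" "bc j x = 1" using bar_nonneg[OF a(2), of i] bar_nonneg[OF a(3), of j] by linarith+
  then show ?thesis using bar_corner a by blast
qed

lemma q_inj [simp]: "q i = q j \<longleftrightarrow> i = j"
  using bar_q[of i i] bar_q[of i j] by (auto split: if_splits)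

lemma F_eq_q: "x \<in> SG q \<Longrightarrow> F q i x = q j \<longleftrightarrow> i = j \<and> x = q j"
  using F_SG_Int[of i j x "q j"] by (cases "i = j") (auto simp: F_eq_iff[of j x "q j", simplified])

subsection \<open>The self-similar measure\<close>

abbreviation "P3 \<equiv> measure_pmf (pmf_of_set (UNIV :: 3 set))"
abbreviation "S3 \<equiv> stream_space P3"

text \<open>The point with infinite address \<open>\<omega>\<close>. The measure is constructed as
  the image of the uniform Bernoulli measure on addresses, so that existence comes with
  self-similarity.\<close>

definition code_pt :: "3 stream \<Rightarrow> real^2" where
  "code_pt \<omega> = (\<Sum>n. (1/2) ^ Suc n *\<^sub>R q (\<omega> !! n))"

lemma norm_q_bound: "\<exists>M. \<forall>j. norm (q j) \<le> M"
  by (rule exI[of _ "norm (q 0) + norm (q 1) + norm (q 2)"]) (simp add: all3)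

lemma code_pt_summable: "summable (\<lambda>n. norm ((1/2) ^ Suc n *\<^sub>R q (\<omega> !! n)))"
proof -
  obtain M where M: "\<And>j. norm (q j) \<le> M" using norm_q_bound by auto
  have s: "summable (\<lambda>n. (1/2 :: real) ^ n * (M / 2))" by (intro summable_mult2 summable_geometric) simp
  show ?thesis
  proof (rule summable_comparison_test'[OF s, of 0])
    fix n
    have "(1/2) ^ n * norm (q (\<omega> !! n)) \<le> (1/2) ^ n * M" using M by (intro mult_left_mono) auto
    then show "norm (norm ((1/2) ^ Suc n *\<^sub>R q (\<omega> !! n))) \<le> (1/2) ^ n * (M / 2)" by simp
  qed
qed

lemma code_pt_SCons: "code_pt (x ## \<omega>) = F q x (code_pt \<omega>)"
proof -
  have s: "summable (\<lambda>n. (1/2) ^ Suc n *\<^sub>R q (\<omega>' !! n))" for \<omega>' :: "3 stream"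
    by (rule summable_norm_cancel[OF code_pt_summable])
  have "code_pt (x ## \<omega>) = (\<Sum>n. (1/2) ^ Suc (Suc n) *\<^sub>R q ((x ## \<omega>) !! Suc n)) + (1/2) ^ Suc 0 *\<^sub>R q ((x ## \<omega>) !! 0)"
    unfolding code_pt_def using suminf_split_head[OF s[of "x ## \<omega>"]] by simp
  also have "(\<Sum>n. (1/2) ^ Suc (Suc n) *\<^sub>R q ((x ## \<omega>) !! Suc n)) = (\<Sum>n. (1/2) *\<^sub>R ((1/2) ^ Suc n *\<^sub>R q (\<omega> !! n)))"
    by simp
  also have "\<dots> = (1/2) *\<^sub>R code_pt \<omega>" unfolding code_pt_def by (rule suminf_scaleR_right[OF s, symmetric])
  finally show ?thesis by (simp add: F_def scaleR_add_right)
qed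

lemma code_pt_measurable [measurable]: "code_pt \<in> borel_measurable S3"
proof (rule borel_measurable_LIMSEQ_metric)
  show "(\<lambda>N. \<Sum>n<N. (1/2) ^ Suc n *\<^sub>R q (\<omega> !! n)) \<longlonglongrightarrow> code_pt \<omega>" for \<omega>
    unfolding code_pt_def by (rule summable_LIMSEQ[OF summable_norm_cancel[OF code_pt_summable]])
  have [measurable]: "(\<lambda>\<omega>. q (\<omega> !! n)) \<in> borel_measurable S3" for n
    by (rule measurable_compose[OF measurable_snth]) simp
  show "(\<lambda>\<omega>. \<Sum>n<N. (1/2) ^ Suc n *\<^sub>R q (\<omega> !! n)) \<in> borel_measurable S3" for N
    by measurable
qed

text \<open>Each letter put in front of an address halves the bound on the distance to the gasket,
  and all points \<open>code_pt \<omega>\<close> lie in a fixed ball.\<close>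

lemma code_pt_SG: "code_pt \<omega> \<in> SG q"
proof -
  obtain M where M: "\<And>j. norm (q j) \<le> M" using norm_q_bound by auto
  have b: "norm (code_pt \<omega>) \<le> M" for \<omega>
  proof -
    have s: "summable (\<lambda>n. (1/2 :: real) ^ n * (M / 2))" by (intro summable_mult2 summable_geometric) simp
    have "norm (code_pt \<omega>) \<le> (\<Sum>n. norm ((1/2) ^ Suc n *\<^sub>R q (\<omega> !! n)))"
      unfolding code_pt_def by (rule summable_norm[OF code_pt_summable])
    also have "\<dots> \<le> (\<Sum>n. (1/2 :: real) ^ n * (M / 2))"
    proof (rule suminf_le[OF _ code_pt_summable s])
      fix n
      have "(1/2) ^ n * norm (q (\<omega> !! n)) \<le> (1/2) ^ n * M" using M by (intro mult_left_mono) auto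
      then show "norm ((1/2) ^ Suc n *\<^sub>R q (\<omega> !! n)) \<le> (1/2) ^ n * (M / 2)" by simp
    qed
    also have "\<dots> = M"
      by (subst suminf_mult2[symmetric]) (auto simp: suminf_geometric)
    finally show ?thesis .
  qed
  have "infdist (code_pt \<omega>) (SG q) \<le> 2 * M * (1/2) ^ n" for n \<omega>
  proof (induction n arbitrary: \<omega>)
    case 0
    have "infdist (code_pt \<omega>) (SG q) \<le> dist (code_pt \<omega>) (q 0)" by (rule infdist_le) simp
    also have "\<dots> \<le> norm (code_pt \<omega>) + norm (q 0)" by (simp add: dist_norm norm_triangle_ineq4)
    also have "\<dots> \<le> M + M" using b[of \<omega>] M[of 0] by (rule add_mono)
    finally show ?case by simp
  next
    case (Suc n)
    let ?y = "code_pt (stl \<omega>)"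
    obtain z where z: "z \<in> SG q" "infdist ?y (SG q) = dist ?y z"
      using infdist_attains_inf[of "SG q" ?y] compact_SG SG_ne compact_imp_closed by blast
    have "code_pt \<omega> = F q (shd \<omega>) ?y" using code_pt_SCons[of "shd \<omega>" "stl \<omega>"] by simp
    moreover have "infdist (F q (shd \<omega>) ?y) (SG q) \<le> dist (F q (shd \<omega>) ?y) (F q (shd \<omega>) z)"
      by (rule infdist_le[OF F_SG[OF z(1)]])
    ultimately show ?case using Suc[of "stl \<omega>"] z by (simp add: dist_F)
  qed
  moreover have "(\<lambda>n. 2 * M * (1/2) ^ n) \<longlonglongrightarrow> 2 * M * 0"
    by (intro tendsto_intros LIMSEQ_realpow_zero) auto
  ultimately have "infdist (code_pt \<omega>) (SG q) \<le> 0"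
    by (intro LIMSEQ_le_const[of "\<lambda>n. 2 * M * (1/2) ^ n"]) auto
  then show ?thesis
    using in_closed_iff_infdist_zero[of "SG q" "code_pt \<omega>"] compact_SG SG_ne compact_imp_closed infdist_nonneg[of "code_pt \<omega>" "SG q"]
    by (metis order_antisym)
qed

definition address_measure :: "(real^2) measure" where "address_measure = distr S3 borel code_pt"

lemma prob_address_measure: "prob_space address_measure"
  unfolding address_measure_def
  by (intro prob_space.prob_space_distr prob_space.prob_space_stream_space measure_pmf.prob_space_axioms) measurable

lemma sets_address_measure [simp, measurable_cong]: "sets address_measure = sets borel" and space_address_measure [simp]: "space address_measure = UNIV"
  by (simp_all add: address_measure_def)

lemma nn_integral_address_measure:
  assumes [measurable]: "h \<in> borel_measurable borel"
  shows "(\<integral>\<^sup>+x. h x \<partial>address_measure) = (\<Sum>j\<in>UNIV. \<integral>\<^sup>+x. h (F q j x) \<partial>address_measure) / 3"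
proof -
  have F [measurable]: "F q j \<in> borel_measurable borel" for j
    by (rule borel_measurable_continuous_onI[OF continuous_F])
  have "(\<integral>\<^sup>+x. h x \<partial>address_measure) = (\<integral>\<^sup>+\<omega>. h (code_pt \<omega>) \<partial>S3)"
    unfolding address_measure_def by (rule nn_integral_distr) measurable
  also have "\<dots> = (\<integral>\<^sup>+j. (\<integral>\<^sup>+\<omega>. h (code_pt (j ## \<omega>)) \<partial>S3) \<partial>P3)"
    by (rule prob_space.nn_integral_stream_space[OF measure_pmf.prob_space_axioms]) measurable
  also have "\<dots> = (\<integral>\<^sup>+j. (\<integral>\<^sup>+x. h (F q j x) \<partial>address_measure) \<partial>P3)"
    unfolding code_pt_SCons address_measure_def by (intro nn_integral_cong nn_integral_distr[symmetric]) measurable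
  also have "\<dots> = (\<Sum>j\<in>UNIV. \<integral>\<^sup>+x. h (F q j x) \<partial>address_measure) / 3"
    by (subst nn_integral_pmf_of_set) auto
  finally show ?thesis .
qed

lemma address_measure_bounded_integrable:
  assumes [measurable]: "h \<in> borel_measurable borel" and b: "\<And>x. \<bar>h x\<bar> \<le> (B :: real)"
  shows "integrable address_measure h"
proof -
  interpret prob_space address_measure by (rule prob_address_measure)
  show ?thesis by (rule integrable_const_bound[of h B]) (use b in auto)
qed

lemma integral_address_measure:
  assumes h [measurable]: "h \<in> borel_measurable borel" and b: "\<And>x. \<bar>h x\<bar> \<le> (B :: real)"
  shows "(LINT x|address_measure. h x) = (\<Sum>j\<in>UNIV. LINT x|address_measure. h (F q j x)) / 3"
proof -
  interpret prob_space address_measure by (rule prob_address_measure)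
  have F [measurable]: "F q j \<in> borel_measurable borel" for j
    by (rule borel_measurable_continuous_onI[OF continuous_F])
  have i: "integrable address_measure h" by (rule address_measure_bounded_integrable[OF h b])
  have iF: "integrable address_measure (\<lambda>x. h (F q j x))" for j by (rule address_measure_bounded_integrable[OF _ b]) measurable
  \<comment> \<open>The shift by \<open>B\<close> makes the nonnegative integral applicable.\<close>
  have nn: "0 \<le> h x + B" for x using b[of x] by linarith
  have "ennreal (LINT x|address_measure. h x + B) = (\<integral>\<^sup>+x. ennreal (h x + B) \<partial>address_measure)"
    by (rule nn_integral_eq_integral[symmetric]) (use i nn in auto)
  also have "\<dots> = (\<Sum>j\<in>UNIV. \<integral>\<^sup>+x. ennreal (h (F q j x) + B) \<partial>address_measure) / 3"
    by (rule nn_integral_address_measure) measurable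
  also have "\<dots> = (\<Sum>j\<in>UNIV. ennreal (LINT x|address_measure. h (F q j x) + B)) / 3"
    by (intro arg_cong2[of _ _ _ _ "(/)"] sum.cong refl nn_integral_eq_integral) (use iF nn in auto)
  also have "\<dots> = ennreal ((\<Sum>j\<in>UNIV. LINT x|address_measure. h (F q j x) + B) / 3)"
  proof -
    have p: "0 \<le> (LINT x|address_measure. h (F q j x) + B)" for j by (intro integral_nonneg_AE) (simp add: nn)
    then have "(\<Sum>j\<in>UNIV. ennreal (LINT x|address_measure. h (F q j x) + B)) = ennreal (\<Sum>j\<in>UNIV. LINT x|address_measure. h (F q j x) + B)"
      by (intro sum_ennreal)
    moreover have "0 \<le> (\<Sum>j\<in>UNIV. LINT x|address_measure. h (F q j x) + B)" by (intro sum_nonneg p)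
    ultimately show ?thesis using divide_ennreal[of "\<Sum>j\<in>UNIV. LINT x|address_measure. h (F q j x) + B" 3] by simp
  qed
  finally have "(LINT x|address_measure. h x + B) = (\<Sum>j\<in>UNIV. LINT x|address_measure. h (F q j x) + B) / 3"
    by (subst (asm) ennreal_inj) (auto intro!: integral_nonneg_AE sum_nonneg divide_nonneg_nonneg simp: nn)
  then show ?thesis using i iF by (simp add: sum3 prob_space)
qed

lemma measure_address_measure:
  assumes [measurable]: "A \<in> sets borel"
  shows "measure address_measure A = (\<Sum>j\<in>UNIV. measure address_measure (F q j -` A)) / 3"
proof -
  have F [measurable]: "F q j \<in> borel_measurable borel" for j
    by (rule borel_measurable_continuous_onI[OF continuous_F])
  have m: "F q j -` A \<in> sets borel" for j using measurable_sets[OF F, of A j] by simp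
  have eqj: "(LINT x|address_measure. indicator A (F q j x)) = measure address_measure (F q j -` A)" for j
  proof -
    have "(\<lambda>x. indicator A (F q j x) :: real) = indicator (F q j -` A)" by (auto simp: indicator_def)
    then show ?thesis using m by simp
  qed
  have "measure address_measure A = (LINT x|address_measure. indicator A x)" by simp
  also have "\<dots> = (\<Sum>j\<in>UNIV. LINT x|address_measure. indicator A (F q j x)) / 3"
    by (rule integral_address_measure[where B = 1]) (auto simp: indicator_def)
  also have "\<dots> = (\<Sum>j\<in>UNIV. measure address_measure (F q j -` A)) / 3" unfolding eqj ..
  finally show ?thesis .
qed

lemma SG_borel [measurable]: "SG q \<in> sets borel"
  using compact_SG by (simp add: borel_compact)

lemma address_measure_SG: "measure address_measure (SG q) = 1"
proof -
  have "code_pt -` SG q \<inter> space S3 = space S3" using code_pt_SG by auto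
  then show ?thesis unfolding address_measure_def using prob_space.prob_space[OF prob_space.prob_space_stream_space[OF measure_pmf.prob_space_axioms]]
    by (subst measure_distr) auto
qed

lemma address_measure_AE_SG: "AE x in address_measure. x \<in> SG q"
proof -
  interpret prob_space address_measure by (rule prob_address_measure)
  show ?thesis using address_measure_SG prob_Collect_eq_1[of "\<lambda>x. x \<in> SG q"] by (simp add: Collect_mem_eq)
qed

lemma address_measure_out: "x \<notin> SG q \<Longrightarrow> measure address_measure {x} = 0"
proof -
  assume x: "x \<notin> SG q"
  interpret prob_space address_measure by (rule prob_address_measure)
  have "measure address_measure {x} \<le> measure address_measure (UNIV - SG q)" using x by (intro finite_measure_mono) auto
  also have "\<dots> = 0" using prob_compl[of "SG q"] address_measure_SG by simp
  finally show ?thesis using measure_nonneg[of address_measure "{x}"] by linarith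
qed

lemma F_vimage: "F q j -` {x} = {2 *\<^sub>R x - q j}"
  using F_inv by (auto simp: F_def)

text \<open>Only one of the three preimages of a corner lies in the gasket, namely the corner
  itself, so its mass \<open>m\<close> satisfies \<open>m = m / 3\<close>.\<close>

lemma address_measure_q: "measure address_measure {q i} = 0"
proof -
  have "measure address_measure {2 *\<^sub>R q i - q j} = 0" if "j \<noteq> i" for j
  proof (rule address_measure_out)
    show "2 *\<^sub>R q i - q j \<notin> SG q" using F_eq_q[of "2 *\<^sub>R q i - q j" j i] that by auto
  qed
  then have "(\<Sum>j\<in>UNIV. measure address_measure {2 *\<^sub>R q i - q j}) = (\<Sum>j\<in>UNIV. if j = i then measure address_measure {q i} else 0)"
    by (intro sum.cong refl) (auto simp: scaleR_2)
  then have "measure address_measure {q i} = measure address_measure {q i} / 3"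
    using measure_address_measure[of "{q i}"] by (simp add: F_vimage)
  then show ?thesis by simp
qed

text \<open>At most one of the three preimages has positive mass, since two of them in the gasket
  would be corners; so each step divides the bound by 3.\<close>

lemma address_measure_point: "measure address_measure {x} = 0"
proof -
  interpret prob_space address_measure by (rule prob_address_measure)
  have "measure address_measure {x} \<le> (1/3) ^ n" for n x
  proof (induction n arbitrary: x)
    case (Suc n)
    let ?m = "\<lambda>j. measure address_measure {2 *\<^sub>R x - q j}"
    have two: "?m j = 0 \<or> ?m k = 0" if "j \<noteq> k" for j k
    proof (rule ccontr)
      assume "\<not> (?m j = 0 \<or> ?m k = 0)"
      then have "2 *\<^sub>R x - q j \<in> SG q" "2 *\<^sub>R x - q k \<in> SG q" "2 *\<^sub>R x - q j \<noteq> q k" using address_measure_out address_measure_q by metis+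
      then show False using F_SG_Int[OF that, of "2 *\<^sub>R x - q j" "2 *\<^sub>R x - q k"] by simp
    qed
    have "?m 0 = 0 \<or> ?m 1 = 0" "?m 0 = 0 \<or> ?m 2 = 0" "?m 1 = 0 \<or> ?m 2 = 0" by (rule two, simp)+
    moreover have "?m 0 \<le> (1/3) ^ n" "?m 1 \<le> (1/3) ^ n" "?m 2 \<le> (1/3) ^ n" using Suc by auto
    ultimately have "?m 0 + ?m 1 + ?m 2 \<le> (1/3) ^ n" by auto
    then show ?case using measure_address_measure[of "{x}"] by (simp add: F_vimage sum3)
  qed simp
  moreover have "(\<lambda>n. (1/3 :: real) ^ n) \<longlonglongrightarrow> 0" by (rule LIMSEQ_realpow_zero) auto
  ultimately have "measure address_measure {x} \<le> 0" by (intro LIMSEQ_le_const[of "\<lambda>n. (1/3 :: real) ^ n"]) auto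
  then show ?thesis using measure_nonneg[of address_measure "{x}"] by linarith
qed

lemma foldr_F_SG: "x \<in> SG q \<Longrightarrow> foldr (F q) w x \<in> SG q"
  by (induction w) (auto intro: F_SG)

lemma continuous_foldr_F: "continuous_on S (foldr (F q) w)"
proof (induction w arbitrary: S)
  case (Cons j w)
  show ?case unfolding foldr.simps by (rule continuous_on_compose[OF Cons continuous_F])
qed (simp add: continuous_on_id)

lemma cell_compact: "compact (cell q w)" and cell_SG: "cell q w \<subseteq> SG q"
  unfolding cell_def using foldr_F_SG by (auto intro: compact_continuous_image continuous_foldr_F compact_SG)

lemma cell_borel [measurable]: "cell q w \<in> sets borel"
  using cell_compact by (simp add: borel_compact)

lemma cell_Cons: "cell q (j # w) = F q j ` cell q w"
  by (auto simp: cell_def)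

lemma cell_Nil [simp]: "cell q [] = SG q"
  by (simp add: cell_def)

text \<open>Preimages of the cell under the maps other than \<open>F q j\<close> lie, up to a null
  set, in the single point \<open>q j\<close>.\<close>

lemma address_measure_cell: "measure address_measure (cell q w) = (1/3) ^ length w"
proof (induction w)
  case Nil
  show ?case by (simp add: address_measure_SG)
next
  case (Cons j w)
  interpret prob_space address_measure by (rule prob_address_measure)
  have z: "measure address_measure (F q i -` (F q j ` cell q w)) = 0" if "i \<noteq> j" for i
  proof -
    have F [measurable]: "F q i \<in> borel_measurable borel"
      by (rule borel_measurable_continuous_onI[OF continuous_F])
    have m: "F q i -` (F q j ` cell q w) \<in> sets borel"
      using measurable_sets[OF F cell_borel[of "j # w"]] by (simp add: cell_Cons)
    have "x = q j" if x: "x \<in> F q i -` (F q j ` cell q w)" "x \<in> SG q" for x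
    proof -
      obtain y where "y \<in> cell q w" "F q i x = F q j y" using x(1) by auto
      then show ?thesis using F_SG_Int[OF \<open>i \<noteq> j\<close> x(2), of y] cell_SG[of w] by blast
    qed
    then have "F q i -` (F q j ` cell q w) \<subseteq> {q j} \<union> (UNIV - SG q)" by blast
    then have "measure address_measure (F q i -` (F q j ` cell q w)) \<le> measure address_measure ({q j} \<union> (UNIV - SG q))"
      by (intro finite_measure_mono) auto
    also have "\<dots> \<le> measure address_measure {q j} + measure address_measure (UNIV - SG q)" by (rule measure_Un_le) auto
    also have "\<dots> = 0" using prob_compl[of "SG q"] address_measure_SG address_measure_point by simp
    finally show ?thesis using measure_nonneg[of address_measure "F q i -` (F q j ` cell q w)"] by linarith
  qed
  have "F q j -` (F q j ` cell q w) = cell q w" by (rule inj_vimage_image_eq[OF inj_F])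
  then have "(\<Sum>i\<in>UNIV. measure address_measure (F q i -` (F q j ` cell q w))) = (\<Sum>i\<in>UNIV. if i = j then measure address_measure (cell q w) else 0)"
    using z by (intro sum.cong refl) auto
  then have "(\<Sum>i\<in>UNIV. measure address_measure (F q i -` (F q j ` cell q w))) = (1/3) ^ length w" using Cons by simp
  then show ?case using measure_address_measure[OF cell_borel[of "j # w"]] by (simp add: cell_Cons)
qed

definition cell_prop :: "(real^2) measure \<Rightarrow> bool" where
  "cell_prop M \<longleftrightarrow> prob_space M \<and> sets M = sets borel \<and> (\<forall>w. measure M (cell q w) = (1/3) ^ length w)"

lemma SG_cells: "x \<in> SG q \<Longrightarrow> \<exists>w. length w = n \<and> x \<in> cell q w"
proof (induction n arbitrary: x)
  case (Suc n)
  obtain j y where y: "y \<in> SG q" "x = F q j y" using SG_cases[OF Suc.prems] by metis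
  obtain w where "length w = n" "y \<in> cell q w" using Suc.IH[OF y(1)] by blast
  then have "length (j # w) = Suc n \<and> x \<in> cell q (j # w)" using y by (auto simp: cell_Cons)
  then show ?case by blast
qed simp

lemma foldr_F_dist: "dist (foldr (F q) w x) (foldr (F q) w y) = dist x y / 2 ^ length w"
  by (induction w) (simp_all add: dist_F)

lemma cell_diam: "x \<in> cell q w \<Longrightarrow> y \<in> cell q w \<Longrightarrow> dist x y \<le> diameter (SG q) / 2 ^ length w"
  by (auto simp: cell_def foldr_F_dist intro!: divide_right_mono diameter_bounded_bound compact_imp_bounded[OF compact_SG])

lemma finite_words: "finite {w :: 3 list. length w = n}"
  using finite_lists_length_eq[of "UNIV :: 3 set" n] by simp

lemma card_words: "card {w :: 3 list. length w = n} = 3 ^ n"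
  using card_lists_length_eq[of "UNIV :: 3 set" n] by simp

text \<open>Both measures are compared with the number of cells that meet a closed set.\<close>

lemma cell_prop_closed_le:
  assumes M: "cell_prop M" and M': "cell_prop M'" and C: "closed C" "C \<noteq> {}"
  shows "measure M C \<le> measure M' C"
proof -
  interpret M: prob_space M using M by (simp add: cell_prop_def)
  interpret M': prob_space M' using M' by (simp add: cell_prop_def)
  have s [simp]: "sets M = sets borel" "sets M' = sets borel" using M M' by (simp_all add: cell_prop_def)
  then have sp [simp]: "space M = UNIV" "space M' = UNIV"
    using sets_eq_imp_space_eq[OF s(1)] sets_eq_imp_space_eq[OF s(2)] by simp_all
  have c: "measure M (cell q w) = (1/3) ^ length w" "measure M' (cell q w) = (1/3) ^ length w" for w
    using M M' by (simp_all add: cell_prop_def)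
  have Z: "measure M (UNIV - SG q) = 0" "measure M' (UNIV - SG q) = 0"
    using M.prob_compl[of "SG q"] M'.prob_compl[of "SG q"] c[of "[]"] by simp_all
  define D where "D = diameter (SG q)"
  define A where "A n = {x. infdist x C \<le> D / 2 ^ n}" for n :: nat
  have closedA: "closed (A n)" for n
    unfolding A_def by (intro closed_Collect_le continuous_intros)
  have key: "measure M C \<le> measure M' (A n)" for n
  proof -
    define W where "W = {w :: 3 list. length w = n}"
    define H where "H = {w \<in> W. cell q w \<inter> C \<noteq> {}}"
    have fin: "finite W" "finite H" using finite_words[of n] by (simp_all add: W_def H_def)
    have U: "(\<Union>w\<in>H. cell q w) \<subseteq> A n"
    proof
      fix x assume "x \<in> (\<Union>w\<in>H. cell q w)"
      then obtain w y where w: "length w = n" "x \<in> cell q w" "y \<in> cell q w" "y \<in> C" by (auto simp: H_def W_def)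
      then have "infdist x C \<le> dist x y" by (intro infdist_le)
      also have "\<dots> \<le> D / 2 ^ n" using cell_diam[OF w(2,3)] w(1) by (simp add: D_def)
      finally show "x \<in> A n" by (simp add: A_def)
    qed
    have "C \<subseteq> (\<Union>w\<in>H. cell q w) \<union> (UNIV - SG q)"
      using SG_cells[of _ n] by (fastforce simp: H_def W_def)
    then have "measure M C \<le> measure M ((\<Union>w\<in>H. cell q w) \<union> (UNIV - SG q))"
      using fin by (intro M.finite_measure_mono) auto
    also have "\<dots> \<le> measure M (\<Union>w\<in>H. cell q w) + measure M (UNIV - SG q)"
      using fin by (intro measure_Un_le) auto
    also have "\<dots> \<le> (\<Sum>w\<in>H. measure M (cell q w))" unfolding Z
      using fin by (simp add: measure_UNION_le)
    also have "\<dots> = card H * (1/3) ^ n" unfolding c by (simp add: H_def W_def)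
    finally have 1: "measure M C \<le> card H * (1/3) ^ n" .
    \<comment> \<open>Cells outside \<open>H\<close> miss \<open>C\<close>; the cells in
      \<open>H\<close> lie in \<open>A n\<close>.\<close>
    have "SG q \<subseteq> A n \<union> (\<Union>w\<in>W - H. cell q w)"
      using SG_cells[of _ n] U by (fastforce simp: W_def)
    then have "measure M' (SG q) \<le> measure M' (A n \<union> (\<Union>w\<in>W - H. cell q w))"
      using fin closedA[of n] by (intro M'.finite_measure_mono) (auto intro!: sets.Un sets.finite_UN)
    also have "\<dots> \<le> measure M' (A n) + measure M' (\<Union>w\<in>W - H. cell q w)"
      using fin closedA[of n] by (intro measure_Un_le) (auto intro!: sets.finite_UN)
    also have "measure M' (\<Union>w\<in>W - H. cell q w) \<le> (\<Sum>w\<in>W - H. measure M' (cell q w))"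
      using fin by (intro measure_UNION_le) auto
    also have "(\<Sum>w\<in>W - H. measure M' (cell q w)) = card (W - H) * (1/3) ^ n" unfolding c by (simp add: W_def)
    also have "real (card (W - H)) = 3 ^ n - real (card H)"
    proof -
      have "card (W - H) = card W - card H" using fin by (intro card_Diff_subset) (auto simp: H_def)
      moreover have "card H \<le> card W" using fin by (intro card_mono) (auto simp: H_def)
      ultimately show ?thesis using card_words[of n] by (simp add: W_def of_nat_diff)
    qed
    finally have "1 \<le> measure M' (A n) + (3 ^ n - real (card H)) * (1/3) ^ n" using c(2)[of "[]"] by simp
    then have "card H * (1/3) ^ n \<le> measure M' (A n)"
      by (simp add: left_diff_distrib power_mult_distrib[symmetric])
    then show ?thesis using 1 by linarith
  qed
  have "decseq A"
  proof (rule decseq_SucI)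
    fix n
    have "D / 2 ^ Suc n \<le> D / 2 ^ n" using diameter_ge_0[OF compact_imp_bounded[OF compact_SG]]
      by (intro divide_left_mono) (auto simp: D_def)
    then show "A (Suc n) \<subseteq> A n" by (auto simp: A_def)
  qed
  then have lim: "(\<lambda>n. measure M' (A n)) \<longlonglongrightarrow> measure M' (\<Inter>n. A n)"
    using closedA by (intro M'.finite_Lim_measure_decseq) auto
  have "(\<Inter>n. A n) \<subseteq> C"
  proof
    fix x assume x: "x \<in> (\<Inter>n. A n)"
    have "(\<lambda>n. D / 2 ^ n) \<longlonglongrightarrow> 0" by (rule LIMSEQ_divide_realpow_zero) simp
    then have "infdist x C \<le> 0" using x by (intro LIMSEQ_le_const[of "\<lambda>n. D / 2 ^ n"]) (auto simp: A_def)
    then show "x \<in> C" using in_closed_iff_infdist_zero[OF C] infdist_nonneg[of x C] by (metis order_antisym)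
  qed
  then have "measure M' (\<Inter>n. A n) \<le> measure M' C" using C by (intro M'.finite_measure_mono) auto
  moreover have "measure M C \<le> measure M' (\<Inter>n. A n)" using LIMSEQ_le_const[OF lim] key by blast
  ultimately show ?thesis by linarith
qed

text \<open>Closed sets form an intersection-stable generator of the Borel sets, and on them the
  comparison holds both ways.\<close>

lemma cell_prop_unique: "cell_prop M \<Longrightarrow> cell_prop M' \<Longrightarrow> M = M'"
proof -
  assume M: "cell_prop M" and M': "cell_prop M'"
  interpret M: prob_space M using M by (simp add: cell_prop_def)
  interpret M': prob_space M' using M' by (simp add: cell_prop_def)
  have s: "sets M = sets borel" "sets M' = sets borel" using M M' by (simp_all add: cell_prop_def)
  have "measure M C = measure M' C" if "closed C" for C
    using cell_prop_closed_le[OF M M' that] cell_prop_closed_le[OF M' M that] by (cases "C = {}") auto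
  then have e: "emeasure M C = emeasure M' C" if "closed C" for C
    using that by (simp add: M.emeasure_eq_measure M'.emeasure_eq_measure)
  show "M = M'"
  proof (rule measure_eqI_generator_eq[where E = "Collect closed" and \<Omega> = UNIV and A = "\<lambda>_. UNIV"])
    show "Int_stable (Collect closed)" by (auto simp: Int_stable_def)
    show "sets M = sigma_sets UNIV (Collect closed)" "sets M' = sigma_sets UNIV (Collect closed)"
      using s by (simp_all add: borel_eq_closed)
  qed (use e in auto)
qed

lemma SG_measure_eq: "SG_measure q = address_measure"
proof -
  have address_measure: "cell_prop address_measure" using prob_address_measure address_measure_cell by (simp add: cell_prop_def)
  show ?thesis unfolding SG_measure_def
  proof (rule the_equality)
    show "prob_space address_measure \<and> sets address_measure = sets borel \<and> (\<forall>w. measure address_measure (cell q w) = (1/3) ^ length w)"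
      using address_measure unfolding cell_prop_def .
    fix M assume "prob_space M \<and> sets M = sets borel \<and> (\<forall>w. measure M (cell q w) = (1/3) ^ length w)"
    then show "M = address_measure" using cell_prop_unique[OF _ address_measure] unfolding cell_prop_def by blast
  qed
qed

end

lemma avg3_dev:
  fixes a b c :: real
  assumes "\<bar>a - a'\<bar> \<le> e1" "\<bar>b - b'\<bar> \<le> e2" "\<bar>c - c'\<bar> \<le> e3"
  shows "\<bar>(a + b + c) / 3 - (1/3) * (a' + b' + c')\<bar> \<le> (e1 + e2 + e3) / 3"
proof -
  have e: "(a + b + c) / 3 - (1/3) * (a' + b' + c') = ((a - a') + (b - b') + (c - c')) / 3"
    by (simp add: field_simps)
  have "\<bar>(a - a') + (b - b') + (c - c')\<bar> \<le> e1 + e2 + e3" using assms by arith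
  then show ?thesis unfolding e by simp
qed

context triangle
begin

subsection \<open>The half gasket\<close>

abbreviation "K \<equiv> cl_Omega q"

text \<open>The point is that an axis point of the gasket other than \<open>q 0\<close> belongs to
  \<open>X\<close>, so that weakening the strict inequality of \<open>Omega\<close> adds nothing
  beyond \<open>bd_Omega\<close>.\<close>

lemma cl_Omega_bar: "x \<in> K \<longleftrightarrow> x \<in> SG q \<and> bc 2 x \<le> bc 1 x"
proof
  have X: "y \<in> SG q \<and> bc 2 y = bc 1 y" if y: "y \<in> X q" for y
  proof -
    obtain m where m: "y = (F q 0 ^^ m) (F q 2 (q 1))" using y by (auto simp: X_def)
    have "(F q 0 ^^ m) (F q 2 (q 1)) \<in> SG q \<and> bc 2 ((F q 0 ^^ m) (F q 2 (q 1))) = bc 1 ((F q 0 ^^ m) (F q 2 (q 1)))"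
      by (induction m) (simp_all add: F_SG bar_F bar_q)
    then show ?thesis using m by simp
  qed
  assume "x \<in> K"
  then consider "x \<in> Omega q" | "x = q 0" | "x = q 1" | "x \<in> X q" by (auto simp: cl_Omega_def bd_Omega_def)
  then show "x \<in> SG q \<and> bc 2 x \<le> bc 1 x"
    by cases (use X in \<open>auto simp: Omega_def dist_less_iff bar_q\<close>)
next
  assume x: "x \<in> SG q \<and> bc 2 x \<le> bc 1 x"
  \<comment> \<open>Since \<open>F q 0\<close> halves \<open>bc 1\<close>, the number
    \<open>n\<close> of doublings that lift \<open>bc 1 y\<close> above 1/2 bounds the number of
    letters 0 at the start of the address.\<close>
  have X: "bc 1 y * 2 ^ n > 1/2 \<Longrightarrow> y \<in> SG q \<Longrightarrow> bc 1 y = bc 2 y \<Longrightarrow> y \<in> X q" for n y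
  proof (induction n arbitrary: y)
    case 0
    then show ?case using bar_sum[of y] bar_nonneg[of y 0] by simp
  next
    case (Suc n)
    obtain j z where z: "z \<in> SG q" "y = F q j z" using SG_cases[OF Suc.prems(2)] by metis
    have jj: "j = 0 \<or> j = 1 \<or> j = 2" using ex3[of "\<lambda>k. j = k"] by auto
    have n: "bc 0 z \<ge> 0" "bc 1 z \<ge> 0" "bc 2 z \<ge> 0" using bar_nonneg[OF z(1)] by auto
    have x1: "F q 2 (q 1) \<in> X q" unfolding X_def by (rule CollectI) (rule exI[of _ 1], simp)
    from jj show ?case
    proof (elim disjE)
      assume j: "j = 0"
      then have "z \<in> X q" using Suc.prems z by (intro Suc.IH) (simp_all add: bar_F)
      then obtain m where m: "1 \<le> m" "z = (F q 0 ^^ (m - 1)) (F q 2 (q 1))" by (auto simp: X_def)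
      then have "y = (F q 0 ^^ (Suc m - 1)) (F q 2 (q 1))" using z j by (cases m) auto
      then show ?thesis unfolding X_def using m by (intro CollectI exI[of _ "Suc m"]) auto
    next
      assume j: "j = 1"
      then have "bc 1 z + 1 = bc 2 z" using Suc.prems(3) z by (simp add: bar_F)
      then have "bc 2 z = 1" using n bar_sum[of z] by linarith
      then have "y = F q 2 (q 1)" using bar_corner[OF z(1)] z(2) j F_comm by metis
      then show ?thesis using x1 by simp
    next
      assume j: "j = 2"
      then have "bc 2 z + 1 = bc 1 z" using Suc.prems(3) z by (simp add: bar_F)
      then have "bc 1 z = 1" using n bar_sum[of z] by linarith
      then have "y = F q 2 (q 1)" using bar_corner[OF z(1)] z(2) j by metis
      then show ?thesis using x1 by simp
    qed
  qed
  show "x \<in> K"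
  proof (cases "bc 2 x < bc 1 x")
    case True
    then show ?thesis using x by (auto simp: cl_Omega_def Omega_def bd_Omega_def dist_less_iff)
  next
    case False
    then have e: "bc 1 x = bc 2 x" using x by simp
    show ?thesis
    proof (cases "bc 1 x = 0")
      case True
      then have "bc 0 x = 1" using e bar_sum[of x] by simp
      then show ?thesis using bar_corner x by (auto simp: cl_Omega_def bd_Omega_def)
    next
      case False
      then have "bc 1 x > 0" using bar_nonneg[of x 1] x by simp
      then have "1 / (2 * bc 1 x) \<ge> 0" by simp
      obtain n where "1 / (2 * bc 1 x) < 2 ^ n" using real_arch_pow[of 2 "1 / (2 * bc 1 x)"] by auto
      then have "bc 1 x * 2 ^ n > 1/2" using \<open>bc 1 x > 0\<close> by (simp add: field_simps)
      then show ?thesis using X x e by (auto simp: cl_Omega_def bd_Omega_def)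
    qed
  qed
qed

lemma K_SG: "K \<subseteq> SG q" using cl_Omega_bar by auto

lemma closed_K: "closed K"
proof -
  have "K = SG q \<inter> {x. bc 2 x \<le> bc 1 x}" using cl_Omega_bar by auto
  moreover have "closed {x. bc 2 x \<le> bc 1 x}" by (intro closed_Collect_le bar_continuous)
  ultimately show ?thesis using compact_SG compact_imp_closed by auto
qed

lemma compact_K: "compact K"
  using closed_K K_SG compact_SG by (metis compact_Int_closed inf.absorb_iff2)

lemma F0_K: "x \<in> SG q \<Longrightarrow> F q 0 x \<in> K \<longleftrightarrow> x \<in> K"
  by (simp add: cl_Omega_bar F_SG bar_F)

lemma bar_le_1: "x \<in> SG q \<Longrightarrow> bc i x \<le> 1"
proof -
  assume x: "x \<in> SG q"
  have "\<forall>i. bc i x \<le> 1" unfolding all3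
    using bar_nonneg[OF x, of 0] bar_nonneg[OF x, of 1] bar_nonneg[OF x, of 2] bar_sum[of x] by auto
  then show ?thesis by blast
qed

lemma F1_K: "x \<in> SG q \<Longrightarrow> F q 1 x \<in> K"
  using bar_le_1[of x 2] bar_nonneg[of x 1] by (simp add: cl_Omega_bar F_SG bar_F)

lemma F2_K: "x \<in> SG q \<Longrightarrow> F q 2 x \<in> K \<longleftrightarrow> x = q 1"
proof
  assume x: "x \<in> SG q" "F q 2 x \<in> K"
  then have "bc 1 x = 1" using bar_le_1[OF x(1), of 1] bar_nonneg[of x 2] by (simp add: cl_Omega_bar bar_F)
  then show "x = q 1" using bar_corner x by simp
qed (simp add: cl_Omega_bar F_SG bar_F bar_q)

lemma K_cases:
  assumes "x \<in> K"
  obtains y where "y \<in> K" "x = F q 0 y" | y where "y \<in> SG q" "x = F q 1 y"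
proof -
  have xs: "x \<in> SG q" using assms K_SG by auto
  obtain j z where z: "z \<in> SG q" "x = F q j z" using SG_cases[OF xs] by metis
  have "j = 0 \<or> j = 1 \<or> j = 2" using ex3[of "\<lambda>k. j = k"] by auto
  then show ?thesis
  proof (elim disjE)
    assume "j = 2"
    then have "x = F q 1 (q 2)" using F2_K[OF z(1)] z assms F_comm by metis
    then show ?thesis using that(2)[of "q 2"] by simp
  qed (use z F0_K assms that in blast)+
qed

lemma q01_K [simp]: "q 0 \<in> K" "q 1 \<in> K" "q 2 \<notin> K"
  by (simp_all add: cl_Omega_bar bar_q)

text \<open>\<open>q 1\<close> is removed before \<open>F q 0\<close> is applied, because
  \<open>F q 0 (q 1)\<close> is an interior junction of the half gasket.\<close>

lemma bd_Omega_F: "bd_Omega q = {q 1, F q 1 (q 2)} \<union> F q 0 ` (bd_Omega q - {q 1})"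
proof -
  have X: "X q = insert (F q 1 (q 2)) (F q 0 ` X q)"
  proof (rule set_eqI, rule iffI)
    fix x assume "x \<in> X q"
    then obtain m where m: "1 \<le> m" "x = (F q 0 ^^ (m - 1)) (F q 2 (q 1))" by (auto simp: X_def)
    show "x \<in> insert (F q 1 (q 2)) (F q 0 ` X q)"
    proof (cases "m = 1")
      case True
      then show ?thesis using m F_comm[of 2 1] by simp
    next
      case False
      then obtain k where k: "m - 1 = Suc k" "m = Suc (Suc k)" using m(1) by (cases m; cases "m - 1") auto
      then have "(F q 0 ^^ k) (F q 2 (q 1)) \<in> X q" unfolding X_def by (intro CollectI exI[of _ "Suc k"]) auto
      then show ?thesis using m(2) k(1) by auto
    qed
  next
    fix x assume "x \<in> insert (F q 1 (q 2)) (F q 0 ` X q)"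
    then show "x \<in> X q"
    proof
      assume "x = F q 1 (q 2)"
      then show ?thesis unfolding X_def using F_comm[of 2 1] by (intro CollectI exI[of _ 1]) simp
    next
      assume "x \<in> F q 0 ` X q"
      then obtain m where m: "1 \<le> m" "x = F q 0 ((F q 0 ^^ (m - 1)) (F q 2 (q 1)))" by (auto simp: X_def)
      then have "x = (F q 0 ^^ (Suc m - 1)) (F q 2 (q 1))" by (cases m) auto
      then show ?thesis unfolding X_def using m by (intro CollectI exI[of _ "Suc m"]) auto
    qed
  qed
  have n: "q 1 \<notin> X q"
  proof
    assume "q 1 \<in> X q"
    then obtain m where m: "q 1 = (F q 0 ^^ m) (F q 2 (q 1))" by (auto simp: X_def)
    have "(F q 0 ^^ m) (F q 2 (q 1)) \<in> SG q" by (induction m) (simp_all add: F_SG)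
    have "(F q 0 ^^ m) (F q 2 (q 1)) \<noteq> q 1"
    proof (cases m)
      case (Suc k)
      have "(F q 0 ^^ k) (F q 2 (q 1)) \<in> SG q" by (induction k) (simp_all add: F_SG)
      then show ?thesis using Suc F_eq_q by simp
    qed (simp add: F_eq_q)
    then show False using m by simp
  qed
  have "bd_Omega q - {q 1} = insert (q 0) (X q)" using n by (auto simp: bd_Omega_def)
  then show ?thesis using X by (auto simp: bd_Omega_def)
qed

lemma bd_K: "bd_Omega q \<subseteq> K" by (auto simp: cl_Omega_def)

subsection \<open>Integrals and Riemann sums\<close>

abbreviation "IS h \<equiv> LINT x:SG q|SG_measure q. (h x :: real)"
abbreviation "IK h \<equiv> LINT x:K|SG_measure q. (h x :: real)"

lemma cont_ind_bounded:
  fixes A :: "(real^2) set" and h :: "real^2 \<Rightarrow> real"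
  assumes "compact A" "continuous_on A h"
  shows "(\<lambda>x. indicator A x *\<^sub>R (h x :: real)) \<in> borel_measurable borel" "\<exists>B. \<forall>x. \<bar>indicator A x *\<^sub>R h x\<bar> \<le> B"
proof -
  show "(\<lambda>x. indicator A x *\<^sub>R h x) \<in> borel_measurable borel"
    by (rule borel_measurable_continuous_on_indicator[OF _ assms(2)]) (use assms in \<open>simp add: borel_compact\<close>)
  have "bounded (h ` A)" using assms by (intro compact_imp_bounded compact_continuous_image)
  then obtain B where "\<And>x. x \<in> A \<Longrightarrow> \<bar>h x\<bar> \<le> B" by (auto simp: bounded_iff)
  then have "\<forall>x. \<bar>indicator A x *\<^sub>R h x\<bar> \<le> max B 0" by (auto simp: indicator_def le_max_iff_disj)
  then show "\<exists>B. \<forall>x. \<bar>indicator A x *\<^sub>R h x\<bar> \<le> B" by blast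
qed

lemma set_integral_split:
  fixes A :: "(real^2) set" and h :: "real^2 \<Rightarrow> real"
  assumes "compact A" "continuous_on A h"
  shows "(LINT x:A|SG_measure q. h x) = (\<Sum>j\<in>UNIV. LINT x|address_measure. indicator A (F q j x) *\<^sub>R h (F q j x)) / 3"
proof -
  obtain B where "\<And>x. \<bar>indicator A x *\<^sub>R h x\<bar> \<le> B" using cont_ind_bounded(2)[OF assms] by auto
  then show ?thesis unfolding set_lebesgue_integral_def SG_measure_eq
    by (rule integral_address_measure[OF cont_ind_bounded(1)[OF assms]])
qed

lemma F_measurable [measurable]: "F q j \<in> borel_measurable borel"
  by (rule borel_measurable_continuous_onI[OF continuous_F])

lemma ind_F_measurable:
  fixes A :: "(real^2) set" and h :: "real^2 \<Rightarrow> real"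
  assumes "compact A" "continuous_on A h"
  shows "(\<lambda>x. indicator A (F q j x) *\<^sub>R (h (F q j x) :: real)) \<in> borel_measurable address_measure"
  using measurable_compose[OF F_measurable cont_ind_bounded(1)[OF assms]] by simp

lemma integral_AE_eq:
  fixes A A' :: "(real^2) set" and h h' :: "real^2 \<Rightarrow> real"
  assumes "compact A" "continuous_on A h" "compact A'" "continuous_on A' h'"
    and "AE x in address_measure. indicator A (F q j x) *\<^sub>R (h (F q j x) :: real) = indicator A' x *\<^sub>R h' x"
  shows "(LINT x|address_measure. indicator A (F q j x) *\<^sub>R h (F q j x)) = (LINT x:A'|SG_measure q. h' x)"
  unfolding set_lebesgue_integral_def SG_measure_eq
  by (rule integral_cong_AE[OF ind_F_measurable[OF assms(1,2)] _ assms(5)])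
     (use cont_ind_bounded(1)[OF assms(3,4)] in simp)

lemma continuous_on_F: "continuous_on (SG q) h \<Longrightarrow> continuous_on (SG q) (\<lambda>x. h (F q j x))"
  by (rule continuous_on_compose2[OF _ continuous_F]) (auto intro: F_SG)

lemma continuous_on_K_F0: "continuous_on K h \<Longrightarrow> continuous_on K (\<lambda>x. h (F q 0 x))"
  by (rule continuous_on_compose2[OF _ continuous_F]) (use K_SG F0_K in auto)

lemma continuous_on_K_F1: "continuous_on K h \<Longrightarrow> continuous_on (SG q) (\<lambda>x. h (F q 1 x))"
  by (rule continuous_on_compose2[OF _ continuous_F]) (use F1_K in auto)

lemma IS_split: "continuous_on (SG q) h \<Longrightarrow> IS h = (\<Sum>j\<in>UNIV. IS (\<lambda>x. h (F q j x))) / 3"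
proof -
  assume h: "continuous_on (SG q) h"
  have "(LINT x|address_measure. indicator (SG q) (F q j x) *\<^sub>R h (F q j x)) = IS (\<lambda>x. h (F q j x))" for j
    by (rule integral_AE_eq[OF compact_SG h compact_SG continuous_on_F[OF h]])
       (use address_measure_AE_SG in eventually_elim, simp add: F_SG)
  then show ?thesis using set_integral_split[OF compact_SG h] by simp
qed

text \<open>The third cell meets \<open>K\<close> only in the null set consisting of
  \<open>F q 2 (q 1)\<close>.\<close>

lemma IK_split: "continuous_on K h \<Longrightarrow> IK h = (IK (\<lambda>x. h (F q 0 x)) + IS (\<lambda>x. h (F q 1 x))) / 3"
proof -
  assume h: "continuous_on K h"
  have "(LINT x|address_measure. indicator K (F q 0 x) *\<^sub>R h (F q 0 x)) = IK (\<lambda>x. h (F q 0 x))"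
    by (rule integral_AE_eq[OF compact_K h compact_K continuous_on_K_F0[OF h]])
       (use address_measure_AE_SG in eventually_elim, simp add: F0_K indicator_def)
  moreover have "(LINT x|address_measure. indicator K (F q 1 x) *\<^sub>R h (F q 1 x)) = IS (\<lambda>x. h (F q 1 x))"
    by (rule integral_AE_eq[OF compact_K h compact_SG continuous_on_K_F1[OF h]])
       (use address_measure_AE_SG in eventually_elim, simp add: F1_K indicator_def)
  moreover have "(LINT x|address_measure. indicator K (F q 2 x) *\<^sub>R h (F q 2 x)) = 0"
  proof -
    interpret prob_space address_measure by (rule prob_address_measure)
    have "{q 1} \<in> null_sets address_measure" using address_measure_point[of "q 1"] by (simp add: null_sets_def emeasure_eq_measure)
    then have "AE x in address_measure. x \<notin> {q 1}" by (rule AE_not_in)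
    then have "AE x in address_measure. indicator K (F q 2 x) *\<^sub>R h (F q 2 x) = 0"
      using address_measure_AE_SG by eventually_elim (simp add: F2_K indicator_def)
    then show ?thesis by (rule integral_eq_zero_AE)
  qed
  ultimately show ?thesis using set_integral_split[OF compact_K h] by (simp add: sum3)
qed

definition code :: "(real^2 \<Rightarrow> real) \<Rightarrow> code" where
  "code u = (\<lambda>(w, j). u (foldr (F q) w (q j)))"

lemma sh_code [simp]: "sh (code u) i = code (\<lambda>x. u (F q i x))"
  by (auto simp: sh_def code_def)

lemma code_apply [simp]: "code u (w, j) = u (foldr (F q) w (q j))"
  by (simp add: code_def)

lemma code_crn [simp]: "code u (crn n j) = u (q j)"
proof -
  have "foldr (F q) (replicate n j) (q j) = q j" by (induction n) simp_all
  then show ?thesis by (simp add: crn_def)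
qed

lemma crs_code [simp]: "crs (code u) = code u"
  by (auto simp: crs_def code_def)

lemma cmp_code: "cmp n (code u)"
proof (induction n arbitrary: u)
  case (Suc n)
  show ?case using Suc by (simp add: F_comm)
qed simp

lemma hcmp_code: "hcmp n (code u)"
  by (induction n arbitrary: u) (simp_all add: cmp_code F_comm)

lemma hz_code: "\<forall>x\<in>bd_Omega q. u x = 0 \<Longrightarrow> hz n (code u)"
proof -
  have "\<forall>x\<in>bd_Omega q - {q 1}. u x = 0 \<Longrightarrow> hz n (code u)" for u
  proof (induction n arbitrary: u)
    case 0
    then show ?case by (simp add: bd_Omega_def)
  next
    case (Suc n)
    have "F q 1 (q 2) \<noteq> q 1" by (simp add: F_eq_q)
    then have "u (F q 1 (q 2)) = 0" using Suc.prems bd_Omega_F by blast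
    moreover have "hz n (code (\<lambda>x. u (F q 0 x)))"
    proof (rule Suc.IH)
      show "\<forall>x\<in>bd_Omega q - {q 1}. u (F q 0 x) = 0"
      proof
        fix x assume x: "x \<in> bd_Omega q - {q 1}"
        have "x \<in> SG q" using x bd_K K_SG by blast
        then have "F q 0 x \<noteq> q 1" using F_eq_q[of x 0 1] by simp
        moreover have "F q 0 x \<in> bd_Omega q" using x by (subst bd_Omega_F) blast
        ultimately show "u (F q 0 x) = 0" using Suc.prems by blast
      qed
    qed
    ultimately show ?case by simp
  qed
  then show "\<forall>x\<in>bd_Omega q. u x = 0 \<Longrightarrow> hz n (code u)" by blast
qed

lemma integral_const_dev:
  fixes A :: "(real^2) set" and h :: "real^2 \<Rightarrow> real"
  assumes A: "compact A" "continuous_on A h" and m: "measure address_measure A \<le> 1" and e: "\<And>x. x \<in> A \<Longrightarrow> \<bar>h x\<bar> \<le> e" "0 \<le> e"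
  shows "\<bar>LINT x:A|SG_measure q. h x\<bar> \<le> e"
proof -
  interpret prob_space address_measure by (rule prob_address_measure)
  obtain B where "\<And>x. \<bar>indicator A x *\<^sub>R h x\<bar> \<le> B" using cont_ind_bounded(2)[OF A] by auto
  then have i: "integrable address_measure (\<lambda>x. indicator A x *\<^sub>R h x)" by (rule address_measure_bounded_integrable[OF cont_ind_bounded(1)[OF A]])
  have "\<bar>LINT x:A|SG_measure q. h x\<bar> \<le> (LINT x|address_measure. \<bar>indicator A x *\<^sub>R h x\<bar>)"
    unfolding set_lebesgue_integral_def SG_measure_eq by (rule integral_abs_bound)
  also have "\<dots> \<le> (LINT x|address_measure. e)"
    by (rule integral_mono) (use i e in \<open>auto simp: indicator_def\<close>)
  also have "\<dots> = e" using prob_space by simp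
  finally show ?thesis .
qed

lemma IS_const_diff:
  assumes h: "continuous_on (SG q) h"
  shows "IS (\<lambda>x. h x - c) = IS h - c"
proof -
  interpret prob_space address_measure by (rule prob_address_measure)
  obtain B where "\<And>x. \<bar>indicator (SG q) x *\<^sub>R h x\<bar> \<le> B" using cont_ind_bounded(2)[OF compact_SG h] by auto
  then have i: "integrable address_measure (\<lambda>x. indicator (SG q) x *\<^sub>R h x)"
    by (rule address_measure_bounded_integrable[OF cont_ind_bounded(1)[OF compact_SG h]])
  have "IS (\<lambda>x. h x - c) = (LINT x|address_measure. indicator (SG q) x *\<^sub>R h x - c * indicator (SG q) x)"
    unfolding set_lebesgue_integral_def SG_measure_eq by (simp add: algebra_simps)
  also have "\<dots> = IS h - (LINT x|address_measure. c * indicator (SG q) x)"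
    unfolding set_lebesgue_integral_def SG_measure_eq
    by (rule Bochner_Integration.integral_diff[OF i])
      (intro integrable_mult_right address_measure_bounded_integrable[where B = 1]; simp add: indicator_def)
  also have "(LINT x|address_measure. c * indicator (SG q) x) = c" using address_measure_SG by simp
  finally show ?thesis .
qed

text \<open>\<open>(1/3) ^ Suc n * mf n\<close> averages over \<open>3 ^ n\<close> cells of equal
  mass and the three corners of each.\<close>

lemma IS_riemann:
  "continuous_on (SG q) h \<Longrightarrow> 0 \<le> e \<Longrightarrow>
   (\<And>w x y. length w = n \<Longrightarrow> x \<in> cell q w \<Longrightarrow> y \<in> cell q w \<Longrightarrow> \<bar>h x - h y\<bar> \<le> e) \<Longrightarrow>
   \<bar>IS h - (1/3) ^ Suc n * mf n (code h)\<bar> \<le> e"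
proof (induction n arbitrary: h)
  case 0
  have d: "\<bar>IS h - h (q j)\<bar> \<le> e" for j
  proof -
    have "\<bar>IS (\<lambda>x. h x - h (q j))\<bar> \<le> e"
      by (rule integral_const_dev[OF compact_SG]) (use 0 address_measure_SG in \<open>auto intro!: continuous_intros\<close>)
    then show ?thesis by (simp add: IS_const_diff[OF 0(1)])
  qed
  show ?case using d[of 0] d[of 1] d[of 2] by (auto simp: sum3 abs_le_iff field_simps)
next
  case (Suc n)
  have IH: "\<bar>IS (\<lambda>x. h (F q j x)) - (1/3) ^ Suc n * mf n (code (\<lambda>x. h (F q j x)))\<bar> \<le> e" for j
  proof (rule Suc.IH[OF continuous_on_F[OF Suc.prems(1)] Suc.prems(2)])
    fix w x y assume "length w = n" "x \<in> cell q w" "y \<in> cell q w"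
    then show "\<bar>h (F q j x) - h (F q j y)\<bar> \<le> e"
      by (intro Suc.prems(3)[of "j # w"]) (auto simp: cell_Cons)
  qed
  show ?case unfolding IS_split[OF Suc.prems(1)] mf.simps(2) sh_code sum3
    using avg3_dev[OF IH[of 0] IH[of 1] IH[of 2]] by (simp add: algebra_simps)
qed

text \<open>The extra error \<open>2 * B * (1/3) ^ n\<close> comes from the cut cell, where
  \<open>h\<close> is merely bounded and not compared with its vertex values.\<close>

lemma IK_riemann:
  "continuous_on K h \<Longrightarrow> 0 \<le> e \<Longrightarrow> (\<And>x. x \<in> K \<Longrightarrow> \<bar>h x\<bar> \<le> B) \<Longrightarrow>
   (\<And>w x y. length w = n \<Longrightarrow> x \<in> cell q w \<inter> K \<Longrightarrow> y \<in> cell q w \<inter> K \<Longrightarrow> \<bar>h x - h y\<bar> \<le> e) \<Longrightarrow>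
   \<bar>IK h - (1/3) ^ Suc n * mh n (code h)\<bar> \<le> e + 2 * B * (1/3) ^ n"
proof (induction n arbitrary: h)
  case 0
  have "0 \<le> B" using 0(3)[of "q 0"] by simp
  interpret prob_space address_measure by (rule prob_address_measure)
  have "\<bar>IK h\<bar> \<le> B" by (rule integral_const_dev[OF compact_K 0(1)]) (use 0(3) \<open>0 \<le> B\<close> in auto)
  moreover have "\<bar>h (q 0)\<bar> \<le> B" "\<bar>h (q 1)\<bar> \<le> B" using 0(3) by auto
  ultimately show ?case using 0(2) \<open>0 \<le> B\<close> by (auto simp: abs_le_iff field_simps)
next
  case (Suc n)
  have 1: "\<bar>IK (\<lambda>x. h (F q 0 x)) - (1/3) ^ Suc n * mh n (code (\<lambda>x. h (F q 0 x)))\<bar> \<le> e + 2 * B * (1/3) ^ n"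
  proof (rule Suc.IH[OF continuous_on_K_F0[OF Suc.prems(1)] Suc.prems(2)])
    show "\<bar>h (F q 0 x)\<bar> \<le> B" if "x \<in> K" for x using Suc.prems(3) that F0_K K_SG by blast
    fix w x y assume a: "length w = n" "x \<in> cell q w \<inter> K" "y \<in> cell q w \<inter> K"
    then have "F q 0 x \<in> cell q (0 # w) \<inter> K" "F q 0 y \<in> cell q (0 # w) \<inter> K" using F0_K K_SG by (auto simp: cell_Cons)
    then show "\<bar>h (F q 0 x) - h (F q 0 y)\<bar> \<le> e" using a(1) by (intro Suc.prems(4)[of "0 # w"]) auto
  qed
  have 2: "\<bar>IS (\<lambda>x. h (F q 1 x)) - (1/3) ^ Suc n * mf n (code (\<lambda>x. h (F q 1 x)))\<bar> \<le> e"
  proof (rule IS_riemann[OF continuous_on_K_F1[OF Suc.prems(1)] Suc.prems(2)])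
    fix w x y assume a: "length w = n" "x \<in> cell q w" "y \<in> cell q w"
    then have "F q 1 x \<in> cell q (1 # w) \<inter> K" "F q 1 y \<in> cell q (1 # w) \<inter> K"
      using F1_K cell_SG[of w] by (auto simp: cell_Cons)
    then show "\<bar>h (F q 1 x) - h (F q 1 y)\<bar> \<le> e" using a(1) by (intro Suc.prems(4)[of "1 # w"]) auto
  qed
  have "\<bar>IK h - (1/3) ^ Suc (Suc n) * mh (Suc n) (code h)\<bar> \<le> (e + 2 * B * (1/3) ^ n + e + 0) / 3"
    unfolding IK_split[OF Suc.prems(1)] mh.simps(2) sh_code
    using avg3_dev[OF 1 2, of 0 0 0] by (simp add: algebra_simps)
  also have "\<dots> \<le> e + 2 * B * (1/3) ^ Suc n" using Suc.prems(2) by (simp add: field_simps)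
  finally show ?case .
qed

lemma IK_riemann_limit:
  assumes h: "continuous_on K h"
  shows "(\<lambda>n. (1/3) ^ Suc n * mh n (code h)) \<longlonglongrightarrow> IK h"
proof (rule LIMSEQ_I)
  fix r :: real assume r: "0 < r"
  have "bounded (h ` K)" using h compact_K by (intro compact_imp_bounded compact_continuous_image)
  then obtain B where B: "\<And>x. x \<in> K \<Longrightarrow> \<bar>h x\<bar> \<le> B" by (auto simp: bounded_iff)
  have "uniformly_continuous_on K h" by (rule compact_uniformly_continuous[OF h compact_K])
  then obtain d where d: "d > 0" "\<And>x y. x \<in> K \<Longrightarrow> y \<in> K \<Longrightarrow> dist x y < d \<Longrightarrow> dist (h x) (h y) < r / 2"
    unfolding uniformly_continuous_on_def using r by (metis half_gt_zero dist_commute)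
  have "(\<lambda>n. diameter (SG q) / 2 ^ n) \<longlonglongrightarrow> 0" by (rule LIMSEQ_divide_realpow_zero) simp
  then have "\<forall>\<^sub>F n in sequentially. diameter (SG q) / 2 ^ n < d" using d(1) by (rule order_tendstoD)
  moreover have "(\<lambda>n. 2 * B * (1/3) ^ n) \<longlonglongrightarrow> 2 * B * 0" by (intro tendsto_intros LIMSEQ_realpow_zero) auto
  then have "\<forall>\<^sub>F n in sequentially. 2 * B * (1/3) ^ n < r / 2" by (rule order_tendstoD) (use r in simp)
  ultimately have "\<forall>\<^sub>F n in sequentially. norm ((1/3) ^ Suc n * mh n (code h) - IK h) < r"
  proof eventually_elim
    case (elim n)
    have "\<bar>IK h - (1/3) ^ Suc n * mh n (code h)\<bar> \<le> r / 2 + 2 * B * (1/3) ^ n"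
    proof (rule IK_riemann[OF h _ B])
      fix w x y assume a: "length w = n" "x \<in> cell q w \<inter> K" "y \<in> cell q w \<inter> K"
      then have "dist x y < d" using cell_diam[of x w y] elim(1) by simp
      then show "\<bar>h x - h y\<bar> \<le> r / 2" using d(2)[of x y] a by (simp add: dist_real_def)
    qed (use r in auto)
    then show ?case using elim(2) by simp
  qed
  then show "\<exists>no. \<forall>n\<ge>no. norm ((1/3) ^ Suc n * mh n (code h) - IK h) < r"
    by (simp add: eventually_sequentially)
qed

subsection \<open>Edges and energy\<close>

lemma V_F: "x \<in> SG q \<Longrightarrow> F q j x \<in> V q (Suc n) \<longleftrightarrow> x \<in> V q n"
proof
  assume x: "x \<in> SG q" "F q j x \<in> V q (Suc n)"
  then obtain i y where y: "y \<in> V q n" "F q j x = F q i y" by auto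
  show "x \<in> V q n"
  proof (cases "i = j")
    case False
    have "y \<in> SG q" using y(1) V_SG by blast
    then have "x = q i" using F_SG_Int[of j i x y] False x(1) y(2) by auto
    then show ?thesis using V_0_mem by simp
  qed (use y in simp)
qed auto

lemma adj_Suc: "adj q (Suc n) x y \<longleftrightarrow> (\<exists>j x' y'. x = F q j x' \<and> y = F q j y' \<and> adj q n x' y')"
proof
  assume a: "adj q (Suc n) x y"
  then obtain w where w: "length w = Suc n" "x \<in> cell q w" "y \<in> cell q w" by (auto simp: adj_def)
  then obtain j v where v: "w = j # v" "length v = n" by (auto simp: length_Suc_conv)
  obtain x' y' where xy: "x = F q j x'" "y = F q j y'" "x' \<in> cell q v" "y' \<in> cell q v"
    using w v by (auto simp: cell_Cons)
  have "x' \<in> SG q" "y' \<in> SG q" using xy cell_SG by blast+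
  then have "x' \<in> V q n" "y' \<in> V q n" using a V_F xy(1,2) unfolding adj_def by blast+
  then have "adj q n x' y'" using a xy v by (auto simp: adj_def)
  then show "\<exists>j x' y'. x = F q j x' \<and> y = F q j y' \<and> adj q n x' y'" using xy by blast
next
  assume "\<exists>j x' y'. x = F q j x' \<and> y = F q j y' \<and> adj q n x' y'"
  then obtain j x' y' where xy: "x = F q j x'" "y = F q j y'" "adj q n x' y'" by blast
  then obtain w where w: "length w = n" "x' \<in> cell q w" "y' \<in> cell q w" by (auto simp: adj_def)
  then have "length (j # w) = Suc n" "x \<in> cell q (j # w)" "y \<in> cell q (j # w)" using xy by (auto simp: cell_Cons)
  then show "adj q (Suc n) x y" using xy unfolding adj_def by (metis F_eq_iff V_F V_SG subsetD)
qed

lemma adj_0: "adj q 0 x y \<longleftrightarrow> x \<noteq> y \<and> x \<in> range q \<and> y \<in> range q"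
  using V_SG[of 0] by (auto simp: adj_def)

lemma adj_SG: "adj q n x y \<Longrightarrow> x \<in> SG q \<and> y \<in> SG q"
  using V_SG by (auto simp: adj_def)

lemma finite_V: "finite (V q n)"
  by (induction n) auto

definition edges :: "(real^2) set \<Rightarrow> nat \<Rightarrow> ((real^2) \<times> (real^2)) set" where
  "edges A n = {(x, y). x \<in> A \<and> y \<in> A \<and> adj q n x y}"

lemma finite_edges: "finite (edges A n)"
  by (rule finite_subset[of _ "V q n \<times> V q n"]) (auto simp: edges_def adj_def finite_V)

definition sumE :: "((real^2) \<times> (real^2)) set \<Rightarrow> (real^2 \<Rightarrow> real) \<Rightarrow> (real^2 \<Rightarrow> real) \<Rightarrow> real" where
  "sumE E u v = (\<Sum>(x, y)\<in>E. (u x - u y) * (v x - v y)) / 2"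

lemma graph_energy_sumE: "graph_energy q A n u v = (5/3) ^ n * sumE (edges A n) u v"
proof -
  have "(\<Sum>(x, y)\<in>edges A n. (5/3) ^ n * (u x - u y) * (v x - v y))
    = (5/3) ^ n * (\<Sum>(x, y)\<in>edges A n. (u x - u y) * (v x - v y))"
    by (simp add: sum_distrib_left mult.assoc case_prod_unfold)
  then show ?thesis unfolding graph_energy_def sumE_def edges_def by simp
qed

lemma sumE_F: "sumE ((\<lambda>(x, y). (F q j x, F q j y)) ` E) u v = sumE E (\<lambda>x. u (F q j x)) (\<lambda>x. v (F q j x))"
proof -
  have "inj_on (\<lambda>(x, y). (F q j x, F q j y)) E" by (auto simp: inj_on_def)
  then show ?thesis unfolding sumE_def by (subst sum.reindex) (auto simp: case_prod_unfold comp_def)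
qed

lemma sumE_Un: "finite E \<Longrightarrow> finite E' \<Longrightarrow> E \<inter> E' = {} \<Longrightarrow> sumE (E \<union> E') u v = sumE E u v + sumE E' u v"
  unfolding sumE_def by (simp add: sum.union_disjoint add_divide_distrib)

abbreviation "FF j \<equiv> (\<lambda>(x, y). (F q j x, F q j y))"

lemma FF_disjoint: "i \<noteq> j \<Longrightarrow> FF i ` edges A n \<inter> FF j ` edges A' n = {}"
proof (rule ccontr)
  assume ij: "i \<noteq> j" and "FF i ` edges A n \<inter> FF j ` edges A' n \<noteq> {}"
  then obtain x y x' y' where a: "adj q n x y" "adj q n x' y'" "F q i x = F q j x'" "F q i y = F q j y'"
    by (auto simp: edges_def)
  have s: "x \<in> SG q" "y \<in> SG q" "x' \<in> SG q" "y' \<in> SG q" using adj_SG a(1,2) by blast+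
  have "x = q j" "y = q j" using F_SG_Int[OF ij s(1,3) a(3)] F_SG_Int[OF ij s(2,4) a(4)] by auto
  then show False using a(1) by (simp add: adj_def)
qed

lemma edges_SG_Suc: "edges (SG q) (Suc n) = FF 0 ` edges (SG q) n \<union> (FF 1 ` edges (SG q) n \<union> FF 2 ` edges (SG q) n)"
  (is "_ = ?r")
proof -
  have e: "(x, y) \<in> edges (SG q) n \<longleftrightarrow> adj q n x y" for x y n
    using adj_SG by (auto simp: edges_def)
  have "edges (SG q) (Suc n) = (\<Union>j. FF j ` edges (SG q) n)"
  proof (rule set_eqI, clarify)
    fix x y
    have "(x, y) \<in> (\<Union>j. FF j ` edges (SG q) n) \<longleftrightarrow> (\<exists>j x' y'. x = F q j x' \<and> y = F q j y' \<and> (x', y') \<in> edges (SG q) n)"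
    proof
      assume "(x, y) \<in> (\<Union>j. FF j ` edges (SG q) n)"
      then obtain j p where "(x, y) = FF j p" "p \<in> edges (SG q) n" by blast
      then show "\<exists>j x' y'. x = F q j x' \<and> y = F q j y' \<and> (x', y') \<in> edges (SG q) n" by (cases p) auto
    next
      assume "\<exists>j x' y'. x = F q j x' \<and> y = F q j y' \<and> (x', y') \<in> edges (SG q) n"
      then obtain j x' y' where "x = F q j x'" "y = F q j y'" "(x', y') \<in> edges (SG q) n" by blast
      then have "(x, y) = FF j (x', y')" "(x', y') \<in> edges (SG q) n" by simp_all
      then show "(x, y) \<in> (\<Union>j. FF j ` edges (SG q) n)" by blast
    qed
    then show "(x, y) \<in> edges (SG q) (Suc n) \<longleftrightarrow> (x, y) \<in> (\<Union>j. FF j ` edges (SG q) n)"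
      unfolding e adj_Suc by blast
  qed
  also have "\<dots> = ?r"
  proof (rule set_eqI)
    fix p
    show "p \<in> (\<Union>j. FF j ` edges (SG q) n) \<longleftrightarrow> p \<in> ?r"
      unfolding UN_iff Un_iff bex_UNIV by (rule ex3)
  qed
  finally show ?thesis .
qed

text \<open>Cell 2 meets \<open>K\<close> in one point and contributes no edge.\<close>

lemma edges_K_Suc: "edges K (Suc n) = FF 0 ` edges K n \<union> FF 1 ` edges (SG q) n"
proof (rule set_eqI, clarify)
  fix x y
  show "(x, y) \<in> edges K (Suc n) \<longleftrightarrow> (x, y) \<in> FF 0 ` edges K n \<union> FF 1 ` edges (SG q) n"
  proof
    assume "(x, y) \<in> edges K (Suc n)"
    then obtain j x' y' where a: "x \<in> K" "y \<in> K" "x = F q j x'" "y = F q j y'" "adj q n x' y'"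
      by (auto simp: edges_def adj_Suc)
    have s: "x' \<in> SG q" "y' \<in> SG q" using adj_SG[OF a(5)] by auto
    have "j = 0 \<or> j = 1 \<or> j = 2" using ex3[of "\<lambda>k. j = k"] by auto
    then show "(x, y) \<in> FF 0 ` edges K n \<union> FF 1 ` edges (SG q) n"
    proof (elim disjE)
      assume "j = 2"
      then have "x' = q 1" "y' = q 1" using a F2_K s by blast+
      then show ?thesis using a(5) by (simp add: adj_def)
    qed (use a s F0_K in \<open>force simp: edges_def\<close>)+
  next
    assume "(x, y) \<in> FF 0 ` edges K n \<union> FF 1 ` edges (SG q) n"
    then show "(x, y) \<in> edges K (Suc n)"
    proof
      assume "(x, y) \<in> FF 0 ` edges K n"
      then show ?thesis using F0_K K_SG by (fastforce simp: edges_def adj_Suc)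
    next
      assume "(x, y) \<in> FF 1 ` edges (SG q) n"
      then show ?thesis using F1_K by (fastforce simp: edges_def adj_Suc)
    qed
  qed
qed

lemma sumE_SG: "sumE (edges (SG q) n) u v = Qf 0 n (code u) (code v)"
proof (induction n arbitrary: u v)
  case 0
  have "edges (SG q) 0 = {(q 0, q 1), (q 1, q 0), (q 0, q 2), (q 2, q 0), (q 1, q 2), (q 2, q 1)}"
    (is "_ = ?s")
  proof -
    have "range q = {q 0, q 1, q 2}" using UNIV_3 by auto
    then show ?thesis by (auto simp: edges_def adj_0)
  qed
  then show ?case by (simp add: sumE_def sum3 T_def field_simps)
next
  case (Suc n)
  show ?case unfolding edges_SG_Suc
    by (subst sumE_Un sumE_Un; (simp add: finite_edges FF_disjoint Int_Un_distrib)?)+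
       (simp add: sumE_F Suc sum3)
qed

lemma sumE_K: "sumE (edges K n) u v = Qh False 0 n (code u) (code v)"
proof (induction n arbitrary: u v)
  case 0
  have "edges K 0 = {(q 0, q 1), (q 1, q 0)}"
  proof -
    have "range q = {q 0, q 1, q 2}" using UNIV_3 by auto
    then show ?thesis by (auto simp: edges_def adj_0)
  qed
  then show ?case by (simp add: sumE_def field_simps)
next
  case (Suc n)
  show ?case unfolding edges_K_Suc
    by (subst sumE_Un) (simp_all add: finite_edges FF_disjoint sumE_F Suc sumE_SG)
qed

lemma graph_energy_K: "graph_energy q K n u v = (5/3) ^ n * Qh False 0 n (code u) (code v)"
  by (simp add: graph_energy_sumE sumE_K)

subsection \<open>Normal derivatives\<close>

lemma nbr_SG: "{y. adj q (Suc n) (q i) y} = F q i ` {y. adj q n (q i) y}"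
proof -
  have "adj q (Suc n) (q i) y \<longleftrightarrow> (\<exists>y'. y = F q i y' \<and> adj q n (q i) y')" for y
  proof
    assume "adj q (Suc n) (q i) y"
    then obtain j x' y' where a: "q i = F q j x'" "y = F q j y'" "adj q n x' y'" by (auto simp: adj_Suc)
    then have "j = i" "x' = q i" using F_eq_q[of x' j i] adj_SG by auto
    then show "\<exists>y'. y = F q i y' \<and> adj q n (q i) y'" using a by blast
  next
    assume "\<exists>y'. y = F q i y' \<and> adj q n (q i) y'"
    then show "adj q (Suc n) (q i) y" unfolding adj_Suc by (metis F_q)
  qed
  then show ?thesis by auto
qed

lemma nbr_sum_SG: "(\<Sum>y | adj q n (q i) y. u (q i) - u y) = T 0 (\<lambda>k. code u (replicate n i, k)) i"
proof (induction n arbitrary: u)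
  case 0
  have r: "range q = {q 0, q 1, q 2}" using UNIV_3 by auto
  have "{y. adj q 0 (q 0) y} = {q 1, q 2}" "{y. adj q 0 (q 1) y} = {q 0, q 2}" "{y. adj q 0 (q 2) y} = {q 0, q 1}"
    using r by (auto simp: adj_0)
  then have "\<forall>i. (\<Sum>y | adj q 0 (q i) y. u (q i) - u y) = T 0 (\<lambda>k. code u (replicate 0 i, k)) i"
    by (simp add: all3 T_def)
  then show ?case by blast
next
  case (Suc n)
  show ?case unfolding nbr_SG
    by (subst sum.reindex) (use Suc[of "\<lambda>x. u (F q i x)"] in \<open>auto simp: inj_on_def\<close>)
qed

abbreviation "nd n u p \<equiv> (\<Sum>y\<in>{y \<in> K. adj q n p y}. u p - u y)"

lemma nd_q1: "nd (Suc n) u (q 1) = T 0 (\<lambda>k. code u (1 # replicate n 1, k)) 1"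
proof -
  have "{y \<in> K. adj q (Suc n) (q 1) y} = {y. adj q (Suc n) (q 1) y}"
  proof -
    have "y \<in> K" if y: "adj q (Suc n) (q 1) y" for y
    proof -
      obtain z where "y = F q 1 z" "adj q n (q 1) z" using nbr_SG[of n 1] y by blast
      then show ?thesis using F1_K adj_SG[of n "q 1" z] by simp
    qed
    then show ?thesis by blast
  qed
  then show ?thesis using nbr_sum_SG[where n = "Suc n" and i = 1 and u = u] by simp
qed

lemma nd_q0: "nd n u (q 0) = u (q 0) - code u (replicate n 0, 1)"
proof (induction n arbitrary: u)
  case 0
  have r: "range q = {q 0, q 1, q 2}" using UNIV_3 by auto
  have "{y \<in> K. adj q 0 (q 0) y} = {q 1}" using r by (auto simp: adj_0)
  then show ?case by simp
next
  case (Suc n)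
  have "{y \<in> K. adj q (Suc n) (q 0) y} = F q 0 ` {y \<in> K. adj q n (q 0) y}"
  proof (rule set_eqI, rule iffI)
    fix y assume y: "y \<in> {y \<in> K. adj q (Suc n) (q 0) y}"
    obtain z where z: "y = F q 0 z" "adj q n (q 0) z" using nbr_SG[of n 0] y by blast
    then have "z \<in> K" using F0_K[of z] adj_SG[OF z(2)] y by simp
    then show "y \<in> F q 0 ` {y \<in> K. adj q n (q 0) y}" using z by blast
  next
    fix y assume "y \<in> F q 0 ` {y \<in> K. adj q n (q 0) y}"
    then obtain z where z: "y = F q 0 z" "adj q n (q 0) z" "z \<in> K" by blast
    then have "y \<in> K" using F0_K[of z] K_SG by auto
    moreover have "adj q (Suc n) (q 0) y" using nbr_SG[of n 0] z by blast
    ultimately show "y \<in> {y \<in> K. adj q (Suc n) (q 0) y}" by blast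
  qed
  then show ?case using Suc[of "\<lambda>x. u (F q 0 x)"]
    by (simp add: sum.reindex inj_on_def)
qed

lemma nd_x1: "nd (Suc n) u (F q 1 (q 2)) = T 0 (\<lambda>k. code u (1 # replicate n 2, k)) 2"
proof -
  have "{y \<in> K. adj q (Suc n) (F q 1 (q 2)) y} = F q 1 ` {y. adj q n (q 2) y}"
  proof (rule set_eqI, rule iffI)
    fix y assume "y \<in> {y \<in> K. adj q (Suc n) (F q 1 (q 2)) y}"
    then obtain j x' y' where a: "y \<in> K" "F q 1 (q 2) = F q j x'" "y = F q j y'" "adj q n x' y'" by (auto simp: adj_Suc)
    have s: "x' \<in> SG q" "y' \<in> SG q" using adj_SG[OF a(4)] by auto
    show "y \<in> F q 1 ` {y. adj q n (q 2) y}"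
    proof (cases "j = 1")
      case True
      then show ?thesis using a by auto
    next
      case False
      then have "x' = q 1" "q 2 = q j" using F_SG_Int[of 1 j "q 2" x'] a(2) s by auto
      then have "j = 2" by simp
      then have "y' = q 1" using F2_K[OF s(2)] a by simp
      then show ?thesis using a(4) \<open>x' = q 1\<close> by (simp add: adj_def)
    qed
  next
    fix y assume "y \<in> F q 1 ` {y. adj q n (q 2) y}"
    then show "y \<in> {y \<in> K. adj q (Suc n) (F q 1 (q 2)) y}" using F1_K adj_SG by (auto simp: adj_Suc)
  qed
  then show ?thesis using nbr_sum_SG[where n = n and i = 2 and u = "\<lambda>x. u (F q 1 x)"]
    by (simp add: sum.reindex inj_on_def)
qed

text \<open>\<open>p = q 1\<close> is excluded since \<open>F q 0 (q 1)\<close> has neighbours in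
  cell 1 as well.\<close>

lemma nd_F0: "p \<in> K \<Longrightarrow> p \<noteq> q 1 \<Longrightarrow> nd (Suc n) u (F q 0 p) = nd n (\<lambda>x. u (F q 0 x)) p"
proof -
  assume p: "p \<in> K" "p \<noteq> q 1"
  have "{y \<in> K. adj q (Suc n) (F q 0 p) y} = F q 0 ` {y \<in> K. adj q n p y}"
  proof (rule set_eqI, rule iffI)
    fix y assume "y \<in> {y \<in> K. adj q (Suc n) (F q 0 p) y}"
    then obtain j x' y' where a: "y \<in> K" "F q 0 p = F q j x'" "y = F q j y'" "adj q n x' y'" by (auto simp: adj_Suc)
    have s: "x' \<in> SG q" "y' \<in> SG q" "p \<in> SG q" using adj_SG[OF a(4)] p K_SG by auto
    have "j = 0"
    proof (rule ccontr)
      assume "j \<noteq> 0"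
      then have "p = q j" using F_SG_Int[of 0 j p x'] a(2) s by auto
      moreover have "j = 1 \<or> j = 2" using ex3[of "\<lambda>k. j = k"] \<open>j \<noteq> 0\<close> by auto
      ultimately show False using p by auto
    qed
    then show "y \<in> F q 0 ` {y \<in> K. adj q n p y}" using a F0_K s by auto
  next
    fix y assume "y \<in> F q 0 ` {y \<in> K. adj q n p y}"
    then show "y \<in> {y \<in> K. adj q (Suc n) (F q 0 p) y}" using F0_K K_SG by (auto simp: adj_Suc)
  qed
  then show ?thesis by (simp add: sum.reindex inj_on_def)
qed

text \<open>The point first appears on level \<open>Suc k\<close>; \<open>n\<close> levels later,
  its cell in the closed half has the word consisting of \<open>k\<close> letters 0, one letter 1
  and \<open>n\<close> letters 2.\<close>

lemma nd_x: "nd (n + Suc k) u ((F q 0 ^^ k) (F q 1 (q 2))) = T 0 (\<lambda>j. code u (replicate k 0 @ 1 # replicate n 2, j)) 2"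
proof (induction k arbitrary: u)
  case 0
  show ?case using nd_x1 by simp
next
  case (Suc k)
  let ?p = "(F q 0 ^^ k) (F q 1 (q 2))"
  have p: "?p \<in> K"
    by (induction k) (use F1_K F0_K K_SG in auto)
  have "?p \<noteq> q 1"
  proof (cases k)
    case 0
    then show ?thesis by (simp add: F_eq_q)
  next
    case (Suc l)
    have "(F q 0 ^^ l) (F q 1 (q 2)) \<in> SG q" by (induction l) (simp_all add: F_SG)
    then show ?thesis using Suc by (simp add: F_eq_q)
  qed
  then show ?case using nd_F0[OF p, where n = "n + Suc k" and u = u] Suc[of "\<lambda>x. u (F q 0 x)"] by simp
qed

end

section \<open>Splines\<close>

text \<open>This decay makes decimation a summable perturbation of harmonic extension.\<close>

definition okseq :: "(nat \<Rightarrow> real) \<Rightarrow> bool" where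
  "okseq nu \<longleftrightarrow> (\<exists>D. \<forall>j. \<bar>nu j\<bar> \<le> D / 5 ^ j)"

lemma okseq_Suc: "okseq nu \<Longrightarrow> okseq (\<lambda>k. nu (Suc k))"
proof -
  assume "okseq nu"
  then obtain D where D: "\<And>j. \<bar>nu j\<bar> \<le> D / 5 ^ j" by (auto simp: okseq_def)
  have "\<bar>nu (Suc j)\<bar> \<le> (D / 5) / 5 ^ j" for j using D[of "Suc j"] by simp
  then show ?thesis unfolding okseq_def by blast
qed

lemma EV_lc: "EV mu (\<lambda>k. c * a k + d * b k) i j = c * EV mu a i j + d * EV mu b i j"
proof -
  define D where "D = (2 - mu) * (5 - mu)"
  define n where "n a = (2 - mu) * (a i + a j) + 2 * (a 0 + a 1 + a 2)" for a :: "3 \<Rightarrow> real"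
  have e: "EV mu a i j = (if i = j then a i else n a / D)" for a by (simp add: EV_def n_def D_def)
  have "n (\<lambda>k. c * a k + d * b k) = c * n a + d * n b" by (simp add: n_def algebra_simps)
  then show ?thesis unfolding e by (simp add: add_divide_distrib)
qed

lemma EV_lc': "EV mu (\<lambda>k. c * a k + d * b k) i = (\<lambda>j. c * EV mu a i j + d * EV mu b i j)"
  by (rule ext) (rule EV_lc)

lemma EV_self [simp]: "EV mu a i i = a i"
  by (simp add: EV_def)

text \<open>The case \<open>mu = 0\<close> of \<open>EV\<close>: the values of the harmonic extension.\<close>

definition hm :: "(3 \<Rightarrow> real) \<Rightarrow> 3 \<Rightarrow> 3 \<Rightarrow> real" where
  "hm a i j = (if i = j then a i else (a i + a j + (a 0 + a 1 + a 2)) / 5)"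

text \<open>Over the common denominator \<open>5 * D\<close> the numerators differ by a multiple of
  \<open>mu\<close>.\<close>

lemma EV_hm:
  assumes mu: "\<bar>mu\<bar> \<le> 1" and A: "\<And>k. \<bar>a k\<bar> \<le> A"
  shows "\<bar>EV mu a i j - hm a i j\<bar> \<le> 2 * \<bar>mu\<bar> * A"
proof -
  have A0: "0 \<le> A" using A[of 0] by linarith
  show ?thesis
  proof (cases "i = j")
    case True
    then show ?thesis using A0 by (simp add: hm_def)
  next
    case False
    define s where "s = a i + a j"
    define S where "S = a 0 + a 1 + a 2"
    define D where "D = (2 - mu) * (5 - mu)"
    have "1 * 4 \<le> D" unfolding D_def using mu by (intro mult_mono) auto
    then have D: "D \<ge> 4" by simp
    have 1: "EV mu a i j * D = (2 - mu) * s + 2 * S"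
      using False D by (simp add: EV_def s_def[symmetric] S_def[symmetric] D_def[symmetric])
    have 2: "hm a i j * 5 = s + S" using False by (simp add: hm_def s_def S_def)
    have "(EV mu a i j - hm a i j) * (5 * D) = 5 * (EV mu a i j * D) - (hm a i j * 5) * D" by (simp add: algebra_simps)
    also have "\<dots> = mu * (s * (2 - mu) + S * (7 - mu))" unfolding 1 2 by (simp add: D_def algebra_simps)
    finally have "(EV mu a i j - hm a i j) * (5 * D) = mu * (s * (2 - mu) + S * (7 - mu))" .
    then have e: "\<bar>EV mu a i j - hm a i j\<bar> * (5 * D) = \<bar>mu\<bar> * \<bar>s * (2 - mu) + S * (7 - mu)\<bar>"
      using D by (metis abs_mult abs_of_nonneg mult_nonneg_nonneg zero_le_numeral order_trans)
    have "\<bar>s * (2 - mu)\<bar> \<le> (2 * A) * 3" "\<bar>S * (7 - mu)\<bar> \<le> (3 * A) * 8"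
      unfolding abs_mult s_def S_def using A[of i] A[of j] A[of 0] A[of 1] A[of 2] mu by (intro mult_mono; arith)+
    then have "\<bar>s * (2 - mu) + S * (7 - mu)\<bar> \<le> 30 * A" by linarith
    then have "\<bar>EV mu a i j - hm a i j\<bar> * (5 * D) \<le> \<bar>mu\<bar> * (30 * A)"
      unfolding e by (intro mult_left_mono) auto
    moreover have "\<bar>EV mu a i j - hm a i j\<bar> * 20 \<le> \<bar>EV mu a i j - hm a i j\<bar> * (5 * D)"
      using D by (intro mult_left_mono) auto
    moreover have "0 \<le> \<bar>mu\<bar> * A" using A0 by simp
    ultimately show ?thesis by (simp add: mult.commute mult.left_commute)
  qed
qed

lemma hm_bound: "(\<And>k. \<bar>a k\<bar> \<le> A) \<Longrightarrow> \<bar>hm a i j\<bar> \<le> A"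
proof -
  assume A: "\<And>k. \<bar>a k\<bar> \<le> A"
  show ?thesis using A[of i] A[of j] A[of 0] A[of 1] A[of 2] unfolding hm_def by auto
qed

lemma hm_dev:
  fixes a :: "3 \<Rightarrow> real"
  assumes O: "\<And>k l. \<bar>a k - a l\<bar> \<le> C"
  shows "\<bar>3 * a i - (a 0 + a 1 + a 2)\<bar> \<le> 2 * C"
proof -
  have o: "\<bar>a 0 - a 1\<bar> \<le> C" "\<bar>a 0 - a 2\<bar> \<le> C" "\<bar>a 1 - a 2\<bar> \<le> C" using O by auto
  have "\<forall>i. \<bar>3 * a i - (a 0 + a 1 + a 2)\<bar> \<le> 2 * C"
    unfolding all3 using o by (intro conjI; arith)
  then show ?thesis by blast
qed

text \<open>Harmonic extension contracts the oscillation on each subcell by 3/5, the reciprocal of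
  the energy factor.\<close>

lemma hm_osc:
  fixes a :: "3 \<Rightarrow> real"
  assumes O: "\<And>k l. \<bar>a k - a l\<bar> \<le> C"
  shows "\<bar>hm a i j - hm a i k\<bar> \<le> 3 / 5 * C"
proof -
  define t where "t = 3 * a i - (a 0 + a 1 + a 2)"
  have t: "\<bar>t\<bar> \<le> 2 * C" unfolding t_def by (rule hm_dev[OF O])
  have C: "0 \<le> C" using O[of 0 0] by simp
  have h: "hm a i l = a i - (t + (a i - a l)) / 5" if "i \<noteq> l" for l
    using that by (simp add: hm_def t_def field_simps)
  have e: "\<bar>(t + (a i - a l)) / 5\<bar> \<le> 3 / 5 * C" for l using t O[of i l] by simp
  show ?thesis
  proof (cases "i = j")
    case True
    have 1: "hm a i j = a i" using True by (simp add: hm_def)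
    show ?thesis
    proof (cases "i = k")
      case True
      then show ?thesis using \<open>i = j\<close> C by simp
    next
      case False
      show ?thesis unfolding 1 h[OF False] using e[of k] by simp
    qed
  next
    case False
    show ?thesis
    proof (cases "i = k")
      case True
      have "hm a i k = a i" using True by (simp add: hm_def)
      then show ?thesis using e[of j] h[OF False] by simp
    next
      case f: False
      have 1: "hm a i j - hm a i k = (a j - a k) / 5" unfolding h[OF False] h[OF f] by (simp add: field_simps)
      show ?thesis unfolding 1 using O[of j k] C by simp
    qed
  qed
qed

lemma hm_mid:
  fixes a :: "3 \<Rightarrow> real"
  assumes O: "\<And>k l. \<bar>a k - a l\<bar> \<le> C"
  shows "\<bar>hm a i j - (a i + a j) / 2\<bar> \<le> C"
proof -
  define t where "t k = 3 * a k - (a 0 + a 1 + a 2)" for k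
  have t: "\<bar>t k\<bar> \<le> 2 * C" for k unfolding t_def by (rule hm_dev[OF O])
  have C: "0 \<le> C" using O[of 0 0] by simp
  show ?thesis
  proof (cases "i = j")
    case True
    then show ?thesis using C by (simp add: hm_def)
  next
    case False
    then have 1: "hm a i j - (a i + a j) / 2 = - (t i + t j) / 10" by (simp add: hm_def t_def field_simps)
    have "\<bar>t i + t j\<bar> \<le> 10 * C" using t[of i] t[of j] C by arith
    then show ?thesis unfolding 1 by simp
  qed
qed

context triangle
begin

section \<open>Gluing and approximating splines\<close>

definition glue :: "(3 \<Rightarrow> real^2 \<Rightarrow> real) \<Rightarrow> real^2 \<Rightarrow> real" where
  "glue h x = (if x \<in> F q 0 ` SG q then h 0 (2 *\<^sub>R x - q 0) else if x \<in> F q 1 ` SG q then h 1 (2 *\<^sub>R x - q 1)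
     else h 2 (2 *\<^sub>R x - q 2))"

text \<open>The branch depends on \<open>x\<close> alone and is the same for every \<open>h\<close>:
  limits, linearity and estimates pass through \<open>glue\<close> without comparing values at
  junctions.\<close>

lemma glue_chosen:
  assumes "x \<in> SG q"
  obtains j y where "y \<in> SG q" "x = F q j y" "\<And>h. glue h x = h j y"
proof -
  obtain i z where z: "z \<in> SG q" "x = F q i z" using SG_cases[OF assms] by metis
  consider y where "y \<in> SG q" "x = F q 0 y" | y where "y \<in> SG q" "x = F q 1 y" "x \<notin> F q 0 ` SG q"
    | "x \<notin> F q 0 ` SG q" "x \<notin> F q 1 ` SG q" by blast
  then show ?thesis
  proof cases
    case 1
    then show ?thesis using that[of y 0] by (auto simp: glue_def)
  next
    case 2
    then show ?thesis using that[of y 1] by (auto simp: glue_def)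
  next
    case 3
    then have "i = 2" using z ex3[of "\<lambda>k. i = k"] by auto
    then show ?thesis using that[of z 2] 3 z by (auto simp: glue_def)
  qed
qed

lemma glue_F:
  assumes c: "\<And>i j. h i (q j) = h j (q i)" and x: "x \<in> SG q"
  shows "glue h (F q i x) = h i x"
proof -
  obtain j y where y: "y \<in> SG q" "F q i x = F q j y" "glue h (F q i x) = h j y"
    using glue_chosen[OF F_SG[OF x]] by metis
  show ?thesis
  proof (cases "i = j")
    case False
    then show ?thesis using F_SG_Int[OF False x y(1,2)] y(3) c by simp
  qed (use y in simp)
qed

lemma glue_q: "glue h (q j) = h j (q j)"
proof -
  obtain k y where y: "y \<in> SG q" "q j = F q k y" "glue h (q j) = h k y"
    using glue_chosen[OF q_SG] by metis
  then have "k = j" "y = q j" using F_eq_q[OF y(1), of k j] by metis+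
  then show ?thesis using y(3) by simp
qed

lemma glue_continuous:
  assumes c: "\<And>i j. h i (q j) = h j (q i)" and h: "\<And>i. continuous_on (SG q) (h i)"
  shows "continuous_on (SG q) (glue h)"
proof -
  have "continuous_on (\<Union>j. F q j ` SG q) (glue h)"
  proof (rule continuous_on_closed_Union)
    show "closed (F q j ` SG q)" for j
      by (intro compact_imp_closed compact_continuous_image continuous_F compact_SG)
    show "continuous_on (F q j ` SG q) (glue h)" for j
    proof (rule continuous_on_eq)
      show "continuous_on (F q j ` SG q) (\<lambda>x. h j (2 *\<^sub>R x - q j))"
        by (rule continuous_on_compose2[OF h]) (auto intro!: continuous_intros)
      show "h j (2 *\<^sub>R x - q j) = glue h x" if "x \<in> F q j ` SG q" for x
        using that glue_F[of h, OF c] by auto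
    qed
  qed simp
  then show ?thesis using SG_eq by simp
qed

text \<open>\<open>n\<close> steps of decimation followed by linear interpolation in the cells; the
  spline is the limit.\<close>

primrec sapp :: "nat \<Rightarrow> (nat \<Rightarrow> real) \<Rightarrow> (3 \<Rightarrow> real) \<Rightarrow> real^2 \<Rightarrow> real" where
  "sapp 0 nu a = (\<lambda>x. \<Sum>k\<in>UNIV. bc k x * a k)"
| "sapp (Suc n) nu a = glue (\<lambda>i. sapp n (\<lambda>k. nu (Suc k)) (EV (nu 0) a i))"

lemma sapp_q: "sapp n nu a (q j) = a j"
proof (induction n arbitrary: nu a)
  case 0
  have "\<forall>j. (\<Sum>k\<in>UNIV. bc k (q j) * a k) = a j" by (simp add: all3 sum3 bar_q)
  then show ?case by simp
qed (simp add: glue_q)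

lemma sapp_F: "x \<in> SG q \<Longrightarrow> sapp (Suc n) nu a (F q i x) = sapp n (\<lambda>k. nu (Suc k)) (EV (nu 0) a i) x"
  unfolding sapp.simps(2) by (rule glue_F) (auto simp: sapp_q EV_sym)

lemma sapp_continuous: "continuous_on (SG q) (sapp n nu a)"
proof (induction n arbitrary: nu a)
  case 0
  show ?case by (auto intro!: continuous_intros bar_continuous)
next
  case (Suc n)
  show ?case unfolding sapp.simps(2) by (rule glue_continuous) (auto simp: sapp_q EV_sym intro: Suc)
qed

lemma sapp_lc: "x \<in> SG q \<Longrightarrow> sapp n nu (\<lambda>k. c * a k + d * b k) x = c * sapp n nu a x + d * sapp n nu b x"
proof (induction n arbitrary: nu a b x)
  case 0
  show ?case by (simp add: sum3 algebra_simps)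
next
  case (Suc n)
  obtain j y where y: "y \<in> SG q" "\<And>h. glue h x = h j y" using glue_chosen[OF Suc.prems] by metis
  show ?case unfolding sapp.simps(2) y(2) EV_lc' by (rule Suc.IH[OF y(1)])
qed

lemma bar_avg:
  assumes "x \<in> SG q" "\<And>k. \<bar>a k - b k\<bar> \<le> e"
  shows "\<bar>(\<Sum>k\<in>UNIV. bc k x * a k) - (\<Sum>k\<in>UNIV. bc k x * b k)\<bar> \<le> e"
proof -
  have "\<bar>(\<Sum>k\<in>UNIV. bc k x * a k) - (\<Sum>k\<in>UNIV. bc k x * b k)\<bar> = \<bar>\<Sum>k\<in>UNIV. bc k x * (a k - b k)\<bar>"
    by (simp add: sum_subtractf right_diff_distrib)
  also have "\<dots> \<le> (\<Sum>k\<in>UNIV. bc k x * e)"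
  proof (rule order_trans[OF sum_abs])
    show "(\<Sum>k\<in>UNIV. \<bar>bc k x * (a k - b k)\<bar>) \<le> (\<Sum>k\<in>UNIV. bc k x * e)"
      using assms bar_nonneg by (intro sum_mono) (simp add: abs_mult mult_left_mono)
  qed
  also have "\<dots> = e" using bar_sum[of x] by (simp add: sum3 distrib_right[symmetric])
  finally show ?thesis .
qed

text \<open>One step turns \<open>C\<close> into \<open>3/5 * C + 4 * (d * A)\<close>,
  \<open>d\<close> into \<open>d / 5\<close> and \<open>A\<close> into
  \<open>(1 + 2 * d) * A\<close>. The weight 8 makes \<open>C + 8 * d * A\<close> shrink by 4/5 as
  long as \<open>d \<le> 1/5\<close>.\<close>

lemma sapp_diff:
  "\<lbrakk>x \<in> SG q; 0 \<le> d; d \<le> 1/5; \<And>j. \<bar>nu j\<bar> \<le> d / 5 ^ j; \<And>k. \<bar>a k\<bar> \<le> A; \<And>k l. \<bar>a k - a l\<bar> \<le> C\<rbrakk> \<Longrightarrow>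
    \<bar>sapp (Suc n) nu a x - sapp n nu a x\<bar> \<le> (4/5) ^ n * (C + 8 * d * A)"
proof (induction n arbitrary: nu a x d A C)
  case 0
  have A0: "0 \<le> A" using 0(5)[of 0] by linarith
  have nu: "\<bar>nu 0\<bar> \<le> d" using 0(4)[of 0] by simp
  have dA: "\<bar>nu 0\<bar> * A \<le> d * A" using nu A0 by (intro mult_right_mono)
  obtain i y where y: "y \<in> SG q" "x = F q i y" using SG_cases[OF 0(1)] by metis
  have 1: "sapp (Suc 0) nu a x = (\<Sum>k\<in>UNIV. bc k y * EV (nu 0) a i k)" using y by (simp add: sapp_F del: sapp.simps(2))
  have "\<forall>i. (\<Sum>k\<in>UNIV. bc k (F q i y) * a k) = (\<Sum>k\<in>UNIV. bc k y * ((a i + a k) / 2))"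
  proof -
    have s: "bc 0 y = 1 - bc 1 y - bc 2 y" using bar_sum[of y] by linarith
    show ?thesis unfolding all3 sum3 bar_F s by (simp add: field_simps)
  qed
  then have 2: "sapp 0 nu a x = (\<Sum>k\<in>UNIV. bc k y * ((a i + a k) / 2))" using y by simp
  have "\<bar>EV (nu 0) a i k - (a i + a k) / 2\<bar> \<le> C + 8 * d * A" for k
  proof -
    have "\<bar>EV (nu 0) a i k - hm a i k\<bar> \<le> 2 * \<bar>nu 0\<bar> * A" by (rule EV_hm) (use nu 0 in auto)
    moreover have "\<bar>hm a i k - (a i + a k) / 2\<bar> \<le> C" by (rule hm_mid) (use 0 in auto)
    moreover have "0 \<le> d * A" using 0(2) A0 by simp
    ultimately show ?thesis using dA by linarith
  qed
  then have "\<bar>(\<Sum>k\<in>UNIV. bc k y * EV (nu 0) a i k) - (\<Sum>k\<in>UNIV. bc k y * ((a i + a k) / 2))\<bar> \<le> C + 8 * d * A"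
    by (rule bar_avg[OF y(1)])
  then show ?case unfolding 1 2 power_0 mult_1_left .
next
  case (Suc n)
  have A0: "0 \<le> A" using Suc.prems(5)[of 0] by linarith
  have nu: "\<bar>nu 0\<bar> \<le> d" using Suc.prems(4)[of 0] by simp
  have dA: "\<bar>nu 0\<bar> * A \<le> d * A" using nu A0 by (intro mult_right_mono)
  obtain i y where y: "y \<in> SG q" "x = F q i y" using SG_cases[OF Suc.prems(1)] by metis
  have ev: "\<bar>EV (nu 0) a i k - hm a i k\<bar> \<le> 2 * (d * A)" for k
  proof -
    have "\<bar>EV (nu 0) a i k - hm a i k\<bar> \<le> 2 * \<bar>nu 0\<bar> * A" by (rule EV_hm) (use nu Suc.prems in auto)
    then show ?thesis using dA by linarith
  qed
  have 1: "\<bar>EV (nu 0) a i k\<bar> \<le> (1 + 2 * d) * A" for k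
    using ev[of k] hm_bound[of a A i k, OF Suc.prems(5)] by (simp add: algebra_simps)
  have 2: "\<bar>EV (nu 0) a i k - EV (nu 0) a i l\<bar> \<le> 3 / 5 * C + 4 * (d * A)" for k l
    using ev[of k] ev[of l] hm_osc[of a C i k l, OF Suc.prems(6)] by linarith
  have 3: "\<bar>nu (Suc j)\<bar> \<le> (d / 5) / 5 ^ j" for j using Suc.prems(4)[of "Suc j"] by simp
  have "\<bar>sapp (Suc n) (\<lambda>k. nu (Suc k)) (EV (nu 0) a i) y - sapp n (\<lambda>k. nu (Suc k)) (EV (nu 0) a i) y\<bar>
     \<le> (4/5) ^ n * ((3 / 5 * C + 4 * (d * A)) + 8 * (d / 5) * ((1 + 2 * d) * A))"
    by (rule Suc.IH[OF y(1) _ _ 3 1 2]) (use Suc.prems in auto)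
  also have "\<dots> \<le> (4/5) ^ n * (4 / 5 * (C + 8 * d * A))"
  proof (intro mult_left_mono)
    have C0: "0 \<le> C" using Suc.prems(6)[of 0 0] by simp
    have "d * (d * A) \<le> (1/5) * (d * A)" using Suc.prems(2,3) A0 by (intro mult_right_mono) auto
    moreover have "0 \<le> d * A" using Suc.prems(2) A0 by simp
    moreover have "(3 / 5 * C + 4 * (d * A)) + 8 * (d / 5) * ((1 + 2 * d) * A)
      = 3 / 5 * C + 28 / 5 * (d * A) + 16 / 5 * (d * (d * A))" by (simp add: field_simps)
    moreover have "4 / 5 * (C + 8 * d * A) = 4 / 5 * C + 32 / 5 * (d * A)" by (simp add: field_simps)
    ultimately show "(3 / 5 * C + 4 * (d * A)) + 8 * (d / 5) * ((1 + 2 * d) * A) \<le> 4 / 5 * (C + 8 * d * A)"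
      using C0 by linarith
  qed simp
  also have "\<dots> = (4/5) ^ Suc n * (C + 8 * d * A)" by simp
  finally show ?case unfolding y(2) sapp_F[OF y(1)] .
qed

definition uconv :: "(nat \<Rightarrow> real) \<Rightarrow> bool" where
  "uconv nu \<longleftrightarrow> (\<forall>a. \<exists>l. uniform_limit (SG q) (\<lambda>n. sapp n nu a) l sequentially)"

lemma uconv_small:
  assumes nu: "\<And>j. \<bar>nu j\<bar> \<le> (1/5) / 5 ^ j"
  shows "uconv nu"
  unfolding uconv_def
proof (rule allI)
  fix a :: "3 \<Rightarrow> real"
  define A where "A = \<bar>a 0\<bar> + \<bar>a 1\<bar> + \<bar>a 2\<bar>"
  have "\<forall>k. \<bar>a k\<bar> \<le> A" by (simp add: all3 A_def)
  then have A: "\<bar>a k\<bar> \<le> A" for k by blast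
  have C: "\<bar>a k - a l\<bar> \<le> 2 * A" for k l using A[of k] A[of l] by linarith
  define f where "f n x = sapp (Suc n) nu a x - sapp n nu a x" for n x
  have "uniform_limit (SG q) (\<lambda>n x. \<Sum>i<n. f i x) (\<lambda>x. suminf (\<lambda>i. f i x)) sequentially"
  proof (rule Weierstrass_m_test)
    show "norm (f n x) \<le> (4/5) ^ n * (2 * A + 8 * (1/5) * A)" if "x \<in> SG q" for n x
      unfolding f_def real_norm_def by (rule sapp_diff[OF that _ _ nu A C]) auto
    show "summable (\<lambda>n. (4/5) ^ n * (2 * A + 8 * (1/5) * A))" by (intro summable_mult2 summable_geometric) simp
  qed
  then have "uniform_limit (SG q) (\<lambda>n x. sapp 0 nu a x + (\<Sum>i<n. f i x)) (\<lambda>x. sapp 0 nu a x + suminf (\<lambda>i. f i x)) sequentially"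
    by (intro uniform_limit_intros)
  moreover have "sapp 0 nu a x + (\<Sum>i<n. f i x) = sapp n nu a x" for n x
    unfolding f_def by (subst sum_lessThan_telescope) simp
  ultimately show "\<exists>l. uniform_limit (SG q) (\<lambda>n. sapp n nu a) l sequentially" by auto
qed

text \<open>A first decimation step with any \<open>nu 0\<close> preserves convergence, so the
  smallness demanded by \<open>uconv_small\<close> need only hold from some level on.\<close>

lemma uconv_Suc:
  assumes "uconv (\<lambda>k. nu (Suc k))" shows "uconv nu"
  unfolding uconv_def
proof (rule allI)
  fix a
  have "\<forall>i. \<exists>l. uniform_limit (SG q) (\<lambda>n. sapp n (\<lambda>k. nu (Suc k)) (EV (nu 0) a i)) l sequentially"
    using assms unfolding uconv_def by blast
  then obtain l where l: "\<And>i. uniform_limit (SG q) (\<lambda>n. sapp n (\<lambda>k. nu (Suc k)) (EV (nu 0) a i)) (l i) sequentially"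
    by metis
  have "uniform_limit (SG q) (\<lambda>n. sapp n nu a) (glue l) sequentially"
    unfolding uniform_limit_sequentially_iff
  proof (intro allI impI)
    fix e :: real assume "e > 0"
    then have "\<forall>i. \<exists>N. \<forall>n\<ge>N. \<forall>x\<in>SG q. dist (sapp n (\<lambda>k. nu (Suc k)) (EV (nu 0) a i) x) (l i x) < e"
      using l unfolding uniform_limit_sequentially_iff by blast
    then obtain N where N: "\<And>i n x. n \<ge> N i \<Longrightarrow> x \<in> SG q \<Longrightarrow> dist (sapp n (\<lambda>k. nu (Suc k)) (EV (nu 0) a i) x) (l i x) < e"
      by metis
    have "dist (sapp n nu a x) (glue l x) < e" if n: "n \<ge> Suc (N 0 + N 1 + N 2)" and x: "x \<in> SG q" for n x
    proof -
      obtain m where m: "n = Suc m" "m \<ge> N 0 + N 1 + N 2" using n by (cases n) auto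
      have "\<forall>i. N i \<le> m" using m(2) by (simp add: all3)
      obtain j y where y: "y \<in> SG q" "\<And>h. glue h x = h j y" using glue_chosen[OF x] by metis
      show ?thesis unfolding m sapp.simps(2) y(2) by (rule N[OF _ y(1)]) (use \<open>\<forall>i. N i \<le> m\<close> in blast)
    qed
    then show "\<exists>N. \<forall>n\<ge>N. \<forall>x\<in>SG q. dist (sapp n nu a x) (glue l x) < e" by blast
  qed
  then show "\<exists>l. uniform_limit (SG q) (\<lambda>n. sapp n nu a) l sequentially" by blast
qed

lemma uconv: "okseq nu \<Longrightarrow> uconv nu"
proof -
  assume "okseq nu"
  then obtain D where D: "\<And>j. \<bar>nu j\<bar> \<le> D / 5 ^ j" by (auto simp: okseq_def)
  \<comment> \<open>After \<open>N\<close> steps the bound \<open>D / 5 ^ N\<close> is below 1/5, as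
    \<open>uconv_small\<close> demands.\<close>
  obtain N where N: "5 * D < 5 ^ N" using real_arch_pow[of 5 "5 * D"] by auto
  have "\<bar>nu (N + j)\<bar> \<le> (1/5) / 5 ^ j" for j
  proof -
    have "\<bar>nu (N + j)\<bar> \<le> D / 5 ^ (N + j)" by (rule D)
    also have "\<dots> = (D / 5 ^ N) / 5 ^ j" by (simp add: power_add)
    also have "\<dots> \<le> (1/5) / 5 ^ j" using N by (intro divide_right_mono) (simp_all add: field_simps)
    finally show ?thesis .
  qed
  then show ?thesis
  proof (induction N arbitrary: nu)
    case 0
    then show ?case by (intro uconv_small) simp
  next
    case (Suc N)
    have "uconv (\<lambda>k. nu (Suc k))" by (rule Suc.IH) (use Suc.prems in simp)
    then show ?case by (rule uconv_Suc)
  qed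
qed

text \<open>\<open>spl nu a\<close> is the \<open>\<lambda>\<close>-eigenfunction on a cell with corner values \<open>a\<close>; its level-\<open>n\<close> values arise
  by decimation with the graph eigenvalues \<open>nu 0\<close>, \<open>nu 1\<close>, \<dots>.\<close>

definition spl :: "(nat \<Rightarrow> real) \<Rightarrow> (3 \<Rightarrow> real) \<Rightarrow> real^2 \<Rightarrow> real" where
  "spl nu a x = lim (\<lambda>n. sapp n nu a x)"

lemma spl_uniform: "okseq nu \<Longrightarrow> uniform_limit (SG q) (\<lambda>n. sapp n nu a) (spl nu a) sequentially"
proof -
  assume "okseq nu"
  then obtain l where l: "uniform_limit (SG q) (\<lambda>n. sapp n nu a) l sequentially" using uconv uconv_def by blast
  have "spl nu a x = l x" if "x \<in> SG q" for x
    unfolding spl_def by (rule limI[OF tendsto_uniform_limitI[OF l that]])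
  then show ?thesis using l uniform_limit_cong'[of "SG q" "\<lambda>n. sapp n nu a" "\<lambda>n. sapp n nu a" "spl nu a" l] by simp
qed

lemma spl_tendsto: "okseq nu \<Longrightarrow> x \<in> SG q \<Longrightarrow> (\<lambda>n. sapp n nu a x) \<longlonglongrightarrow> spl nu a x"
  by (rule tendsto_uniform_limitI[OF spl_uniform])

lemma spl_continuous: "okseq nu \<Longrightarrow> continuous_on (SG q) (spl nu a)"
  by (rule uniform_limit_theorem[OF _ spl_uniform]) (simp_all add: sapp_continuous)

lemma spl_q [simp]: "spl nu a (q j) = a j"
  unfolding spl_def sapp_q by simp

lemma spl_F: "okseq nu \<Longrightarrow> x \<in> SG q \<Longrightarrow> spl nu a (F q i x) = spl (\<lambda>k. nu (Suc k)) (EV (nu 0) a i) x"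
proof -
  assume nu: "okseq nu" and x: "x \<in> SG q"
  have "(\<lambda>n. sapp (Suc n) nu a (F q i x)) \<longlonglongrightarrow> spl nu a (F q i x)"
    using spl_tendsto[OF nu F_SG[OF x]] by (rule LIMSEQ_Suc)
  moreover have "(\<lambda>n. sapp (Suc n) nu a (F q i x)) \<longlonglongrightarrow> spl (\<lambda>k. nu (Suc k)) (EV (nu 0) a i) x"
    unfolding sapp_F[OF x] by (rule spl_tendsto[OF okseq_Suc[OF nu] x])
  ultimately show ?thesis by (rule LIMSEQ_unique)
qed

lemma spl_lc: "okseq nu \<Longrightarrow> x \<in> SG q \<Longrightarrow> spl nu (\<lambda>k. c * a k + d * b k) x = c * spl nu a x + d * spl nu b x"
proof (rule LIMSEQ_unique)
  assume nu: "okseq nu" and x: "x \<in> SG q"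
  show "(\<lambda>n. sapp n nu (\<lambda>k. c * a k + d * b k) x) \<longlonglongrightarrow> spl nu (\<lambda>k. c * a k + d * b k) x" by (rule spl_tendsto[OF nu x])
  show "(\<lambda>n. sapp n nu (\<lambda>k. c * a k + d * b k) x) \<longlonglongrightarrow> c * spl nu a x + d * spl nu b x"
    unfolding sapp_lc[OF x] by (intro tendsto_intros spl_tendsto nu x)
qed

lemma vertex_SG [simp]: "foldr (F q) w (q j) \<in> SG q"
  by (rule foldr_F_SG) simp

lemma code_cong: "(\<And>x. x \<in> SG q \<Longrightarrow> u x = v x) \<Longrightarrow> code u = code v"
  by (auto simp: code_def)

lemma code_spl_F: "okseq nu \<Longrightarrow> code (\<lambda>x. spl nu a (F q i x)) = code (spl (\<lambda>k. nu (Suc k)) (EV (nu 0) a i))"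
  by (rule code_cong) (rule spl_F)

lemma dec_spl: "okseq nu \<Longrightarrow> dec (nu n) n (code (spl nu a))"
proof (induction n arbitrary: nu a)
  case 0
  then show ?case by (simp add: spl_F)
next
  case (Suc n)
  show ?case using Suc.IH[OF okseq_Suc[OF Suc.prems]] by (simp add: code_spl_F[OF Suc.prems])
qed

section \<open>Splines with prescribed values on level \<open>m\<close>\<close>

primrec fspl :: "nat \<Rightarrow> (nat \<Rightarrow> real) \<Rightarrow> code \<Rightarrow> real^2 \<Rightarrow> real" where
  "fspl 0 nu f = spl nu (\<lambda>k. f ([], k))"
| "fspl (Suc m) nu f = glue (\<lambda>i. fspl m nu (sh f i))"

lemma fspl_q: "fspl m nu f (q j) = f (crn m j)"
  by (induction m arbitrary: f) (simp_all add: glue_q crn_Suc, simp add: crn_def)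

lemma fspl_F: "cmp (Suc m) f \<Longrightarrow> x \<in> SG q \<Longrightarrow> fspl (Suc m) nu f (F q i x) = fspl m nu (sh f i) x"
  unfolding fspl.simps(2) by (rule glue_F) (auto simp: fspl_q)

lemma fspl_continuous: "okseq nu \<Longrightarrow> cmp m f \<Longrightarrow> continuous_on (SG q) (fspl m nu f)"
proof (induction m arbitrary: f)
  case 0
  then show ?case by (simp add: spl_continuous)
next
  case (Suc m)
  show ?case unfolding fspl.simps(2) by (rule glue_continuous) (use Suc in \<open>auto simp: fspl_q\<close>)
qed

lemma fspl_lc: "okseq nu \<Longrightarrow> x \<in> SG q \<Longrightarrow> fspl m nu (lc c f d g) x = c * fspl m nu f x + d * fspl m nu g x"
proof (induction m arbitrary: f g x)
  case 0
  then show ?case by (simp add: spl_lc)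
next
  case (Suc m)
  obtain j y where y: "y \<in> SG q" "\<And>h. glue h x = h j y" using glue_chosen[OF Suc.prems(2)] by metis
  show ?case unfolding fspl.simps(2) y(2) sh_lc by (rule Suc.IH[OF Suc.prems(1) y(1)])
qed

lemma code_fspl_F: "cmp (Suc m) f \<Longrightarrow> code (\<lambda>x. fspl (Suc m) nu f (F q i x)) = code (fspl m nu (sh f i))"
  by (rule code_cong) (rule fspl_F)

lemma res_code_fspl: "cmp m f \<Longrightarrow> res m (code (fspl m nu f)) = res m f"
proof (induction m arbitrary: f)
  case 0
  show ?case by (auto simp: res_def)
next
  case (Suc m)
  show ?case
    by (rule code_eqI) (use Suc in \<open>simp_all add: code_fspl_F[OF Suc.prems] del: fspl.simps\<close>)
qed

lemma dec_fspl: "okseq nu \<Longrightarrow> cmp m f \<Longrightarrow> dec (nu n) (m + n) (code (fspl m nu f))"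
proof (induction m arbitrary: f)
  case 0
  then show ?case by (simp add: dec_spl)
next
  case (Suc m)
  then show ?case by (simp add: code_fspl_F[OF Suc.prems(2)] del: fspl.simps)
qed

text \<open>In the cut cell the spline of the reflected corner values is taken on the whole cell, so
  that parity passes to all finer levels.\<close>

primrec hspl :: "bool \<Rightarrow> nat \<Rightarrow> (nat \<Rightarrow> real) \<Rightarrow> code \<Rightarrow> real^2 \<Rightarrow> real" where
  "hspl b 0 nu f = spl nu (hval b (f ([], 0)) (f ([], 1)))"
| "hspl b (Suc m) nu f = (\<lambda>x. if x \<in> F q 0 ` SG q then hspl b m nu (sh f 0) (2 *\<^sub>R x - q 0)
     else fspl m nu (sh f 1) (2 *\<^sub>R x - q 1))"

lemma hspl_F0: "x \<in> SG q \<Longrightarrow> hspl b (Suc m) nu f (F q 0 x) = hspl b m nu (sh f 0) x"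
  by simp

lemma hspl_q1: "hspl b m nu f (q 1) = f (crn m 1)"
proof (cases m)
  case 0
  then show ?thesis by (simp add: hval_def crn_def)
next
  case (Suc k)
  have "q 1 \<notin> F q 0 ` SG q"
  proof
    assume "q 1 \<in> F q 0 ` SG q"
    then obtain y where "y \<in> SG q" "q 1 = F q 0 y" by blast
    then show False using F_eq_q[of y 0 1] by simp
  qed
  then show ?thesis using Suc by (simp add: scaleR_2 fspl_q crn_Suc)
qed

lemma hspl_F1: "hcmp (Suc m) f \<Longrightarrow> x \<in> SG q \<Longrightarrow> hspl b (Suc m) nu f (F q 1 x) = fspl m nu (sh f 1) x"
proof (cases "F q 1 x \<in> F q 0 ` SG q")
  case True
  assume f: "hcmp (Suc m) f" and x: "x \<in> SG q"
  obtain y where y: "y \<in> SG q" "F q 1 x = F q 0 y" using True by blast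
  then have "x = q 0" "y = q 1" using F_SG_Int[of 1 0 x y] x by auto
  then show ?thesis using hspl_F0[OF y(1), of b m nu f] y f by (simp add: hspl_q1 fspl_q)
qed simp

lemma K_eq: "K = F q 0 ` K \<union> F q 1 ` SG q"
  using K_cases F0_K F1_K K_SG by blast

lemma hspl_continuous: "okseq nu \<Longrightarrow> hcmp m f \<Longrightarrow> continuous_on K (hspl b m nu f)"
proof (induction m arbitrary: f)
  case 0
  then show ?case using continuous_on_subset[OF spl_continuous K_SG] by simp
next
  case (Suc m)
  have "continuous_on (F q 0 ` K \<union> F q 1 ` SG q) (hspl b (Suc m) nu f)"
  proof (rule continuous_on_closed_Un)
    show "closed (F q 0 ` K)" "closed (F q 1 ` SG q)"
      by (intro compact_imp_closed compact_continuous_image continuous_F compact_SG compact_K)+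
    show "continuous_on (F q 0 ` K) (hspl b (Suc m) nu f)"
    proof (rule continuous_on_eq)
      show "continuous_on (F q 0 ` K) (\<lambda>x. hspl b m nu (sh f 0) (2 *\<^sub>R x - q 0))"
        by (rule continuous_on_compose2[OF Suc.IH[OF Suc.prems(1), of "sh f 0"]])
          (use Suc.prems in \<open>auto intro!: continuous_intros\<close>)
      fix x assume "x \<in> F q 0 ` K"
      then obtain y where y: "y \<in> K" "x = F q 0 y" by blast
      then have "y \<in> SG q" using K_SG by blast
      then show "hspl b m nu (sh f 0) (2 *\<^sub>R x - q 0) = hspl b (Suc m) nu f x"
        using hspl_F0[of y, where b = b and m = m and nu = nu and f = f] y(2) by (simp del: hspl.simps)
    qed
    show "continuous_on (F q 1 ` SG q) (hspl b (Suc m) nu f)"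
    proof (rule continuous_on_eq)
      show "continuous_on (F q 1 ` SG q) (\<lambda>x. fspl m nu (sh f 1) (2 *\<^sub>R x - q 1))"
        by (rule continuous_on_compose2[OF fspl_continuous[OF Suc.prems(1), of m "sh f 1"]])
          (use Suc.prems in \<open>auto intro!: continuous_intros\<close>)
      fix x assume "x \<in> F q 1 ` SG q"
      then obtain y where y: "y \<in> SG q" "x = F q 1 y" by blast
      then show "fspl m nu (sh f 1) (2 *\<^sub>R x - q 1) = hspl b (Suc m) nu f x"
        using hspl_F1[OF Suc.prems(2), of y, where b = b and nu = nu] by (simp del: hspl.simps)
    qed
  qed
  then show ?case using K_eq by simp
qed

lemma hspl_lc: "okseq nu \<Longrightarrow> x \<in> K \<Longrightarrow> hspl b m nu (lc c f d g) x = c * hspl b m nu f x + d * hspl b m nu g x"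
proof (induction m arbitrary: f g x)
  case 0
  have e: "hval b (c * u + d * u') (c * v + d * v') = (\<lambda>k. c * hval b u v k + d * hval b u' v' k)" for u u' v v'
    by (auto simp: hval_def)
  show ?case using spl_lc[OF 0(1), of x] 0(2) K_SG by (auto simp: e)
next
  case (Suc m)
  show ?case
  proof (cases "x \<in> F q 0 ` SG q")
    case True
    then obtain y where y: "y \<in> SG q" "x = F q 0 y" by blast
    then have "y \<in> K" using F0_K Suc.prems by simp
    then show ?thesis unfolding y(2) hspl_F0[OF y(1)] sh_lc by (rule Suc.IH[OF Suc.prems(1)])
  next
    case False
    then have "x \<in> F q 1 ` SG q" using Suc.prems(2) K_eq K_SG by blast
    then obtain y where y: "y \<in> SG q" "x = F q 1 y" by blast
    have e: "hspl b (Suc m) nu g' x = fspl m nu (sh g' 1) y" for g' using False y by simp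
    show ?thesis unfolding e sh_lc by (rule fspl_lc[OF Suc.prems(1) y(1)])
  qed
qed

lemma code_hspl_F0: "code (\<lambda>x. hspl b (Suc m) nu f (F q 0 x)) = code (hspl b m nu (sh f 0))"
  by (rule code_cong) (rule hspl_F0)

lemma code_hspl_F1: "hcmp (Suc m) f \<Longrightarrow> code (\<lambda>x. hspl b (Suc m) nu f (F q 1 x)) = code (fspl m nu (sh f 1))"
  by (rule code_cong) (rule hspl_F1)

lemma hres_code_hspl: "hcmp m f \<Longrightarrow> hres m (code (hspl b m nu f)) = hres m f"
proof (induction m arbitrary: f)
  case 0
  have "(\<forall>j. j \<noteq> 2 \<longrightarrow> hval b (f ([], 0)) (f ([], 1)) j = f ([], j))" by (simp add: all3 hval_def)
  then show ?case by (auto simp: fun_eq_iff)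
next
  case (Suc m)
  have s: "hres m (code (hspl b m nu (sh f 0))) = hres m (sh f 0)" by (rule Suc.IH) (use Suc.prems in simp)
  have t: "res m (code (fspl m nu (sh f 1))) = res m (sh f 1)" by (rule res_code_fspl) (use Suc.prems in simp)
  have "\<forall>i. sh (hres (Suc m) (code (hspl b (Suc m) nu f))) i = sh (hres (Suc m) f) i"
    unfolding all3 sh_hres sh_code code_hspl_F0 code_hspl_F1[OF Suc.prems] s t by simp
  then show ?case by (intro code_eqI[of "hres _ _"]) simp_all
qed

text \<open>Decimation commutes with the reflection, so the subcell at \<open>q 0\<close> again
  carries reflected values and the recursion towards \<open>q 0\<close> closes up.\<close>

lemma EV_hval0: "mu \<noteq> 2 \<Longrightarrow> (b \<longrightarrow> u = 0) \<Longrightarrow> EV mu (hval b u v) 0 = hval b u (EV mu (hval b u v) 0 1)"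
proof -
  assume "mu \<noteq> 2" and u: "b \<longrightarrow> u = 0"
  have "\<forall>j. EV mu (hval b u v) 0 j = hval b u (EV mu (hval b u v) 0 1) j"
    using u by (cases b) (simp_all add: all3 EV_def hval_def)
  then show ?thesis by blast
qed

lemma hdec_spl: "okseq nu \<Longrightarrow> (\<And>j. nu j \<noteq> 2) \<Longrightarrow> (b \<longrightarrow> u = 0) \<Longrightarrow> hdec b (nu n) n (code (spl nu (hval b u v)))"
proof (induction n arbitrary: nu v)
  case 0
  have "hval b u v 0 = u" "hval b u v 1 = v" by (simp_all add: hval_def)
  then show ?case using 0(1) by (simp add: spl_F Let_def)
next
  case (Suc n)
  have "hdec b (nu (Suc n)) n (code (spl (\<lambda>k. nu (Suc k)) (hval b u (EV (nu 0) (hval b u v) 0 1))))"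
    using Suc.IH[OF okseq_Suc[OF Suc.prems(1)]] Suc.prems(2,3) by blast
  then show ?case
    using dec_spl[OF okseq_Suc[OF Suc.prems(1)], of n] EV_hval0[OF Suc.prems(2,3)]
    by (simp add: code_spl_F[OF Suc.prems(1)])
qed

lemma hdec_hspl: "okseq nu \<Longrightarrow> (\<And>j. nu j \<noteq> 2) \<Longrightarrow> hcmp m f \<Longrightarrow> (b \<longrightarrow> hz m f) \<Longrightarrow>
    hdec b (nu n) (m + n) (code (hspl b m nu f))"
proof (induction m arbitrary: f)
  case 0
  then show ?case by (simp add: hdec_spl)
next
  case (Suc m)
  have "hdec b (nu n) (m + n) (code (hspl b m nu (sh f 0)))" by (rule Suc.IH) (use Suc.prems in auto)
  moreover have "dec (nu n) (m + n) (code (fspl m nu (sh f 1)))" by (rule dec_fspl) (use Suc.prems in auto)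
  ultimately show ?case
    unfolding add_Suc hdec.simps(2) sh_code code_hspl_F0 code_hspl_F1[OF Suc.prems(3)] by blast
qed

text \<open>An odd spline vanishes on the symmetry axis. In the even case \<open>v = 0\<close> makes
  all corner values 0.\<close>

lemma spl_X:
  assumes "okseq nu" "\<And>j. nu j \<noteq> 2" "b \<or> v = 0"
  shows "spl nu (hval b 0 v) ((F q 0 ^^ k) (F q 1 (q 2))) = 0"
  using assms
proof (induction k arbitrary: nu v)
  case 0
  have "EV (nu 0) (hval b 0 v) 1 2 = 0" using 0 by (auto simp: EV_def hval_def)
  then show ?case using 0 by (simp add: spl_F)
next
  case (Suc k)
  have p: "(F q 0 ^^ k) (F q 1 (q 2)) \<in> SG q" by (induction k) (simp_all add: F_SG)
  have "b \<or> EV (nu 0) (hval b 0 v) 0 1 = 0" using Suc.prems(3) by (auto simp: EV_def hval_def)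
  then have "spl (\<lambda>k. nu (Suc k)) (hval b 0 (EV (nu 0) (hval b 0 v) 0 1)) ((F q 0 ^^ k) (F q 1 (q 2))) = 0"
    using Suc.IH[OF okseq_Suc[OF Suc.prems(1)]] Suc.prems(2) by blast
  then show ?case using EV_hval0[OF Suc.prems(2), of b 0] by (simp add: spl_F[OF Suc.prems(1) p])
qed

lemma bd_Omega_cases: "x \<in> bd_Omega q \<Longrightarrow> x = q 0 \<or> x = q 1 \<or> (\<exists>k. x = (F q 0 ^^ k) (F q 1 (q 2)))"
  unfolding bd_Omega_def X_def using F_comm[of 2 1] by auto

lemma hspl_bd':
  assumes nu: "okseq nu" "\<And>j. nu j \<noteq> 2"
  shows "hz m f \<Longrightarrow> hcmp m f \<Longrightarrow> b \<or> f (replicate m 0, 1) = 0 \<Longrightarrow> x \<in> bd_Omega q - {q 1} \<Longrightarrow> hspl b m nu f x = 0"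
proof (induction m arbitrary: f x)
  case 0
  have f0: "f ([], 0) = 0" using 0(1) by simp
  from 0(4) consider "x = q 0" | k where "x = (F q 0 ^^ k) (F q 1 (q 2))" using bd_Omega_cases by blast
  then show ?case
  proof cases
    case 1
    then show ?thesis using f0 by (simp add: hval_def)
  next
    case 2
    then show ?thesis using spl_X[OF nu, of b "f ([], 1)" k] 0(3) f0 by simp
  qed
next
  case (Suc m)
  have f: "hz m (sh f 0)" "hcmp m (sh f 0)" "b \<or> sh f 0 (replicate m 0, 1) = 0" "sh f 1 (crn m 2) = 0"
    using Suc.prems by simp_all
  have "x = F q 1 (q 2) \<or> (\<exists>y\<in>bd_Omega q - {q 1}. x = F q 0 y)" using Suc.prems(4) bd_Omega_F by blast
  then show ?case
  proof
    assume "x = F q 1 (q 2)"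
    then show ?thesis using hspl_F1[OF Suc.prems(2), of "q 2", where b = b and nu = nu] f(4) by (simp add: fspl_q del: hspl.simps)
  next
    assume "\<exists>y\<in>bd_Omega q - {q 1}. x = F q 0 y"
    then obtain y where y: "y \<in> bd_Omega q - {q 1}" "x = F q 0 y" by blast
    then have "y \<in> SG q" using bd_K K_SG by blast
    then show ?thesis using hspl_F0[of y, where b = b and m = m and nu = nu and f = f] Suc.IH[OF f(1,2,3) y(1)] y(2) by (simp del: hspl.simps)
  qed
qed

lemma hspl_bd:
  assumes "okseq nu" "\<And>j. nu j \<noteq> 2" "hz m f" "hcmp m f" "b \<or> f (replicate m 0, 1) = 0" "f (crn m 1) = 0" "x \<in> bd_Omega q"
  shows "hspl b m nu f x = 0"
  using hspl_bd'[OF assms(1-5), of x] assms(6,7) hspl_q1[where b = b and m = m and nu = nu and f = f] by (cases "x = q 1") auto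

definition kspl :: "bool \<Rightarrow> nat \<Rightarrow> (nat \<Rightarrow> real) \<Rightarrow> code \<Rightarrow> real^2 \<Rightarrow> real" where
  "kspl b m nu f x = (if x \<in> K then hspl b m nu f x else 0)"

lemma hres_code_cong: "(\<And>x. x \<in> K \<Longrightarrow> u x = v x) \<Longrightarrow> hres n (code u) = hres n (code v)"
proof (induction n arbitrary: u v)
  case 0
  have "\<forall>j. j \<noteq> 2 \<longrightarrow> u (q j) = v (q j)" using 0 by (simp add: all3)
  then show ?case by (auto simp: fun_eq_iff)
next
  case (Suc n)
  have 0: "hres n (code (\<lambda>x. u (F q 0 x))) = hres n (code (\<lambda>x. v (F q 0 x)))"
    by (rule Suc.IH) (use Suc.prems F0_K K_SG in blast)
  have 1: "code (\<lambda>x. u (F q 1 x)) = code (\<lambda>x. v (F q 1 x))"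
    by (rule code_cong) (use Suc.prems F1_K in blast)
  have "\<forall>i. sh (hres (Suc n) (code u)) i = sh (hres (Suc n) (code v)) i"
    unfolding all3 sh_hres sh_code 0 1 by simp
  then show ?case by (intro code_eqI[of "hres _ _"]) simp_all
qed

lemma hdec_hres: "hdec b mu n (hres (Suc n) f) = hdec b mu n f"
proof (induction n arbitrary: f)
  case 0
  show ?case by (simp add: hres.simps(2) jn_def res_def)
next
  case (Suc n)
  have "dec mu m (res (Suc m) g) = dec mu m g" for m g
  proof (induction m arbitrary: g)
    case 0
    show ?case by (simp add: res_def)
  qed simp
  then show ?case using Suc by simp
qed

lemma hdec_code_cong: "(\<And>x. x \<in> K \<Longrightarrow> u x = v x) \<Longrightarrow> hdec b mu n (code u) = hdec b mu n (code v)"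
  using hres_code_cong[of u v "Suc n"] hdec_hres by metis

lemma kspl_facts:
  assumes nu: "okseq nu" "\<And>j. nu j \<noteq> 2" and f: "hcmp m f" "b \<longrightarrow> hz m f"
  shows "continuous_on K (kspl b m nu f)" "hres m (code (kspl b m nu f)) = hres m f"
    "hdec b (nu n) (m + n) (code (kspl b m nu f))" "x \<notin> K \<Longrightarrow> kspl b m nu f x = 0"
    "hz m f \<Longrightarrow> b \<or> f (replicate m 0, 1) = 0 \<Longrightarrow> f (crn m 1) = 0 \<Longrightarrow> x \<in> bd_Omega q \<Longrightarrow> kspl b m nu f x = 0"
proof -
  have e: "x \<in> K \<Longrightarrow> kspl b m nu f x = hspl b m nu f x" for x by (simp add: kspl_def)
  show "continuous_on K (kspl b m nu f)" using hspl_continuous[OF nu(1) f(1)] by (rule continuous_on_eq) (simp add: e)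
  show "hres m (code (kspl b m nu f)) = hres m f" using hres_code_cong[OF e, where n = m] hres_code_hspl[OF f(1)] by simp
  show "hdec b (nu n) (m + n) (code (kspl b m nu f))"
    using hdec_code_cong[OF e] hdec_hspl[OF nu f] by simp
  show "x \<notin> K \<Longrightarrow> kspl b m nu f x = 0" by (simp add: kspl_def)
  show "hz m f \<Longrightarrow> b \<or> f (replicate m 0, 1) = 0 \<Longrightarrow> f (crn m 1) = 0 \<Longrightarrow> x \<in> bd_Omega q \<Longrightarrow> kspl b m nu f x = 0"
    using hspl_bd[OF nu _ f(1)] e bd_K by auto
qed

end

section \<open>Eigenspaces of the half gasket\<close>

lemma Qf_res: "Qf mu n f (res n g) = Qf mu n f g"
  by (induction n arbitrary: f g) (simp_all, simp add: res_def)

lemma Qh_hres: "Qh b mu n f (hres n g) = Qh b mu n f g"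
  by (induction n arbitrary: f g) (simp_all add: Qf_res)

lemma dec_uniq: "dec mu n f \<Longrightarrow> dec mu n g \<Longrightarrow> res n (crs f) = res n (crs g) \<Longrightarrow> res (Suc n) f = res (Suc n) g"
proof (induction n arbitrary: f g)
  case 0
  have "f ([k], k) = g ([k], k)" for k using fun_cong[OF 0(3), of "([], k)"] by (simp add: res_def crs_def)
  then have "EV mu (\<lambda>k. f ([k], k)) = EV mu (\<lambda>k. g ([k], k))" by simp
  moreover have "f ([i], j) = EV mu (\<lambda>k. f ([k], k)) i j" "g ([i], j) = EV mu (\<lambda>k. g ([k], k)) i j" for i j
    using 0(1,2)[unfolded dec.simps, THEN spec, THEN spec] .
  ultimately have "f ([i], j) = g ([i], j)" for i j by metis
  then show ?case by (auto simp: res_def length_Suc_conv fun_eq_iff)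
next
  case (Suc n)
  have "sh (res (Suc n) (crs f)) i = sh (res (Suc n) (crs g)) i" for i by (simp only: Suc.prems(3))
  then have "res n (crs (sh f i)) = res n (crs (sh g i))" for i by simp
  then have "res (Suc n) (sh f i) = res (Suc n) (sh g i)" for i using Suc.prems(1,2) by (intro Suc.IH) simp_all
  then show ?case by (intro code_eqI[of "res _ _"]) simp_all
qed

lemma hdec_uniq: "hdec b mu n f \<Longrightarrow> hdec b mu n g \<Longrightarrow> hres n (crs f) = hres n (crs g) \<Longrightarrow> hres (Suc n) f = hres (Suc n) g"
proof (induction n arbitrary: f g)
  case 0
  have "f ([k], k) = g ([k], k)" if "k \<noteq> 2" for k using that fun_cong[OF 0(3), of "([], k)"] by (simp add: crs_def)
  then have e: "f ([0], 0) = g ([0], 0)" "f ([1], 1) = g ([1], 1)" by simp_all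
  then have "f ([0], 1) = g ([0], 1)" "f ([1], 0) = g ([1], 0)" "f ([1], 2) = g ([1], 2)"
    using 0(1,2) by (simp_all add: Let_def)
  then have "\<forall>j. f ([1], j) = g ([1], j)" "\<forall>j. j \<noteq> 2 \<longrightarrow> f ([0], j) = g ([0], j)" using e by (simp_all add: all3)
  then have "res 0 (sh f 1) = res 0 (sh g 1)" "hres 0 (sh f 0) = hres 0 (sh g 0)" by (auto simp: res_def fun_eq_iff)
  then have "\<forall>i. sh (hres (Suc 0) f) i = sh (hres (Suc 0) g) i" by (simp add: all3 del: hres.simps)
  then show ?case by (intro code_eqI[of "hres _ _"]) simp_all
next
  case (Suc n)
  have "sh (hres (Suc n) (crs f)) i = sh (hres (Suc n) (crs g)) i" for i by (simp only: Suc.prems(3))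
  from this[of 0] this[of 1] have e: "hres n (crs (sh f 0)) = hres n (crs (sh g 0))" "res n (crs (sh f 1)) = res n (crs (sh g 1))"
    by simp_all
  have "hres (Suc n) (sh f 0) = hres (Suc n) (sh g 0)" by (rule Suc.IH) (use Suc.prems e in simp_all)
  moreover have "res (Suc n) (sh f 1) = res (Suc n) (sh g 1)" by (rule dec_uniq[of mu]) (use Suc.prems e in simp_all)
  ultimately have "\<forall>i. sh (hres (Suc (Suc n)) f) i = sh (hres (Suc (Suc n)) g) i" by (simp add: all3)
  then show ?case by (intro code_eqI[of "hres _ _"]) simp_all
qed

lemma hdec_cut: "hdec b mu n f \<Longrightarrow>
   f (replicate (Suc n) 0, 1) = EV mu (hval b (f (replicate (Suc n) 0, 0)) (f (replicate n 0 @ [1], 1))) 0 1"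
proof (induction n arbitrary: f)
  case (Suc n)
  then show ?case using Suc.IH[of "sh f 0"] by simp
qed (simp add: Let_def)

lemma null_mult_bounded:
  fixes x y :: "nat \<Rightarrow> real"
  assumes "x \<longlonglongrightarrow> 0" "\<And>n. \<bar>y n\<bar> \<le> B"
  shows "(\<lambda>n. x n * y n) \<longlonglongrightarrow> 0"
proof (rule Lim_null_comparison)
  show "(\<lambda>n. \<bar>x n\<bar> * B) \<longlonglongrightarrow> 0" using tendsto_mult_left_zero[OF tendsto_rabs_zero[OF assms(1)]] .
  show "\<forall>\<^sub>F n in sequentially. norm (x n * y n) \<le> \<bar>x n\<bar> * B"
    using assms(2) by (simp add: abs_mult mult_left_mono)
qed

text \<open>The numerical part of \<open>in_series\<close>. It also makes sense when
  \<open>lam\<close> is not an eigenvalue, and the counts apply it to all \<open>lam\<close> in an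
  interval.\<close>

definition eigseq :: "(nat \<Rightarrow> real) \<Rightarrow> nat \<Rightarrow> real \<Rightarrow> bool" where
  "eigseq mu k lam \<longleftrightarrow> (\<forall>m>k. mu (m - 1) = mu m * (5 - mu m)) \<and>
     (\<lambda>m. 3/2 * (5 ^ m * mu m)) \<longlonglongrightarrow> lam \<and> (\<forall>m>k. mu m \<notin> {2, 5, 6})"

locale eigen = triangle +
  fixes mu :: "nat \<Rightarrow> real" and kk :: nat and lam :: real
  assumes eigseq: "eigseq mu kk lam"
begin

lemma R_mu: "kk \<le> n \<Longrightarrow> R (mu (Suc n)) = mu n"
  using eigseq unfolding eigseq_def R_def by (auto dest: spec[of _ "Suc n"])

lemma mu_good: "kk \<le> n \<Longrightarrow> mu (Suc n) \<noteq> 2" "kk \<le> n \<Longrightarrow> mu (Suc n) \<noteq> 5" "kk \<le> n \<Longrightarrow> mu (Suc n) \<noteq> 6"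
  using eigseq unfolding eigseq_def by (auto dest: spec[of _ "Suc n"])

lemma mu_lim: "(\<lambda>m. 3/2 * (5 ^ m * mu m)) \<longlonglongrightarrow> lam"
  using eigseq by (simp add: eigseq_def)

lemma mu_bound: "\<exists>D\<ge>0. \<forall>n. \<bar>mu n\<bar> \<le> D / 5 ^ n"
proof -
  have "Bseq (\<lambda>m. 3/2 * (5 ^ m * mu m))" using mu_lim by (intro convergent_imp_Bseq convergentI)
  then obtain B where B: "B > 0" "\<And>n. norm (3/2 * (5 ^ n * mu n)) \<le> B" by (auto simp: Bseq_def)
  have "\<bar>mu n\<bar> \<le> B / 5 ^ n" for n
  proof -
    have "5 ^ n * \<bar>mu n\<bar> \<le> 3/2 * (5 ^ n * \<bar>mu n\<bar>)" by simp
    also have "\<dots> \<le> B" using B(2)[of n] by (simp add: abs_mult)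
    finally show ?thesis by (simp add: le_divide_eq mult.commute)
  qed
  then show ?thesis using B(1) by (intro exI[of _ B]) simp
qed

lemma mu_null: "0 \<le> r \<Longrightarrow> r < 5 \<Longrightarrow> (\<lambda>n. r ^ n * mu n) \<longlonglongrightarrow> 0"
proof -
  assume r: "0 \<le> r" "r < 5"
  obtain D where D: "\<And>n. \<bar>mu n\<bar> \<le> D / 5 ^ n" using mu_bound by auto
  show ?thesis
  proof (rule Lim_null_comparison)
    show "\<forall>\<^sub>F n in sequentially. norm (r ^ n * mu n) \<le> D * (r / 5) ^ n"
    proof (rule always_eventually, rule allI)
      fix n
      have "r ^ n * \<bar>mu n\<bar> \<le> r ^ n * (D / 5 ^ n)" using D r by (intro mult_left_mono) auto
      then show "norm (r ^ n * mu n) \<le> D * (r / 5) ^ n" using r by (simp add: abs_mult power_divide mult.commute)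
    qed
    have "(\<lambda>n. D * (r / 5) ^ n) \<longlonglongrightarrow> D * 0" using r by (intro tendsto_intros LIMSEQ_realpow_zero) auto
    then show "(\<lambda>n. D * (r / 5) ^ n) \<longlonglongrightarrow> 0" by simp
  qed
qed

lemma mu_null1: "mu \<longlonglongrightarrow> 0"
  using mu_null[of 1] by simp

lemma mu_null53: "(\<lambda>n. (5/3) ^ n * mu n) \<longlonglongrightarrow> 0"
  by (rule mu_null) auto

abbreviation "nus m \<equiv> (\<lambda>j. mu (Suc m + j))"

lemma okseq_nus: "okseq (nus m)"
proof -
  obtain D where D: "D \<ge> 0" "\<And>n. \<bar>mu n\<bar> \<le> D / 5 ^ n" using mu_bound by auto
  have "\<bar>mu (Suc m + j)\<bar> \<le> D / 5 ^ j" for j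
  proof -
    have "\<bar>mu (Suc m + j)\<bar> \<le> D / 5 ^ (Suc m + j)" by (rule D)
    also have "\<dots> \<le> D / 5 ^ j" using D(1) by (intro divide_left_mono power_increasing) auto
    finally show ?thesis .
  qed
  then show ?thesis unfolding okseq_def by blast
qed

text \<open>The flux ratio times the energy factor 5/3; it tends to 1 because
  \<open>k0 0 = 3/5\<close>.\<close>

definition kap :: "nat \<Rightarrow> real" where "kap n = 5/3 * k0 (mu (Suc n))"

lemma kap_nz: "kk \<le> n \<Longrightarrow> kap n \<noteq> 0"
  using mu_good[of n] by (simp add: kap_def k0_def)

lemma kap_near_1: "\<bar>mu (Suc n)\<bar> \<le> 1 \<Longrightarrow> \<bar>kap n - 1\<bar> \<le> 2 * \<bar>mu (Suc n)\<bar>"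
proof -
  define m where "m = mu (Suc n)"
  define D where "D = (2 - m) * (5 - m)"
  assume "\<bar>mu (Suc n)\<bar> \<le> 1"
  then have m: "\<bar>m\<bar> \<le> 1" by (simp add: m_def)
  have "1 * 4 \<le> D" unfolding D_def using m by (intro mult_mono) auto
  then have D: "D \<ge> 4" by simp
  have "(kap n - 1) * (3 * D) = m * (16 - 3 * m)"
  proof -
    have "kap n * (3 * D) = 5 * (6 - m)" using D unfolding kap_def k0_def m_def[symmetric] D_def[symmetric] by simp
    then show ?thesis by (simp add: left_diff_distrib) (simp add: D_def algebra_simps)
  qed
  then have "\<bar>kap n - 1\<bar> * (3 * D) = \<bar>m\<bar> * \<bar>16 - 3 * m\<bar>" using D by (metis abs_mult abs_of_nonneg mult_nonneg_nonneg order_trans zero_le_numeral)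
  also have "\<dots> \<le> \<bar>m\<bar> * 24" using m by (intro mult_left_mono) auto
  finally have 1: "\<bar>kap n - 1\<bar> * (3 * D) \<le> \<bar>m\<bar> * 24" .
  have "\<bar>kap n - 1\<bar> * 12 \<le> \<bar>kap n - 1\<bar> * (3 * D)" using D by (intro mult_left_mono) auto
  then show ?thesis using 1 by (simp add: m_def)
qed

text \<open>\<open>kap n - 1\<close> is summable since \<open>mu n\<close> is bounded by a multiple
  of \<open>1 / 5 ^ n\<close>, and no factor is 0 because \<open>mu\<close> avoids 6. One nonzero
  \<open>P\<close> serves all quantities obeying the recursion: a limit 0 means the value 0 on level
  \<open>m\<close>.\<close>

lemma prod_limit:
  assumes m: "kk \<le> m"
  obtains P where "P \<noteq> 0" "\<And>s. (\<And>n. m \<le> n \<Longrightarrow> s (Suc n) = kap n * s n) \<Longrightarrow> s \<longlonglongrightarrow> P * s m"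
proof -
  obtain D where D: "D \<ge> 0" "\<And>n. \<bar>mu n\<bar> \<le> D / 5 ^ n" using mu_bound by auto
  let ?f = "\<lambda>j. kap (m + j)"
  have "\<forall>\<^sub>F n in sequentially. norm (mu n) < 1" by (rule order_tendstoD(2)[OF tendsto_norm_zero[OF mu_null1] zero_less_one])
  then obtain N where N: "\<And>n. n \<ge> N \<Longrightarrow> \<bar>mu n\<bar> < 1" by (auto simp: eventually_sequentially)
  have "summable (\<lambda>j. norm (?f j - 1))"
  proof (rule summable_comparison_test)
    show "\<exists>N. \<forall>n\<ge>N. norm (norm (?f n - 1)) \<le> (2 * D) * (1/5) ^ n"
    proof (intro exI[of _ N] allI impI)
      fix j assume j: "N \<le> j"
      have "\<bar>?f j - 1\<bar> \<le> 2 * \<bar>mu (Suc (m + j))\<bar>" by (rule kap_near_1) (use N[of "Suc (m + j)"] j in simp)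
      also have "\<dots> \<le> 2 * (D / 5 ^ Suc (m + j))" using D(2)[of "Suc (m + j)"] by simp
      also have "\<dots> \<le> 2 * (D / 5 ^ j)" using D(1) by (intro mult_left_mono divide_left_mono power_increasing) auto
      also have "\<dots> = (2 * D) * (1/5) ^ j" by (simp only: power_one_over divide_inverse power_inverse mult.assoc mult_1)
      finally show "norm (norm (?f j - 1)) \<le> (2 * D) * (1/5) ^ j" by (simp only: real_norm_def abs_idempotent)
    qed
    show "summable (\<lambda>n. (2 * D) * (1/5) ^ n)" by (intro summable_mult summable_geometric) simp
  qed
  then have "abs_convergent_prod ?f" by (simp add: abs_convergent_prod_conv_summable)
  then have "convergent_prod ?f" by (rule abs_convergent_prod_imp_convergent_prod)
  moreover have "?f j \<noteq> 0" for j using m by (intro kap_nz) simp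
  ultimately obtain P where P: "(\<lambda>n. \<Prod>i\<le>n. ?f i) \<longlonglongrightarrow> P" "P \<noteq> 0"
    using convergent_prod_iff_nz_lim[of ?f] by blast
  have P': "(\<lambda>n. \<Prod>i<n. ?f i) \<longlonglongrightarrow> P"
    by (rule LIMSEQ_imp_Suc) (use P(1) in \<open>simp add: lessThan_Suc_atMost\<close>)
  show ?thesis
  proof (rule that[OF P(2)])
    fix s :: "nat \<Rightarrow> real" assume s: "\<And>n. m \<le> n \<Longrightarrow> s (Suc n) = kap n * s n"
    have "s (n + m) = (\<Prod>i<n. ?f i) * s m" for n
    proof (induction n)
      case (Suc n)
      then show ?case using s[of "n + m"] by (simp add: add.commute)
    qed simp
    then have "(\<lambda>n. s (n + m)) \<longlonglongrightarrow> P * s m" using P' by (auto intro!: tendsto_intros)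
    then show "s \<longlonglongrightarrow> P * s m" by (rule LIMSEQ_offset)
  qed
qed

section \<open>Limits of renormalized energies\<close>

lemma code_mult: "(\<lambda>p. code u p * code v p) = code (\<lambda>x. u x * v x)"
  by (auto simp: code_def)

lemma Q_step:
  assumes n: "kk \<le> n" and v: "hdec b (mu (Suc n)) n (code v)"
    and z: "b \<Longrightarrow> \<forall>x\<in>bd_Omega q. u x = 0" "b \<Longrightarrow> \<forall>x\<in>bd_Omega q. v x = 0"
  shows "(5/3) ^ Suc n * Qh b (mu (Suc n)) (Suc n) (code u) (code v) = kap n * ((5/3) ^ n * Qh b (mu n) n (code u) (code v))"
proof -
  have "Qh b (mu (Suc n)) (Suc n) (code v) (code u) = k0 (mu (Suc n)) * Qh b (R (mu (Suc n))) n (crs (code v)) (crs (code u))"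
    by (rule Qh_dec) (use mu_good[OF n] v z hz_code hcmp_code in \<open>auto simp del: hz.simps hcmp.simps sh_code\<close>)
  then show ?thesis using R_mu[OF n] by (simp add: kap_def Qh_sym[of b _ _ "code u" "code v"] del: Qh.simps)
qed

lemma cut_point_K: "foldr (F q) (replicate n 0) (q 1) \<in> K"
  by (induction n) (use F0_K K_SG in auto)

lemma bounded_K: "continuous_on K u \<Longrightarrow> \<exists>B. \<forall>x\<in>K. \<bar>u x\<bar> \<le> (B :: real)"
proof -
  assume "continuous_on K u"
  then have "bounded (u ` K)" using compact_K by (intro compact_imp_bounded compact_continuous_image)
  then show ?thesis by (auto simp: bounded_iff)
qed

text \<open>This controls the extra term of \<open>Qh_mass_dirichlet\<close>. By oddness each step
  divides the value at the cut cell by \<open>5 - mu\<close>, which beats the factor 5/3.\<close>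

lemma cut_dirichlet:
  assumes v: "\<And>n. m \<le> n \<Longrightarrow> hdec True (mu (Suc n)) n (code v)" and z: "v (q 0) = 0"
  shows "(\<lambda>n. (5/3) ^ n * code v (replicate n 0, 1)) \<longlonglongrightarrow> 0"
proof -
  let ?y = "\<lambda>n. (5/3) ^ n * code v (replicate n 0, 1)"
  have "\<forall>\<^sub>F n in sequentially. norm (mu n) < 1" by (rule order_tendstoD(2)[OF tendsto_norm_zero[OF mu_null1] zero_less_one])
  then obtain N where N: "\<And>n. n \<ge> N \<Longrightarrow> \<bar>mu n\<bar> < 1" by (auto simp: eventually_sequentially)
  have fq: "foldr (F q) (replicate n j) (q j) = q j" for n j by (induction n) simp_all
  \<comment> \<open>\<open>5/12\<close> is 5/3 divided by 4, and \<open>5 - mu\<close> exceeds 4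
    once \<open>mu\<close> is below 1.\<close>
  have "norm (?y (Suc n)) \<le> 5/12 * norm (?y n)" if n: "n \<ge> N + m" for n
  proof -
    let ?M = "mu (Suc n)" let ?a = "code v (replicate n 0, 1)"
    have M: "\<bar>?M\<bar> < 1" using N n by simp
    then have M2: "?M \<noteq> 2" "?M < 2" "5 - ?M \<ge> 4" by auto
    have "code v (replicate (Suc n) 0, 1)
      = EV ?M (hval True (code v (replicate (Suc n) 0, 0)) (code v (replicate n 0 @ [1], 1))) 0 1"
      by (rule hdec_cut[OF v]) (use n in simp)
    also have "code v (replicate (Suc n) 0, 0) = 0" using z fq[of "Suc n" 0] by simp
    also have "code v (replicate n 0 @ [1], 1) = ?a" by simp
    also have "EV ?M (hval True 0 ?a) 0 1 = ?a / (5 - ?M)" using M2 by (simp add: EV_def hval_def)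
    finally have "\<bar>code v (replicate (Suc n) 0, 1)\<bar> = \<bar>?a\<bar> / (5 - ?M)" using M2 by (simp del: code_apply)
    also have "\<dots> \<le> \<bar>?a\<bar> / 4" using M2 by (intro divide_left_mono) auto
    finally have "(5/3) ^ Suc n * \<bar>code v (replicate (Suc n) 0, 1)\<bar> \<le> (5/3) ^ Suc n * (\<bar>?a\<bar> / 4)"
      by (intro mult_left_mono) auto
    then show ?thesis by (simp add: abs_mult del: code_apply replicate_Suc)
  qed
  then have "summable ?y" by (intro summable_ratio_test[of "5/12" "N + m"]) auto
  then show ?thesis by (rule summable_LIMSEQ_zero)
qed

text \<open>The graph energy splits into the form for \<open>mu n\<close>, multiplied by
  \<open>kap\<close> at each step, and a mass term, which is \<open>3/2 * (5 ^ n * mu n)\<close>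
  times a Riemann sum. Only \<open>v\<close> is decimated; \<open>u\<close> is any continuous
  function, vanishing on the boundary in the Dirichlet case.\<close>

lemma energy_limit:
  assumes m: "kk \<le> m"
  obtains P where "P \<noteq> 0"
    "\<And>b u v. \<lbrakk>continuous_on K u; continuous_on K v; \<And>n. m \<le> n \<Longrightarrow> hdec b (mu (Suc n)) n (code v);
       b \<Longrightarrow> \<forall>x\<in>bd_Omega q. u x = 0; b \<Longrightarrow> \<forall>x\<in>bd_Omega q. v x = 0\<rbrakk> \<Longrightarrow>
       (\<lambda>n. (5/3) ^ n * Qh b (mu n) n (code u) (code v)) \<longlonglongrightarrow> P * Qh b (mu m) m (code u) (code v) \<and>
       (\<lambda>n. graph_energy q K n u v) \<longlonglongrightarrow> lam * IK (\<lambda>x. u x * v x) + P * Qh b (mu m) m (code u) (code v)"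
proof -
  obtain P where P: "P \<noteq> 0" "\<And>s. (\<And>n. m \<le> n \<Longrightarrow> s (Suc n) = kap n * s n) \<Longrightarrow> s \<longlonglongrightarrow> P * s m"
    using prod_limit[OF m] by blast
  show ?thesis
  proof (rule that[of "P * (5/3) ^ m"])
    show "P * (5/3) ^ m \<noteq> 0" using P(1) by simp
    fix b and u v :: "real^2 \<Rightarrow> real"
    assume u: "continuous_on K u" and v: "continuous_on K v" and d: "\<And>n. m \<le> n \<Longrightarrow> hdec b (mu (Suc n)) n (code v)"
      and zu: "b \<Longrightarrow> \<forall>x\<in>bd_Omega q. u x = 0" and zv: "b \<Longrightarrow> \<forall>x\<in>bd_Omega q. v x = 0"
    let ?A = "\<lambda>n. (5/3) ^ n * Qh b (mu n) n (code u) (code v)"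
    let ?B = "\<lambda>n. (3/2 * (5 ^ n * mu n)) * ((1/3) ^ Suc n * mh n (code (\<lambda>x. u x * v x)))"
    let ?C = "\<lambda>n. if b then 2 * ((5/3) ^ n * code v (replicate n 0, 1)) * code u (replicate n 0, 1) else 0"
    have A: "?A \<longlonglongrightarrow> P * ?A m"
      by (rule P(2)) (rule Q_step, use m d zu zv in auto)
    have B: "?B \<longlonglongrightarrow> lam * IK (\<lambda>x. u x * v x)"
      by (intro tendsto_mult mu_lim IK_riemann_limit continuous_on_mult u v)
    have C: "?C \<longlonglongrightarrow> 0"
    proof (cases b)
      case True
      obtain Bu where "\<forall>x\<in>K. \<bar>u x\<bar> \<le> Bu" using bounded_K[OF u] by blast
      then have bu: "\<bar>code u (replicate n 0, 1)\<bar> \<le> Bu" for n using cut_point_K by simp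
      have "v (q 0) = 0" using zv True by (simp add: bd_Omega_def)
      then have "(\<lambda>n. (5/3) ^ n * code v (replicate n 0, 1)) \<longlonglongrightarrow> 0"
        using cut_dirichlet[of m v] d True by simp
      then have "(\<lambda>n. 2 * ((5/3) ^ n * code v (replicate n 0, 1))) \<longlonglongrightarrow> 0" by (rule tendsto_mult_right_zero)
      then show ?thesis using null_mult_bounded[OF _ bu] True by (simp del: code_apply)
    qed simp
    have e: "graph_energy q K n u v = ?A n + ?B n - ?C n" for n
    proof -
      have s: "(5/3) ^ n * (mu n / 2 * M) = (3/2 * (5 ^ n * mu n)) * ((1/3) ^ Suc n * M)" for M
        by (simp add: power_divide ac_simps)
      have "graph_energy q K n u v = (5/3) ^ n * Qh False 0 n (code u) (code v)" by (rule graph_energy_K)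
      also have "\<dots> = ?A n + (5/3) ^ n * (mu n / 2 * mh n (code (\<lambda>x. u x * v x))) - ?C n"
      proof (cases b)
        case True
        then have "Qh True (mu n) n (code u) (code v) + mu n / 2 * mh n (code (\<lambda>x. u x * v x)) =
            Qh False 0 n (code u) (code v) + 2 * (code u (replicate n 0, 1) * code v (replicate n 0, 1))"
          using Qh_mass_dirichlet[of n "code u" "code v" "mu n"] hz_code[of u n] hz_code[of v n] zu zv
          by (simp add: code_mult algebra_simps del: code_apply)
        then have e: "Qh False 0 n (code u) (code v) = Qh True (mu n) n (code u) (code v)
            + mu n / 2 * mh n (code (\<lambda>x. u x * v x)) - 2 * (code u (replicate n 0, 1) * code v (replicate n 0, 1))"
          by linarith
        show ?thesis unfolding e using True by (simp add: algebra_simps del: code_apply)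
      next
        case False
        then have e: "Qh False 0 n (code u) (code v) = Qh False (mu n) n (code u) (code v) + mu n / 2 * mh n (code (\<lambda>x. u x * v x))"
          using Qh_mass_neumann[of "mu n" n "code u" "code v"] by (simp add: code_mult)
        show ?thesis using False unfolding e by (simp add: distrib_left)
      qed
      finally show ?thesis unfolding s .
    qed
    have "(\<lambda>n. ?A n + ?B n - ?C n) \<longlonglongrightarrow> P * ?A m + lam * IK (\<lambda>x. u x * v x) - 0"
      by (intro tendsto_diff tendsto_add A B C)
    then have "(\<lambda>n. graph_energy q K n u v) \<longlonglongrightarrow> P * ?A m + lam * IK (\<lambda>x. u x * v x) - 0"
      by (subst e)
    then show "?A \<longlonglongrightarrow> P * (5/3) ^ m * Qh b (mu m) m (code u) (code v) \<and>
       (\<lambda>n. graph_energy q K n u v) \<longlonglongrightarrow> lam * IK (\<lambda>x. u x * v x) + P * (5/3) ^ m * Qh b (mu m) m (code u) (code v)"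
      using A by (simp add: add.commute mult.assoc)
  qed
qed

abbreviation "sp b m g \<equiv> kspl b m (nus m) g"

lemma sp_facts:
  assumes m: "kk \<le> m" and g: "hcmp m g" "b \<longrightarrow> hz m g"
  shows "continuous_on K (sp b m g)" "hres m (code (sp b m g)) = hres m g"
    "\<And>n. m \<le> n \<Longrightarrow> hdec b (mu (Suc n)) n (code (sp b m g))" "\<And>x. x \<notin> K \<Longrightarrow> sp b m g x = 0"
    "hz m g \<Longrightarrow> b \<or> g (replicate m 0, 1) = 0 \<Longrightarrow> g (crn m 1) = 0 \<Longrightarrow> \<forall>x\<in>bd_Omega q. sp b m g x = 0"
proof -
  have good: "nus m j \<noteq> 2" for j using mu_good[of "m + j"] m by simp
  note f = kspl_facts[OF okseq_nus[of m] good g]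
  show "continuous_on K (sp b m g)" "hres m (code (sp b m g)) = hres m g" by (rule f(1), rule f(2))
  show "hdec b (mu (Suc n)) n (code (sp b m g))" if "m \<le> n" for n using f(3)[of "n - m"] that by simp
  show "\<And>x. x \<notin> K \<Longrightarrow> sp b m g x = 0" by (rule f(4))
  show "hz m g \<Longrightarrow> b \<or> g (replicate m 0, 1) = 0 \<Longrightarrow> g (crn m 1) = 0 \<Longrightarrow> \<forall>x\<in>bd_Omega q. sp b m g x = 0"
    using f(5) by blast
qed

lemma weak_rhs: "- (LINT x:K|SG_measure q. - (lam * u x) * v x) = lam * IK (\<lambda>x. u x * (v x :: real))"
proof -
  have "(LINT x:K|SG_measure q. - (lam * u x) * v x) = (LINT x:K|SG_measure q. (- lam) * (u x * v x))"
    by (simp add: mult.assoc)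
  also have "\<dots> = (- lam) * IK (\<lambda>x. u x * v x)" by (rule set_integral_mult_right)
  finally show ?thesis by simp
qed

text \<open>The integral terms of both sides agree, which leaves \<open>P\<close> times the
  level-\<open>m\<close> form. An even spline need not vanish on \<open>X\<close>; for the Neumann
  form the test is therefore 0 on the cut cell.\<close>

lemma weak_test:
  assumes u: "eigen_eq q K (bd_Omega q) lam u" "b \<longrightarrow> (\<forall>x\<in>bd_Omega q. u x = 0)"
    and m: "kk \<le> m" and g: "hcmp m g" "hz m g" "g (crn m 1) = 0" "b \<or> g (replicate m 0, 1) = 0"
  shows "Qh b (mu m) m (code u) g = 0"
proof -
  let ?v = "sp b m g"
  obtain P where P: "P \<noteq> 0"
    "\<And>b u v. \<lbrakk>continuous_on K u; continuous_on K v; \<And>n. m \<le> n \<Longrightarrow> hdec b (mu (Suc n)) n (code v);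
       b \<Longrightarrow> \<forall>x\<in>bd_Omega q. u x = 0; b \<Longrightarrow> \<forall>x\<in>bd_Omega q. v x = 0\<rbrakk> \<Longrightarrow>
       (\<lambda>n. (5/3) ^ n * Qh b (mu n) n (code u) (code v)) \<longlonglongrightarrow> P * Qh b (mu m) m (code u) (code v) \<and>
       (\<lambda>n. graph_energy q K n u v) \<longlonglongrightarrow> lam * IK (\<lambda>x. u x * v x) + P * Qh b (mu m) m (code u) (code v)"
    using energy_limit[OF m] by blast
  have "b \<longrightarrow> hz m g" using g by simp
  note f = sp_facts[OF m g(1) this]
  have z: "\<forall>x\<in>bd_Omega q. ?v x = 0" by (rule f(5)[OF g(2,4,3)])
  have cu: "continuous_on K u" using u(1) by (simp add: eigen_eq_def has_laplacian_def finite_energy_def)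
  have "convergent (\<lambda>n. graph_energy q K n ?v ?v)"
    by (rule convergentI[OF conjunct2[OF P(2)[OF f(1) f(1) f(3)]]]) (use z in auto)
  then have "finite_energy q K ?v" using f(1) by (simp add: finite_energy_def)
  then have "energy q K u ?v = - (LINT x:K|SG_measure q. - (lam * u x) * ?v x)"
    using u(1) z unfolding eigen_eq_def has_laplacian_def by blast
  moreover have "(\<lambda>n. graph_energy q K n u ?v) \<longlonglongrightarrow> lam * IK (\<lambda>x. u x * ?v x) + P * Qh b (mu m) m (code u) (code ?v)"
    by (rule conjunct2[OF P(2)[OF cu f(1) f(3)]]) (use z u in auto)
  then have "energy q K u ?v = lam * IK (\<lambda>x. u x * ?v x) + P * Qh b (mu m) m (code u) (code ?v)"
    unfolding energy_def by (rule limI)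
  ultimately have "P * Qh b (mu m) m (code u) (code ?v) = 0" unfolding weak_rhs by linarith
  then have "Qh b (mu m) m (code u) (code ?v) = 0" using P(1) by simp
  then show ?thesis using Qh_hres[of b "mu m" m "code u" g] Qh_hres[of b "mu m" m "code u" "code ?v"] f(2) by simp
qed

section \<open>From eigenfunctions to graph solutions\<close>

lemma dirichlet_restrict:
  assumes u: "u \<in> Omega_dirichlet_space q lam" and m: "kk \<le> m"
  shows "hnet 1 True (mu m) m (code u)" "u (q 1) = 0"
proof -
  have u': "eigen_eq q K (bd_Omega q) lam u" "\<forall>x\<in>bd_Omega q. u x = 0" using u by (auto simp: Omega_dirichlet_space_def)
  then show "u (q 1) = 0" by (simp add: bd_Omega_def)
  show "hnet 1 True (mu m) m (code u)"
  proof (rule weak_hnet)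
    show "True \<longrightarrow> hz m (code u)" using hz_code[OF u'(2)] by blast
    fix g assume "hcmp m g" "True \<longrightarrow> hz m g" "g (crn m 1) = 0"
    then show "Qh True (mu m) m (code u) g = 0" using u' by (intro weak_test[OF _ _ m]) auto
  qed
qed

text \<open>Renormalized corner fluxes on a cell of depth \<open>c\<close> are multiplied by
  \<open>kap\<close> and have the same limit as the renormalized differences, since
  \<open>(5/3) ^ n * mu n\<close> tends to 0. A zero limit makes all of them 0.\<close>

lemma flux_zero:
  assumes c: "kk \<le> c + lo" and n: "\<And>l. lo \<le> l \<Longrightarrow> net 1 (mu (c + Suc l)) (Suc l) (code h)"
    and lim: "(\<lambda>l. (5/3) ^ l * T 0 (\<lambda>i. code h (replicate l j, i)) j) \<longlonglongrightarrow> 0" and l: "lo \<le> l"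
  shows "flx 1 (mu (c + l)) l (code h) j = 0"
proof -
  let ?s = "\<lambda>l. (5/3) ^ l * flx 1 (mu (c + l)) l (code h) j"
  have rec: "?s (Suc l) = kap (c + l) * ?s l" if l: "lo \<le> l" for l
  proof -
    have k: "kk \<le> c + l" using c l by simp
    have "dec (mu (c + Suc l)) l (code h)"
      using net_dec[OF _ _ cmp_code, of "mu (c + Suc l)" l h] mu_good[OF k] n[OF l] by simp
    then have "flx 1 (mu (c + Suc l)) (Suc l) (code h) j = flx (k0 (mu (c + Suc l))) (R (mu (c + Suc l))) l (crs (code h)) j"
      using flx_dec[of "mu (c + Suc l)" l "code h" j] mu_good[OF k] by simp
    then have "flx 1 (mu (c + Suc l)) (Suc l) (code h) j = k0 (mu (c + Suc l)) * flx 1 (mu (c + l)) l (code h) j"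
      using R_mu[OF k] by (simp add: flx_scale[of "k0 _"])
    then show ?thesis by (simp add: kap_def)
  qed
  have "?s \<longlonglongrightarrow> 0"
  proof -
    have q: "code h (replicate l j, j) = h (q j)" for l using code_crn[of h l j] by (simp add: crn_def)
    have "?s l = (5/3) ^ l * T 0 (\<lambda>i. code h (replicate l j, i)) j - h (q j) / 2 * (3/5) ^ c * ((5/3) ^ (l + c) * mu (l + c))" for l
    proof -
      have "(3/5) ^ c * ((5/3) ^ (l + c) * mu (l + c)) = ((3/5) * (5/3)) ^ c * ((5/3) ^ l * mu (c + l))"
        unfolding power_mult_distrib power_add by (simp add: add.commute)
      then have "(3/5) ^ c * ((5/3) ^ (l + c) * mu (l + c)) = (5/3) ^ l * mu (c + l)" by simp
      then have e: "h (q j) / 2 * (3/5) ^ c * ((5/3) ^ (l + c) * mu (l + c)) = h (q j) / 2 * ((5/3) ^ l * mu (c + l))"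
        by (simp only: mult.assoc)
      show ?thesis unfolding e flx_def T_def q by (simp add: algebra_simps)
    qed
    moreover have "(\<lambda>l. (5/3) ^ l * T 0 (\<lambda>i. code h (replicate l j, i)) j - h (q j) / 2 * (3/5) ^ c * ((5/3) ^ (l + c) * mu (l + c)))
       \<longlonglongrightarrow> 0 - h (q j) / 2 * (3/5) ^ c * 0"
      by (intro tendsto_diff lim tendsto_mult tendsto_const LIMSEQ_ignore_initial_segment[OF mu_null53])
    ultimately show ?thesis by simp
  qed
  \<comment> \<open>Reindexed by absolute levels, to which \<open>prod_limit\<close> refers.\<close>
  define S where "S n = ?s (n - c)" for n
  have "(\<lambda>n. S (n + c)) \<longlonglongrightarrow> 0" using \<open>?s \<longlonglongrightarrow> 0\<close> by (simp add: S_def)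
  then have S0: "S \<longlonglongrightarrow> 0" by (rule LIMSEQ_offset)
  have "kk \<le> c + l" using c l by simp
  then obtain P where P: "P \<noteq> 0" "\<And>s. (\<And>n. c + l \<le> n \<Longrightarrow> s (Suc n) = kap n * s n) \<Longrightarrow> s \<longlonglongrightarrow> P * s (c + l)"
    using prod_limit by blast
  have "S \<longlonglongrightarrow> P * S (c + l)"
  proof (rule P(2))
    fix n assume "c + l \<le> n"
    then show "S (Suc n) = kap n * S n" using rec[of "n - c"] l unfolding S_def by (simp add: Suc_diff_le)
  qed
  then have "P * S (c + l) = 0" using S0 LIMSEQ_unique by blast
  then show ?thesis using P(1) by (simp add: S_def)
qed

lemma hW_net: "hW M n (code u) \<Longrightarrow> k < n \<Longrightarrow> net 1 M (n - Suc k) (code (\<lambda>x. u ((F q 0 ^^ k) (F q 1 x))))"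
proof (induction k arbitrary: n u)
  case 0
  then obtain l where "n = Suc l" by (cases n) auto
  then show ?case using 0 by simp
next
  case (Suc k)
  then obtain l where l: "n = Suc l" by (cases n) auto
  then have "net 1 M (l - Suc k) (code (\<lambda>x. u (F q 0 ((F q 0 ^^ k) (F q 1 x)))))"
    using Suc.prems by (intro Suc.IH[of l "\<lambda>x. u (F q 0 x)"]) auto
  then show ?case using l by simp
qed

lemma xz_code: "(\<And>k. k < n \<Longrightarrow> flx 1 M (n - Suc k) (code (\<lambda>x. u ((F q 0 ^^ k) (F q 1 x)))) 2 = 0) \<Longrightarrow> xz M n (code u)"
proof (induction n arbitrary: u)
  case (Suc n)
  have "xz M n (code (\<lambda>x. u (F q 0 x)))"
  proof (rule Suc.IH)
    fix k assume "k < n"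
    then show "flx 1 M (n - Suc k) (code (\<lambda>x. u (F q 0 ((F q 0 ^^ k) (F q 1 x))))) 2 = 0"
      using Suc.prems[of "Suc k"] by simp
  qed
  then show ?case using Suc.prems[of 0] by simp
qed simp

text \<open>\<open>weak_hW\<close> gives the interior equations away from the cut cell,
  \<open>flux_zero\<close> those on \<open>X\<close> and at \<open>q 1\<close>. The defects in the
  cut cell are only shown to tend to 0 after renormalization. By \<open>energy_limit\<close> this
  suffices: the form against every spline is then 0 on level \<open>m\<close>, and
  \<open>weak_hflx\<close> recovers all equations.\<close>

lemma neumann_restrict:
  assumes u: "u \<in> Omega_neumann_space q lam" and m: "kk \<le> m"
  shows "hnet 1 False (mu m) m (code u)" "hflx 1 False (mu m) m (code u) = 0"
proof -
  have u': "eigen_eq q K (bd_Omega q) lam u" and ndz: "\<And>p. p \<in> bd_Omega q \<Longrightarrow> (\<lambda>n. (5/3) ^ n * nd n u p) \<longlonglongrightarrow> 0"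
    using u by (auto simp: Omega_neumann_space_def has_normal_deriv_Omega_def)
  have cu: "continuous_on K u" using u' by (simp add: eigen_eq_def has_laplacian_def finite_energy_def)
  have W: "hW (mu n) n (code u)" if "kk \<le> n" for n
    by (rule weak_hW) (use u' that in \<open>auto intro!: weak_test\<close>)
  let ?h = "\<lambda>k x. u ((F q 0 ^^ k) (F q 1 x))"
  have lim_x: "(\<lambda>l. (5/3) ^ l * T 0 (\<lambda>i. code (?h k) (replicate l 2, i)) 2) \<longlonglongrightarrow> 0" for k
  proof -
    have p: "(F q 0 ^^ k) (F q 1 (q 2)) \<in> bd_Omega q"
      unfolding bd_Omega_def X_def using F_comm[of 2 1] by (auto intro!: exI[of _ "Suc k"])
    have "(\<lambda>l. (5/3) ^ (l + Suc k) * nd (l + Suc k) u ((F q 0 ^^ k) (F q 1 (q 2)))) \<longlonglongrightarrow> 0"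
      by (rule LIMSEQ_ignore_initial_segment[OF ndz[OF p]])
    then have "(\<lambda>l. (3/5) ^ Suc k * ((5/3) ^ (l + Suc k) * nd (l + Suc k) u ((F q 0 ^^ k) (F q 1 (q 2))))) \<longlonglongrightarrow> 0"
      by (rule tendsto_mult_right_zero)
    moreover have e: "(3/5) ^ Suc k * ((5/3) ^ (l + Suc k) * z) = (5/3) ^ l * z" for l and z :: real
    proof -
      have "(3/5) ^ Suc k * ((5/3) ^ (l + Suc k) * z) = ((3/5) * (5/3)) ^ Suc k * ((5/3) ^ l * z)"
        unfolding power_mult_distrib power_add by (simp only: ac_simps)
      then show ?thesis by simp
    qed
    moreover have "nd (l + Suc k) u ((F q 0 ^^ k) (F q 1 (q 2))) = T 0 (\<lambda>i. code (?h k) (replicate l 2, i)) 2" for l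
      unfolding nd_x by (simp add: foldr_replicate)
    ultimately show ?thesis unfolding e by simp
  qed
  have fx: "flx 1 (mu n) (n - Suc k) (code (?h k)) 2 = 0" if n: "kk \<le> n" "k < n" for n k
  proof -
    have "flx 1 (mu (Suc k + (n - Suc k))) (n - Suc k) (code (?h k)) 2 = 0"
    proof (rule flux_zero[where lo = "kk - Suc k" and c = "Suc k" and h = "?h k" and j = 2 and l = "n - Suc k", OF _ _ lim_x[of k]])
      fix l assume "kk - Suc k \<le> l"
      then have "kk \<le> Suc k + Suc l" by simp
      then show "net 1 (mu (Suc k + Suc l)) (Suc l) (code (?h k))"
        using hW_net[OF W, of "Suc k + Suc l" k] by simp
    qed (use n in auto)
    then show ?thesis using n by simp
  qed
  have xz: "xz (mu n) n (code u)" if "kk \<le> n" for n by (rule xz_code) (rule fx[OF that])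
  have f1: "hflx 1 False (mu (Suc n)) (Suc n) (code u) = 0" if n: "kk \<le> Suc n" for n
  proof -
    have "(\<lambda>l. (5/3) ^ Suc l * nd (Suc l) u (q 1)) \<longlonglongrightarrow> 0"
      by (rule LIMSEQ_Suc[OF ndz]) (simp add: bd_Omega_def)
    then have "(\<lambda>l. 3/5 * ((5/3) ^ Suc l * nd (Suc l) u (q 1))) \<longlonglongrightarrow> 0" by (rule tendsto_mult_right_zero)
    then have l1: "(\<lambda>l. (5/3) ^ l * T 0 (\<lambda>i. code (?h 0) (replicate l 1, i)) 1) \<longlonglongrightarrow> 0" unfolding nd_q1 by simp
    have "flx 1 (mu (Suc 0 + n)) n (code (?h 0)) 1 = 0"
    proof (rule flux_zero[where lo = "kk - Suc 0" and c = "Suc 0" and h = "?h 0" and j = 1, OF _ _ l1])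
      fix l assume "kk - Suc 0 \<le> l"
      then have "kk \<le> Suc 0 + Suc l" by simp
      then show "net 1 (mu (Suc 0 + Suc l)) (Suc l) (code (?h 0))"
        using hW_net[OF W, of "Suc 0 + Suc l" 0] by simp
    qed (use n in auto)
    then show ?thesis by simp
  qed
  let ?a = "u (q 0)" let ?al = "\<lambda>n. code u (replicate n 0, 1)"
  let ?E = "\<lambda>n. (5/3) ^ n * (?a - ?al n)"
  \<comment> \<open>This is the Neumann condition at \<open>q 0\<close>, where the cut cell leaves a
    single neighbour.\<close>
  have E: "?E \<longlonglongrightarrow> 0" using ndz[of "q 0"] unfolding nd_q0 by (simp add: bd_Omega_def del: code_apply)
  have ES: "(\<lambda>n. ?E (Suc n)) \<longlonglongrightarrow> 0" by (rule LIMSEQ_Suc[OF E])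
  obtain Bu where Bu: "\<forall>x\<in>K. \<bar>u x\<bar> \<le> Bu" using bounded_K[OF cu] by blast
  let ?x = "\<lambda>n. code u (replicate n 0 @ [1], 2)"
  have bx: "\<bar>?x n\<bar> \<le> Bu" for n
  proof -
    have "foldr (F q) (replicate n 0) (F q 1 (q 2)) \<in> K" by (induction n) (use F0_K F1_K K_SG in auto)
    then show ?thesis using Bu by simp
  qed
  have bal: "\<bar>?al n\<bar> \<le> Bu" for n using cut_point_K Bu by simp
  let ?M = "\<lambda>n. mu (Suc n)"
  have M0: "?M \<longlonglongrightarrow> 0" by (rule LIMSEQ_Suc[OF mu_null1])
  have M53: "(\<lambda>n. (5/3) ^ Suc n * ?M n) \<longlonglongrightarrow> 0" by (rule LIMSEQ_Suc[OF mu_null53])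
  let ?dq = "\<lambda>n. (1 - ?M n / 4) * code u (replicate (Suc n) 0, 0) - ?al (Suc n)"
  \<comment> \<open>The defect at the vertex where the cut cell of level \<open>Suc n\<close> meets
    its neighbour in the closed half.\<close>
  let ?jd = "\<lambda>n. T (?M n) (\<lambda>k. code u (replicate n 0 @ [1], k)) 0 + (1 - ?M n / 2) * ?al (Suc n) - code u (replicate (Suc n) 0, 0)"
  have q0: "code u (replicate n 0, 0) = ?a" for n using code_crn[of u n 0] by (simp add: crn_def)
  have dq: "(\<lambda>n. (5/3) ^ Suc n * ?dq n) \<longlonglongrightarrow> 0"
  proof -
    have "(\<lambda>n. ?E (Suc n) - ?a / 4 * ((5/3) ^ Suc n * ?M n)) \<longlonglongrightarrow> 0 - ?a / 4 * 0"
      by (intro tendsto_diff ES tendsto_mult tendsto_const M53)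
    moreover have e: "(5/3) ^ Suc n * ?dq n = ?E (Suc n) - ?a / 4 * ((5/3) ^ Suc n * ?M n)" for n
      unfolding q0 by (simp add: algebra_simps del: code_apply power_Suc replicate_Suc)
    ultimately show ?thesis unfolding e by simp
  qed
  have jd: "(\<lambda>n. (5/3) ^ Suc n * ?jd n) \<longlonglongrightarrow> 0"
  proof -
    have "(\<lambda>n. (3 - ?M n / 2) / 2 * (5/3 * ?E n - ?E (Suc n) - 1/2 * (((5/3) ^ Suc n * ?M n) * ?x n)) - ?E (Suc n)
        - 1/2 * (((5/3) ^ Suc n * ?M n) * ?al (Suc n)))
      \<longlonglongrightarrow> (3 - 0 / 2) / 2 * (5/3 * 0 - 0 - 1/2 * 0) - 0 - 1/2 * 0"
      by (intro tendsto_diff tendsto_mult tendsto_const tendsto_divide E ES M0 null_mult_bounded[OF M53 bx]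
           null_mult_bounded[OF M53 bal]) auto
    \<comment> \<open>The equation at the point of \<open>X\<close> expresses the defect through
      \<open>?E n\<close> and \<open>?E (Suc n)\<close>, up to terms with the factor
      \<open>mu\<close>.\<close>
    moreover have "(5/3) ^ Suc n * ?jd n = (3 - ?M n / 2) / 2 * (5/3 * ?E n - ?E (Suc n) - 1/2 * (((5/3) ^ Suc n * ?M n) * ?x n)) - ?E (Suc n)
        - 1/2 * (((5/3) ^ Suc n * ?M n) * ?al (Suc n))" if n: "kk \<le> n" for n
    proof -
      define a x y z M where "a = ?a" "x = ?x n" "y = ?al (Suc n)" "z = ?al n" "M = ?M n"
      note d = this
      have e0: "code u (replicate n 0 @ [1], 0) = y" using F_comm[of 1 0] by (simp add: d replicate_append_same[symmetric] del: replicate_append_same)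
      have e1: "code u (replicate n 0 @ [1], 1) = z" by (simp add: d)
      have "flx 1 (mu (Suc n)) (Suc n - Suc n) (code (?h n)) 2 = 0" by (rule fx) (use n in auto)
      then have "T M (\<lambda>k. code u (replicate n 0 @ [1], k)) 2 = 0"
        by (simp add: flx_def d foldr_replicate)
      then have x: "(3 - M / 2) * x = y + z + x" using e0 e1 by (simp add: T_def d del: code_apply)
      have j: "?jd n = (3 - M / 2) * y - (y + z + x) + (1 - M / 2) * y - a"
        unfolding q0 T_def e0 e1 by (simp add: d del: code_apply)
      have "(4 - M) * x = 2 * y + 2 * z" using x by (simp add: algebra_simps)
      then have "2 * ?jd n = (3 - M / 2) * ((y - a) - (z - a) - M / 2 * x) + 2 * (y - a) - M * y"
        unfolding j by algebra
      then have j2: "?jd n = (3 - M / 2) / 2 * ((a - z) - (a - y) - 1/2 * (M * x)) - (a - y) - 1/2 * (M * y)"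
        by (simp add: field_simps)
      have "(5/3) ^ Suc n * ?jd n = (3 - M / 2) / 2 * ((5/3) ^ Suc n * (a - z) - (5/3) ^ Suc n * (a - y) - 1/2 * (((5/3) ^ Suc n * M) * x))
         - (5/3) ^ Suc n * (a - y) - 1/2 * (((5/3) ^ Suc n * M) * y)"
      proof -
        have "p * (A * (B - C - 1/2 * (M * x)) - D - 1/2 * (M * y)) =
            A * (p * B - p * C - 1/2 * ((p * M) * x)) - p * D - 1/2 * ((p * M) * y)" for p A B C D :: real
          by (simp add: algebra_simps)
        then show ?thesis unfolding j2 .
      qed
      moreover have "(5/3) ^ Suc n * (a - z) = 5/3 * ((5/3) ^ n * (a - z))" by simp
      ultimately show ?thesis by (simp only: d)
    qed
    then have "\<forall>\<^sub>F n in sequentially. (3 - ?M n / 2) / 2 * (5/3 * ?E n - ?E (Suc n) - 1/2 * (((5/3) ^ Suc n * ?M n) * ?x n)) - ?E (Suc n)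
        - 1/2 * (((5/3) ^ Suc n * ?M n) * ?al (Suc n)) = (5/3) ^ Suc n * ?jd n"
      unfolding eventually_sequentially by metis
    ultimately show ?thesis by (simp add: tendsto_cong del: code_apply power_Suc replicate_Suc)
  qed
  have weak: "Qh False (mu m) m (code u) g = 0" if g: "hcmp m g" for g
  proof -
    let ?s = "sp False m g"
    obtain P where P: "P \<noteq> 0"
      "\<And>b u v. \<lbrakk>continuous_on K u; continuous_on K v; \<And>n. m \<le> n \<Longrightarrow> hdec b (mu (Suc n)) n (code v);
         b \<Longrightarrow> \<forall>x\<in>bd_Omega q. u x = 0; b \<Longrightarrow> \<forall>x\<in>bd_Omega q. v x = 0\<rbrakk> \<Longrightarrow>
         (\<lambda>n. (5/3) ^ n * Qh b (mu n) n (code u) (code v)) \<longlonglongrightarrow> P * Qh b (mu m) m (code u) (code v) \<and>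
         (\<lambda>n. graph_energy q K n u v) \<longlonglongrightarrow> lam * IK (\<lambda>x. u x * v x) + P * Qh b (mu m) m (code u) (code v)"
      using energy_limit[OF m] by blast
    have "False \<longrightarrow> hz m g" by simp
    note f = sp_facts[OF m g this]
    have "(\<lambda>n. (5/3) ^ n * Qh False (mu n) n (code u) (code ?s)) \<longlonglongrightarrow> P * Qh False (mu m) m (code u) (code ?s)"
      by (rule conjunct1[OF P(2)[OF cu f(1)]]) (use f(3) in auto)
    then have L: "(\<lambda>n. (5/3) ^ Suc n * Qh False (?M n) (Suc n) (code u) (code ?s)) \<longlonglongrightarrow> P * Qh False (mu m) m (code u) (code ?s)"
      by (rule LIMSEQ_Suc)
    obtain Bs where Bs: "\<forall>x\<in>K. \<bar>?s x\<bar> \<le> Bs" using bounded_K[OF f(1)] by blast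
    have bs: "\<bar>code ?s (replicate (Suc n) 0, 1)\<bar> \<le> Bs" for n using cut_point_K[of "Suc n"] Bs by (simp del: replicate_Suc)
    have s0: "code ?s (replicate (Suc n) 0, 0) = ?s (q 0)" for n using code_crn[of ?s "Suc n" 0] by (simp add: crn_def)
    have "(\<lambda>n. ((5/3) ^ Suc n * ?jd n) * code ?s (replicate (Suc n) 0, 1) + ((5/3) ^ Suc n * ?dq n) * ?s (q 0)) \<longlonglongrightarrow> 0 + 0 * ?s (q 0)"
      by (intro tendsto_add null_mult_bounded[OF jd bs] tendsto_mult dq tendsto_const)
    moreover have "(5/3) ^ Suc n * Qh False (?M n) (Suc n) (code u) (code ?s) =
        ((5/3) ^ Suc n * ?jd n) * code ?s (replicate (Suc n) 0, 1) + ((5/3) ^ Suc n * ?dq n) * ?s (q 0)" if n: "kk \<le> n" for n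
    proof -
      have "Qh False (?M n) (Suc n) (code u) (code ?s) = ?jd n * code ?s (replicate (Suc n) 0, 1) + ?dq n * ?s (q 0)"
        using hW_green[OF W[of "Suc n"] xz[of "Suc n"] hcmp_code, of ?s] f1[of n] n unfolding s0 by (simp del: code_apply hflx.simps replicate_Suc)
      then show ?thesis by (simp only: distrib_left mult.assoc)
    qed
    then have "\<forall>\<^sub>F n in sequentially. ((5/3) ^ Suc n * ?jd n) * code ?s (replicate (Suc n) 0, 1) + ((5/3) ^ Suc n * ?dq n) * ?s (q 0)
       = (5/3) ^ Suc n * Qh False (?M n) (Suc n) (code u) (code ?s)"
      unfolding eventually_sequentially by metis
    ultimately have "(\<lambda>n. (5/3) ^ Suc n * Qh False (?M n) (Suc n) (code u) (code ?s)) \<longlonglongrightarrow> 0"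
      using Lim_transform_eventually by fastforce
    then have "P * Qh False (mu m) m (code u) (code ?s) = 0" using L LIMSEQ_unique by blast
    then have "Qh False (mu m) m (code u) (code ?s) = 0" using P(1) by simp
    then show ?thesis using Qh_hres[of False "mu m" m "code u" g] Qh_hres[of False "mu m" m "code u" "code ?s"] f(2) by simp
  qed
  show "hnet 1 False (mu m) m (code u)" "hflx 1 False (mu m) m (code u) = 0"
    by (rule weak_hflx(1)[OF weak], assumption) (rule weak_hflx(2)[OF weak], assumption)
qed

end

section \<open>From graph solutions to eigenfunctions\<close>

lemma hnet_q0: "hnet 1 False M n f \<Longrightarrow> (1 - M / 4) * f (replicate n 0, 0) = f (replicate n 0, 1)"
proof (induction n arbitrary: f)
  case (Suc n)
  then show ?case using Suc.IH[of "sh f 0"] by simp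
qed simp

lemma hnet_x: "hnet 1 False M (n + Suc k) f \<Longrightarrow> T M (\<lambda>j. f (replicate k 0 @ 1 # replicate n 2, j)) 2 = 0"
proof (induction k arbitrary: f)
  case 0
  then show ?case by (simp add: flx_def)
next
  case (Suc k)
  then show ?case using Suc.IH[of "sh f 0"] by simp
qed

lemma T_0: "T M a j = 0 \<Longrightarrow> T 0 a j = M / 2 * a j"
  by (simp add: T_def algebra_simps)

context triangle begin

lemma code_lc: "code (lc c u d v) = lc c (code u) d (code v)"
  by (auto simp: code_def lc_def)

lemma res_eq_close:
  assumes "res n (code u) = res n (code v)" "x \<in> SG q"
  shows "\<exists>y\<in>SG q. u y = v y \<and> dist x y \<le> diameter (SG q) / 2 ^ n"
proof -
  obtain w where w: "length w = n" "x \<in> cell q w" using SG_cells[OF assms(2)] by blast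
  have "foldr (F q) w (q 0) \<in> cell q w" using vertex_SG[of "[]"] by (auto simp: cell_def)
  then have "dist x (foldr (F q) w (q 0)) \<le> diameter (SG q) / 2 ^ n" using cell_diam[OF w(2)] w(1) by simp
  moreover have "u (foldr (F q) w (q 0)) = v (foldr (F q) w (q 0))"
    using fun_cong[OF assms(1), of "(w, 0)"] w(1) by (simp add: res_def)
  ultimately show ?thesis by (intro bexI[of _ "foldr (F q) w (q 0)"]) simp_all
qed

lemma hres_eq_close:
  "hres n (code u) = hres n (code v) \<Longrightarrow> x \<in> K \<Longrightarrow> \<exists>y\<in>K. u y = v y \<and> dist x y \<le> diameter (SG q) / 2 ^ n"
proof (induction n arbitrary: u v x)
  case 0
  have q0: "q 0 \<in> K" using bd_K by (auto simp: bd_Omega_def)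
  have "u (q 0) = v (q 0)" using fun_cong[OF 0(1), of "([], 0)"] by simp
  moreover have "dist x (q 0) \<le> diameter (SG q)"
    using 0(2) q0 K_SG compact_imp_bounded[OF compact_SG] by (intro diameter_bounded_bound) auto
  ultimately show ?case using q0 by (intro bexI[of _ "q 0"]) simp_all
next
  case (Suc n)
  have e: "sh (hres (Suc n) (code u)) i = sh (hres (Suc n) (code v)) i" for i by (simp only: Suc.prems(1))
  have 0: "hres n (code (\<lambda>x. u (F q 0 x))) = hres n (code (\<lambda>x. v (F q 0 x)))" using e[of 0] by simp
  have 1: "res n (code (\<lambda>x. u (F q 1 x))) = res n (code (\<lambda>x. v (F q 1 x)))" using e[of 1] by simp
  show ?case
  proof (rule K_cases[OF Suc.prems(2)])
    fix y assume y: "y \<in> K" "x = F q 0 y"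
    obtain z where z: "z \<in> K" "u (F q 0 z) = v (F q 0 z)" "dist y z \<le> diameter (SG q) / 2 ^ n"
      using Suc.IH[OF 0 y(1)] by blast
    have "F q 0 z \<in> K" using z(1) F0_K K_SG by blast
    then show ?thesis using z y by (intro bexI[of _ "F q 0 z"]) (simp_all add: dist_F)
  next
    fix y assume y: "y \<in> SG q" "x = F q 1 y"
    obtain z where z: "z \<in> SG q" "u (F q 1 z) = v (F q 1 z)" "dist y z \<le> diameter (SG q) / 2 ^ n"
      using res_eq_close[OF 1 y(1)] by blast
    then show ?thesis using F1_K[OF z(1)] y by (intro bexI[of _ "F q 1 z"]) (simp_all add: dist_F)
  qed
qed

text \<open>Vertices of level \<open>n\<close> come within \<open>diameter (SG q) / 2 ^ n\<close> of
  every point of \<open>K\<close>, so continuity carries agreement over from the vertices.\<close>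

lemma hres_determines:
  assumes u: "continuous_on K u" "continuous_on K v"
    and e: "\<And>n. m \<le> n \<Longrightarrow> hres n (code u) = hres n (code v)" and x: "x \<in> K"
  shows "u x = (v x :: real)"
proof -
  have "\<forall>n. \<exists>y\<in>K. u y = v y \<and> dist x y \<le> diameter (SG q) / 2 ^ (n + m)"
    using hres_eq_close[OF e x] by simp
  then obtain y where y: "\<And>n. y n \<in> K" "\<And>n. u (y n) = v (y n)" "\<And>n. dist x (y n) \<le> diameter (SG q) / 2 ^ (n + m)"
    by metis
  have "(\<lambda>n. diameter (SG q) * (1 / 2) ^ (n + m)) \<longlonglongrightarrow> diameter (SG q) * 0"
    by (intro tendsto_mult tendsto_const LIMSEQ_ignore_initial_segment[of "\<lambda>n. (1 / 2) ^ n"] LIMSEQ_realpow_zero) auto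
  then have "(\<lambda>n. diameter (SG q) / 2 ^ (n + m)) \<longlonglongrightarrow> 0" by (simp add: power_one_over)
  then have "(\<lambda>n. dist (y n) x) \<longlonglongrightarrow> 0"
    by (rule Lim_null_comparison[rotated]) (use y(3) in \<open>simp add: dist_commute\<close>)
  then have l: "y \<longlonglongrightarrow> x" by (rule tendsto_dist_iff[THEN iffD2])
  have "(\<lambda>n. u (y n)) \<longlonglongrightarrow> u x" "(\<lambda>n. v (y n)) \<longlonglongrightarrow> v x"
    by (rule continuous_on_tendsto_compose[OF _ l x], use u y(1) in simp_all)+
  then show ?thesis unfolding y(2) using LIMSEQ_unique by blast
qed

lemma kspl_lc: "okseq nu \<Longrightarrow> kspl b m nu (lc c f d g) = lc c (kspl b m nu f) d (kspl b m nu g)"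
  by (rule ext) (simp add: kspl_def lc_def[of c "kspl b m nu f"] hspl_lc)

definition Omega_space :: "bool \<Rightarrow> real \<Rightarrow> (real^2 \<Rightarrow> real) set" where
  "Omega_space b lam = (if b then Omega_dirichlet_space q lam else Omega_neumann_space q lam)"

end

context eigen begin

lemma hdec_determines:
  assumes u: "continuous_on K u" "continuous_on K v"
    and d: "\<And>n. m \<le> n \<Longrightarrow> hdec b (mu (Suc n)) n (code u)" "\<And>n. m \<le> n \<Longrightarrow> hdec b (mu (Suc n)) n (code v)"
    and e: "hres m (code u) = hres m (code v)" and x: "x \<in> K"
  shows "u x = v x"
proof (rule hres_determines[OF u _ x])
  fix n assume "m \<le> n"
  then show "hres n (code u) = hres n (code v)"
  proof (induction n rule: dec_induct)
    case base
    show ?case by (rule e)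
  next
    case (step n)
    then show ?case using hdec_uniq[OF d(1) d(2), of n] by simp
  qed
qed

lemma Omega_space_eigen: "u \<in> Omega_space b lam \<Longrightarrow> eigen_eq q K (bd_Omega q) lam u"
  by (cases b) (auto simp: Omega_space_def Omega_dirichlet_space_def Omega_neumann_space_def)

lemma Omega_space_restrict:
  assumes u: "u \<in> Omega_space b lam" and m: "kk \<le> m"
  shows "hres m (code u) \<in> Sol 1 b m (mu m)" "hdec b (mu (Suc m)) m (code u)"
proof -
  have a: "hnet 1 b (mu n) n (code u) \<and> (if b then u (q 1) = 0 else hflx 1 b (mu n) n (code u) = 0)" if "kk \<le> n" for n
    using dirichlet_restrict[OF _ that, of u] neumann_restrict[OF _ that, of u] u by (cases b) (simp_all add: Omega_space_def)
  show "hres m (code u) \<in> Sol 1 b m (mu m)"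
    using a[OF m] by (cases b) (simp_all add: Sol_def hcmp_code)
  have "hnet 1 b (mu (Suc m)) (Suc m) (code u)" using a[of "Suc m"] m by (simp del: hnet.simps)
  then show "hdec b (mu (Suc m)) m (code u)" using hnet_dec[OF mu_good(1,2)[OF m] hcmp_code] by blast
qed

lemma hnet_up:
  assumes m: "kk \<le> n" and d: "hdec b (mu (Suc n)) n (code u)" and h: "hnet 1 b (mu n) n (code u)"
  shows "hnet 1 b (mu (Suc n)) (Suc n) (code u)"
    "(b \<longrightarrow> hz (Suc n) (code u)) \<Longrightarrow> hflx 1 b (mu n) n (code u) = 0 \<Longrightarrow> hflx 1 b (mu (Suc n)) (Suc n) (code u) = 0"
proof -
  have k: "k0 (mu (Suc n)) \<noteq> 0" using mu_good[OF m] by (simp add: k0_def)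
  show "hnet 1 b (mu (Suc n)) (Suc n) (code u)"
    using hnet_dec[OF mu_good(1,2)[OF m] hcmp_code, where b = b] d h by (simp add: hnet_scale[OF k] R_mu[OF m] del: hnet.simps)
  assume "b \<longrightarrow> hz (Suc n) (code u)" "hflx 1 b (mu n) n (code u) = 0"
  then show "hflx 1 b (mu (Suc n)) (Suc n) (code u) = 0"
    using hflx_dec[OF mu_good(1,2)[OF m] d] by (simp add: hflx_scale[of "k0 _"] R_mu[OF m] del: hflx.simps hz.simps)
qed

lemma nd_null:
  assumes "\<And>n. n \<ge> N \<Longrightarrow> nd n u p = c * mu n"
  shows "(\<lambda>n. (5/3) ^ n * nd n u p) \<longlonglongrightarrow> 0"
proof -
  have "(\<lambda>n. c * ((5/3) ^ n * mu n)) \<longlonglongrightarrow> 0" by (rule tendsto_mult_right_zero[OF mu_null53])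
  moreover have "\<forall>\<^sub>F n in sequentially. c * ((5/3) ^ n * mu n) = (5/3) ^ n * nd n u p"
    using assms by (auto simp: eventually_sequentially intro!: exI[of _ N])
  ultimately show ?thesis by (rule Lim_transform_eventually)
qed

text \<open>Pairing with a test function leaves the level-\<open>m\<close> form, which
  \<open>hgreen\<close> reduces to a term at \<open>q 1\<close>, where the test is 0. In the Neumann
  case zero graph fluxes make the sums of differences a multiple of \<open>mu n\<close>, so the
  normal derivatives are 0 in the limit.\<close>

lemma spline_eigen:
  assumes f: "f \<in> Sol 1 b m (mu m)" and m: "kk \<le> m"
  shows "sp b m f \<in> Omega_space b lam"
proof -
  let ?u = "sp b m f"
  have f': "hres m f = f" "hcmp m f" "hnet 1 b (mu m) m f" and fb: "if b then f (crn m 1) = 0 else hflx 1 b (mu m) m f = 0"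
    using f by (auto simp: Sol_def)
  have bz: "b \<longrightarrow> hz m f" using f'(3) hnet_hz[of 1 "mu m" m f] by (cases b) auto
  note s = sp_facts[OF m f'(2) bz]
  have r: "hres m (code ?u) = f" using s(2) f'(1) by (rule trans)
  have z: "\<forall>x\<in>bd_Omega q. ?u x = 0" if b using s(5) bz fb that by simp
  have hn: "hnet 1 b (mu n) n (code ?u)" if "m \<le> n" for n using that
  proof (induction n rule: dec_induct)
    case base
    show ?case using f'(3) hnet_hres[of 1 b "mu m" m "code ?u"] unfolding r by blast
  next
    case (step n)
    then show ?case using m by (intro hnet_up(1) s(3)) auto
  qed
  have E: "finite_energy q K ?u \<and> (\<forall>v. finite_energy q K v \<and> (\<forall>x\<in>bd_Omega q. v x = 0) \<longrightarrow>
      energy q K ?u v = - (LINT x:K|SG_measure q. - (lam * ?u x) * v x))"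
  proof -
    obtain P where P: "P \<noteq> 0"
      "\<And>b u v. \<lbrakk>continuous_on K u; continuous_on K v; \<And>n. m \<le> n \<Longrightarrow> hdec b (mu (Suc n)) n (code v);
         b \<Longrightarrow> \<forall>x\<in>bd_Omega q. u x = 0; b \<Longrightarrow> \<forall>x\<in>bd_Omega q. v x = 0\<rbrakk> \<Longrightarrow>
         (\<lambda>n. (5/3) ^ n * Qh b (mu n) n (code u) (code v)) \<longlonglongrightarrow> P * Qh b (mu m) m (code u) (code v) \<and>
         (\<lambda>n. graph_energy q K n u v) \<longlonglongrightarrow> lam * IK (\<lambda>x. u x * v x) + P * Qh b (mu m) m (code u) (code v)"
      using energy_limit[OF m] by blast
    have "convergent (\<lambda>n. graph_energy q K n ?u ?u)"
      by (rule convergentI[OF conjunct2[OF P(2)[OF s(1) s(1) s(3)]]]) (use z in auto)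
    then have "finite_energy q K ?u" using s(1) by (simp add: finite_energy_def)
    moreover have "energy q K ?u v = - (LINT x:K|SG_measure q. - (lam * ?u x) * v x)"
      if v: "finite_energy q K v" "\<forall>x\<in>bd_Omega q. v x = 0" for v
    proof -
      have cv: "continuous_on K v" using v(1) by (simp add: finite_energy_def)
      have "(\<lambda>n. graph_energy q K n v ?u) \<longlonglongrightarrow> lam * IK (\<lambda>x. v x * ?u x) + P * Qh b (mu m) m (code v) (code ?u)"
        by (rule conjunct2[OF P(2)[OF cv s(1) s(3)]]) (use z v in auto)
      moreover have "graph_energy q K n v ?u = graph_energy q K n ?u v" for n
        unfolding graph_energy_K using Qh_sym[of False 0 n "code v" "code ?u"] by simp
      moreover have "Qh b (mu m) m (code v) (code ?u) = 0"
      proof -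
        have "Qh b (mu m) m (code ?u) (code v) = hflx 1 b (mu m) m (code ?u) * code v (crn m 1)"
          by (rule hgreen[OF hcmp_code hn]) (use hz_code[OF v(2)] in auto)
        also have "\<dots> = 0" using v(2) by (simp add: bd_Omega_def)
        finally show ?thesis using Qh_sym[of b "mu m" m "code v" "code ?u"] by simp
      qed
      ultimately have "(\<lambda>n. graph_energy q K n ?u v) \<longlonglongrightarrow> lam * IK (\<lambda>x. v x * ?u x)" by simp
      then have "energy q K ?u v = lam * IK (\<lambda>x. v x * ?u x)" unfolding energy_def by (rule limI)
      then show ?thesis unfolding weak_rhs by (simp only: mult.commute)
    qed
    ultimately show ?thesis by blast
  qed
  have "continuous_on K (\<lambda>x. - (lam * ?u x))" by (intro continuous_intros s(1))
  then have e: "eigen_eq q K (bd_Omega q) lam ?u"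
    using E s(4) unfolding eigen_eq_def has_laplacian_def by blast
  show ?thesis
  proof (cases b)
    case True
    then show ?thesis using e z by (simp add: Omega_space_def Omega_dirichlet_space_def)
  next
    case False
    then have b: "b = False" by simp
    have hf: "hflx 1 False (mu n) n (code ?u) = 0" if "m \<le> n" for n using that
    proof (induction n rule: dec_induct)
      case base
      have "hflx 1 False (mu m) m f = 0" using fb b by simp
      then have "hflx 1 False (mu m) m (hres m (code ?u)) = 0" by (simp only: r)
      then show ?case by (simp only: hflx_hres)
    next
      case (step n)
      have n: "m \<le> n" "kk \<le> n" using step m by auto
      have "hdec False (mu (Suc n)) n (code ?u)" "hnet 1 False (mu n) n (code ?u)" using s(3)[OF n(1)] hn[OF n(1)] by (simp_all only: b)
      from hnet_up(2)[OF n(2) this _ step.IH] show ?case by (simp only: simp_thms)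
    qed
    have "(\<lambda>n. (5/3) ^ n * nd n ?u p) \<longlonglongrightarrow> 0" if p: "p \<in> bd_Omega q" for p
    proof -
      consider "p = q 0" | "p = q 1" | k where "p = (F q 0 ^^ k) (F q 1 (q 2))" using bd_Omega_cases[OF p] by blast
      then show ?thesis
      proof cases
        case 1
        show ?thesis unfolding 1
        proof (rule nd_null)
          fix n assume n: "n \<ge> m"
          have "code ?u (replicate n 0, 0) = ?u (q 0)" using code_crn[of ?u n 0] by (simp add: crn_def)
          then show "nd n ?u (q 0) = ?u (q 0) / 4 * mu n"
            using hnet_q0[OF hn[OF n, unfolded b]] unfolding nd_q0 b by (simp add: algebra_simps del: code_apply)
        qed
      next
        case 2
        show ?thesis unfolding 2
        proof (rule nd_null)
          fix n assume n: "n \<ge> Suc m"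
          then obtain l where l: "n = Suc l" by (cases n) auto
          have "T (mu n) (\<lambda>k. code ?u (1 # replicate l 1, k)) 1 = 0"
            using hf[of n] n l by (simp add: flx_def b)
          moreover have "code ?u (1 # replicate l 1, 1) = ?u (q 1)" using code_crn[of ?u "Suc l" 1] by (simp add: crn_def del: code_crn)
          ultimately show "nd n ?u (q 1) = ?u (q 1) / 2 * mu n"
            using T_0[of "mu n" "\<lambda>k. code ?u (1 # replicate l 1, k)" 1] unfolding l nd_q1 by (simp del: code_apply)
        qed
      next
        case (3 k)
        show ?thesis unfolding 3
        proof (rule nd_null)
          fix n assume n: "n \<ge> m + Suc k"
          define l where "l = n - Suc k"
          have l: "n = l + Suc k" using n by (simp add: l_def)
          let ?a = "\<lambda>j. code ?u (replicate k 0 @ 1 # replicate l 2, j)"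
          have "m \<le> n" using n by simp
          then have "hnet 1 False (mu n) n (code ?u)" using hn by (simp only: b)
          then have "hnet 1 False (mu n) (l + Suc k) (code ?u)" by (simp only: l[symmetric])
          then have "T (mu n) ?a 2 = 0" by (rule hnet_x)
          moreover have "(F q 2 ^^ l) (q 2) = q 2" by (induction l) simp_all
          then have "?a 2 = ?u ((F q 0 ^^ k) (F q 1 (q 2)))" by (simp add: foldr_replicate)
          ultimately show "nd n ?u ((F q 0 ^^ k) (F q 1 (q 2))) = ?u ((F q 0 ^^ k) (F q 1 (q 2))) / 2 * mu n"
            using T_0[of "mu n" ?a 2] unfolding l nd_x by (simp del: code_apply)
        qed
      qed
    qed
    then have "?u \<in> Omega_neumann_space q lam"
      using e unfolding Omega_neumann_space_def has_normal_deriv_Omega_def by blast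
    then show ?thesis by (simp only: Omega_space_def b if_False)
  qed
qed

text \<open>An eigenfunction restricts to a graph solution on level \<open>kk\<close>, and all its
  finer values follow by decimation; so it is the spline of its restriction.\<close>

lemma Omega_space_spline: "Omega_space b lam = sp b kk ` Sol 1 b kk (mu kk)"
proof (rule set_eqI, rule iffI)
  fix u assume "u \<in> sp b kk ` Sol 1 b kk (mu kk)"
  then show "u \<in> Omega_space b lam" using spline_eigen[of _ b kk] by auto
next
  fix u assume u: "u \<in> Omega_space b lam"
  let ?f = "hres kk (code u)"
  have f: "?f \<in> Sol 1 b kk (mu kk)" by (rule Omega_space_restrict(1)[OF u]) simp
  have s: "sp b kk ?f \<in> Omega_space b lam" by (rule spline_eigen[OF f]) simp
  have c: "continuous_on K w" "x \<notin> K \<Longrightarrow> w x = 0" if "w \<in> Omega_space b lam" for w x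
    using Omega_space_eigen[OF that] by (auto simp: eigen_eq_def has_laplacian_def finite_energy_def)
  have g: "hcmp kk ?f" "hnet 1 b (mu kk) kk ?f" using f by (auto simp: Sol_def)
  have bz: "b \<longrightarrow> hz kk ?f" using g(2) hnet_hz[of 1 "mu kk" kk ?f] by (cases b) auto
  have r: "hres kk (code u) = hres kk (code (sp b kk ?f))" using sp_facts(2)[OF _ g(1) bz] by simp
  have "u x = sp b kk ?f x" for x
  proof (cases "x \<in> K")
    case True
    show ?thesis
      by (rule hdec_determines[OF c(1)[OF u] c(1)[OF s] Omega_space_restrict(2)[OF u] Omega_space_restrict(2)[OF s] r True])
  qed (use c(2)[OF u] c(2)[OF s] in simp)
  then have "u = sp b kk ?f" by (rule ext)
  then show "u \<in> sp b kk ` Sol 1 b kk (mu kk)" using f by (rule image_eqI)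
qed

lemma Omega_space_dim:
  assumes "dimn d (Sol 1 b kk (mu kk))"
  shows "lin_sub (Omega_space b lam)" "dimn d (Omega_space b lam)"
proof -
  have l: "lin_on (Sol 1 b kk (mu kk)) (sp b kk)" using kspl_lc[OF okseq_nus] unfolding lin_on_def by blast
  show "lin_sub (Omega_space b lam)" unfolding Omega_space_spline by (rule lin_sub_image[OF lin_sub_Sol l])
  show "dimn d (Omega_space b lam)" unfolding Omega_space_spline
  proof (rule dimn_iso[OF lin_sub_Sol l _ _ assms])
    show "lin_on UNIV (\<lambda>u. hres kk (code u))" by (simp add: lin_on_def code_lc)
    fix f assume f: "f \<in> Sol 1 b kk (mu kk)"
    have g: "hcmp kk f" "hnet 1 b (mu kk) kk f" "hres kk f = f" using f by (auto simp: Sol_def)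
    have bz: "b \<longrightarrow> hz kk f" using g(2) hnet_hz[of 1 "mu kk" kk f] by (cases b) auto
    show "hres kk (code (sp b kk f)) = f" using sp_facts(2)[OF _ g(1) bz] g(3) by simp
  qed
qed

end

subsection \<open>Multiplicities of graph eigenvalues\<close>

text \<open>Dimension of \<open>Sol 1 b n mu\<close> for every real \<open>mu\<close>; it is 0 off
  the graph spectrum.\<close>

primrec gmult :: "bool \<Rightarrow> nat \<Rightarrow> real \<Rightarrow> nat" where
  "gmult b 0 mu = (if \<not> b \<and> (mu = 0 \<or> mu = 6) then 1 else 0)"
| "gmult b (Suc n) mu =
    (if mu = 2 then 0 else if mu = 5 then (if b then 1 + wd5 n else nd5 n)
     else if mu = 6 then hzd b n + (if b then 0 else 1) else gmult b n (R mu))"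

lemma dimn_gmult: "dimn (gmult b n mu) (Sol 1 b n mu)"
proof (induction n arbitrary: mu)
  case 0
  show ?case using Sol_level0_dirichlet Sol_level0_neumann[of mu] by (cases b) (simp_all split: if_splits)
next
  case (Suc n)
  consider "mu = 2" | "mu = 5" | "mu = 6" | "mu \<noteq> 2" "mu \<noteq> 5" "mu \<noteq> 6" by blast
  then show ?case
  proof cases
    case 1
    then show ?thesis using dimn_Sol_2[of b n] by simp
  next
    case 2
    then show ?thesis using dimn_Sol_5_dirichlet[of n] dimn_Sol_5_neumann[of n] by (cases b) simp_all
  next
    case 3
    then show ?thesis using dimn_Sol_6[of b n] by simp
  next
    case 4
    have "dimn (gmult b n (R mu)) (Sol (k0 mu) b n (R mu))"
      using Suc[of "R mu"] Sol_scale[of "k0 mu" b n "R mu"] 4 by (simp add: k0_def)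
    then show ?thesis using Sol_dec[OF 4(1,2)] 4 by simp
  qed
qed

lemma gmult_range: "gmult b n x \<noteq> 0 \<Longrightarrow> 0 \<le> x \<and> x \<le> 5 \<or> x = 6"
proof (induction n arbitrary: x)
  case 0
  then show ?case by (auto split: if_splits)
next
  case (Suc n)
  show ?case
  proof (cases "x = 2 \<or> x = 5 \<or> x = 6")
    case False
    then have "gmult b n (R x) \<noteq> 0" using Suc.prems by simp
    then have "0 \<le> x * (5 - x)" using Suc.IH[of "R x"] by (auto simp: R_def)
    then show ?thesis by (auto simp: zero_le_mult_iff)
  qed auto
qed

lemma gmult_0: "gmult b n 0 = (if b then 0 else 1)"
  by (induction n) (simp_all add: R_def)

section \<open>Closed forms of the multiplicities\<close>

lemma fzd_eq: "2 * real (fzd n) = 3 ^ Suc n - 3"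
  by (induction n) simp_all

lemma zd_eq: "2 * real (zd n) = 3 ^ n - 1"
  by (induction n) simp_all

lemma hzd_eq: "4 * real (hzd b n) = (if b then 3 ^ Suc n - 3 - 2 * real n else 3 ^ Suc n + 2 * real n + 1)"
proof (induction n)
  case (Suc n)
  then show ?case using fzd_eq[of n] by (cases b) simp_all
qed simp

lemma nd5_eq: "4 * real (nd5 n) = 3 ^ n - 1 - 2 * real n"
proof (induction n)
  case (Suc n)
  then show ?case using zd_eq[of n] by simp
qed simp

lemma wd5_eq: "4 * real (wd5 n) = 3 ^ n - 1 + 2 * real n"
proof (induction n)
  case (Suc n)
  then show ?case using zd_eq[of n] by simp
qed simp

lemma gmult_5: "4 * real (gmult b (Suc n) 5) = (if b then 3 ^ n + 3 + 2 * real n else 3 ^ n - 1 - 2 * real n)"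
  using wd5_eq[of n] nd5_eq[of n] by simp

lemma gmult_6: "4 * real (gmult b n 6) = (if b then 3 ^ n - 1 - 2 * real n else 3 ^ n + 3 + 2 * real n)"
proof (cases n)
  case (Suc m)
  then show ?thesis using hzd_eq[of b m] by (cases b) simp_all
qed simp

section \<open>Preimages under \<open>R\<close> and the total multiplicity\<close>

text \<open>The preimages of \<open>x\<close> under \<open>R\<close> are \<open>psi x\<close> and \<open>5 - psi x\<close>; for \<open>x > 25/4\<close> there are none, and
  \<open>psi x\<close> is junk.\<close>

definition psi :: "real \<Rightarrow> real" where "psi x = (5 - sqrt (25 - 4 * x)) / 2"

lemma psi_R: "x \<le> 25/4 \<Longrightarrow> psi x * (5 - psi x) = x"
proof -
  assume "x \<le> 25/4"
  then have "(sqrt (25 - 4 * x))\<^sup>2 = 25 - 4 * x" by simp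
  then show ?thesis by (simp add: psi_def power2_eq_square field_simps)
qed

lemma R_psi: "x \<le> 25/4 \<Longrightarrow> R (psi x) = x"
  by (simp add: R_def psi_R)

lemma R_5_minus: "R (5 - x) = R x"
  by (simp add: R_def mult.commute)

lemma psi_0 [simp]: "psi 0 = 0"
  by (simp add: psi_def)

lemma psi_6: "psi 6 = 2"
  by (simp add: psi_def)

lemma psi_nonneg: "0 \<le> x \<Longrightarrow> 0 \<le> psi x"
proof -
  assume "0 \<le> x"
  then have "sqrt (25 - 4 * x) \<le> 5" by (intro real_le_lsqrt) auto
  then show ?thesis by (simp add: psi_def)
qed

lemma psi_mono: "x \<le> y \<Longrightarrow> psi x \<le> psi y"
  by (simp add: psi_def)

lemma psi_less_2: "x < 6 \<Longrightarrow> psi x < 2"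
proof -
  assume "x < 6"
  then have "1 < sqrt (25 - 4 * x)" by (intro real_less_rsqrt) auto
  then show ?thesis by (simp add: psi_def)
qed

lemma R_preimage: "x \<le> 25/4 \<Longrightarrow> R y = x \<Longrightarrow> y = psi x \<or> y = 5 - psi x"
proof -
  assume "x \<le> 25/4" "R y = x"
  then have "(y - psi x) * (y - (5 - psi x)) = 0" using psi_R[of x] by (simp add: R_def algebra_simps)
  then show ?thesis by simp
qed

lemma finite_gmult: "finite {x. gmult b n x \<noteq> 0}"
proof (induction n)
  case 0
  have "{x. gmult b 0 x \<noteq> 0} \<subseteq> {0, 6}" by auto
  then show ?case by (rule finite_subset) simp
next
  case (Suc n)
  let ?S = "{x. gmult b n x \<noteq> 0}"
  have "{x. gmult b (Suc n) x \<noteq> 0} \<subseteq> {2, 5, 6} \<union> (psi ` ?S \<union> (\<lambda>x. 5 - psi x) ` ?S)"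
  proof
    fix x assume x: "x \<in> {x. gmult b (Suc n) x \<noteq> 0}"
    show "x \<in> {2, 5, 6} \<union> (psi ` ?S \<union> (\<lambda>x. 5 - psi x) ` ?S)"
    proof (cases "x \<in> {2, 5, 6}")
      case False
      then have "R x \<in> ?S" using x by simp
      moreover have "x = psi (R x) \<or> x = 5 - psi (R x)"
        by (rule R_preimage) (use gmult_range[of b n "R x"] \<open>R x \<in> ?S\<close> in auto)
      ultimately show ?thesis by blast
    qed blast
  qed
  then show ?case by (rule finite_subset) (use Suc in auto)
qed

definition gmult_sum :: "bool \<Rightarrow> nat \<Rightarrow> real" where
  "gmult_sum b n = (\<Sum>x | gmult b n x \<noteq> 0. real (gmult b n x))"

lemma gmult_psi:
  assumes "gmult b n x \<noteq> 0" "x \<noteq> 6"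
  shows "gmult b (Suc n) (psi x) = gmult b n x" "0 \<le> psi x" "psi x < 2"
proof -
  have x: "0 \<le> x" "x \<le> 5" using gmult_range[OF assms(1)] assms(2) by auto
  show 1: "0 \<le> psi x" "psi x < 2" using psi_nonneg[OF x(1)] psi_less_2[of x] x by auto
  then show "gmult b (Suc n) (psi x) = gmult b n x" using R_psi[of x] x by simp
qed

lemma gmult_5_psi:
  assumes "gmult b n x \<noteq> 0" "x \<noteq> 0"
  shows "gmult b (Suc n) (5 - psi x) = gmult b n x" "3 \<le> 5 - psi x" "5 - psi x < 5"
proof -
  have x: "0 \<le> x" "x \<le> 6" using gmult_range[OF assms(1)] by auto
  have R: "R (psi x) = x" using R_psi[of x] x by simp
  have "psi x \<le> 2" using psi_mono[OF x(2)] by (simp add: psi_6)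
  moreover have "psi x \<noteq> 0" using R assms(2) by (auto simp: R_def)
  ultimately show "3 \<le> 5 - psi x" "5 - psi x < 5" using psi_nonneg[OF x(1)] by auto
  then show "gmult b (Suc n) (5 - psi x) = gmult b n x" using R by (simp add: R_5_minus)
qed

lemma psi_inj: "x \<le> 25/4 \<Longrightarrow> y \<le> 25/4 \<Longrightarrow> psi x = psi y \<Longrightarrow> x = y"
  using R_psi by metis

lemma gmult_le: "gmult b n x \<noteq> 0 \<Longrightarrow> x \<le> 25/4"
  using gmult_range[of b n x] by auto

text \<open>Every \<open>x\<close> passes its multiplicity on to its preimages \<open>psi x\<close>
  and \<open>5 - psi x\<close>, except that the preimage 2 of 6 and the preimage 5 of 0 do not
  inherit; 5 and 6 enter with multiplicities of their own.\<close>

lemma gmult_sum_Suc: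
  "gmult_sum b (Suc n) = real (gmult b (Suc n) 5) + real (gmult b (Suc n) 6) + 2 * gmult_sum b n - real (gmult b n 0) - real (gmult b n 6)"
proof -
  let ?S = "{x. gmult b n x \<noteq> 0}"
  let ?d = "\<lambda>x. real (gmult b (Suc n) x)"
  let ?A = "psi ` (?S - {6})" and ?B = "(\<lambda>x. 5 - psi x) ` (?S - {0})"
  have fin: "finite ?S" by (rule finite_gmult)
  have A2: "y < 2" if "y \<in> ?A" for y using that gmult_psi(3) by blast
  have B3: "3 \<le> y \<and> y < 5" if "y \<in> ?B" for y using that gmult_5_psi(2,3) by blast
  have AB: "?A \<inter> ?B = {}" using A2 B3 by fastforce
  have nA: "5 \<notin> ?A \<union> ?B" "6 \<notin> ?A \<union> ?B" using A2[of 5] A2[of 6] B3[of 5] B3[of 6] by auto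
  have sub: "{x. gmult b (Suc n) x \<noteq> 0} \<subseteq> {5, 6} \<union> (?A \<union> ?B)"
  proof
    fix x assume x: "x \<in> {x. gmult b (Suc n) x \<noteq> 0}"
    show "x \<in> {5, 6} \<union> (?A \<union> ?B)"
    proof (cases "x = 5 \<or> x = 6")
      case False
      then have x2: "x \<noteq> 2" using x by auto
      then have R: "gmult b n (R x) \<noteq> 0" using x False by simp
      have "x = psi (R x) \<or> x = 5 - psi (R x)" by (rule R_preimage[OF gmult_le[OF R] refl])
      then show ?thesis
      proof
        assume e: "x = psi (R x)"
        then have "R x \<noteq> 6" using x2 psi_6 by metis
        then have "R x \<in> ?S - {6}" using R by simp
        then show ?thesis using e by blast
      next
        assume e: "x = 5 - psi (R x)"
        then have "R x \<noteq> 0" using False by auto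
        then have "R x \<in> ?S - {0}" using R by simp
        then show ?thesis using e by blast
      qed
    qed auto
  qed
  have "gmult_sum b (Suc n) = sum ?d ({5, 6} \<union> (?A \<union> ?B))"
    unfolding gmult_sum_def by (rule sum.mono_neutral_left) (use fin sub in auto)
  also have "\<dots> = sum ?d {5, 6} + sum ?d (?A \<union> ?B)" by (rule sum.union_disjoint) (use fin nA in auto)
  also have "sum ?d (?A \<union> ?B) = sum ?d ?A + sum ?d ?B" by (rule sum.union_disjoint) (use fin AB in auto)
  also have "sum ?d ?A = (\<Sum>x\<in>?S - {6}. real (gmult b n x))"
  proof (subst sum.reindex)
    show "inj_on psi (?S - {6})" by (rule inj_onI) (use psi_inj gmult_le in blast)
    show "sum (?d \<circ> psi) (?S - {6}) = (\<Sum>x\<in>?S - {6}. real (gmult b n x))"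
      by (rule sum.cong) (use gmult_psi(1) in auto)
  qed
  also have "\<dots> = gmult_sum b n - real (gmult b n 6)" using fin by (simp add: gmult_sum_def sum_diff1)
  also have "sum ?d ?B = (\<Sum>x\<in>?S - {0}. real (gmult b n x))"
  proof (subst sum.reindex)
    show "inj_on (\<lambda>x. 5 - psi x) (?S - {0})" by (rule inj_onI) (use psi_inj gmult_le in auto)
    show "sum (?d \<circ> (\<lambda>x. 5 - psi x)) (?S - {0}) = (\<Sum>x\<in>?S - {0}. real (gmult b n x))"
      by (rule sum.cong) (use gmult_5_psi(1) in auto)
  qed
  also have "\<dots> = gmult_sum b n - real (gmult b n 0)" using fin by (simp add: gmult_sum_def sum_diff1)
  finally show ?thesis by (simp del: gmult.simps)
qed

lemma gmult_sum_eq: "4 * gmult_sum b n = (if b then 3 ^ Suc n - 3 - 2 * real n else 3 ^ Suc n + 5 + 2 * real n)"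
proof (induction n)
  case 0
  have "{x. gmult False 0 x \<noteq> 0} = {0, 6}" "{x. gmult True 0 x \<noteq> 0} = {}" by auto
  then show ?case by (cases b) (simp_all add: gmult_sum_def)
next
  case (Suc n)
  then show ?case using gmult_5[of b n] gmult_6[of b n] gmult_6[of b "Suc n"] gmult_0[of b n] unfolding gmult_sum_Suc
    by (cases b) (simp_all del: gmult.simps)
qed

text \<open>The part of the next spectrum up to 3 is a copy of the present one: \<open>psi x\<close>
  for \<open>x\<close> other than 6, and 3 for \<open>x = 6\<close>, whose smaller preimage 2 is
  forbidden.\<close>

lemma gmult_sum_lower:
  "finite {x. 0 \<le> x \<and> x \<le> 3 \<and> gmult b (Suc n) x \<noteq> 0}"
  "(\<Sum>x | 0 \<le> x \<and> x \<le> 3 \<and> gmult b (Suc n) x \<noteq> 0. real (gmult b (Suc n) x)) = gmult_sum b n"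
proof -
  let ?S = "{x. gmult b n x \<noteq> 0}" and ?A = "{x. 0 \<le> x \<and> x \<le> 3 \<and> gmult b (Suc n) x \<noteq> 0}"
  show "finite ?A" by (rule finite_subset[OF _ finite_gmult[of b "Suc n"]]) auto
  define nu where "nu x = (if x = 6 then 3 else psi x)" for x :: real
  have R: "R (nu x) = x" if "gmult b n x \<noteq> 0" for x using R_psi[OF gmult_le[OF that]] by (simp add: nu_def) (simp add: R_def)
  have d: "gmult b (Suc n) (nu x) = gmult b n x" if "gmult b n x \<noteq> 0" for x
  proof (cases "x = 6")
    case True
    then show ?thesis by (simp add: nu_def) (simp add: R_def)
  next
    case False
    then show ?thesis using gmult_psi(1)[OF that False] by (simp add: nu_def del: gmult.simps)
  qed
  have "?A = nu ` ?S"
  proof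
    show "nu ` ?S \<subseteq> ?A"
    proof
      fix y assume "y \<in> nu ` ?S"
      then obtain x where x: "gmult b n x \<noteq> 0" "y = nu x" by auto
      have "0 \<le> y \<and> y \<le> 3" using x gmult_psi(2,3)[OF x(1)] by (cases "x = 6") (auto simp: nu_def)
      then show "y \<in> ?A" using d[OF x(1)] x by (simp del: gmult.simps)
    qed
    show "?A \<subseteq> nu ` ?S"
    proof
      fix y assume y: "y \<in> ?A"
      then have y': "y \<noteq> 2" "y \<noteq> 5" "y \<noteq> 6" by (auto split: if_splits)
      then have S: "gmult b n (R y) \<noteq> 0" using y by simp
      have "y = psi (R y) \<or> y = 5 - psi (R y)" by (rule R_preimage[OF gmult_le[OF S] refl])
      then have "y = nu (R y)"
      proof
        assume e: "y = psi (R y)"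
        then have "R y \<noteq> 6" using y'(1) psi_6 by metis
        then show ?thesis using e by (simp add: nu_def)
      next
        assume e: "y = 5 - psi (R y)"
        have "\<not> R y < 6" using psi_less_2[of "R y"] e y by auto
        then have "R y = 6" using gmult_range[OF S] by auto
        then show ?thesis using e psi_6 by (simp add: nu_def)
      qed
      then show "y \<in> nu ` ?S" using S by blast
    qed
  qed
  moreover have "inj_on nu ?S"
  proof (rule inj_onI)
    fix x y assume a: "x \<in> ?S" "y \<in> ?S" "nu x = nu y"
    then have "R (nu x) = x" "R (nu y) = y" using R by blast+
    then show "x = y" unfolding a(3) by (rule trans[OF sym])
  qed
  ultimately have "(\<Sum>x\<in>?A. real (gmult b (Suc n) x)) = (\<Sum>x\<in>?S. real (gmult b (Suc n) (nu x)))"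
    by (intro sum.reindex_cong[where l = nu and B = ?S]) (assumption | rule refl)+
  also have "\<dots> = gmult_sum b n" unfolding gmult_sum_def by (rule sum.cong) (use d in auto)
  finally show "(\<Sum>x\<in>?A. real (gmult b (Suc n) x)) = gmult_sum b n" .
qed

subsection \<open>The limit along the lower inverse branch\<close>

lemma psi_abs:
  assumes "-1 \<le> x" "x \<le> 3" shows "\<bar>psi x\<bar> \<le> \<bar>x\<bar> / 4"
proof -
  have "3 \<le> sqrt (25 - 4 * x)" using assms by (intro real_le_rsqrt) auto
  then have p: "psi x \<le> 1" by (simp add: psi_def)
  have "\<bar>x\<bar> = \<bar>psi x\<bar> * \<bar>5 - psi x\<bar>" unfolding abs_mult[symmetric] using psi_R[of x] assms by simp
  also have "\<dots> \<ge> \<bar>psi x\<bar> * 4" using p by (intro mult_left_mono) auto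
  finally show ?thesis by simp
qed

lemma psi_iter:
  assumes "-1 \<le> x" "x \<le> 3"
  shows "-1 \<le> (psi ^^ n) x \<and> (psi ^^ n) x \<le> 3 \<and> \<bar>(psi ^^ n) x\<bar> \<le> \<bar>x\<bar> / 4 ^ n"
proof (induction n)
  case (Suc n)
  have "\<bar>psi ((psi ^^ n) x)\<bar> \<le> \<bar>(psi ^^ n) x\<bar> / 4" using psi_abs Suc by blast
  then show ?case using Suc by auto
qed (use assms in auto)

text \<open>The limit of \<open>5 ^ n * (psi ^^ n) x\<close>, as a series obtained from \<open>5 * psi y = y + (psi y)\<^sup>2\<close>.\<close>

definition Lf :: "real \<Rightarrow> real" where
  "Lf x = x + (\<Sum>j. 5 ^ j * ((psi ^^ Suc j) x)\<^sup>2)"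

lemma Lf_term:
  assumes "-1 \<le> x" "x \<le> 3"
  shows "norm (5 ^ j * ((psi ^^ Suc j) x)\<^sup>2) \<le> x\<^sup>2 / 16 * (5 / 16) ^ j"
proof -
  have "\<bar>(psi ^^ Suc j) x\<bar>\<^sup>2 \<le> (\<bar>x\<bar> / 4 ^ Suc j)\<^sup>2"
    using psi_iter[OF assms, of "Suc j"] by (intro power_mono) auto
  then have "((psi ^^ Suc j) x)\<^sup>2 \<le> x\<^sup>2 / (4 ^ Suc j)\<^sup>2" by (simp add: power_divide del: funpow.simps power_Suc)
  also have "(4 ^ Suc j)\<^sup>2 = (16 :: real) * 16 ^ j" using power_mult_distrib[of "4 :: real" 4 j] by (simp add: power2_eq_square)
  finally have "5 ^ j * ((psi ^^ Suc j) x)\<^sup>2 \<le> 5 ^ j * (x\<^sup>2 / (16 * 16 ^ j))" by (intro mult_left_mono) auto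
  then show ?thesis by (simp add: power_divide ac_simps del: funpow.simps)
qed

lemma Lf_term_summable: "summable (\<lambda>j. c * (5 / 16 :: real) ^ j)"
  by (intro summable_mult summable_geometric) simp

lemma Lf_summable: "-1 \<le> x \<Longrightarrow> x \<le> 3 \<Longrightarrow> summable (\<lambda>j. 5 ^ j * ((psi ^^ Suc j) x)\<^sup>2)"
  by (rule summable_comparison_test[OF _ Lf_term_summable]) (use Lf_term in blast)

lemma Lf_tendsto:
  assumes "-1 \<le> x" "x \<le> 3"
  shows "(\<lambda>n. 5 ^ n * (psi ^^ n) x) \<longlonglongrightarrow> Lf x"
proof -
  have "5 ^ n * (psi ^^ n) x = x + (\<Sum>j<n. 5 ^ j * ((psi ^^ Suc j) x)\<^sup>2)" for n
  proof (induction n)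
    case (Suc n)
    define y where "y = (psi ^^ n) x"
    have "y \<le> 25/4" using psi_iter[OF assms, of n] by (simp add: y_def)
    then have "5 * psi y = y + (psi y)\<^sup>2" using psi_R[of y] by (simp add: power2_eq_square algebra_simps)
    then have "5 ^ Suc n * psi y = 5 ^ n * y + 5 ^ n * (psi y)\<^sup>2" by (simp add: distrib_left[symmetric])
    then show ?case using Suc by (simp add: y_def)
  qed simp
  moreover have "(\<lambda>n. x + (\<Sum>j<n. 5 ^ j * ((psi ^^ Suc j) x)\<^sup>2)) \<longlonglongrightarrow> Lf x"
    unfolding Lf_def by (intro tendsto_add tendsto_const summable_LIMSEQ Lf_summable assms)
  ultimately show ?thesis by simp
qed

lemma psi_iter_continuous: "continuous_on A (psi ^^ n)"
proof (induction n)
  case (Suc n)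
  have "continuous_on UNIV psi" unfolding psi_def by (intro continuous_intros) auto
  then have "continuous_on A (\<lambda>x. psi ((psi ^^ n) x))" using Suc by (rule continuous_on_compose2) simp
  then show ?case by (simp add: o_def)
qed simp

lemma Lf_continuous: "continuous_on {-1..3} Lf"
proof -
  have "uniform_limit {-1..3} (\<lambda>n x. \<Sum>j<n. 5 ^ j * ((psi ^^ Suc j) x)\<^sup>2) (\<lambda>x. \<Sum>j. 5 ^ j * ((psi ^^ Suc j) x)\<^sup>2) sequentially"
  proof (rule Weierstrass_m_test)
    fix j and x :: real assume x: "x \<in> {-1..3}"
    then have "\<bar>x\<bar>\<^sup>2 \<le> 4\<^sup>2" by (intro power_mono) auto
    then have "x\<^sup>2 / 16 * (5 / 16) ^ j \<le> 1 * (5 / 16) ^ j" by (intro mult_right_mono) auto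
    moreover have "norm (5 ^ j * ((psi ^^ Suc j) x)\<^sup>2) \<le> x\<^sup>2 / 16 * (5 / 16) ^ j" by (rule Lf_term) (use x in auto)
    ultimately show "norm (5 ^ j * ((psi ^^ Suc j) x)\<^sup>2) \<le> 1 * (5 / 16) ^ j" by (rule order_trans[rotated])
  qed (rule Lf_term_summable)
  then have "continuous_on {-1..3} (\<lambda>x. \<Sum>j. 5 ^ j * ((psi ^^ Suc j) x)\<^sup>2)"
    by (rule uniform_limit_theorem[rotated])
      (auto intro!: always_eventually continuous_on_sum continuous_intros psi_iter_continuous simp del: funpow.simps)
  then show ?thesis unfolding Lf_def by (intro continuous_intros)
qed

lemma Lf_0 [simp]: "Lf 0 = 0"
proof -
  have "(psi ^^ n) 0 = 0" for n by (induction n) simp_all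
  then show ?thesis by (simp add: Lf_def del: funpow.simps)
qed

text \<open>The series is at most 1/16 divided by \<open>1 - 5/16\<close>, that is 1/11. A negative
  value of \<open>Lf\<close> gives access to negative \<open>lam\<close>.\<close>

lemma Lf_neg: "Lf (-1) < 0"
proof -
  have "(\<Sum>j. 5 ^ j * ((psi ^^ Suc j) (-1))\<^sup>2) \<le> (\<Sum>j. 1 / 16 * (5 / 16) ^ j)"
    by (rule suminf_le[OF _ Lf_summable Lf_term_summable]) (use Lf_term[of "-1"] in \<open>auto simp del: funpow.simps\<close>)
  also have "\<dots> = 1 / 11" using suminf_mult[OF summable_geometric[of "5/16 :: real"], of "1/16"] by (simp add: suminf_geometric)
  finally show ?thesis by (simp add: Lf_def del: funpow.simps)
qed

lemma psi_expand:
  assumes "0 \<le> x" "x \<le> y" "y \<le> 3" shows "y - x \<le> 5 * (psi y - psi x)"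
proof -
  have "y - x = (psi y - psi x) * (5 - psi x - psi y)"
    using psi_R[of x] psi_R[of y] assms by (simp add: algebra_simps)
  also have "\<dots> \<le> (psi y - psi x) * 5"
    using psi_mono[OF assms(2)] psi_nonneg[of x] psi_nonneg[of y] assms by (intro mult_left_mono) auto
  finally show ?thesis by simp
qed

text \<open>\<open>5 * psi\<close> does not shrink distances on \<open>[0, 3]\<close>, hence neither
  does the limit; in particular \<open>Lf\<close> is strictly increasing there.\<close>

lemma Lf_expand:
  assumes "0 \<le> x" "x \<le> y" "y \<le> 3" shows "y - x \<le> Lf y - Lf x"
proof -
  have "0 \<le> (psi ^^ n) x \<and> (psi ^^ n) x \<le> (psi ^^ n) y \<and> (psi ^^ n) y \<le> 3 \<and> y - x \<le> 5 ^ n * (psi ^^ n) y - 5 ^ n * (psi ^^ n) x" for n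
  proof (induction n)
    case (Suc n)
    let ?x = "(psi ^^ n) x" and ?y = "(psi ^^ n) y"
    have "?y - ?x \<le> 5 * (psi ?y - psi ?x)" using Suc by (intro psi_expand) auto
    then have "5 ^ n * (?y - ?x) \<le> 5 ^ n * (5 * (psi ?y - psi ?x))" by (intro mult_left_mono) auto
    then have "5 ^ n * ?y - 5 ^ n * ?x \<le> 5 ^ Suc n * psi ?y - 5 ^ Suc n * psi ?x" by (simp add: right_diff_distrib)
    moreover have "psi ?y \<le> 3" using psi_iter[of y "Suc n"] assms by simp
    ultimately show ?case using Suc psi_nonneg psi_mono[of ?x ?y] by auto
  qed (use assms in auto)
  moreover have "(\<lambda>n. 5 ^ n * (psi ^^ n) y - 5 ^ n * (psi ^^ n) x) \<longlonglongrightarrow> Lf y - Lf x"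
    using assms by (intro tendsto_diff Lf_tendsto) auto
  ultimately show ?thesis by (intro LIMSEQ_le_const) blast+
qed

text \<open>Below level \<open>n\<close>, where \<open>eigseq\<close> demands nothing, the sequence
  is set to 0.\<close>

lemma eigseq_psi:
  assumes "-1 \<le> x" "x \<le> 3"
  shows "eigseq (\<lambda>j. if j < n then 0 else (psi ^^ (j - n)) x) n (3/2 * 5 ^ n * Lf x)"
  unfolding eigseq_def
proof (intro conjI allI impI)
  let ?mu = "\<lambda>j. if j < n then 0 else (psi ^^ (j - n)) x"
  have i: "-1 \<le> (psi ^^ j) x" "(psi ^^ j) x \<le> 3" for j using psi_iter[OF assms, of j] by auto
  fix m assume "n < m"
  then obtain l where l: "m = n + Suc l" using less_imp_Suc_add by fastforce
  have e: "?mu (m - 1) = (psi ^^ l) x" "?mu m = psi ((psi ^^ l) x)" by (simp_all add: l)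
  show "?mu (m - 1) = ?mu m * (5 - ?mu m)" unfolding e using psi_R[of "(psi ^^ l) x"] i[of l] by simp
  have "\<bar>psi ((psi ^^ l) x)\<bar> \<le> 1" using psi_abs[OF i[of l]] i[of l] by auto
  then show "?mu m \<notin> {2, 5, 6}" unfolding e by auto
next
  let ?mu = "\<lambda>j. if j < n then 0 else (psi ^^ (j - n)) x"
  have "(\<lambda>l. 3/2 * 5 ^ n * (5 ^ l * (psi ^^ l) x)) \<longlonglongrightarrow> 3/2 * 5 ^ n * Lf x"
    by (intro tendsto_mult_left Lf_tendsto assms)
  then have "(\<lambda>l. 3/2 * (5 ^ (l + n) * ?mu (l + n))) \<longlonglongrightarrow> 3/2 * 5 ^ n * Lf x" by (simp add: power_add ac_simps)
  then show "(\<lambda>m. 3/2 * (5 ^ m * ?mu m)) \<longlonglongrightarrow> 3/2 * 5 ^ n * Lf x" by (rule LIMSEQ_offset)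
qed

subsection \<open>Eigenvalue counts\<close>

lemma dimn_nonzero_iff:
  fixes S :: "(real^2 \<Rightarrow> real) set"
  assumes S: "lin_sub S" "dimn d S"
  shows "S \<noteq> {0} \<longleftrightarrow> d \<noteq> 0"
proof -
  have "dimn 0 {\<lambda>_ :: real^2. 0 :: real}" "lin_sub {\<lambda>_ :: real^2. 0 :: real}" by (simp_all add: lin_sub_def)
  then have "has_dim {\<lambda>_. 0} (real 0)" using has_dim_dimn by blast
  then have z: "S = {\<lambda>_. 0} \<Longrightarrow> d = 0" using has_dim_dimn[OF S] by (simp add: has_dim_def)
  have "d = 0 \<Longrightarrow> S = {\<lambda>_. 0}" using S by simp
  then show ?thesis using z by (auto simp: zero_fun_def)
qed

context triangle begin

lemma Omega_space_eigseq:
  assumes "eigseq mu k lam" shows "lin_sub (Omega_space b lam)" "dimn (gmult b k (mu k)) (Omega_space b lam)"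
proof -
  interpret eigen q mu k lam by unfold_locales (rule assms)
  show "lin_sub (Omega_space b lam)" "dimn (gmult b k (mu k)) (Omega_space b lam)" using Omega_space_dim[OF dimn_gmult] by blast+
qed

lemma Omega_space_psi:
  assumes "-1 \<le> x" "x \<le> 3"
  shows "lin_sub (Omega_space b (3/2 * 5 ^ n * Lf x))" "dimn (gmult b n x) (Omega_space b (3/2 * 5 ^ n * Lf x))"
  using Omega_space_eigseq[OF eigseq_psi[OF assms]] by (fastforce simp del: gmult.simps)+

text \<open>Instead of positivity of the energy, decimation is used again: since
  \<open>Lf (-1) < 0\<close>, a large power of 5 makes every negative \<open>lam\<close> arise from
  a start in \<open>[-1, 0)\<close>, where the graph multiplicity is 0.\<close>

lemma Omega_space_negative:
  assumes lam: "lam < 0" shows "lin_sub (Omega_space b lam)" "dimn 0 (Omega_space b lam)"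
proof -
  have d: "3/2 * Lf (-1) < 0" using Lf_neg by simp
  obtain J where "lam / (3/2 * Lf (-1)) < 5 ^ J" using real_arch_pow[of 5] by auto
  then have J: "3/2 * 5 ^ J * Lf (-1) < lam" using d by (simp add: neg_divide_less_eq ac_simps)
  then have "Lf (-1) \<le> lam / (3/2 * 5 ^ J)" by (simp add: field_simps)
  moreover have "lam / (3/2 * 5 ^ J) \<le> Lf 0" using lam by (simp add: divide_le_0_iff)
  moreover have "continuous_on {-1..0} Lf" by (rule continuous_on_subset[OF Lf_continuous]) auto
  ultimately obtain x where x: "-1 \<le> x" "x \<le> 0" "Lf x = lam / (3/2 * 5 ^ J)" using IVT'[of Lf "-1" _ 0] by auto
  have e: "3/2 * 5 ^ J * Lf x = lam" unfolding x(3) by simp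
  have "x \<noteq> 0" using e lam by auto
  then have z: "gmult b J x = 0" using gmult_range[of b J x] x by auto
  show "lin_sub (Omega_space b lam)" "dimn 0 (Omega_space b lam)" using Omega_space_psi[of x b J] x unfolding e z by auto
qed

text \<open>\<open>Lf\<close> maps \<open>[0, 3]\<close> bijectively onto \<open>[0, Lf 3]\<close>,
  so each nonnegative \<open>lam\<close> in range has exactly one start in \<open>[0, 3]\<close> on
  level \<open>Suc m\<close>, and the graph multiplicity of the start is that of
  \<open>lam\<close>.\<close>

lemma Omega_space_count: "has_eigen_count (Omega_space b) (3/2 * 5 ^ Suc m * Lf 3) (gmult_sum b m)"
proof -
  define c where "c = (3/2 * 5 ^ Suc m :: real)"
  have c: "c > 0" by (simp add: c_def)
  let ?d = "gmult b (Suc m)"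
  let ?A = "{x. 0 \<le> x \<and> x \<le> 3 \<and> ?d x \<noteq> 0}"
  have mono: "c * Lf x \<le> c * Lf y \<longleftrightarrow> x \<le> y" if "0 \<le> x" "0 \<le> y" "x \<le> 3" "y \<le> 3" for x y
    using Lf_expand[of x y] Lf_expand[of y x] that c by (cases "x \<le> y") auto
  have ex: "\<exists>x. 0 \<le> x \<and> x \<le> 3 \<and> lam = c * Lf x" if lam: "0 \<le> lam" "lam \<le> c * Lf 3" for lam
  proof -
    have "Lf 0 \<le> lam / c" "lam / c \<le> Lf 3" using lam c by (simp_all add: field_simps)
    moreover have "continuous_on {0..3} Lf" by (rule continuous_on_subset[OF Lf_continuous]) auto
    ultimately obtain x where "0 \<le> x" "x \<le> 3" "Lf x = lam / c" using IVT'[of Lf 0 "lam / c" 3] by auto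
    then show ?thesis using c by (intro exI[of _ x]) simp
  qed
  have dim: "lin_sub (Omega_space b (c * Lf x))" "dimn (?d x) (Omega_space b (c * Lf x))" if "0 \<le> x" "x \<le> 3" for x
    using Omega_space_psi[of x b "Suc m"] that unfolding c_def by (auto simp del: gmult.simps)
  have nz: "Omega_space b (c * Lf x) \<noteq> {0} \<longleftrightarrow> ?d x \<noteq> 0" if "0 \<le> x" "x \<le> 3" for x
    by (rule dimn_nonzero_iff[OF dim[OF that]])
  have "\<exists>d. has_dim (Omega_space b lam) d" if le: "lam \<le> c * Lf 3" for lam
  proof (cases "lam < 0")
    case True
    then show ?thesis using has_dim_dimn[OF Omega_space_negative] by blast
  next
    case False
    then have "0 \<le> lam" by simp
    then obtain x where "0 \<le> x" "x \<le> 3" "lam = c * Lf x" using ex[OF _ le] by blast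
    then show ?thesis using has_dim_dimn[OF dim] by blast
  qed
  then have sub: "\<forall>lam\<le>c * Lf 3. fun_vs.subspace (Omega_space b lam) \<and> fin_dim (Omega_space b lam)" by (auto simp: has_dim_def)
  have set: "{lam. lam \<le> c * Lf 3 \<and> Omega_space b lam \<noteq> {0}} = (\<lambda>x. c * Lf x) ` ?A"
  proof
    show "(\<lambda>x. c * Lf x) ` ?A \<subseteq> {lam. lam \<le> c * Lf 3 \<and> Omega_space b lam \<noteq> {0}}"
      using nz mono by (auto simp del: gmult.simps)
    show "{lam. lam \<le> c * Lf 3 \<and> Omega_space b lam \<noteq> {0}} \<subseteq> (\<lambda>x. c * Lf x) ` ?A"
    proof
      fix lam assume "lam \<in> {lam. lam \<le> c * Lf 3 \<and> Omega_space b lam \<noteq> {0}}"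
      then have lam: "lam \<le> c * Lf 3" "Omega_space b lam \<noteq> {0}" by auto
      have "\<not> lam < 0" using dimn_nonzero_iff[OF Omega_space_negative, of lam b] lam(2) by blast
      then have "0 \<le> lam" by simp
      then obtain x where x: "0 \<le> x" "x \<le> 3" "lam = c * Lf x" using ex[OF _ lam(1)] by blast
      then have "x \<in> ?A" using nz lam(2) by blast
      then show "lam \<in> (\<lambda>x. c * Lf x) ` ?A" using x(3) by blast
    qed
  qed
  have inj: "inj_on (\<lambda>x. c * Lf x) ?A"
  proof (rule inj_onI)
    fix x y assume a: "x \<in> ?A" "y \<in> ?A" "c * Lf x = c * Lf y"
    then show "x = y" using mono[of x y] mono[of y x] by auto
  qed
  have "(\<Sum>lam\<in>(\<lambda>x. c * Lf x) ` ?A. real (fun_vs.dim (Omega_space b lam))) = (\<Sum>x\<in>?A. real (?d x))"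
  proof (rule sum.reindex_cong[OF inj refl])
    fix x assume "x \<in> ?A"
    then show "real (fun_vs.dim (Omega_space b (c * Lf x))) = real (?d x)"
      using has_dim_dimn[OF dim, of x] by (simp add: has_dim_def del: gmult.simps)
  qed
  also have "\<dots> = gmult_sum b m" by (rule gmult_sum_lower(2))
  finally show ?thesis using sub gmult_sum_lower(1)[of b m]
    unfolding has_eigen_count_def c_def[symmetric] set by (simp del: gmult.simps)
qed

lemma in_series_dim:
  assumes "in_series q c k lam" shows "has_dim (Omega_space b lam) (real (gmult b k c))"
proof -
  obtain mu where "eigseq mu k lam" "mu k = c" using assms unfolding in_series_def eigseq_def by blast
  then show ?thesis using has_dim_dimn[OF Omega_space_eigseq] by metis
qed

end

theorem mainTheorem7:
  fixes q :: "3 \<Rightarrow> real^2"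
  assumes "equilateral q"
  shows
    "(\<exists>C0::real. C0 > 0 \<and> (\<forall>m::nat.
        has_eigen_count (Omega_neumann_space q) (C0 * 5 ^ m)
          (1/2 * ((3 ^ (m + 1) + 3) / 2 + real m + 1)) \<and>
        has_eigen_count (Omega_dirichlet_space q) (C0 * 5 ^ m)
          (1/2 * ((3 ^ (m + 1) - 3) / 2 - real m))))
     \<and> (has_dim (Omega_neumann_space q 0) 1 \<and> has_dim (Omega_dirichlet_space q 0) 0)
     \<and> (\<forall>lam. in_series q 2 1 lam \<longrightarrow>
          has_dim (Omega_neumann_space q lam) 0 \<and> has_dim (Omega_dirichlet_space q lam) 0)
     \<and> (\<forall>lam. in_series q 3 1 lam \<longrightarrow>
          has_dim (Omega_neumann_space q lam) 1 \<and> has_dim (Omega_dirichlet_space q lam) 0)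
     \<and> (\<forall>k\<ge>1. \<forall>lam. in_series q 5 k lam \<longrightarrow>
          has_dim (Omega_neumann_space q lam) (1/2 * ((3 ^ (k - 1) + 1) / 2 - real k)) \<and>
          has_dim (Omega_dirichlet_space q lam) (1/2 * ((3 ^ (k - 1) + 1) / 2 + real k)))
     \<and> (\<forall>k\<ge>1. \<forall>lam. in_series q 6 k lam \<longrightarrow>
          has_dim (Omega_neumann_space q lam) (1/2 * ((3 ^ k + 3) / 2 + real k)) \<and>
          has_dim (Omega_dirichlet_space q lam) (1/2 * ((3 ^ k - 3) / 2 - real k + 1)))"
proof -
  interpret triangle q by unfold_locales (rule assms)
  have O: "Omega_neumann_space q = Omega_space False" "Omega_dirichlet_space q = Omega_space True" by (simp_all add: Omega_space_def fun_eq_iff)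
  note gmult.simps [simp del]
  have cN: "gmult_sum False m = 1/2 * ((3 ^ (m + 1) + 3) / 2 + real m + 1)" for m using gmult_sum_eq[of False m] by (simp add: field_simps)
  have cD: "gmult_sum True m = 1/2 * ((3 ^ (m + 1) - 3) / 2 - real m)" for m using gmult_sum_eq[of True m] by (simp add: field_simps)
  \<comment> \<open>The constant is the \<open>lam\<close> whose sequence takes the value 3 on level
    1 and follows \<open>psi\<close> afterwards.\<close>
  have "0 < 3/2 * 5 * Lf 3" using Lf_expand[of 0 3] by simp
  moreover have "has_eigen_count (Omega_space b) (3/2 * 5 * Lf 3 * 5 ^ m) (gmult_sum b m)" for b m
    using Omega_space_count[of b m] by (simp add: ac_simps)
  ultimately have count: "\<exists>C0::real. C0 > 0 \<and> (\<forall>m::nat.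
        has_eigen_count (Omega_space False) (C0 * 5 ^ m) (1/2 * ((3 ^ (m + 1) + 3) / 2 + real m + 1)) \<and>
        has_eigen_count (Omega_space True) (C0 * 5 ^ m) (1/2 * ((3 ^ (m + 1) - 3) / 2 - real m)))"
    unfolding cN[symmetric] cD[symmetric] by blast
  \<comment> \<open>The eigenvalue 0 comes from the constant sequence 0, taken from level 0
    on.\<close>
  have "eigseq (\<lambda>_. 0) 0 0" by (simp add: eigseq_def)
  then have dim0: "has_dim (Omega_space b 0) (real (gmult b 0 0))" for b using has_dim_dimn[OF Omega_space_eigseq] by blast
  have dim2: "real (gmult b 1 2) = 0" for b by (simp add: gmult.simps)
  \<comment> \<open>\<open>R 3 = 6\<close>, and on level 0 the value 6 has multiplicity 1 in the
    Neumann case and 0 in the Dirichlet case.\<close>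
  have dim3: "real (gmult b 1 3) = (if b then 0 else 1)" for b by (simp add: gmult.simps R_def)
  have dim5: "real (gmult False k 5) = 1/2 * ((3 ^ (k - 1) + 1) / 2 - real k)"
    "real (gmult True k 5) = 1/2 * ((3 ^ (k - 1) + 1) / 2 + real k)" if "k \<ge> 1" for k
    using gmult_5[of _ "k - 1"] that by (auto simp: field_simps of_nat_diff)
  have dim6: "real (gmult False k 6) = 1/2 * ((3 ^ k + 3) / 2 + real k)"
    "real (gmult True k 6) = 1/2 * ((3 ^ k - 3) / 2 - real k + 1)" for k
    using gmult_6[of _ k] by (auto simp: field_simps)
  have dim0': "has_dim (Omega_space False 0) 1" "has_dim (Omega_space True 0) 0" using dim0[of False] dim0[of True] by (simp_all add: gmult_0)
  have series: "in_series q c k lam \<Longrightarrow> real (gmult b k c) = d \<Longrightarrow> has_dim (Omega_space b lam) d" for b c k lam d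
    using in_series_dim by blast
  show ?thesis
    unfolding O
    by (intro conjI allI impI count dim0'; erule series, simp only: dim2 dim3 dim5 dim6 if_True if_False)
qed

end
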